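(* Let $\mathcal{A}$ be the unital free $*$-algebra generated by a set $\mathcal{G}$, let $\mu$ and $\nu$ be states on $\mathcal{A}$, and let $\mu\boxplus\nu$ be their free additive convolution. Then there exist states $\widehat\mu$ and $\widehat\nu$ on $\mathcal{F}(\mathcal{G})$, such that the state $\widehat\mu\,\overline{\otimes}\,\widehat\nu$ is well defined, and a unital $*$-homomorphism $J:\mathcal{A}*\mathcal{A}\to\mathcal{F}(\mathcal{G})\overline{\otimes}\mathcal{F}(\mathcal{G})$ with $\mu*\nu=(\widehat\mu\,\overline{\otimes}\,\widehat\nu)\circ J$, such that, setting $\widehat\mu\star\widehat\nu=(\widehat\mu\,\overline{\otimes}\,\widehat\nu)\circ\Delta$, $$\mu\boxplus\nu=(\widehat\mu\star\widehat\nu)\circ\tau,$$ where $\tau:\mathcal{A}\to\mathcal{F}(\mathcal{G})$ is the unital $*$-homomorphism given by $$\tau(X)=\sum_{k=1}^\infty\delta X(k)\quad (X\in\mathcal{G}),\qquad\tau(1_{\mathcal{A}})=1 .$$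
   Context: All algebras are over $\mathbb{C}$; a state on a unital $*$-algebra is a linear functional $\varphi$ with $\varphi(1)=1$, $\varphi(x^*x)\ge0$. $\mathcal{A}*\mathcal{A}$ is the free product with identified units of two copies of $\mathcal{A}$; the free product state $\mu*\nu$ is the state on it which equals $\mu$ on the first copy, $\nu$ on the second copy, and vanishes on every product $a_1\cdots a_n$ whose factors come alternately from $\ker\mu$ in the first copy and $\ker\nu$ in the second copy. The free additive convolution is $\mu\boxplus\nu=(\mu*\nu)\circ\delta$, where $\delta:\mathcal{A}\to\mathcal{A}*\mathcal{A}$ is the unital $*$-homomorphism sending each $X\in\mathcal{G}$ to the sum of its two copies. Put $\mathcal{G}^*=\{X^*:X\in\mathcal{G}\}$. The algebra $\mathcal{F}_0(\mathcal{G})$ is the unital $*$-algebra generated by elements $X'(k),X''(k)$ ($X\in\mathcal{G}$, $k\ge1$) and $p_k$ ($k\ge1$), subject only to the following relations: $X''(1)=0$; $p_kp_l=\delta_{k,l}p_k$, $p_k^*=p_k$; and, with $q_0=0$, $q_m=p_1+\cdots+p_m$, $q_\infty=1$, $(X^* )'(k):=(X'(k))^*$, $(X^* )''(k):=(X''(k))^*$, for all $X\in\mathcal{G}\cup\mathcal{G}^*$: $(1-q_m)X'(k)=0$ and $(1-q_m)X''(k)=0$ for $k<m$; $q_m(X'(k)-X''(k))=0$ for $k>m$. $\mathcal{F}^{(m)}(\mathcal{G})$ is the unital $*$-subalgebra generated by all $p_j$ and all $X'(k),X''(k)$ with $1\le k\le m$; $\mathcal{F}^{(0)}(\mathcal{G})=\mathbb{C}[p_1,p_2,\ldots]$.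 The unital $*$-homomorphism $\Delta:\mathcal{F}_0(\mathcal{G})\to\mathcal{F}_0(\mathcal{G})\otimes\mathcal{F}_0(\mathcal{G})$ is given by $\Delta(X'(k))=X'(k)\otimes q_k+q_k\otimes X'(k)$, $\Delta(X''(k))=X''(k)\otimes q_{k-1}+q_{k-1}\otimes X''(k)$, $\Delta(q_k)=q_k\otimes q_k$. Monotone closure. Let $\mathcal{C}_0=\bigcup_m\mathcal{C}^{(m)}$ be a union of increasing unital $*$-algebras and let $\mathcal{P}=\{c_m:0\le m\le\infty\}\subset\mathcal{C}^{(0)}$ be an increasing chain of projections with $c_0=0$, $c_\infty=1$. A monotone strongly dense domain (MSDD) is an increasing sequence $(e_m)_{m\ge1}$ in $\mathcal{P}$ with supremum $1$ in $\mathcal{P}$. An operator with monotone closure (OWMC) is a sequence $(x_m,e_m)_{m\ge1}$ with $x_m\in\mathcal{C}^{(m)}$, $(e_m)$ an MSDD, and $x_ne_m=x_me_m$, $x_n^*e_m=x_m^*e_m$ for $n>m$. Two OWMC $(x_m,e_m)$, $(y_m,f_m)$ are equivalent if for some MSDD $(g_m)$, $x_mg_m=y_mg_m$ and $x_m^*g_m=y_m^*g_m$ for all $m$. The classes $[x_m,e_m]$ are called monotone closed operators (MCO). For $x\in\mathcal{C}_0$, $e\in\mathcal{P}$, $x^{-1}(e)$ is the largest $g\in\mathcal{P}$ with $exg=xg$. The MCO form a unital $*$-algebra (the monotone closure of $\mathcal{C}_0$) under $[x_m,e_m]+[y_m,f_m]=[x_m+y_m,e_mf_m]$, $\lambda[x_m,e_m]=[\lambda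 x_m,e_m]$, $[x_m,e_m]^*=[x_m^*,e_m]$, $[x_m,e_m][y_m,f_m]=[x_my_m,k_m]$, $k_m=f_my_m^{-1}(e_m)e_m(x_m^* )^{-1}(f_m)$. An element $x\in\mathcal{C}^{(k)}$ is identified with the class of $(x_m,e_m)$ where $x_m=0$, $e_m=0$ for $m\le k$ and $x_m=x$, $e_m=1$ for $m>k$. $\mathcal{F}(\mathcal{G})$ is the monotone closure of $\mathcal{F}_0(\mathcal{G})$ with $\mathcal{C}^{(m)}=\mathcal{F}^{(m)}(\mathcal{G})$, $c_m=q_m$. The monotone tensor product $\mathcal{F}(\mathcal{G})\overline{\otimes}\mathcal{F}(\mathcal{G})$ is the monotone closure of $\mathcal{F}_0(\mathcal{G})\otimes\mathcal{F}_0(\mathcal{G})$ with $\mathcal{C}^{(m)}=\mathcal{F}^{(m)}(\mathcal{G})\otimes\mathcal{F}^{(m)}(\mathcal{G})$, $c_m=q_m\otimes q_m$. The comultiplication is lifted to $\Delta:\mathcal{F}(\mathcal{G})\to\mathcal{F}(\mathcal{G})\overline{\otimes}\mathcal{F}(\mathcal{G})$ by $\Delta[x_m,e_m]=[\Delta(x_m),\Delta(e_m)]$. For states $\varphi,\psi$ on $\mathcal{F}(\mathcal{G})$, $\varphi\,\overline{\otimes}\,\psi$ is defined by $(\varphi\,\overline{\otimes}\,\psi)([w_m,r_m])=\lim_{m\to\infty}(\varphi\otimes\psi)(w_m)$, with $\varphi,\psi$ restricted to $\mathcal{F}_0(\mathcal{G})$, provided that all these limits exist and do not depend on the representatives. For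 $X\in\mathcal{G}$: $\delta X(1)=X'(1)$, $\delta X(k)=X'(k)-X''(k)$ for $k>1$, and $\sum_{k=1}^\infty\delta X(k)$ denotes the MCO $\big[\sum_{k=1}^m\delta X(k),\,q_m\big]$. *)

theory Defs
  imports Complex_Main "HOL-Library.Extended_Nat" "HOL-Library.Poly_Mapping"
    "HOL-Library.FuncSet" "HOL-Algebra.QuotRing" "HOL-Algebra.Module"
begin

section \<open>Unital $*$-algebras over the complex numbers\<close>

record 'a star_alg = "(complex, 'a) module" +
  adj :: "'a \<Rightarrow> 'a"

definition star_hom :: "('a, 'x) star_alg_scheme \<Rightarrow> ('b, 'y) star_alg_scheme \<Rightarrow> ('a \<Rightarrow> 'b) set" where
  "star_hom A B = {h \<in> ring_hom A B. \<forall>x \<in> carrier A.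
     h (adj A x) = adj B (h x) \<and> (\<forall>c. h (c \<odot>\<^bsub>A\<^esub> x) = c \<odot>\<^bsub>B\<^esub> h x)}"

definition linear_functional :: "('a, 'x) star_alg_scheme \<Rightarrow> ('a \<Rightarrow> complex) \<Rightarrow> bool" where
  "linear_functional A \<phi> \<longleftrightarrow>
     (\<forall>x \<in> carrier A. \<forall>y \<in> carrier A. \<phi> (x \<oplus>\<^bsub>A\<^esub> y) = \<phi> x + \<phi> y) \<and>
     (\<forall>c. \<forall>x \<in> carrier A. \<phi> (c \<odot>\<^bsub>A\<^esub> x) = c * \<phi> x)"

definition state :: "('a, 'x) star_alg_scheme \<Rightarrow> ('a \<Rightarrow> complex) \<Rightarrow> bool" where
  "state A \<phi> \<longleftrightarrow> linear_functional A \<phi> \<and> \<phi> \<one>\<^bsub>A\<^esub> = 1 \<and>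
     (\<forall>x \<in> carrier A. Im (\<phi> (adj A x \<otimes>\<^bsub>A\<^esub> x)) = 0 \<and> Re (\<phi> (adj A x \<otimes>\<^bsub>A\<^esub> x)) \<ge> 0)"

inductive_set lin_span :: "('a, 'x) star_alg_scheme \<Rightarrow> 'a set \<Rightarrow> 'a set"
  for A (structure) and S where
  zero: "\<zero> \<in> lin_span A S"
| base: "s \<in> S \<Longrightarrow> s \<in> lin_span A S"
| add: "x \<in> lin_span A S \<Longrightarrow> y \<in> lin_span A S \<Longrightarrow> x \<oplus> y \<in> lin_span A S"
| scale: "x \<in> lin_span A S \<Longrightarrow> c \<odot> x \<in> lin_span A S"

text \<open>The unital $*$-subalgebra generated by a set.\<close>

inductive_set star_gen :: "('a, 'x) star_alg_scheme \<Rightarrow> 'a set \<Rightarrow> 'a set"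
  for A (structure) and S where
  one: "\<one> \<in> star_gen A S"
| base: "s \<in> S \<Longrightarrow> s \<in> star_gen A S"
| add: "x \<in> star_gen A S \<Longrightarrow> y \<in> star_gen A S \<Longrightarrow> x \<oplus> y \<in> star_gen A S"
| scale: "x \<in> star_gen A S \<Longrightarrow> c \<odot> x \<in> star_gen A S"
| mult: "x \<in> star_gen A S \<Longrightarrow> y \<in> star_gen A S \<Longrightarrow> x \<otimes> y \<in> star_gen A S"
| adj: "x \<in> star_gen A S \<Longrightarrow> adj A x \<in> star_gen A S"

text \<open>
  The quotient by a self-adjoint two-sided ideal (for the tensor product below: a subspace that
  turns out to be one); the ring part is \<^const>\<open>FactRing\<close>.
\<close>

definition star_quot :: "('a, 'x) star_alg_scheme \<Rightarrow> 'a set \<Rightarrow> 'a set star_alg" where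
  "star_quot A I =
    \<lparr>carrier = carrier (A Quot I), mult = mult (A Quot I), one = one (A Quot I),
     zero = zero (A Quot I), add = add (A Quot I),
     smult = (\<lambda>c U. \<Union>x\<in>U. I +>\<^bsub>A\<^esub> (c \<odot>\<^bsub>A\<^esub> x)),
     adj = (\<lambda>U. \<Union>x\<in>U. I +>\<^bsub>A\<^esub> adj A x)\<rparr>"

text \<open>
  The algebra \<open>\<complex>[M]\<close> of a monoid \<open>M\<close> with involution \<open>i\<close>: finite formal linear combinations of
  elements of \<open>M\<close>.
\<close>

definition monoid_alg :: "('m, 'x) monoid_scheme \<Rightarrow> ('m \<Rightarrow> 'm) \<Rightarrow> ('m \<Rightarrow>\<^sub>0 complex) star_alg" where
  "monoid_alg M i =
    \<lparr>carrier = {p. Poly_Mapping.keys p \<subseteq> carrier M},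
     mult = (\<lambda>p q. \<Sum>u\<in>Poly_Mapping.keys p. \<Sum>v\<in>Poly_Mapping.keys q.
        Poly_Mapping.single (u \<otimes>\<^bsub>M\<^esub> v) (Poly_Mapping.lookup p u * Poly_Mapping.lookup q v)),
     one = Poly_Mapping.single \<one>\<^bsub>M\<^esub> 1,
     zero = 0,
     add = (+),
     smult = (\<lambda>c p. Poly_Mapping.map (\<lambda>a. c * a) p),
     adj = (\<lambda>p. \<Sum>u\<in>Poly_Mapping.keys p.
        Poly_Mapping.single (i u) (cnj (Poly_Mapping.lookup p u)))\<rparr>"


section \<open>Free $*$-algebras, presentations, free products, tensor products\<close>

datatype 's letter = Gen 's | Adj 's

primrec flip :: "'s letter \<Rightarrow> 's letter" where
  "flip (Gen s) = Adj s"
| "flip (Adj s) = Gen s"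

type_synonym 's star_poly = "'s letter list \<Rightarrow>\<^sub>0 complex"

definition words :: "'s set \<Rightarrow> 's letter list monoid" where
  "words S = \<lparr>carrier = lists (Gen ` S \<union> Adj ` S), mult = (@), one = []\<rparr>"

definition free_alg :: "'s set \<Rightarrow> 's star_poly star_alg" where
  "free_alg S = monoid_alg (words S) (\<lambda>w. rev (map flip w))"

definition letter :: "'s letter \<Rightarrow> 's star_poly" where
  "letter l = Poly_Mapping.single [l] 1"

text \<open>The $*$-ideal of relations, and the unital $*$-algebra generated by \<open>S\<close> subject to \<open>r = 0\<close>, \<open>r \<in> R\<close>.\<close>

definition rel_ideal :: "'s set \<Rightarrow> 's star_poly set \<Rightarrow> 's star_poly set" where
  "rel_ideal S R = genideal (free_alg S) (R \<union> adj (free_alg S) ` R)"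

definition presented :: "'s set \<Rightarrow> 's star_poly set \<Rightarrow> 's star_poly set star_alg" where
  "presented S R = star_quot (free_alg S) (rel_ideal S R)"

definition pres_class :: "'s set \<Rightarrow> 's star_poly set \<Rightarrow> 's star_poly \<Rightarrow> 's star_poly set" where
  "pres_class S R p = rel_ideal S R +>\<^bsub>free_alg S\<^esub> p"

text \<open>
  The free product with identified units is generated by the disjoint union of the carriers,
  subject to the relations saying that both inclusions are unital $*$-homomorphisms.
\<close>

definition hom_relations :: "'s set \<Rightarrow> ('a, 'x) star_alg_scheme \<Rightarrow> ('a \<Rightarrow> 's) \<Rightarrow> 's star_poly set" where
  "hom_relations S A \<iota> = (let F = free_alg S; g = (\<lambda>a. letter (Gen (\<iota> a))) in
     {g (a \<oplus>\<^bsub>A\<^esub> b) - (g a + g b) | a b. a \<in> carrier A \<and> b \<in> carrier A} \<union>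
     {g (a \<otimes>\<^bsub>A\<^esub> b) - g a \<otimes>\<^bsub>F\<^esub> g b | a b. a \<in> carrier A \<and> b \<in> carrier A} \<union>
     {g (c \<odot>\<^bsub>A\<^esub> a) - c \<odot>\<^bsub>F\<^esub> g a | c a. a \<in> carrier A} \<union>
     {g (adj A a) - adj F (g a) | a. a \<in> carrier A} \<union>
     {g \<one>\<^bsub>A\<^esub> - \<one>\<^bsub>F\<^esub>})"

definition fp_gens :: "('a, 'x) star_alg_scheme \<Rightarrow> ('b, 'y) star_alg_scheme \<Rightarrow> ('a + 'b) set" where
  "fp_gens A B = Inl ` carrier A \<union> Inr ` carrier B"

definition fp_rels :: "('a, 'x) star_alg_scheme \<Rightarrow> ('b, 'y) star_alg_scheme \<Rightarrow> ('a + 'b) star_poly set" where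
  "fp_rels A B = hom_relations (fp_gens A B) A Inl \<union> hom_relations (fp_gens A B) B Inr"

definition free_product ::
    "('a, 'x) star_alg_scheme \<Rightarrow> ('b, 'y) star_alg_scheme \<Rightarrow> ('a + 'b) star_poly set star_alg" where
  "free_product A B = presented (fp_gens A B) (fp_rels A B)"

text \<open>The two inclusions, as one map on the disjoint union.\<close>

definition fp_incl ::
    "('a, 'x) star_alg_scheme \<Rightarrow> ('b, 'y) star_alg_scheme \<Rightarrow> 'a + 'b \<Rightarrow> ('a + 'b) star_poly set" where
  "fp_incl A B s = pres_class (fp_gens A B) (fp_rels A B) (letter (Gen s))"

definition alternating_centered ::
    "('a, 'x) star_alg_scheme \<Rightarrow> ('b, 'y) star_alg_scheme \<Rightarrow> ('a \<Rightarrow> complex) \<Rightarrow> ('b \<Rightarrow> complex)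
       \<Rightarrow> ('a + 'b) list \<Rightarrow> bool" where
  "alternating_centered A B \<mu> \<nu> ss \<longleftrightarrow> ss \<noteq> [] \<and>
     set ss \<subseteq> Inl ` {a \<in> carrier A. \<mu> a = 0} \<union> Inr ` {b \<in> carrier B. \<nu> b = 0} \<and>
     (\<forall>j. Suc j < length ss \<longrightarrow> isl (ss ! j) \<noteq> isl (ss ! Suc j))"

definition free_product_state ::
    "('a, 'x) star_alg_scheme \<Rightarrow> ('b, 'y) star_alg_scheme \<Rightarrow> ('a \<Rightarrow> complex) \<Rightarrow> ('b \<Rightarrow> complex)
       \<Rightarrow> ('a + 'b) star_poly set \<Rightarrow> complex" where
  "free_product_state A B \<mu> \<nu> = (THE \<chi>. \<chi> \<in> extensional (carrier (free_product A B)) \<and>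
     state (free_product A B) \<chi> \<and>
     (\<forall>a \<in> carrier A. \<chi> (fp_incl A B (Inl a)) = \<mu> a) \<and>
     (\<forall>b \<in> carrier B. \<chi> (fp_incl A B (Inr b)) = \<nu> b) \<and>
     (\<forall>ss. alternating_centered A B \<mu> \<nu> ss \<longrightarrow>
        \<chi> (foldr (\<lambda>s z. fp_incl A B s \<otimes>\<^bsub>free_product A B\<^esub> z) ss \<one>\<^bsub>free_product A B\<^esub>) = 0))"

text \<open>
  The tensor product: the quotient of the space freely spanned by the pairs \<open>(a, b)\<close> by the span of
  the bilinearity relations, with multiplication and adjoint induced from the pairs.
\<close>

definition pair_alg ::
    "('a, 'x) star_alg_scheme \<Rightarrow> ('b, 'y) star_alg_scheme \<Rightarrow> ('a \<times> 'b \<Rightarrow>\<^sub>0 complex) star_alg" where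
  "pair_alg A B = monoid_alg (A \<times>\<times> B) (\<lambda>(a, b). (adj A a, adj B b))"

definition bilinear_rels ::
    "('a, 'x) star_alg_scheme \<Rightarrow> ('b, 'y) star_alg_scheme \<Rightarrow> ('a \<times> 'b \<Rightarrow>\<^sub>0 complex) set" where
  "bilinear_rels A B = (let g = (\<lambda>a b. Poly_Mapping.single (a, b) (1 :: complex)) in
     {g (a \<oplus>\<^bsub>A\<^esub> a') b - (g a b + g a' b) | a a' b.
        a \<in> carrier A \<and> a' \<in> carrier A \<and> b \<in> carrier B} \<union>
     {g a (b \<oplus>\<^bsub>B\<^esub> b') - (g a b + g a b') | a b b'.
        a \<in> carrier A \<and> b \<in> carrier B \<and> b' \<in> carrier B} \<union>
     {g (c \<odot>\<^bsub>A\<^esub> a) b - c \<odot>\<^bsub>pair_alg A B\<^esub> g a b | c a b. a \<in> carrier A \<and> b \<in> carrier B} \<union>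
     {g a (c \<odot>\<^bsub>B\<^esub> b) - c \<odot>\<^bsub>pair_alg A B\<^esub> g a b | c a b. a \<in> carrier A \<and> b \<in> carrier B})"

definition tensor_null ::
    "('a, 'x) star_alg_scheme \<Rightarrow> ('b, 'y) star_alg_scheme \<Rightarrow> ('a \<times> 'b \<Rightarrow>\<^sub>0 complex) set" where
  "tensor_null A B = lin_span (pair_alg A B) (bilinear_rels A B)"

definition tensor ::
    "('a, 'x) star_alg_scheme \<Rightarrow> ('b, 'y) star_alg_scheme \<Rightarrow> ('a \<times> 'b \<Rightarrow>\<^sub>0 complex) set star_alg" where
  "tensor A B = star_quot (pair_alg A B) (tensor_null A B)"

definition tens ::
    "('a, 'x) star_alg_scheme \<Rightarrow> ('b, 'y) star_alg_scheme \<Rightarrow> 'a \<Rightarrow> 'b \<Rightarrow> ('a \<times> 'b \<Rightarrow>\<^sub>0 complex) set" where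
  "tens A B a b = tensor_null A B +>\<^bsub>pair_alg A B\<^esub> Poly_Mapping.single (a, b) 1"

definition tensor_functional ::
    "('a, 'x) star_alg_scheme \<Rightarrow> ('b, 'y) star_alg_scheme \<Rightarrow> ('a \<Rightarrow> complex) \<Rightarrow> ('b \<Rightarrow> complex)
       \<Rightarrow> ('a \<times> 'b \<Rightarrow>\<^sub>0 complex) set \<Rightarrow> complex" where
  "tensor_functional A B \<phi> \<psi> = (THE h. h \<in> extensional (carrier (tensor A B)) \<and>
     linear_functional (tensor A B) h \<and>
     (\<forall>a \<in> carrier A. \<forall>b \<in> carrier B. h (tens A B a b) = \<phi> a * \<psi> b))"


section \<open>Monotone closure\<close>

text \<open>
  A tower is the union of the increasing $*$-algebras \<^term>\<open>stage C m\<close>, together with the chain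
  \<open>c\<^sub>k = tproj C k\<close> of projections, \<open>k \<le> \<infinity>\<close>. Sequences are indexed by \<open>m \<ge> 1\<close>; their value at \<open>0\<close> is
  irrelevant (the equivalence of operators with monotone closure ignores it).
\<close>

record 'c tower = "'c star_alg" +
  stage :: "nat \<Rightarrow> 'c set"
  tproj :: "enat \<Rightarrow> 'c"

definition projs :: "('c, 'x) tower_scheme \<Rightarrow> 'c set" where
  "projs C = range (tproj C)"

definition proj_le :: "('c, 'x) tower_scheme \<Rightarrow> 'c \<Rightarrow> 'c \<Rightarrow> bool" where
  "proj_le C e f \<longleftrightarrow> e \<otimes>\<^bsub>C\<^esub> f = e"

definition msdd :: "('c, 'x) tower_scheme \<Rightarrow> (nat \<Rightarrow> 'c) \<Rightarrow> bool" where
  "msdd C e \<longleftrightarrow> (\<forall>m\<ge>1. e m \<in> projs C) \<and> (\<forall>m\<ge>1. \<forall>n\<ge>m. proj_le C (e m) (e n)) \<and>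
     (\<forall>g \<in> projs C. (\<forall>m\<ge>1. proj_le C (e m) g) \<longrightarrow> g = \<one>\<^bsub>C\<^esub>)"

definition owmc :: "('c, 'x) tower_scheme \<Rightarrow> ((nat \<Rightarrow> 'c) \<times> (nat \<Rightarrow> 'c)) set" where
  "owmc C = {(x, e). (\<forall>m\<ge>1. x m \<in> stage C m) \<and> msdd C e \<and>
     (\<forall>m\<ge>1. \<forall>n>m. x n \<otimes>\<^bsub>C\<^esub> e m = x m \<otimes>\<^bsub>C\<^esub> e m \<and>
        adj C (x n) \<otimes>\<^bsub>C\<^esub> e m = adj C (x m) \<otimes>\<^bsub>C\<^esub> e m)}"

definition owmc_rel ::
    "('c, 'x) tower_scheme \<Rightarrow> (((nat \<Rightarrow> 'c) \<times> (nat \<Rightarrow> 'c)) \<times> ((nat \<Rightarrow> 'c) \<times> (nat \<Rightarrow> 'c))) set" where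
  "owmc_rel C = {((x, e), (y, f)). (x, e) \<in> owmc C \<and> (y, f) \<in> owmc C \<and>
     (\<exists>g. msdd C g \<and> (\<forall>m\<ge>1. x m \<otimes>\<^bsub>C\<^esub> g m = y m \<otimes>\<^bsub>C\<^esub> g m \<and>
        adj C (x m) \<otimes>\<^bsub>C\<^esub> g m = adj C (y m) \<otimes>\<^bsub>C\<^esub> g m))}"

type_synonym 'c mco = "((nat \<Rightarrow> 'c) \<times> (nat \<Rightarrow> 'c)) set"

definition mco :: "('c, 'x) tower_scheme \<Rightarrow> (nat \<Rightarrow> 'c) \<Rightarrow> (nat \<Rightarrow> 'c) \<Rightarrow> 'c mco" where
  "mco C x e = owmc_rel C `` {(x, e)}"

definition mco_embed :: "('c, 'x) tower_scheme \<Rightarrow> 'c \<Rightarrow> 'c mco" where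
  "mco_embed C x = (let k = (LEAST k. x \<in> stage C k) in
     mco C (\<lambda>m. if m \<le> k then \<zero>\<^bsub>C\<^esub> else x) (\<lambda>m. if m \<le> k then \<zero>\<^bsub>C\<^esub> else \<one>\<^bsub>C\<^esub>))"

text \<open>The projection \<open>x\<^sup>-\<^sup>1(e)\<close>.\<close>

definition proj_preimage :: "('c, 'x) tower_scheme \<Rightarrow> 'c \<Rightarrow> 'c \<Rightarrow> 'c" where
  "proj_preimage C x e = (THE g. g \<in> projs C \<and> e \<otimes>\<^bsub>C\<^esub> x \<otimes>\<^bsub>C\<^esub> g = x \<otimes>\<^bsub>C\<^esub> g \<and>
     (\<forall>h \<in> projs C. e \<otimes>\<^bsub>C\<^esub> x \<otimes>\<^bsub>C\<^esub> h = x \<otimes>\<^bsub>C\<^esub> h \<longrightarrow> proj_le C h g))"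

definition mclosure :: "('c, 'x) tower_scheme \<Rightarrow> 'c mco star_alg" where
  "mclosure C =
    \<lparr>carrier = owmc C // owmc_rel C,
     mult = (\<lambda>U V. \<Union>(x, e)\<in>U. \<Union>(y, f)\<in>V. mco C (\<lambda>m. x m \<otimes>\<^bsub>C\<^esub> y m)
       (\<lambda>m. f m \<otimes>\<^bsub>C\<^esub> proj_preimage C (y m) (e m) \<otimes>\<^bsub>C\<^esub> e m
              \<otimes>\<^bsub>C\<^esub> proj_preimage C (adj C (x m)) (f m))),
     one = mco_embed C \<one>\<^bsub>C\<^esub>,
     zero = mco_embed C \<zero>\<^bsub>C\<^esub>,
     add = (\<lambda>U V. \<Union>(x, e)\<in>U. \<Union>(y, f)\<in>V.
       mco C (\<lambda>m. x m \<oplus>\<^bsub>C\<^esub> y m) (\<lambda>m. e m \<otimes>\<^bsub>C\<^esub> f m)),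
     smult = (\<lambda>c U. \<Union>(x, e)\<in>U. mco C (\<lambda>m. c \<odot>\<^bsub>C\<^esub> x m) e),
     adj = (\<lambda>U. \<Union>(x, e)\<in>U. mco C (\<lambda>m. adj C (x m)) e)\<rparr>"

definition tensor_tower ::
    "('a, 'x) tower_scheme \<Rightarrow> ('b, 'y) tower_scheme \<Rightarrow> ('a \<times> 'b \<Rightarrow>\<^sub>0 complex) set tower" where
  "tensor_tower C D = star_alg.extend (tensor C D) (tower.fields
     (\<lambda>m. lin_span (tensor C D) {tens C D a b | a b. a \<in> stage C m \<and> b \<in> stage D m})
     (\<lambda>k. tens C D (tproj C k) (tproj D k)))"

definition mtensor_defined ::
    "('a, 'x) tower_scheme \<Rightarrow> ('b, 'y) tower_scheme \<Rightarrow> ('a mco \<Rightarrow> complex) \<Rightarrow> ('b mco \<Rightarrow> complex) \<Rightarrow> bool" where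
  "mtensor_defined C D \<phi> \<psi> \<longleftrightarrow> (\<forall>U \<in> carrier (mclosure (tensor_tower C D)). \<exists>c. \<forall>(w, r) \<in> U.
     (\<lambda>m. tensor_functional C D (\<phi> \<circ> mco_embed C) (\<psi> \<circ> mco_embed D) (w m)) \<longlonglongrightarrow> c)"

definition mtensor ::
    "('a, 'x) tower_scheme \<Rightarrow> ('b, 'y) tower_scheme \<Rightarrow> ('a mco \<Rightarrow> complex) \<Rightarrow> ('b mco \<Rightarrow> complex)
       \<Rightarrow> ('a \<times> 'b \<Rightarrow>\<^sub>0 complex) set mco \<Rightarrow> complex" where
  "mtensor C D \<phi> \<psi> U = (THE c. \<forall>(w, r) \<in> U.
     (\<lambda>m. tensor_functional C D (\<phi> \<circ> mco_embed C) (\<psi> \<circ> mco_embed D) (w m)) \<longlonglongrightarrow> c)"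


section \<open>The algebra \<open>\<F>\<^sub>0(\<G>)\<close> and its comultiplication\<close>

text \<open>\<open>XI X k\<close>, \<open>XII X k\<close> and \<open>Pj k\<close> stand for \<open>X'(k)\<close>, \<open>X''(k)\<close> and \<open>p_elt\<^sub>k\<close>.\<close>

datatype 'g fgen = XI 'g nat | XII 'g nat | Pj nat

definition fgens :: "'g set \<Rightarrow> 'g fgen set" where
  "fgens G = {XI X k | X k. X \<in> G \<and> k \<ge> 1} \<union> {XII X k | X k. X \<in> G \<and> k \<ge> 1} \<union> {Pj k | k. k \<ge> 1}"

text \<open>Elements of \<open>\<G> \<union> \<G>\<^sup>*\<close> are encoded as letters over \<open>\<G>\<close>, and \<open>(X\<^sup>*)'(k) = (X'(k))\<^sup>*\<close>.\<close>

primrec x1_elt :: "'g letter \<Rightarrow> nat \<Rightarrow> 'g fgen star_poly" where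
  "x1_elt (Gen X) k = letter (Gen (XI X k))"
| "x1_elt (Adj X) k = letter (Adj (XI X k))"

primrec x2_elt :: "'g letter \<Rightarrow> nat \<Rightarrow> 'g fgen star_poly" where
  "x2_elt (Gen X) k = letter (Gen (XII X k))"
| "x2_elt (Adj X) k = letter (Adj (XII X k))"

definition p_elt :: "nat \<Rightarrow> 'g fgen star_poly" where
  "p_elt k = letter (Gen (Pj k))"

definition q_elt :: "nat \<Rightarrow> 'g fgen star_poly" where
  "q_elt m = (\<Sum>j=1..m. p_elt j)"

definition frels :: "'g set \<Rightarrow> 'g fgen star_poly set" where
  "frels G = (let A = free_alg (fgens G); L = Gen ` G \<union> Adj ` G in
     {x2_elt (Gen X) 1 | X. X \<in> G} \<union>
     {p_elt k \<otimes>\<^bsub>A\<^esub> p_elt l - (if k = l then p_elt k else 0) | k l. k \<ge> 1 \<and> l \<ge> 1} \<union>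
     {adj A (p_elt k) - p_elt k | k. k \<ge> 1} \<union>
     {(\<one>\<^bsub>A\<^esub> - q_elt m) \<otimes>\<^bsub>A\<^esub> x1_elt X k | m X k. X \<in> L \<and> 1 \<le> k \<and> k < m} \<union>
     {(\<one>\<^bsub>A\<^esub> - q_elt m) \<otimes>\<^bsub>A\<^esub> x2_elt X k | m X k. X \<in> L \<and> 1 \<le> k \<and> k < m} \<union>
     {q_elt m \<otimes>\<^bsub>A\<^esub> (x1_elt X k - x2_elt X k) | m X k. X \<in> L \<and> 1 \<le> k \<and> m < k})"

definition fcls :: "'g set \<Rightarrow> 'g fgen star_poly \<Rightarrow> 'g fgen star_poly set" where
  "fcls G = pres_class (fgens G) (frels G)"

definition F0_alg :: "'g set \<Rightarrow> 'g fgen star_poly set star_alg" where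
  "F0_alg G = presented (fgens G) (frels G)"

definition F0_q :: "'g set \<Rightarrow> enat \<Rightarrow> 'g fgen star_poly set" where
  "F0_q G k = (case k of enat m \<Rightarrow> fcls G (q_elt m) | \<infinity> \<Rightarrow> \<one>\<^bsub>F0_alg G\<^esub>)"

definition F0 :: "'g set \<Rightarrow> 'g fgen star_poly set tower" where
  "F0 G = star_alg.extend (F0_alg G) (tower.fields
     (\<lambda>m. star_gen (F0_alg G) ({fcls G (p_elt j) | j. j \<ge> 1} \<union>
        {fcls G (x1_elt (Gen X) k) | X k. X \<in> G \<and> 1 \<le> k \<and> k \<le> m} \<union>
        {fcls G (x2_elt (Gen X) k) | X k. X \<in> G \<and> 1 \<le> k \<and> k \<le> m}))
     (F0_q G))"

definition \<F> :: "'g set \<Rightarrow> 'g fgen star_poly set mco star_alg" where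
  "\<F> G = mclosure (F0 G)"

abbreviation F0F0 :: "'g set \<Rightarrow> ('g fgen star_poly set \<times> 'g fgen star_poly set \<Rightarrow>\<^sub>0 complex) set tower" where
  "F0F0 G \<equiv> tensor_tower (F0 G) (F0 G)"

text \<open>The monotone tensor product of \<open>\<F>(\<G>)\<close> with itself.\<close>

definition \<F>\<F> ::
    "'g set \<Rightarrow> ('g fgen star_poly set \<times> 'g fgen star_poly set \<Rightarrow>\<^sub>0 complex) set mco star_alg" where
  "\<F>\<F> G = mclosure (F0F0 G)"

definition comult0 ::
    "'g set \<Rightarrow> 'g fgen star_poly set \<Rightarrow> ('g fgen star_poly set \<times> 'g fgen star_poly set \<Rightarrow>\<^sub>0 complex) set" where
  "comult0 G = (let T = F0F0 G; q = (\<lambda>k. fcls G (q_elt k)); t = tens (F0 G) (F0 G) in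
     THE h. h \<in> extensional (carrier (F0 G)) \<and> h \<in> star_hom (F0 G) T \<and>
       (\<forall>X\<in>G. \<forall>k\<ge>1. let x = fcls G (x1_elt (Gen X) k) in h x = t x (q k) \<oplus>\<^bsub>T\<^esub> t (q k) x) \<and>
       (\<forall>X\<in>G. \<forall>k\<ge>1. let x = fcls G (x2_elt (Gen X) k) in h x = t x (q (k - 1)) \<oplus>\<^bsub>T\<^esub> t (q (k - 1)) x) \<and>
       (\<forall>k. h (q k) = t (q k) (q k)))"

definition comult ::
    "'g set \<Rightarrow> 'g fgen star_poly set mco
       \<Rightarrow> ('g fgen star_poly set \<times> 'g fgen star_poly set \<Rightarrow>\<^sub>0 complex) set mco" where
  "comult G U = (\<Union>(x, e)\<in>U. mco (F0F0 G) (\<lambda>m. comult0 G (x m)) (\<lambda>m. comult0 G (e m)))"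

definition \<delta>X :: "'g set \<Rightarrow> 'g \<Rightarrow> nat \<Rightarrow> 'g fgen star_poly set" where
  "\<delta>X G X k = (if k = 1 then fcls G (x1_elt (Gen X) k)
     else fcls G (x1_elt (Gen X) k) \<ominus>\<^bsub>F0 G\<^esub> fcls G (x2_elt (Gen X) k))"

definition \<tau> :: "'g set \<Rightarrow> 'g star_poly \<Rightarrow> 'g fgen star_poly set mco" where
  "\<tau> G = (THE h. h \<in> extensional (carrier (free_alg G)) \<and> h \<in> star_hom (free_alg G) (\<F> G) \<and>
     (\<forall>X\<in>G. h (letter (Gen X)) =
        mco (F0 G) (\<lambda>m. \<Oplus>\<^bsub>F0 G\<^esub>k\<in>{1..m}. \<delta>X G X k) (\<lambda>m. fcls G (q_elt m))))"


section \<open>Convolutions\<close>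

definition fp_delta :: "'g set \<Rightarrow> 'g star_poly \<Rightarrow> ('g star_poly + 'g star_poly) star_poly set" where
  "fp_delta G = (let A = free_alg G; AA = free_product A A in
     THE h. h \<in> extensional (carrier A) \<and> h \<in> star_hom A AA \<and>
       (\<forall>X\<in>G. h (letter (Gen X)) = fp_incl A A (Inl (letter (Gen X))) \<oplus>\<^bsub>AA\<^esub> fp_incl A A (Inr (letter (Gen X)))))"

definition free_conv ::
    "'g set \<Rightarrow> ('g star_poly \<Rightarrow> complex) \<Rightarrow> ('g star_poly \<Rightarrow> complex) \<Rightarrow> 'g star_poly \<Rightarrow> complex" where
  "free_conv G \<mu> \<nu> = free_product_state (free_alg G) (free_alg G) \<mu> \<nu> \<circ> fp_delta G"

definition star_conv ::
    "'g set \<Rightarrow> ('g fgen star_poly set mco \<Rightarrow> complex) \<Rightarrow> ('g fgen star_poly set mco \<Rightarrow> complex)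
       \<Rightarrow> 'g fgen star_poly set mco \<Rightarrow> complex" where
  "star_conv G \<phi> \<psi> = mtensor (F0 G) (F0 G) \<phi> \<psi> \<circ> comult G"

end

theory Submission
  imports Defs "HOL-Library.Nonpos_Ints"
begin

text \<open>
  Let \<open>\<F>\<^sub>0\<close> act on the functions of words whose letters carry a colour \<open>k \<ge> 1\<close>, the colours being
  tensor independent copies of \<open>\<mu>\<close>: \<open>q\<^sub>j\<close> replaces the colours \<open>\<ge> j\<close> by their expectation, and \<open>X'(k)\<close>
  and, for \<open>k > 1\<close>, also \<open>X''(k)\<close> act as the copy of \<open>X\<close> of colour \<open>k\<close>, compressed by \<open>q\<^sub>k\<^sub>+\<^sub>1\<close>. The vacuum
  state of this representation is supported by \<open>q\<^sub>1\<close>, so it is eventually constant along an operator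
  with monotone closure and extends to a state of \<open>\<F>\<close>; the same holds for tensor products.

  In the tensor square, \<open>\<A>\<close> is embedded into the left leg by
  \<open>X \<mapsto> \<Sum>\<^sub>k X'(k) \<otimes> q\<^sub>k - X''(k) \<otimes> q\<^sub>k\<^sub>-\<^sub>1\<close>, and symmetrically into the right leg. On vectors whose right
  leg lies in the range of \<open>p\<^sub>k\<close> the left embedding is the copy of colour \<open>k\<close>, and a centered element of
  that copy moves the left leg from \<open>q\<^sub>k\<close> into \<open>p\<^sub>k\<^sub>+\<^sub>1\<close>. An alternating product of centered elements thus
  uses a new colour at each step and ends up orthogonal to the vacuum, which is freeness. The sum of
  the two embeddings of \<open>X\<close> is \<open>\<Delta>(\<tau>(X))\<close>, hence \<open>\<Delta> \<circ> \<tau> = J \<circ> \<delta>\<close>.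
\<close>

section \<open>Complex algebras and $*$-algebras\<close>

text \<open>A vector of the representation is the function sending a word f to the expectation of f
  applied to that vector, so vectors with equal pairings coincide and no null space has to be
  divided out. The price is that operators on functions carry no adjoint: homomorphisms without
  adjoint are treated separately, relations are checked from both sides, and positivity comes from a
  formal pairing (\<open>comb\<close>) together with the Schur product theorem over the colours.
  Taking X''(k) = X'(k) for k > 1 satisfies q_m (X'(k) - X''(k)) = 0 trivially; at k = 1 only q_0 =
  0 is involved, so X''(1) = 0 does no harm. The compression by q_(k+1) is what (1 - q_m) X'(k) = 0
  for k < m demands. The prescribed domains of sums and products are awkward, but they matter only
  for membership: a class depends on the sequence alone, and a product stabilizes because an
  eventual value of y_n c_i is absorbed by some c_l. The free product state is a definite
  description; the constructed functional itself witnesses existence, and alternating centered words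
  give uniqueness.\<close>

locale complex_alg = ring A for A :: "('a, 'x) star_alg_scheme" (structure) +
  assumes smult_closed [simp, intro]: "x \<in> carrier A \<Longrightarrow> c \<odot> x \<in> carrier A"
    and smult_r_distr: "x \<in> carrier A \<Longrightarrow> y \<in> carrier A \<Longrightarrow> c \<odot> (x \<oplus> y) = c \<odot> x \<oplus> c \<odot> y"
    and smult_l_distr: "x \<in> carrier A \<Longrightarrow> (c + d) \<odot> x = c \<odot> x \<oplus> d \<odot> x"
    and smult_assoc: "x \<in> carrier A \<Longrightarrow> c \<odot> (d \<odot> x) = (c * d) \<odot> x"
    and smult_one [simp]: "x \<in> carrier A \<Longrightarrow> 1 \<odot> x = x"
    and smult_mult_l: "x \<in> carrier A \<Longrightarrow> y \<in> carrier A \<Longrightarrow> (c \<odot> x) \<otimes> y = c \<odot> (x \<otimes> y)"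
    and smult_mult_r: "x \<in> carrier A \<Longrightarrow> y \<in> carrier A \<Longrightarrow> x \<otimes> (c \<odot> y) = c \<odot> (x \<otimes> y)"
begin

lemma smult_zero_l [simp]: "x \<in> carrier A \<Longrightarrow> 0 \<odot> x = \<zero>"
  using smult_l_distr[of x 0 0] by (metis add.inv_closed add.l_cancel_one' smult_closed add_0)

lemma smult_zero_r [simp]: "c \<odot> \<zero> = \<zero>"
  using smult_r_distr[of \<zero> \<zero> c] by (metis add.l_cancel_one' smult_closed zero_closed l_zero)

lemma smult_neg_one: "x \<in> carrier A \<Longrightarrow> (-1) \<odot> x = \<ominus> x"
proof -
  assume x: "x \<in> carrier A"
  have "(-1) \<odot> x \<oplus> x = \<zero>" using smult_l_distr[OF x, of "-1" 1] x by simp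
  then show ?thesis using x by (metis minus_equality smult_closed)
qed

lemma minus_eq_smult: "x \<in> carrier A \<Longrightarrow> y \<in> carrier A \<Longrightarrow> x \<ominus> y = x \<oplus> (-1) \<odot> y"
  by (simp add: smult_neg_one a_minus_def)

lemma finsum_smult:
  "f \<in> S \<rightarrow> carrier A \<Longrightarrow> c \<odot> finsum A f S = (\<Oplus>i\<in>S. c \<odot> f i)"
proof (induction S rule: infinite_finite_induct)
  case (insert i S)
  then have "f i \<in> carrier A" "f \<in> S \<rightarrow> carrier A" by auto
  then have "(\<lambda>i. c \<odot> f i) \<in> S \<rightarrow> carrier A" "c \<odot> f i \<in> carrier A" by auto
  with insert show ?case by (simp add: smult_r_distr)
qed simp_all

lemma minus_mult_l: "x \<in> carrier A \<Longrightarrow> y \<in> carrier A \<Longrightarrow> z \<in> carrier A \<Longrightarrow>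
    (x \<ominus> y) \<otimes> z = x \<otimes> z \<ominus> y \<otimes> z"
  by (simp add: a_minus_def l_distr l_minus)

lemma minus_mult_r: "x \<in> carrier A \<Longrightarrow> y \<in> carrier A \<Longrightarrow> z \<in> carrier A \<Longrightarrow>
    z \<otimes> (x \<ominus> y) = z \<otimes> x \<ominus> z \<otimes> y"
  by (simp add: a_minus_def r_distr r_minus)

lemma minus_self [simp]: "x \<in> carrier A \<Longrightarrow> x \<ominus> x = \<zero>"
  by (simp add: a_minus_def r_neg)

lemma minus_zero_r [simp]: "x \<in> carrier A \<Longrightarrow> x \<ominus> \<zero> = x"
  by (simp add: a_minus_def)

lemma minus_eq_zeroD: "x \<in> carrier A \<Longrightarrow> y \<in> carrier A \<Longrightarrow> x \<ominus> y = \<zero> \<Longrightarrow> x = y"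
  by (metis a_minus_def minus_equality add.inv_closed minus_minus)

end

locale star_algebra = complex_alg +
  assumes adj_closed [simp, intro]: "x \<in> carrier A \<Longrightarrow> adj A x \<in> carrier A"
    and adj_adj [simp]: "x \<in> carrier A \<Longrightarrow> adj A (adj A x) = x"
    and adj_add: "x \<in> carrier A \<Longrightarrow> y \<in> carrier A \<Longrightarrow> adj A (x \<oplus> y) = adj A x \<oplus> adj A y"
    and adj_smult: "x \<in> carrier A \<Longrightarrow> adj A (c \<odot> x) = cnj c \<odot> adj A x"
    and adj_mult: "x \<in> carrier A \<Longrightarrow> y \<in> carrier A \<Longrightarrow> adj A (x \<otimes> y) = adj A y \<otimes> adj A x"
begin

lemma adj_one [simp]: "adj A \<one> = \<one>"
  by (metis adj_adj adj_closed adj_mult l_one one_closed r_one)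

lemma adj_zero [simp]: "adj A \<zero> = \<zero>"
  using adj_smult[of \<zero> 0] by simp

lemma adj_minus: "x \<in> carrier A \<Longrightarrow> y \<in> carrier A \<Longrightarrow> adj A (x \<ominus> y) = adj A x \<ominus> adj A y"
  by (simp add: minus_eq_smult adj_add adj_smult)

lemma adj_finsum: "f \<in> S \<rightarrow> carrier A \<Longrightarrow> adj A (finsum A f S) = (\<Oplus>i\<in>S. adj A (f i))"
proof (induction S rule: infinite_finite_induct)
  case (insert i S)
  then have "f i \<in> carrier A" "f \<in> S \<rightarrow> carrier A" by auto
  then have "(\<lambda>i. adj A (f i)) \<in> S \<rightarrow> carrier A" "adj A (f i) \<in> carrier A" by auto
  with insert show ?case by (simp add: adj_add)
qed simp_all

end

text \<open>Quotients, towers and plain algebras live in different record types with the same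
  operations, so the axioms are carried over along equal fields.\<close>

lemma ring_cong:
  assumes "ring A" and "carrier B = carrier A" "mult B = mult A" "one B = one A"
    "zero B = zero A" "add B = add A"
  shows "ring B"
proof -
  interpret ring A by fact
  show ?thesis
    apply (rule ringI; (rule abelian_groupI monoidI)?)
    by (auto simp: assms(2-) a_ac m_assoc l_distr r_distr intro: l_neg)
qed

lemma star_algebra_cong:
  assumes "star_algebra A" and "carrier B = carrier A" "mult B = mult A" "one B = one A"
    "zero B = zero A" "add B = add A" "smult B = smult A" "adj B = adj A"
  shows "star_algebra B"
proof -
  interpret star_algebra A by fact
  interpret B: ring B by (rule ring_cong[OF ring_axioms assms(2-6)])
  show ?thesis
    by unfold_locales (auto simp: assms(2-) smult_r_distr smult_l_distr smult_assoc smult_mult_l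
        smult_mult_r adj_add adj_smult adj_mult)
qed

section \<open>Linear maps and homomorphisms of the record algebras\<close>

definition linear_map :: "('a, 'x) star_alg_scheme \<Rightarrow> ('b, 'y) star_alg_scheme \<Rightarrow> ('a \<Rightarrow> 'b) set" where
  "linear_map A B = {h \<in> carrier A \<rightarrow> carrier B.
     (\<forall>x\<in>carrier A. \<forall>y\<in>carrier A. h (x \<oplus>\<^bsub>A\<^esub> y) = h x \<oplus>\<^bsub>B\<^esub> h y) \<and>
     (\<forall>c. \<forall>x\<in>carrier A. h (c \<odot>\<^bsub>A\<^esub> x) = c \<odot>\<^bsub>B\<^esub> h x)}"

text \<open>Kept apart from \<open>star_hom\<close> because the algebra of operators on functions,
  in which \<open>\<F>\<^sub>0\<close> is represented, has no meaningful adjoint.\<close>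

definition alg_hom :: "('a, 'x) star_alg_scheme \<Rightarrow> ('b, 'y) star_alg_scheme \<Rightarrow> ('a \<Rightarrow> 'b) set" where
  "alg_hom A B = linear_map A B \<inter> {h. h \<one>\<^bsub>A\<^esub> = \<one>\<^bsub>B\<^esub> \<and>
     (\<forall>x\<in>carrier A. \<forall>y\<in>carrier A. h (x \<otimes>\<^bsub>A\<^esub> y) = h x \<otimes>\<^bsub>B\<^esub> h y)}"

lemma star_hom_iff: "h \<in> star_hom A B \<longleftrightarrow>
    h \<in> alg_hom A B \<and> (\<forall>x\<in>carrier A. h (adj A x) = adj B (h x))"
  by (auto simp: star_hom_def alg_hom_def linear_map_def ring_hom_def)

lemma star_hom_alg_hom: "h \<in> star_hom A B \<Longrightarrow> h \<in> alg_hom A B"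
  by (simp add: star_hom_iff)

lemma linear_mapD:
  assumes "h \<in> linear_map A B"
  shows "x \<in> carrier A \<Longrightarrow> h x \<in> carrier B"
    and "x \<in> carrier A \<Longrightarrow> y \<in> carrier A \<Longrightarrow> h (x \<oplus>\<^bsub>A\<^esub> y) = h x \<oplus>\<^bsub>B\<^esub> h y"
    and "x \<in> carrier A \<Longrightarrow> h (c \<odot>\<^bsub>A\<^esub> x) = c \<odot>\<^bsub>B\<^esub> h x"
  using assms by (auto simp: linear_map_def)

lemma alg_homD:
  assumes "h \<in> alg_hom A B"
  shows "h \<in> linear_map A B" and "x \<in> carrier A \<Longrightarrow> h x \<in> carrier B"
    and "x \<in> carrier A \<Longrightarrow> y \<in> carrier A \<Longrightarrow> h (x \<oplus>\<^bsub>A\<^esub> y) = h x \<oplus>\<^bsub>B\<^esub> h y"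
    and "x \<in> carrier A \<Longrightarrow> h (c \<odot>\<^bsub>A\<^esub> x) = c \<odot>\<^bsub>B\<^esub> h x"
    and "x \<in> carrier A \<Longrightarrow> y \<in> carrier A \<Longrightarrow> h (x \<otimes>\<^bsub>A\<^esub> y) = h x \<otimes>\<^bsub>B\<^esub> h y"
    and "h \<one>\<^bsub>A\<^esub> = \<one>\<^bsub>B\<^esub>"
  using assms by (auto simp: alg_hom_def linear_map_def)

lemma star_homD: "h \<in> star_hom A B \<Longrightarrow> x \<in> carrier A \<Longrightarrow> h (adj A x) = adj B (h x)"
  by (simp add: star_hom_iff)

lemma linear_map_zero:
  assumes "complex_alg A" "complex_alg B" "h \<in> linear_map A B"
  shows "h \<zero>\<^bsub>A\<^esub> = \<zero>\<^bsub>B\<^esub>"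
proof -
  interpret A: complex_alg A by fact
  interpret B: complex_alg B by fact
  show ?thesis using linear_mapD(3)[OF assms(3), of "\<zero>\<^bsub>A\<^esub>" 0] linear_mapD(1)[OF assms(3)] by simp
qed

lemma linear_map_minus:
  assumes "complex_alg A" "complex_alg B" "h \<in> linear_map A B" "x \<in> carrier A" "y \<in> carrier A"
  shows "h (x \<ominus>\<^bsub>A\<^esub> y) = h x \<ominus>\<^bsub>B\<^esub> h y"
proof -
  interpret A: complex_alg A by fact
  interpret B: complex_alg B by fact
  show ?thesis using assms(4-)
    by (simp add: A.minus_eq_smult B.minus_eq_smult linear_mapD[OF assms(3)])
qed

lemma linear_map_finsum:
  assumes "complex_alg A" "complex_alg B" "h \<in> linear_map A B" "f \<in> S \<rightarrow> carrier A"
  shows "h (finsum A f S) = (\<Oplus>\<^bsub>B\<^esub>i\<in>S. h (f i))"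
proof -
  interpret A: complex_alg A by fact
  interpret B: complex_alg B by fact
  show ?thesis using assms(4)
  proof (induction S rule: infinite_finite_induct)
    case (insert i S)
    then have f: "f i \<in> carrier A" "f \<in> S \<rightarrow> carrier A" by auto
    then have g: "(\<lambda>i. h (f i)) \<in> S \<rightarrow> carrier B" "h (f i) \<in> carrier B"
      using linear_mapD(1)[OF assms(3)] by auto
    show ?case using insert f g by (simp add: linear_mapD[OF assms(3)])
  qed (simp_all add: linear_map_zero[OF assms(1-3)])
qed

lemma linear_map_compose:
  "g \<in> linear_map B C \<Longrightarrow> f \<in> linear_map A B \<Longrightarrow> (\<lambda>x. g (f x)) \<in> linear_map A C"
  unfolding linear_map_def Pi_def by simp

lemma alg_hom_compose:
  "g \<in> alg_hom B C \<Longrightarrow> f \<in> alg_hom A B \<Longrightarrow> (\<lambda>x. g (f x)) \<in> alg_hom A C"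
  unfolding alg_hom_def linear_map_def Pi_def by simp

lemma star_hom_compose:
  "g \<in> star_hom B C \<Longrightarrow> f \<in> star_hom A B \<Longrightarrow> (\<lambda>x. g (f x)) \<in> star_hom A C"
  by (auto simp: star_hom_iff alg_hom_compose alg_homD(2))

text \<open>The complex numbers as a $*$-algebra, so that functionals are linear maps.\<close>

definition complex_star :: "complex star_alg" where
  "complex_star = \<lparr>carrier = UNIV, mult = (*), one = 1, zero = 0, add = (+), smult = (*), adj = cnj\<rparr>"

lemma complex_star_simps [simp]:
  "carrier complex_star = UNIV" "mult complex_star = (*)" "one complex_star = 1"
  "zero complex_star = 0" "add complex_star = (+)" "smult complex_star = (*)" "adj complex_star = cnj"
  by (simp_all add: complex_star_def)

lemma star_algebra_complex_star: "star_algebra complex_star"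
proof -
  have "ring complex_star"
    apply (rule ringI; (rule abelian_groupI monoidI)?)
    by (auto simp: algebra_simps intro: exI[of _ "- _"] left_minus)
  then interpret ring complex_star .
  show ?thesis by unfold_locales (auto simp: algebra_simps)
qed

lemma linear_functional_iff: "linear_functional A \<phi> \<longleftrightarrow> \<phi> \<in> linear_map A complex_star"
  by (auto simp: linear_functional_def linear_map_def)

lemma finsum_complex_star: "finsum complex_star f S = sum f S"
proof -
  interpret star_algebra complex_star by (rule star_algebra_complex_star)
  show ?thesis by (induction S rule: infinite_finite_induct) simp_all
qed

lemma minus_complex_star [simp]: "x \<ominus>\<^bsub>complex_star\<^esub> y = x - y"
proof -
  interpret star_algebra complex_star by (rule star_algebra_complex_star)
  show ?thesis using minus_eq_smult[of x y] by simp
qed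

text \<open>All axioms are equations, so they pass to a surjective image; quotient algebras obtain
  them this way without computing with cosets.\<close>

lemma star_algebra_image:
  assumes "star_algebra A" "ring B" "h \<in> alg_hom A B" "h ` carrier A = carrier B"
    and "\<And>x. x \<in> carrier A \<Longrightarrow> adj B (h x) = h (adj A x)"
  shows "star_algebra B"
proof -
  interpret A: star_algebra A by fact
  interpret B: ring B by fact
  have ex: "\<exists>x'\<in>carrier A. x = h x'" if "x \<in> carrier B" for x using that assms(4) by auto
  note h = alg_homD(2-6)[OF assms(3)] and hs = alg_homD(3-6)[OF assms(3), symmetric]
  show ?thesis
  proof (unfold_locales, goal_cases)
    case (1 x c) then show ?case by (auto dest!: ex simp: hs intro!: h(1))
  next
    case (2 x y c)
    then obtain x' y' where "x' \<in> carrier A" "y' \<in> carrier A" "x = h x'" "y = h y'"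
      using ex[OF 2(1)] ex[OF 2(2)] by blast
    moreover from this have "h (c \<odot>\<^bsub>A\<^esub> (x' \<oplus>\<^bsub>A\<^esub> y')) = h (c \<odot>\<^bsub>A\<^esub> x' \<oplus>\<^bsub>A\<^esub> c \<odot>\<^bsub>A\<^esub> y')"
      by (simp add: A.smult_r_distr)
    ultimately show ?case by (simp add: h)
  next
    case (3 x c d)
    then obtain x' where "x' \<in> carrier A" "x = h x'" using ex[OF 3(1)] by blast
    moreover from this have "h ((c + d) \<odot>\<^bsub>A\<^esub> x') = h (c \<odot>\<^bsub>A\<^esub> x' \<oplus>\<^bsub>A\<^esub> d \<odot>\<^bsub>A\<^esub> x')"
      by (simp add: A.smult_l_distr)
    ultimately show ?case by (simp add: h)
  next
    case (4 x c d)
    then obtain x' where "x' \<in> carrier A" "x = h x'" using ex[OF 4(1)] by blast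
    moreover from this have "h (c \<odot>\<^bsub>A\<^esub> (d \<odot>\<^bsub>A\<^esub> x')) = h ((c * d) \<odot>\<^bsub>A\<^esub> x')"
      by (simp add: A.smult_assoc)
    ultimately show ?case by (simp add: h)
  next
    case (5 x)
    then obtain x' where "x' \<in> carrier A" "x = h x'" using ex[OF 5(1)] by blast
    then show ?case using h(3)[of x' 1] by simp
  next
    case (6 x y c)
    then obtain x' y' where "x' \<in> carrier A" "y' \<in> carrier A" "x = h x'" "y = h y'"
      using ex[OF 6(1)] ex[OF 6(2)] by blast
    moreover from this have "h ((c \<odot>\<^bsub>A\<^esub> x') \<otimes>\<^bsub>A\<^esub> y') = h (c \<odot>\<^bsub>A\<^esub> (x' \<otimes>\<^bsub>A\<^esub> y'))"
      by (simp add: A.smult_mult_l)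
    ultimately show ?case by (simp add: h)
  next
    case (7 x y c)
    then obtain x' y' where "x' \<in> carrier A" "y' \<in> carrier A" "x = h x'" "y = h y'"
      using ex[OF 7(1)] ex[OF 7(2)] by blast
    moreover from this have "h (x' \<otimes>\<^bsub>A\<^esub> (c \<odot>\<^bsub>A\<^esub> y')) = h (c \<odot>\<^bsub>A\<^esub> (x' \<otimes>\<^bsub>A\<^esub> y'))"
      by (simp add: A.smult_mult_r)
    ultimately show ?case by (simp add: h)
  next
    case (8 x) then show ?case by (auto dest!: ex simp: assms(5) intro!: h(1))
  next
    case (9 x) then show ?case by (auto dest!: ex simp: assms(5))
  next
    case (10 x y)
    then obtain x' y' where "x' \<in> carrier A" "y' \<in> carrier A" "x = h x'" "y = h y'"
      using ex[OF 10(1)] ex[OF 10(2)] by blast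
    moreover from this have "h (adj A (x' \<oplus>\<^bsub>A\<^esub> y')) = h (adj A x' \<oplus>\<^bsub>A\<^esub> adj A y')"
      by (simp add: A.adj_add)
    ultimately show ?case using assms(5)[of "x' \<oplus>\<^bsub>A\<^esub> y'"] by (simp add: h assms(5))
  next
    case (11 x c)
    then obtain x' where "x' \<in> carrier A" "x = h x'" using ex[OF 11(1)] by blast
    moreover from this have "h (adj A (c \<odot>\<^bsub>A\<^esub> x')) = h (cnj c \<odot>\<^bsub>A\<^esub> adj A x')"
      by (simp add: A.adj_smult)
    ultimately show ?case using assms(5)[of "c \<odot>\<^bsub>A\<^esub> x'"] by (simp add: h assms(5))
  next
    case (12 x y)
    then obtain x' y' where "x' \<in> carrier A" "y' \<in> carrier A" "x = h x'" "y = h y'"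
      using ex[OF 12(1)] ex[OF 12(2)] by blast
    moreover from this have "h (adj A (x' \<otimes>\<^bsub>A\<^esub> y')) = h (adj A y' \<otimes>\<^bsub>A\<^esub> adj A x')"
      by (simp add: A.adj_mult)
    ultimately show ?case using assms(5)[of "x' \<otimes>\<^bsub>A\<^esub> y'"] by (simp add: h assms(5))
  qed
qed


section \<open>Monoid algebras\<close>

lemma poly_mapping_sum_singles:
  fixes p :: "'a \<Rightarrow>\<^sub>0 'b::comm_monoid_add"
  assumes "finite S" "Poly_Mapping.keys p \<subseteq> S"
  shows "(\<Sum>u\<in>S. Poly_Mapping.single u (Poly_Mapping.lookup p u)) = p"
proof (rule poly_mapping_eqI)
  fix k
  have "Poly_Mapping.lookup p k = 0" if "k \<notin> S" using that assms(2) by (auto simp: in_keys_iff)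
  then show "Poly_Mapping.lookup (\<Sum>u\<in>S. Poly_Mapping.single u (Poly_Mapping.lookup p u)) k
      = Poly_Mapping.lookup p k"
    using assms(1) by (simp add: lookup_sum lookup_single when_def)
qed

lemma keys_addD: "k \<in> Poly_Mapping.keys (p + q) \<Longrightarrow> k \<in> Poly_Mapping.keys p \<or> k \<in> Poly_Mapping.keys q"
  using keys_add[of p q] by blast

lemma monoid_alg_simps [simp]:
  "carrier (monoid_alg M i) = {p. Poly_Mapping.keys p \<subseteq> carrier M}"
  "one (monoid_alg M i) = Poly_Mapping.single \<one>\<^bsub>M\<^esub> 1"
  "zero (monoid_alg M i) = 0"
  "add (monoid_alg M i) = (+)"
  by (simp_all add: monoid_alg_def)

lemma lookup_monoid_alg_smult [simp]:
  "Poly_Mapping.lookup (c \<odot>\<^bsub>monoid_alg M i\<^esub> p) u = c * Poly_Mapping.lookup p u"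
  by (simp add: monoid_alg_def Poly_Mapping.map.rep_eq when_def)

lemma monoid_alg_smult_single [simp]:
  "c \<odot>\<^bsub>monoid_alg M i\<^esub> Poly_Mapping.single u a = Poly_Mapping.single u (c * a)"
  by (rule poly_mapping_eqI) (simp add: lookup_single when_def)

lemma monoid_alg_induct [consumes 1, case_names add single]:
  assumes "p \<in> carrier (monoid_alg M i)"
    and add: "\<And>p q. p \<in> carrier (monoid_alg M i) \<Longrightarrow> q \<in> carrier (monoid_alg M i) \<Longrightarrow>
        P p \<Longrightarrow> P q \<Longrightarrow> P (p + q)"
    and single: "\<And>u c. u \<in> carrier M \<Longrightarrow> P (Poly_Mapping.single u c)"
    and "\<one>\<^bsub>M\<^esub> \<in> carrier M"
  shows "P p"
proof -
  have "P (\<Sum>u\<in>S. Poly_Mapping.single u (Poly_Mapping.lookup p u)) \<and>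
      Poly_Mapping.keys (\<Sum>u\<in>S. Poly_Mapping.single u (Poly_Mapping.lookup p u)) \<subseteq> carrier M"
    if "finite S" "S \<subseteq> carrier M" for S
    using that
  proof (induction S)
    case empty
    \<comment> \<open>The empty sum is the basis element of the unit with coefficient 0, which is
      where the unit of the monoid enters.\<close>
    show ?case using single[OF assms(4), of 0] by simp
  next
    case (insert u S)
    then show ?case
      using add[OF _ _ single[of u "Poly_Mapping.lookup p u"]]
      by (auto dest!: keys_addD split: if_splits)
  qed
  from this[of "Poly_Mapping.keys p"] assms(1) show ?thesis
    by (simp add: poly_mapping_sum_singles)
qed

text \<open>The definition sums over the exact supports, which change under addition; enlarging the
  index sets to common finite ones makes distributivity a termwise identity.\<close>

lemma monoid_alg_mult_superset:
  assumes "finite S" "Poly_Mapping.keys p \<subseteq> S" "finite T" "Poly_Mapping.keys q \<subseteq> T"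
  shows "p \<otimes>\<^bsub>monoid_alg M i\<^esub> q = (\<Sum>u\<in>S. \<Sum>v\<in>T.
      Poly_Mapping.single (u \<otimes>\<^bsub>M\<^esub> v) (Poly_Mapping.lookup p u * Poly_Mapping.lookup q v))"
proof -
  have "(\<Sum>v\<in>Poly_Mapping.keys q.
        Poly_Mapping.single (u \<otimes>\<^bsub>M\<^esub> v) (Poly_Mapping.lookup p u * Poly_Mapping.lookup q v)) =
      (\<Sum>v\<in>T. Poly_Mapping.single (u \<otimes>\<^bsub>M\<^esub> v) (Poly_Mapping.lookup p u * Poly_Mapping.lookup q v))" for u
    using assms by (intro sum.mono_neutral_left) (auto simp: in_keys_iff)
  moreover have "(\<Sum>u\<in>Poly_Mapping.keys p. \<Sum>v\<in>T.
        Poly_Mapping.single (u \<otimes>\<^bsub>M\<^esub> v) (Poly_Mapping.lookup p u * Poly_Mapping.lookup q v)) =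
      (\<Sum>u\<in>S. \<Sum>v\<in>T. Poly_Mapping.single (u \<otimes>\<^bsub>M\<^esub> v) (Poly_Mapping.lookup p u * Poly_Mapping.lookup q v))"
    using assms by (intro sum.mono_neutral_left) (auto simp: in_keys_iff)
  ultimately show ?thesis by (simp add: monoid_alg_def)
qed

lemma monoid_alg_mult_single [simp]:
  "Poly_Mapping.single u a \<otimes>\<^bsub>monoid_alg M i\<^esub> Poly_Mapping.single v b =
     Poly_Mapping.single (u \<otimes>\<^bsub>M\<^esub> v) (a * b)"
  by (subst monoid_alg_mult_superset[of "{u}" _ "{v}"]) auto

lemma monoid_alg_mult_add_l:
  "(p + p') \<otimes>\<^bsub>monoid_alg M i\<^esub> q = p \<otimes>\<^bsub>monoid_alg M i\<^esub> q + p' \<otimes>\<^bsub>monoid_alg M i\<^esub> q"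
proof -
  let ?S = "Poly_Mapping.keys p \<union> Poly_Mapping.keys p'" and ?T = "Poly_Mapping.keys q"
  note * = monoid_alg_mult_superset[of ?S _ ?T, OF _ _ _ subset_refl]
  show ?thesis
    by (subst (1 2 3) *)
      (auto dest: keys_addD simp: lookup_add distrib_right single_add sum.distrib)
qed

lemma monoid_alg_mult_add_r:
  "q \<otimes>\<^bsub>monoid_alg M i\<^esub> (p + p') = q \<otimes>\<^bsub>monoid_alg M i\<^esub> p + q \<otimes>\<^bsub>monoid_alg M i\<^esub> p'"
proof -
  let ?S = "Poly_Mapping.keys p \<union> Poly_Mapping.keys p'" and ?T = "Poly_Mapping.keys q"
  note * = monoid_alg_mult_superset[of ?T _ ?S, OF _ subset_refl]
  show ?thesis
    by (subst (1 2 3) *)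
      (auto dest: keys_addD simp: lookup_add distrib_left single_add sum.distrib)
qed

lemma monoid_alg_adj_superset:
  assumes "finite S" "Poly_Mapping.keys p \<subseteq> S"
  shows "adj (monoid_alg M i) p =
    (\<Sum>u\<in>S. Poly_Mapping.single (i u) (cnj (Poly_Mapping.lookup p u)))"
  unfolding monoid_alg_def using assms
  by simp (intro sum.mono_neutral_left, auto simp: in_keys_iff)

lemma monoid_alg_adj_single [simp]:
  "adj (monoid_alg M i) (Poly_Mapping.single u c) = Poly_Mapping.single (i u) (cnj c)"
  by (subst monoid_alg_adj_superset[of "{u}"]) auto

lemma monoid_alg_adj_add:
  "adj (monoid_alg M i) (p + q) = adj (monoid_alg M i) p + adj (monoid_alg M i) q"
proof -
  let ?S = "Poly_Mapping.keys p \<union> Poly_Mapping.keys q"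
  show ?thesis
    by (subst (1 2 3) monoid_alg_adj_superset[of ?S])
      (auto dest: keys_addD simp: lookup_add single_add sum.distrib)
qed

lemma monoid_alg_smult_add:
  "c \<odot>\<^bsub>monoid_alg M i\<^esub> (p + q) = c \<odot>\<^bsub>monoid_alg M i\<^esub> p + c \<odot>\<^bsub>monoid_alg M i\<^esub> q"
  by (rule poly_mapping_eqI) (simp add: lookup_add distrib_left)

lemma complex_alg_monoid_alg:
  assumes "monoid M"
  shows "complex_alg (monoid_alg M i)"
proof -
  interpret M: monoid M by fact
  let ?A = "monoid_alg M i"
  note ind = monoid_alg_induct[OF _ _ _ M.one_closed, consumes 1]
  have mc: "p \<otimes>\<^bsub>?A\<^esub> q \<in> carrier ?A" if p: "p \<in> carrier ?A" and q: "q \<in> carrier ?A" for p q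
    using p
  proof (induction p rule: ind)
    case (1 p p')
    then show ?case by (auto simp: monoid_alg_mult_add_l dest!: keys_addD)
  next
    case (2 u c)
    show ?case using q
    proof (induction q rule: ind)
      case (1 q q')
      then show ?case by (auto simp: monoid_alg_mult_add_r dest!: keys_addD)
    next
      case (2 v d)
      then show ?case using \<open>u \<in> carrier M\<close> by auto
    qed
  qed
  have "ring ?A"
  proof (rule ringI)
    show "abelian_group ?A"
    proof (rule abelian_groupI)
      fix x assume "x \<in> carrier ?A"
      then show "\<exists>y\<in>carrier ?A. y \<oplus>\<^bsub>?A\<^esub> x = \<zero>\<^bsub>?A\<^esub>"
        by (intro bexI[of _ "- x"]) auto
    qed (auto simp: add_ac dest!: keys_addD)
    show "Group.monoid ?A"
    proof (rule monoidI)
      fix p q r assume p: "p \<in> carrier ?A" and q: "q \<in> carrier ?A" and r: "r \<in> carrier ?A"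
      show "p \<otimes>\<^bsub>?A\<^esub> q \<otimes>\<^bsub>?A\<^esub> r = p \<otimes>\<^bsub>?A\<^esub> (q \<otimes>\<^bsub>?A\<^esub> r)" using p
      proof (induction p rule: ind)
        case (2 u c)
        show ?case using q
        proof (induction q rule: ind)
          case (2 v d)
          show ?case using r
          proof (induction r rule: ind)
            case (2 w e)
            then show ?case using \<open>u \<in> carrier M\<close> \<open>v \<in> carrier M\<close> by (simp add: M.m_assoc mult.assoc)
          qed (simp_all only: monoid_alg_mult_add_r)
        qed (simp_all only: monoid_alg_mult_add_r monoid_alg_mult_add_l)
      qed (simp_all only: monoid_alg_mult_add_l)
    next
      fix p assume p: "p \<in> carrier ?A"
      show "\<one>\<^bsub>?A\<^esub> \<otimes>\<^bsub>?A\<^esub> p = p" using p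
        by (induction p rule: ind) (simp_all add: monoid_alg_mult_add_r)
      show "p \<otimes>\<^bsub>?A\<^esub> \<one>\<^bsub>?A\<^esub> = p" using p
        by (induction p rule: ind) (simp_all add: monoid_alg_mult_add_l)
    qed (use mc in auto)
  qed (simp_all add: monoid_alg_mult_add_l monoid_alg_mult_add_r)
  then interpret ring ?A .
  have smc: "c \<odot>\<^bsub>?A\<^esub> p \<in> carrier ?A" if "p \<in> carrier ?A" for p c
    using that by (auto simp: in_keys_iff)
  show ?thesis
  proof (unfold_locales, goal_cases)
    case (1 x c) then show ?case by (rule smc)
  next
    case (2 x y c) then show ?case by (simp add: monoid_alg_smult_add)
  next
    case (3 x c d) show ?case by (rule poly_mapping_eqI) (simp add: lookup_add distrib_right)
  next
    case (4 x c d) show ?case by (rule poly_mapping_eqI) simp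
  next
    case (5 x) show ?case by (rule poly_mapping_eqI) simp
  next
    case (6 p q c)
    show ?case using 6(1)
    proof (induction p rule: ind)
      case (2 u a)
      show ?case using 6(2)
        by (induction q rule: ind)
          (simp_all add: monoid_alg_mult_add_r monoid_alg_smult_add mult.assoc)
    qed (simp_all add: monoid_alg_mult_add_l monoid_alg_smult_add)
  next
    case (7 p q c)
    show ?case using 7(1)
    proof (induction p rule: ind)
      case (2 u a)
      show ?case using 7(2)
        by (induction q rule: ind)
          (simp_all add: monoid_alg_mult_add_r monoid_alg_smult_add mult_ac)
    qed (simp_all add: monoid_alg_mult_add_l monoid_alg_smult_add)
  qed
qed

lemma star_algebra_monoid_alg:
  assumes "monoid M" and i: "\<And>u. u \<in> carrier M \<Longrightarrow> i u \<in> carrier M"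
    "\<And>u. u \<in> carrier M \<Longrightarrow> i (i u) = u"
    "\<And>u v. u \<in> carrier M \<Longrightarrow> v \<in> carrier M \<Longrightarrow> i (u \<otimes>\<^bsub>M\<^esub> v) = i v \<otimes>\<^bsub>M\<^esub> i u"
  shows "star_algebra (monoid_alg M i)"
proof -
  interpret M: monoid M by fact
  let ?A = "monoid_alg M i"
  interpret A: complex_alg ?A by (rule complex_alg_monoid_alg) fact
  note ind = monoid_alg_induct[OF _ _ _ M.one_closed, consumes 1]
  show ?thesis
  proof (unfold_locales, goal_cases)
    case (1 x) then show ?case
      by (induction x rule: ind) (auto simp: monoid_alg_adj_add i dest!: keys_addD)
  next
    case (2 x) then show ?case
      by (induction x rule: ind) (simp_all add: monoid_alg_adj_add i)
  next
    case (3 x y) show ?case by (simp add: monoid_alg_adj_add)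
  next
    case (4 x c) then show ?case
      by (induction x rule: ind) (simp_all add: monoid_alg_adj_add monoid_alg_smult_add)
  next
    case (5 p q)
    show ?case using 5(1)
    proof (induction p rule: ind)
      case (2 u a)
      show ?case using 5(2)
        by (induction q rule: ind)
          (use 2 in \<open>simp_all add: monoid_alg_mult_add_r monoid_alg_mult_add_l monoid_alg_adj_add mult_ac i\<close>)
    qed (simp_all add: monoid_alg_mult_add_l monoid_alg_mult_add_r monoid_alg_adj_add)
  qed
qed

definition monoid_alg_lift ::
    "('b, 'x) star_alg_scheme \<Rightarrow> ('m \<Rightarrow> 'b) \<Rightarrow> ('m \<Rightarrow>\<^sub>0 complex) \<Rightarrow> 'b" where
  "monoid_alg_lift E F p =
    (\<Oplus>\<^bsub>E\<^esub>u\<in>Poly_Mapping.keys p. Poly_Mapping.lookup p u \<odot>\<^bsub>E\<^esub> F u)"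

context
  fixes E :: "('b, 'x) star_alg_scheme" and M :: "('m, 'y) monoid_scheme" and F :: "'m \<Rightarrow> 'b" and i :: "'m \<Rightarrow> 'm"
  assumes E: "complex_alg E" and F: "\<And>u. u \<in> carrier M \<Longrightarrow> F u \<in> carrier E"
begin

interpretation E: complex_alg E by (rule E)

lemma monoid_alg_lift_superset:
  assumes "finite S" "Poly_Mapping.keys p \<subseteq> S" "S \<subseteq> carrier M"
  shows "monoid_alg_lift E F p = (\<Oplus>\<^bsub>E\<^esub>u\<in>S. Poly_Mapping.lookup p u \<odot>\<^bsub>E\<^esub> F u)"
  unfolding monoid_alg_lift_def
  by (rule E.add.finprod_mono_neutral_cong_left) (use assms F in \<open>auto simp: in_keys_iff subset_iff\<close>)

lemma monoid_alg_lift_single [simp]: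
  "u \<in> carrier M \<Longrightarrow> monoid_alg_lift E F (Poly_Mapping.single u c) = c \<odot>\<^bsub>E\<^esub> F u"
  by (subst monoid_alg_lift_superset[of "{u}"]) (auto simp: F)

lemma monoid_alg_lift_linear: "monoid_alg_lift E F \<in> linear_map (monoid_alg M i) E"
proof -
  have "monoid_alg_lift E F (p + q) = monoid_alg_lift E F p \<oplus>\<^bsub>E\<^esub> monoid_alg_lift E F q"
    if "Poly_Mapping.keys p \<subseteq> carrier M" "Poly_Mapping.keys q \<subseteq> carrier M" for p q
  proof -
    let ?S = "Poly_Mapping.keys p \<union> Poly_Mapping.keys q"
    have S: "?S \<subseteq> carrier M" using that by auto
    have c: "(\<lambda>u. Poly_Mapping.lookup p u \<odot>\<^bsub>E\<^esub> F u) \<in> ?S \<rightarrow> carrier E" for p using S F by auto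
    have "monoid_alg_lift E F (p + q) = (\<Oplus>\<^bsub>E\<^esub>u\<in>?S. Poly_Mapping.lookup (p+q) u \<odot>\<^bsub>E\<^esub> F u)"
      using S by (intro monoid_alg_lift_superset) (auto dest: keys_addD)
    also have "\<dots> = (\<Oplus>\<^bsub>E\<^esub>u\<in>?S. Poly_Mapping.lookup p u \<odot>\<^bsub>E\<^esub> F u \<oplus>\<^bsub>E\<^esub> Poly_Mapping.lookup q u \<odot>\<^bsub>E\<^esub> F u)"
      using S F by (intro E.finsum_cong') (auto simp: lookup_add E.smult_l_distr subset_iff)
    also have "\<dots> = monoid_alg_lift E F p \<oplus>\<^bsub>E\<^esub> monoid_alg_lift E F q"
      using S by (subst E.finsum_addf[OF c c]) (simp add: monoid_alg_lift_superset[of ?S])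
    finally show ?thesis .
  qed
  moreover have "monoid_alg_lift E F (c \<odot>\<^bsub>monoid_alg M i\<^esub> p) = c \<odot>\<^bsub>E\<^esub> monoid_alg_lift E F p"
    if S: "Poly_Mapping.keys p \<subseteq> carrier M" for p c
  proof -
    let ?S = "Poly_Mapping.keys p"
    have c: "(\<lambda>u. Poly_Mapping.lookup p u \<odot>\<^bsub>E\<^esub> F u) \<in> ?S \<rightarrow> carrier E" for p using S F by auto
    have "monoid_alg_lift E F (c \<odot>\<^bsub>monoid_alg M i\<^esub> p) =
        (\<Oplus>\<^bsub>E\<^esub>u\<in>?S. Poly_Mapping.lookup (c \<odot>\<^bsub>monoid_alg M i\<^esub> p) u \<odot>\<^bsub>E\<^esub> F u)"
      using S by (intro monoid_alg_lift_superset) (auto simp: in_keys_iff)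
    also have "\<dots> = (\<Oplus>\<^bsub>E\<^esub>u\<in>?S. c \<odot>\<^bsub>E\<^esub> (Poly_Mapping.lookup p u \<odot>\<^bsub>E\<^esub> F u))"
      using S F by (intro E.finsum_cong') (auto simp: E.smult_assoc)
    also have "\<dots> = c \<odot>\<^bsub>E\<^esub> monoid_alg_lift E F p"
      unfolding monoid_alg_lift_def by (rule E.finsum_smult[symmetric]) (rule c)
    finally show ?thesis .
  qed
  moreover have "monoid_alg_lift E F p \<in> carrier E" if "Poly_Mapping.keys p \<subseteq> carrier M" for p
    unfolding monoid_alg_lift_def using that F by (intro E.finsum_closed) auto
  ultimately show ?thesis by (auto simp: linear_map_def)
qed

lemma monoid_alg_lift_hom:
  assumes "monoid M" "F \<one>\<^bsub>M\<^esub> = \<one>\<^bsub>E\<^esub>"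
    and mult: "\<And>u v. u \<in> carrier M \<Longrightarrow> v \<in> carrier M \<Longrightarrow> F (u \<otimes>\<^bsub>M\<^esub> v) = F u \<otimes>\<^bsub>E\<^esub> F v"
  shows "monoid_alg_lift E F \<in> alg_hom (monoid_alg M i) E"
proof -
  interpret M: monoid M by fact
  interpret A: complex_alg "monoid_alg M i" by (rule complex_alg_monoid_alg) fact
  note ind = monoid_alg_induct[OF _ _ _ M.one_closed, consumes 1]
  note L = linear_mapD[OF monoid_alg_lift_linear]
  note Ladd = L(2)[unfolded monoid_alg_simps(4)]
  have "monoid_alg_lift E F (p \<otimes>\<^bsub>monoid_alg M i\<^esub> q) = monoid_alg_lift E F p \<otimes>\<^bsub>E\<^esub> monoid_alg_lift E F q"
    if p: "p \<in> carrier (monoid_alg M i)" and q: "q \<in> carrier (monoid_alg M i)" for p q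
    using p
  proof (induction p rule: ind)
    case (1 p p')
    note c = L(1)[OF 1(1)] L(1)[OF 1(2)] L(1)[OF q] A.m_closed[OF 1(1) q] A.m_closed[OF 1(2) q]
    show ?case unfolding monoid_alg_mult_add_l Ladd[OF c(4,5)] Ladd[OF 1(1,2)] 1(3,4)
      by (rule E.l_distr[symmetric]) (fact c)+
  next
    case (2 u a)
    have u: "Poly_Mapping.single u a \<in> carrier (monoid_alg M i)" using 2 by auto
    show ?case using q
    proof (induction q rule: ind)
      case (1 q q')
      note c = L(1)[OF 1(1)] L(1)[OF 1(2)] L(1)[OF u] A.m_closed[OF u 1(1)] A.m_closed[OF u 1(2)]
      show ?case unfolding monoid_alg_mult_add_r Ladd[OF c(4,5)] Ladd[OF 1(1,2)] 1(3,4)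
        by (rule E.r_distr[symmetric]) (fact c)+
    next
      case (2 v b)
      with \<open>u \<in> carrier M\<close> show ?case
        by (simp add: mult E.smult_mult_l E.smult_mult_r E.smult_assoc F mult.commute)
    qed
  qed
  moreover have "monoid_alg_lift E F \<one>\<^bsub>monoid_alg M i\<^esub> = \<one>\<^bsub>E\<^esub>"
    using assms(2) by simp
  ultimately show ?thesis using monoid_alg_lift_linear by (auto simp: alg_hom_def)
qed

end

lemma linear_map_monoid_alg_eqI:
  assumes "monoid M" "g \<in> linear_map (monoid_alg M i) E" "h \<in> linear_map (monoid_alg M i) E"
    and eq: "\<And>u. u \<in> carrier M \<Longrightarrow> g (Poly_Mapping.single u 1) = h (Poly_Mapping.single u 1)"
    and "p \<in> carrier (monoid_alg M i)"
  shows "g p = h p"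
  using assms(5)
proof (induction p rule: monoid_alg_induct)
  case (add p q)
  then show ?case using linear_mapD(2)[OF assms(2)] linear_mapD(2)[OF assms(3)] by simp
next
  case (single u c)
  then have "Poly_Mapping.single u 1 \<in> carrier (monoid_alg M i)" by auto
  from linear_mapD(3)[OF assms(2) this, of c] linear_mapD(3)[OF assms(3) this, of c] eq[OF single]
  show ?case by simp
qed (use assms(1) in \<open>simp add: monoid.one_closed\<close>)


section \<open>Quotients\<close>

locale star_ideal = star_algebra A + ideal I A for A :: "('a, 'x) star_alg_scheme" (structure) and I +
  assumes adj_mem: "x \<in> I \<Longrightarrow> adj A x \<in> I"
begin

lemma smult_mem: "x \<in> I \<Longrightarrow> c \<odot> x \<in> I"
  using I_l_closed[of x "c \<odot> \<one>"] by (simp add: smult_mult_l a_subset[THEN subsetD])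

abbreviation cls :: "'a \<Rightarrow> 'a set" where "cls x \<equiv> I +> x"

lemma cls_eq_iff: "x \<in> carrier A \<Longrightarrow> y \<in> carrier A \<Longrightarrow> cls x = cls y \<longleftrightarrow> x \<ominus> y \<in> I"
  using quotient_eq_iff_same_a_r_cos[OF ideal_axioms, of x y] by auto

lemma mem_clsE:
  assumes "y \<in> cls x" "x \<in> carrier A"
  obtains j where "j \<in> I" "y = j \<oplus> x"
  using assms by (auto simp: a_r_coset_def')

lemma self_mem_cls: "x \<in> carrier A \<Longrightarrow> x \<in> cls x"
  using a_rcos_self by blast

text \<open>\<open>star_quot\<close> defines scalar multiples and adjoints as unions over all
  representatives. Such a union collapses when the operation is additive and maps the ideal into
  itself.\<close>

lemma UN_cls:
  assumes x: "x \<in> carrier A" and f: "\<And>y. y \<in> carrier A \<Longrightarrow> f y \<in> carrier A"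
    and I: "\<And>j. j \<in> I \<Longrightarrow> f (j \<oplus> x) = f j \<oplus> f x" "\<And>j. j \<in> I \<Longrightarrow> f j \<in> I"
  shows "(\<Union>y\<in>cls x. cls (f y)) = cls (f x)"
proof -
  have eq: "cls (f y) = cls (f x)" if y: "y \<in> cls x" for y
  proof -
    obtain j where j: "j \<in> I" "y = j \<oplus> x" using mem_clsE[OF y x] .
    then have c: "j \<in> carrier A" "f j \<in> carrier A" "f x \<in> carrier A" "f y \<in> carrier A"
      using a_subset x f by auto
    moreover have "f y \<ominus> f x = f j" unfolding j(2) I(1)[OF j(1)] using c(2,3)
      by (simp add: a_minus_def a_assoc r_neg)
    ultimately show ?thesis using I(2)[OF j(1)] by (simp add: cls_eq_iff)
  qed
  have "cls x \<noteq> {}" using self_mem_cls[OF x] by auto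
  then show ?thesis by (rule SUP_eq_const) (rule eq)
qed

lemma star_quot_simps:
  "carrier (star_quot A I) = cls ` carrier A"
  "x \<in> carrier A \<Longrightarrow> y \<in> carrier A \<Longrightarrow> cls x \<otimes>\<^bsub>star_quot A I\<^esub> cls y = cls (x \<otimes> y)"
  "x \<in> carrier A \<Longrightarrow> y \<in> carrier A \<Longrightarrow> cls x \<oplus>\<^bsub>star_quot A I\<^esub> cls y = cls (x \<oplus> y)"
  "\<one>\<^bsub>star_quot A I\<^esub> = cls \<one>"
  "\<zero>\<^bsub>star_quot A I\<^esub> = cls \<zero>"
  "x \<in> carrier A \<Longrightarrow> c \<odot>\<^bsub>star_quot A I\<^esub> cls x = cls (c \<odot> x)"
  "x \<in> carrier A \<Longrightarrow> adj (star_quot A I) (cls x) = cls (adj A x)"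
proof -
  note H = rcos_ring_hom
  show "carrier (star_quot A I) = cls ` carrier A"
    by (auto simp: star_quot_def FactRing_simps)
  show "cls x \<otimes>\<^bsub>star_quot A I\<^esub> cls y = cls (x \<otimes> y)" "cls x \<oplus>\<^bsub>star_quot A I\<^esub> cls y = cls (x \<oplus> y)"
    if "x \<in> carrier A" "y \<in> carrier A"
    using ring_hom_mult[OF H that] ring_hom_add[OF H that] by (simp_all add: star_quot_def)
  show "\<one>\<^bsub>star_quot A I\<^esub> = cls \<one>" using ring_hom_one[OF H] by (simp add: star_quot_def)
  show "\<zero>\<^bsub>star_quot A I\<^esub> = cls \<zero>"
    using a_rcos_zero[OF ideal_axioms additive_subgroup.zero_closed[OF additive_subgroup_axioms]]
    by (simp add: star_quot_def FactRing_def)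
  show "c \<odot>\<^bsub>star_quot A I\<^esub> cls x = cls (c \<odot> x)" if "x \<in> carrier A"
    using that a_subset unfolding star_quot_def
    by (simp, intro UN_cls) (auto simp: smult_r_distr smult_mem)
  show "adj (star_quot A I) (cls x) = cls (adj A x)" if "x \<in> carrier A"
    using that a_subset unfolding star_quot_def
    by (simp, intro UN_cls) (auto simp: adj_add adj_mem)
qed

lemma ring_star_quot: "ring (star_quot A I)"
  by (rule ring_cong[OF quotient_is_ring]) (simp_all add: star_quot_def)

lemma cls_alg_hom: "cls \<in> alg_hom A (star_quot A I)"
  by (auto simp: alg_hom_def linear_map_def star_quot_simps)

lemma star_algebra_star_quot: "star_algebra (star_quot A I)"
  by (rule star_algebra_image[OF star_algebra_axioms ring_star_quot cls_alg_hom])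
    (auto simp: star_quot_simps)

lemma cls_star_hom: "cls \<in> star_hom A (star_quot A I)"
  using cls_alg_hom by (auto simp: star_hom_iff star_quot_simps)

text \<open>The map is defined through a chosen representative; two representatives differ by an
  element of the ideal, on which \<open>h\<close> vanishes.\<close>

lemma star_quot_lift_linear:
  assumes "complex_alg E" "h \<in> linear_map A E" "\<And>x. x \<in> I \<Longrightarrow> h x = \<zero>\<^bsub>E\<^esub>"
  obtains k where "k \<in> linear_map (star_quot A I) E" "\<And>x. x \<in> carrier A \<Longrightarrow> k (cls x) = h x"
proof -
  interpret E: complex_alg E by fact
  define k where "k U = h (SOME x. x \<in> carrier A \<and> U = cls x)" for U
  have k: "k (cls x) = h x" if x: "x \<in> carrier A" for x
  proof -
    define y where "y = (SOME y. y \<in> carrier A \<and> cls x = cls y)"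
    have y: "y \<in> carrier A" "cls x = cls y"
      using someI[of "\<lambda>y. y \<in> carrier A \<and> cls x = cls y" x] x by (auto simp: y_def)
    then have "x \<ominus> y \<in> I" using x by (simp add: cls_eq_iff)
    then have "h x \<ominus>\<^bsub>E\<^esub> h y = \<zero>\<^bsub>E\<^esub>"
      using assms(3) linear_map_minus[OF complex_alg_axioms assms(1,2) x y(1)] by simp
    then show ?thesis
      using E.minus_eq_zeroD[OF linear_mapD(1)[OF assms(2) x] linear_mapD(1)[OF assms(2) y(1)]]
      by (simp add: k_def flip: y_def)
  qed
  have "k \<in> linear_map (star_quot A I) E"
    using linear_mapD[OF assms(2)] by (auto simp: linear_map_def star_quot_simps k)
  with k that show ?thesis by blast
qed

lemma star_quot_lift_alg_hom:
  assumes "complex_alg E" "h \<in> alg_hom A E" "\<And>x. x \<in> I \<Longrightarrow> h x = \<zero>\<^bsub>E\<^esub>"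
  obtains k where "k \<in> alg_hom (star_quot A I) E" "\<And>x. x \<in> carrier A \<Longrightarrow> k (cls x) = h x"
proof (rule star_quot_lift_linear[OF assms(1) alg_homD(1)[OF assms(2)] assms(3)])
  fix k assume k: "k \<in> linear_map (star_quot A I) E" "\<And>x. x \<in> carrier A \<Longrightarrow> k (cls x) = h x"
  then have "k \<in> alg_hom (star_quot A I) E"
    using alg_homD[OF assms(2)] by (auto simp: alg_hom_def star_quot_simps)
  with k that show ?thesis by blast
qed

end

section \<open>Free and presented $*$-algebras\<close>

lemma monoid_alg_mult_diff_l:
  "(p - p') \<otimes>\<^bsub>monoid_alg M i\<^esub> q = p \<otimes>\<^bsub>monoid_alg M i\<^esub> q - p' \<otimes>\<^bsub>monoid_alg M i\<^esub> q"
  using monoid_alg_mult_add_l[of M i "p - p'" p' q] by simp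

lemma monoid_alg_mult_diff_r:
  "q \<otimes>\<^bsub>monoid_alg M i\<^esub> (p - p') = q \<otimes>\<^bsub>monoid_alg M i\<^esub> p - q \<otimes>\<^bsub>monoid_alg M i\<^esub> p'"
  using monoid_alg_mult_add_r[of M i q "p - p'" p'] by simp

lemma monoid_alg_adj_diff:
  "adj (monoid_alg M i) (p - q) = adj (monoid_alg M i) p - adj (monoid_alg M i) q"
  using monoid_alg_adj_add[of M i "p - q" q] by simp

lemma monoid_alg_diff_closed:
  "p \<in> carrier (monoid_alg M i) \<Longrightarrow> q \<in> carrier (monoid_alg M i) \<Longrightarrow> p - q \<in> carrier (monoid_alg M i)"
  using keys_diff[of p q] by auto

text \<open>The relations are written with the subtraction of finitely supported functions; on the
  carrier it is the ring subtraction, so homomorphisms can be applied to them.\<close>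

lemma monoid_alg_minus:
  assumes "monoid M" "p \<in> carrier (monoid_alg M i)" "q \<in> carrier (monoid_alg M i)"
  shows "p \<ominus>\<^bsub>monoid_alg M i\<^esub> q = p - q"
proof -
  interpret A: complex_alg "monoid_alg M i" by (rule complex_alg_monoid_alg) fact
  have "\<ominus>\<^bsub>monoid_alg M i\<^esub> q = - q"
    using assms(3) by (intro A.minus_equality) auto
  then show ?thesis by (simp add: a_minus_def)
qed

abbreviation letters :: "'s set \<Rightarrow> 's letter set" where
  "letters S \<equiv> Gen ` S \<union> Adj ` S"

lemma flip_flip [simp]: "flip (flip l) = l"
  by (cases l) simp_all

lemma flip_mem_letters [simp]:
  "flip l \<in> letters S \<longleftrightarrow> l \<in> letters S"
  "flip l \<in> Gen ` S \<or> flip l \<in> Adj ` S \<longleftrightarrow> l \<in> Gen ` S \<or> l \<in> Adj ` S"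
  by (cases l; auto)+

lemma words_simps [simp]:
  "carrier (words S) = lists (letters S)" "mult (words S) = (@)" "one (words S) = []"
  by (simp_all add: words_def)

lemma monoid_words: "monoid (words S)"
  by unfold_locales (auto simp: words_def)

lemma star_algebra_free_alg: "star_algebra (free_alg S)"
  unfolding free_alg_def
  by (rule star_algebra_monoid_alg[OF monoid_words]) (auto simp: rev_map in_lists_conv_set comp_def)

lemma complex_alg_free_alg: "complex_alg (free_alg S)"
  using star_algebra_free_alg star_algebra.axioms(1) by blast

lemma free_alg_simps [simp]:
  "carrier (free_alg S) = {p. Poly_Mapping.keys p \<subseteq> lists (letters S)}"
  "one (free_alg S) = Poly_Mapping.single [] 1"
  "zero (free_alg S) = 0"
  "add (free_alg S) = (+)"
  "c \<odot>\<^bsub>free_alg S\<^esub> Poly_Mapping.single u a = Poly_Mapping.single u (c * a)"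
  "Poly_Mapping.single u a \<otimes>\<^bsub>free_alg S\<^esub> Poly_Mapping.single v b = Poly_Mapping.single (u @ v) (a * b)"
  "adj (free_alg S) (Poly_Mapping.single u a) = Poly_Mapping.single (rev (map flip u)) (cnj a)"
  by (simp_all add: free_alg_def)

lemma free_alg_minus:
  "p \<in> carrier (free_alg S) \<Longrightarrow> q \<in> carrier (free_alg S) \<Longrightarrow> p \<ominus>\<^bsub>free_alg S\<^esub> q = p - q"
  unfolding free_alg_def by (rule monoid_alg_minus[OF monoid_words])

lemma free_alg_diff_closed:
  "p \<in> carrier (free_alg S) \<Longrightarrow> q \<in> carrier (free_alg S) \<Longrightarrow> p - q \<in> carrier (free_alg S)"
  unfolding free_alg_def by (rule monoid_alg_diff_closed)

lemma keys_letter [simp]: "Poly_Mapping.keys (letter l) = {[l]}"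
  by (simp add: letter_def)

lemma letter_mem [simp]: "letter l \<in> carrier (free_alg S) \<longleftrightarrow> l \<in> letters S"
  by (simp add: letter_def)

lemma adj_letter [simp]: "adj (free_alg S) (letter l) = letter (flip l)"
  by (simp add: letter_def)

lemma free_alg_induct [consumes 1, case_names one letter add smult mult]:
  assumes p: "p \<in> carrier (free_alg S)"
    and one: "P \<one>\<^bsub>free_alg S\<^esub>"
    and letter: "\<And>l. l \<in> letters S \<Longrightarrow> P (letter l)"
    and add: "\<And>p q. p \<in> carrier (free_alg S) \<Longrightarrow> q \<in> carrier (free_alg S) \<Longrightarrow> P p \<Longrightarrow> P q \<Longrightarrow> P (p \<oplus>\<^bsub>free_alg S\<^esub> q)"
    and smult: "\<And>p c. p \<in> carrier (free_alg S) \<Longrightarrow> P p \<Longrightarrow> P (c \<odot>\<^bsub>free_alg S\<^esub> p)"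
    and mult: "\<And>p q. p \<in> carrier (free_alg S) \<Longrightarrow> q \<in> carrier (free_alg S) \<Longrightarrow> P p \<Longrightarrow> P q \<Longrightarrow> P (p \<otimes>\<^bsub>free_alg S\<^esub> q)"
  shows "P p"
proof -
  have word: "P (Poly_Mapping.single w 1)" if "w \<in> lists (letters S)" for w
    using that
  proof (induction w)
    case Nil
    then show ?case using one by simp
  next
    case (Cons l w)
    have "P (letter l \<otimes>\<^bsub>free_alg S\<^esub> Poly_Mapping.single w 1)"
      using Cons by (intro mult letter) auto
    then show ?case by (simp add: letter_def)
  qed
  have p': "p \<in> carrier (monoid_alg (words S) (\<lambda>w. rev (map flip w)))"
    using p by (simp add: free_alg_def)
  show ?thesis using p'
  proof (induction p rule: monoid_alg_induct)
    case (add p q)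
    then show ?case using assms(4)[of p q] by (simp add: free_alg_def)
  next
    case (single u c)
    then show ?case using smult[of "Poly_Mapping.single u 1" c] word[of u] by simp
  qed simp
qed

definition word_prod :: "('e, 'x) star_alg_scheme \<Rightarrow> ('l \<Rightarrow> 'e) \<Rightarrow> 'l list \<Rightarrow> 'e" where
  "word_prod E f w = foldr (\<lambda>l z. f l \<otimes>\<^bsub>E\<^esub> z) w \<one>\<^bsub>E\<^esub>"

definition free_lift :: "('e, 'x) star_alg_scheme \<Rightarrow> ('s letter \<Rightarrow> 'e) \<Rightarrow> 's star_poly \<Rightarrow> 'e" where
  "free_lift E f = monoid_alg_lift E (word_prod E f)"

lemma word_prod_simps [simp]:
  "word_prod E f [] = \<one>\<^bsub>E\<^esub>" "word_prod E f (l # w) = f l \<otimes>\<^bsub>E\<^esub> word_prod E f w"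
  by (simp_all add: word_prod_def)

lemma word_prod_closed:
  assumes "complex_alg E" "\<And>l. l \<in> L \<Longrightarrow> f l \<in> carrier E" "w \<in> lists L"
  shows "word_prod E f w \<in> carrier E"
proof -
  interpret E: complex_alg E by fact
  show ?thesis using assms(3) by (induction w) (auto simp: assms(2))
qed

lemma word_prod_append:
  assumes "complex_alg E" "\<And>l. l \<in> L \<Longrightarrow> f l \<in> carrier E" "v \<in> lists L" "w \<in> lists L"
  shows "word_prod E f (v @ w) = word_prod E f v \<otimes>\<^bsub>E\<^esub> word_prod E f w"
proof -
  interpret E: complex_alg E by fact
  have c: "word_prod E f u \<in> carrier E" if "u \<in> lists L" for u
    using word_prod_closed[OF assms(1), of L f u] assms(2) that by blast
  show ?thesis using assms(3)
  proof (induction v)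
    case Nil
    show ?case using c[OF assms(4)] by simp
  next
    case (Cons l v)
    then show ?case using c[of v] c[OF assms(4)] assms(2)[of l] by (simp add: E.m_assoc)
  qed
qed

context
  fixes E :: "('e, 'x) star_alg_scheme" and S :: "'s set" and f :: "'s letter \<Rightarrow> 'e"
  assumes E: "complex_alg E" and f: "\<And>l. l \<in> letters S \<Longrightarrow> f l \<in> carrier E"
begin

interpretation E: complex_alg E by (rule E)

lemma free_lift_alg_hom: "free_lift E f \<in> alg_hom (free_alg S) E"
proof -
  have F: "word_prod E f u \<in> carrier E" if "u \<in> carrier (words S)" for u
    using word_prod_closed[OF E, of "letters S" f u] f that by auto
  show ?thesis unfolding free_lift_def free_alg_def
    by (rule monoid_alg_lift_hom[OF E F monoid_words]) (auto intro!: word_prod_append[OF E, of "letters S"] f)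
qed

lemma free_lift_single:
  "u \<in> lists (letters S) \<Longrightarrow> free_lift E f (Poly_Mapping.single u c) = c \<odot>\<^bsub>E\<^esub> word_prod E f u"
proof -
  assume u: "u \<in> lists (letters S)"
  have F: "word_prod E f u \<in> carrier E" if "u \<in> carrier (words S)" for u
    using word_prod_closed[OF E, of "letters S" f u] f that by auto
  show ?thesis unfolding free_lift_def
    by (rule monoid_alg_lift_single[where M = "words S", OF E F]) (use u in simp_all)
qed

lemma free_lift_letter: "l \<in> letters S \<Longrightarrow> free_lift E f (letter l) = f l"
  using free_lift_single[of "[l]" 1] f[of l] by (simp add: letter_def)

lemma free_lift_diff:
  assumes "p \<in> carrier (free_alg S)" "q \<in> carrier (free_alg S)"
  shows "free_lift E f (p - q) = free_lift E f p \<ominus>\<^bsub>E\<^esub> free_lift E f q"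
  using linear_map_minus[OF complex_alg_free_alg E alg_homD(1)[OF free_lift_alg_hom] assms]
  by (simp add: free_alg_minus[OF assms])

lemma free_lift_zero: "free_lift E f 0 = \<zero>\<^bsub>E\<^esub>"
  using linear_map_zero[OF complex_alg_free_alg E alg_homD(1)[OF free_lift_alg_hom]] by simp

lemma free_lift_star_hom:
  assumes "star_algebra E" "\<And>l. l \<in> letters S \<Longrightarrow> f (flip l) = adj E (f l)"
  shows "free_lift E f \<in> star_hom (free_alg S) E"
proof -
  interpret S: star_algebra E by fact
  interpret F: star_algebra "free_alg S" by (rule star_algebra_free_alg)
  note h = alg_homD(2-6)[OF free_lift_alg_hom]
  have "free_lift E f (adj (free_alg S) p) = adj E (free_lift E f p)" if "p \<in> carrier (free_alg S)" for p
    using that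
  proof (induction p rule: free_alg_induct)
    case one
    show ?case using h(5) S.adj_one F.adj_one by metis
  next
    case (letter l)
    then show ?case using free_lift_letter[of l] free_lift_letter[of "flip l"] assms(2)[of l] by simp
  next
    case (add p q)
    then show ?case by (simp only: F.adj_add S.adj_add h F.adj_closed)
  next
    case (smult p c)
    then show ?case by (simp only: F.adj_smult S.adj_smult h F.adj_closed)
  next
    case (mult p q)
    then show ?case by (simp only: F.adj_mult S.adj_mult h F.adj_closed)
  qed
  then show ?thesis using free_lift_alg_hom by (auto simp: star_hom_iff)
qed

end

lemma alg_hom_free_alg_eqI:
  assumes "g \<in> alg_hom (free_alg S) E" "h \<in> alg_hom (free_alg S) E"
    and "\<And>l. l \<in> letters S \<Longrightarrow> g (letter l) = h (letter l)" "p \<in> carrier (free_alg S)"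
  shows "g p = h p"
  using assms(4)
  by (induction p rule: free_alg_induct)
    (use assms(3) in \<open>simp_all only: alg_homD[OF assms(1)] alg_homD[OF assms(2)]\<close>)

lemma star_hom_free_alg_eqI:
  assumes "g \<in> star_hom (free_alg S) E" "h \<in> star_hom (free_alg S) E"
    and "\<And>s. s \<in> S \<Longrightarrow> g (letter (Gen s)) = h (letter (Gen s))" "p \<in> carrier (free_alg S)"
  shows "g p = h p"
proof (rule alg_hom_free_alg_eqI[OF star_hom_alg_hom[OF assms(1)] star_hom_alg_hom[OF assms(2)] _ assms(4)])
  fix l assume "l \<in> letters S"
  then obtain s where s: "s \<in> S" "l = Gen s \<or> l = Adj s" by auto
  have "letter (Gen s) \<in> carrier (free_alg S)" using s by auto
  from star_homD[OF assms(1) this] star_homD[OF assms(2) this] assms(3)[OF s(1)] s(2)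
  show "g (letter l) = h (letter l)" by auto
qed

context
  fixes S :: "'s set" and R :: "'s star_poly set"
  assumes R: "R \<subseteq> carrier (free_alg S)"
begin

interpretation F: star_algebra "free_alg S" by (rule star_algebra_free_alg)

lemma rel_ideal_gens_closed: "R \<union> adj (free_alg S) ` R \<subseteq> carrier (free_alg S)"
  using R F.adj_closed by blast

text \<open>The elements whose adjoint lies in the generated ideal form an ideal themselves. It
  contains the generators because the generating set is closed under the adjoint, so by minimality
  it contains the whole ideal.\<close>

lemma star_ideal_rel_ideal: "star_ideal (free_alg S) (rel_ideal S R)"
proof -
  let ?I = "rel_ideal S R" and ?A = "free_alg S"
  interpret I: ideal ?I ?A
    unfolding rel_ideal_def by (rule F.genideal_ideal[OF rel_ideal_gens_closed])
  let ?J = "{x \<in> carrier ?A. adj ?A x \<in> ?I}"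
  have J: "ideal ?J ?A"
  proof (rule idealI)
    show "subgroup ?J (add_monoid ?A)"
    proof (rule F.add.subgroupI)
      have "adj ?A \<zero>\<^bsub>?A\<^esub> \<in> ?I" unfolding F.adj_zero by (rule I.zero_closed)
      then show "?J \<noteq> {}" using F.zero_closed by blast
    next
      fix a assume "a \<in> ?J"
      then have a: "a \<in> carrier ?A" "adj ?A a \<in> ?I" by blast+
      have "adj ?A (\<ominus>\<^bsub>?A\<^esub> a) = \<ominus>\<^bsub>?A\<^esub> (adj ?A a)"
        using F.adj_smult[OF a(1), of "-1"] unfolding F.smult_neg_one[OF a(1)]
        by (simp add: F.smult_neg_one[OF F.adj_closed[OF a(1)]])
      then have "adj ?A (\<ominus>\<^bsub>?A\<^esub> a) \<in> ?I" using I.a_inv_closed[OF a(2)] by metis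
      then show "\<ominus>\<^bsub>?A\<^esub> a \<in> ?J" using a(1) F.a_inv_closed by blast
    next
      fix a b assume "a \<in> ?J" "b \<in> ?J"
      then have ab: "a \<in> carrier ?A" "b \<in> carrier ?A" "adj ?A a \<in> ?I" "adj ?A b \<in> ?I" by blast+
      have "adj ?A (a \<oplus>\<^bsub>?A\<^esub> b) \<in> ?I" unfolding F.adj_add[OF ab(1,2)] by (rule I.a_closed[OF ab(3,4)])
      then show "a \<oplus>\<^bsub>?A\<^esub> b \<in> ?J" using F.a_closed[OF ab(1,2)] by blast
    qed blast
  next
    fix a x assume "a \<in> ?J" and x: "x \<in> carrier ?A"
    then have a: "a \<in> carrier ?A" "adj ?A a \<in> ?I" by blast+
    have "adj ?A (x \<otimes>\<^bsub>?A\<^esub> a) \<in> ?I" unfolding F.adj_mult[OF x a(1)]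
      by (rule I.I_r_closed[OF a(2) F.adj_closed[OF x]])
    then show "x \<otimes>\<^bsub>?A\<^esub> a \<in> ?J" using F.m_closed[OF x a(1)] by blast
    have "adj ?A (a \<otimes>\<^bsub>?A\<^esub> x) \<in> ?I" unfolding F.adj_mult[OF a(1) x]
      by (rule I.I_l_closed[OF a(2) F.adj_closed[OF x]])
    then show "a \<otimes>\<^bsub>?A\<^esub> x \<in> ?J" using F.m_closed[OF a(1) x] by blast
  qed (rule F.ring_axioms)
  have self: "R \<union> adj ?A ` R \<subseteq> ?I"
    unfolding rel_ideal_def by (rule F.genideal_self[OF rel_ideal_gens_closed])
  have "R \<union> adj ?A ` R \<subseteq> ?J"
  proof
    fix x assume x: "x \<in> R \<union> adj ?A ` R"
    have "adj ?A x \<in> R \<union> adj ?A ` R"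
    proof (cases "x \<in> R")
      case False
      then obtain r where r: "r \<in> R" "x = adj ?A r" using x by blast
      have "adj ?A x = r" unfolding r(2) using R r(1) by (intro F.adj_adj) blast
      then show ?thesis using r(1) by blast
    qed blast
    then have "adj ?A x \<in> ?I" using self by blast
    moreover have "x \<in> carrier ?A" using x rel_ideal_gens_closed by blast
    ultimately show "x \<in> ?J" by blast
  qed
  then have "?I \<subseteq> ?J" unfolding rel_ideal_def
    using F.genideal_minimal[OF J[unfolded rel_ideal_def]] by blast
  then show ?thesis by unfold_locales blast
qed

interpretation I: star_ideal "free_alg S" "rel_ideal S R" by (rule star_ideal_rel_ideal)

lemma star_algebra_presented: "star_algebra (presented S R)"
  unfolding presented_def by (rule I.star_algebra_star_quot)

lemma pres_class_star_hom: "pres_class S R \<in> star_hom (free_alg S) (presented S R)"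
  using I.cls_star_hom by (simp add: presented_def pres_class_def[abs_def])

lemma carrier_presented: "carrier (presented S R) = pres_class S R ` carrier (free_alg S)"
  by (simp add: presented_def pres_class_def I.star_quot_simps)

lemma pres_class_rel:
  assumes "r \<in> R"
  shows "pres_class S R r = \<zero>\<^bsub>presented S R\<^esub>"
proof -
  have "r \<in> rel_ideal S R"
    using F.genideal_self[OF rel_ideal_gens_closed] assms unfolding rel_ideal_def by blast
  moreover have "r \<in> carrier (free_alg S)" using R assms by blast
  ultimately have "I.cls r = I.cls \<zero>\<^bsub>free_alg S\<^esub>"
    using I.cls_eq_iff[of r "\<zero>\<^bsub>free_alg S\<^esub>"] F.minus_zero_r[of r] F.zero_closed by metis
  then show ?thesis by (simp add: pres_class_def presented_def I.star_quot_simps)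
qed

lemma presented_induct [consumes 1, case_names one letter add smult mult]:
  assumes x: "x \<in> carrier (presented S R)"
    and one: "P \<one>\<^bsub>presented S R\<^esub>"
    and letter: "\<And>l. l \<in> letters S \<Longrightarrow> P (pres_class S R (letter l))"
    and add: "\<And>x y. x \<in> carrier (presented S R) \<Longrightarrow> y \<in> carrier (presented S R) \<Longrightarrow> P x \<Longrightarrow> P y \<Longrightarrow> P (x \<oplus>\<^bsub>presented S R\<^esub> y)"
    and smult: "\<And>x c. x \<in> carrier (presented S R) \<Longrightarrow> P x \<Longrightarrow> P (c \<odot>\<^bsub>presented S R\<^esub> x)"
    and mult: "\<And>x y. x \<in> carrier (presented S R) \<Longrightarrow> y \<in> carrier (presented S R) \<Longrightarrow> P x \<Longrightarrow> P y \<Longrightarrow> P (x \<otimes>\<^bsub>presented S R\<^esub> y)"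
  shows "P x"
proof -
  note h = alg_homD(2-6)[OF star_hom_alg_hom[OF pres_class_star_hom]]
  obtain p where p: "p \<in> carrier (free_alg S)" "x = pres_class S R p"
    using x unfolding carrier_presented by blast
  from p(1) have "P (pres_class S R p)"
  proof (induction p rule: free_alg_induct)
    case one
    then show ?case using assms(2) h(5) by metis
  next
    case (letter l)
    then show ?case by (rule assms(3))
  next
    case (add p q)
    then show ?case using assms(4)[OF h(1)[of p] h(1)[of q]] h(2)[of p q] by metis
  next
    case (smult p c)
    then show ?case using assms(5)[OF h(1)[of p]] h(3)[of p c] by metis
  next
    case (mult p q)
    then show ?case using assms(6)[OF h(1)[of p] h(1)[of q]] h(4)[of p q] by metis
  qed
  then show ?thesis using p(2) by simp
qed

text \<open>The kernel of the free extension is an ideal, so it suffices that it contains the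
  generators. Since \<open>E\<close> comes without an adjoint, the adjoint relations are not
  consequences of the original ones and are assumed to vanish separately.\<close>

lemma presented_lift_alg_hom:
  assumes "complex_alg E" and f: "\<And>l. l \<in> letters S \<Longrightarrow> f l \<in> carrier E"
    and kill: "\<And>r. r \<in> R \<Longrightarrow> free_lift E f r = \<zero>\<^bsub>E\<^esub>"
      "\<And>r. r \<in> R \<Longrightarrow> free_lift E f (adj (free_alg S) r) = \<zero>\<^bsub>E\<^esub>"
  obtains h where "h \<in> alg_hom (presented S R) E"
    "\<And>p. p \<in> carrier (free_alg S) \<Longrightarrow> h (pres_class S R p) = free_lift E f p"
proof -
  interpret E: complex_alg E by fact
  let ?f = "free_lift E f" and ?A = "free_alg S"
  have lift: "?f \<in> alg_hom ?A E" by (rule free_lift_alg_hom[OF assms(1)]) (rule f)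
  note h = alg_homD(2-6)[OF lift]
  have z: "?f \<zero>\<^bsub>?A\<^esub> = \<zero>\<^bsub>E\<^esub>" using linear_map_zero[OF F.complex_alg_axioms assms(1) alg_homD(1)[OF lift]] .
  let ?K = "{x \<in> carrier ?A. ?f x = \<zero>\<^bsub>E\<^esub>}"
  have K: "ideal ?K ?A"
  proof (rule idealI)
    show "subgroup ?K (add_monoid ?A)"
    proof (rule F.add.subgroupI)
      show "?K \<noteq> {}" using z F.zero_closed by blast
    next
      fix a assume "a \<in> ?K"
      then have a: "a \<in> carrier ?A" "?f a = \<zero>\<^bsub>E\<^esub>" by blast+
      then have "?f (\<ominus>\<^bsub>?A\<^esub> a) = \<zero>\<^bsub>E\<^esub>"
        using h(3)[OF a(1), of "-1"] F.smult_neg_one[OF a(1)] by simp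
      then show "\<ominus>\<^bsub>?A\<^esub> a \<in> ?K" using a(1) F.a_inv_closed by blast
    next
      fix a b assume "a \<in> ?K" "b \<in> ?K"
      then show "a \<oplus>\<^bsub>?A\<^esub> b \<in> ?K" using h(2)[of a b] F.a_closed by auto
    qed blast
  next
    fix a x assume "a \<in> ?K" "x \<in> carrier ?A"
    then show "x \<otimes>\<^bsub>?A\<^esub> a \<in> ?K" "a \<otimes>\<^bsub>?A\<^esub> x \<in> ?K"
      using h(4)[of a x] h(4)[of x a] h(1)[of x] F.m_closed by auto
  qed (rule F.ring_axioms)
  have "R \<union> adj ?A ` R \<subseteq> ?K" using kill rel_ideal_gens_closed by blast
  then have "rel_ideal S R \<subseteq> ?K" unfolding rel_ideal_def by (rule F.genideal_minimal[OF K])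
  then have "?f x = \<zero>\<^bsub>E\<^esub>" if "x \<in> rel_ideal S R" for x using that by blast
  from I.star_quot_lift_alg_hom[OF assms(1) lift this] that
  show ?thesis by (auto simp: presented_def pres_class_def)
qed

lemma presented_lift_star_hom:
  assumes "star_algebra E" and f: "\<And>l. l \<in> letters S \<Longrightarrow> f l \<in> carrier E"
    "\<And>l. l \<in> letters S \<Longrightarrow> f (flip l) = adj E (f l)"
    and kill: "\<And>r. r \<in> R \<Longrightarrow> free_lift E f r = \<zero>\<^bsub>E\<^esub>"
  obtains h where "h \<in> star_hom (presented S R) E"
    "\<And>p. p \<in> carrier (free_alg S) \<Longrightarrow> h (pres_class S R p) = free_lift E f p"
proof -
  interpret E: star_algebra E by fact
  have sh: "free_lift E f \<in> star_hom (free_alg S) E"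
    by (rule free_lift_star_hom[OF E.complex_alg_axioms _ assms(1)]) (rule f; assumption)+
  have "free_lift E f (adj (free_alg S) r) = \<zero>\<^bsub>E\<^esub>" if "r \<in> R" for r
    using star_homD[OF sh, of r] kill[OF that] that R by auto
  with presented_lift_alg_hom[of E f] E.complex_alg_axioms f(1) kill
  obtain h where h: "h \<in> alg_hom (presented S R) E"
    "\<And>p. p \<in> carrier (free_alg S) \<Longrightarrow> h (pres_class S R p) = free_lift E f p" by metis
  have "h (adj (presented S R) x) = adj E (h x)" if x: "x \<in> carrier (presented S R)" for x
  proof -
    obtain p where p: "p \<in> carrier (free_alg S)" "x = pres_class S R p"
      using x unfolding carrier_presented by blast
    then show ?thesis
      using star_homD[OF pres_class_star_hom p(1)] h(2)[OF p(1)] h(2)[OF F.adj_closed[OF p(1)]] star_homD[OF sh p(1)]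
      by simp
  qed
  then have "h \<in> star_hom (presented S R) E" using h(1) by (simp add: star_hom_iff)
  with h(2) that show ?thesis by blast
qed

lemma star_hom_presented_eqI:
  assumes "g \<in> star_hom (presented S R) E" "h \<in> star_hom (presented S R) E"
    and "\<And>s. s \<in> S \<Longrightarrow> g (pres_class S R (letter (Gen s))) = h (pres_class S R (letter (Gen s)))"
    and "x \<in> carrier (presented S R)"
  shows "g x = h x"
proof -
  obtain p where p: "p \<in> carrier (free_alg S)" "x = pres_class S R p"
    using assms(4) unfolding carrier_presented by blast
  have "(\<lambda>p. g (pres_class S R p)) p = (\<lambda>p. h (pres_class S R p)) p"
    by (rule star_hom_free_alg_eqI[OF star_hom_compose star_hom_compose])
      (use assms p pres_class_star_hom in auto)
  then show ?thesis using p(2) by simp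
qed

end


section \<open>Tensor products\<close>

lemma pair_alg_simps [simp]:
  "carrier (pair_alg A B) = {p. Poly_Mapping.keys p \<subseteq> carrier A \<times> carrier B}"
  "one (pair_alg A B) = Poly_Mapping.single (\<one>\<^bsub>A\<^esub>, \<one>\<^bsub>B\<^esub>) 1"
  "zero (pair_alg A B) = 0"
  "add (pair_alg A B) = (+)"
  "c \<odot>\<^bsub>pair_alg A B\<^esub> Poly_Mapping.single (a, b) z = Poly_Mapping.single (a, b) (c * z)"
  "Poly_Mapping.single (a, b) z \<otimes>\<^bsub>pair_alg A B\<^esub> Poly_Mapping.single (a', b') z' =
     Poly_Mapping.single (a \<otimes>\<^bsub>A\<^esub> a', b \<otimes>\<^bsub>B\<^esub> b') (z * z')"
  "adj (pair_alg A B) (Poly_Mapping.single (a, b) z) = Poly_Mapping.single (adj A a, adj B b) (cnj z)"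
  by (simp_all add: pair_alg_def DirProd_def)

context
  fixes A :: "('a, 'x) star_alg_scheme" and B :: "('b, 'y) star_alg_scheme"
  assumes A: "star_algebra A" and B: "star_algebra B"
begin

interpretation A: star_algebra A by (rule A)
interpretation B: star_algebra B by (rule B)

abbreviation (input) "PA \<equiv> pair_alg A B"
abbreviation (input) "PS a b \<equiv> Poly_Mapping.single (a, b) (1 :: complex)"

lemma star_algebra_pair_alg: "star_algebra (pair_alg A B)"
  unfolding pair_alg_def
  by (rule star_algebra_monoid_alg[OF DirProd_monoid[OF A.monoid_axioms B.monoid_axioms]])
    (auto simp: A.adj_mult B.adj_mult)

interpretation P: star_algebra "pair_alg A B" by (rule star_algebra_pair_alg)

lemma pair_alg_diff:
  "x \<otimes>\<^bsub>PA\<^esub> (y - z) = x \<otimes>\<^bsub>PA\<^esub> y - x \<otimes>\<^bsub>PA\<^esub> z"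
  "(y - z) \<otimes>\<^bsub>PA\<^esub> x = y \<otimes>\<^bsub>PA\<^esub> x - z \<otimes>\<^bsub>PA\<^esub> x"
  "x \<otimes>\<^bsub>PA\<^esub> (y + z) = x \<otimes>\<^bsub>PA\<^esub> y + x \<otimes>\<^bsub>PA\<^esub> z"
  "(y + z) \<otimes>\<^bsub>PA\<^esub> x = y \<otimes>\<^bsub>PA\<^esub> x + z \<otimes>\<^bsub>PA\<^esub> x"
  "adj PA (y - z) = adj PA y - adj PA z"
  "adj PA (y + z) = adj PA y + adj PA z"
  by (simp_all add: pair_alg_def monoid_alg_mult_diff_l monoid_alg_mult_diff_r monoid_alg_mult_add_l
      monoid_alg_mult_add_r monoid_alg_adj_diff monoid_alg_adj_add)

lemma pair_alg_minus:
  "x \<in> carrier PA \<Longrightarrow> y \<in> carrier PA \<Longrightarrow> x \<ominus>\<^bsub>PA\<^esub> y = x - y"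
  unfolding pair_alg_def
  by (rule monoid_alg_minus[OF DirProd_monoid[OF A.monoid_axioms B.monoid_axioms]])

lemma bilinear_rels_cases [consumes 1, case_names add_l add_r smult_l smult_r]:
  assumes "s \<in> bilinear_rels A B"
  obtains a a' b where "a \<in> carrier A" "a' \<in> carrier A" "b \<in> carrier B" "s = PS (a \<oplus>\<^bsub>A\<^esub> a') b - (PS a b + PS a' b)"
    | a b b' where "a \<in> carrier A" "b \<in> carrier B" "b' \<in> carrier B" "s = PS a (b \<oplus>\<^bsub>B\<^esub> b') - (PS a b + PS a b')"
    | c a b where "a \<in> carrier A" "b \<in> carrier B" "s = PS (c \<odot>\<^bsub>A\<^esub> a) b - c \<odot>\<^bsub>PA\<^esub> PS a b"
    | c a b where "a \<in> carrier A" "b \<in> carrier B" "s = PS a (c \<odot>\<^bsub>B\<^esub> b) - c \<odot>\<^bsub>PA\<^esub> PS a b"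
  using assms unfolding bilinear_rels_def Let_def by auto

lemma bilinear_relsI:
  "a \<in> carrier A \<Longrightarrow> a' \<in> carrier A \<Longrightarrow> b \<in> carrier B \<Longrightarrow>
     PS (a \<oplus>\<^bsub>A\<^esub> a') b - (PS a b + PS a' b) \<in> bilinear_rels A B"
  "a \<in> carrier A \<Longrightarrow> b \<in> carrier B \<Longrightarrow> b' \<in> carrier B \<Longrightarrow>
     PS a (b \<oplus>\<^bsub>B\<^esub> b') - (PS a b + PS a b') \<in> bilinear_rels A B"
  "a \<in> carrier A \<Longrightarrow> b \<in> carrier B \<Longrightarrow>
     PS (c \<odot>\<^bsub>A\<^esub> a) b - c \<odot>\<^bsub>PA\<^esub> PS a b \<in> bilinear_rels A B"
  "a \<in> carrier A \<Longrightarrow> b \<in> carrier B \<Longrightarrow>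
     PS a (c \<odot>\<^bsub>B\<^esub> b) - c \<odot>\<^bsub>PA\<^esub> PS a b \<in> bilinear_rels A B"
  unfolding bilinear_rels_def Let_def by blast+

lemma bilinear_rels_closed: "s \<in> bilinear_rels A B \<Longrightarrow> s \<in> carrier PA"
proof (induction rule: bilinear_rels_cases)
qed (auto dest!: keys_diff[THEN subsetD] keys_addD split: if_splits)

text \<open>A simple tensor times a bilinearity relation is again a relation of the same type. This
  is why the mere span \<open>tensor_null\<close> turns out to be a two-sided ideal.\<close>

lemma bilinear_rels_mult_l:
  assumes "s \<in> bilinear_rels A B" "x \<in> carrier A" "y \<in> carrier B"
  shows "PS x y \<otimes>\<^bsub>PA\<^esub> s \<in> bilinear_rels A B"
  using assms(1)
proof (cases rule: bilinear_rels_cases)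
  case (add_l a a' b)
  then show ?thesis using bilinear_relsI(1)[of "x \<otimes>\<^bsub>A\<^esub> a" "x \<otimes>\<^bsub>A\<^esub> a'" "y \<otimes>\<^bsub>B\<^esub> b"] assms
    by (simp add: pair_alg_diff A.r_distr)
next
  case (add_r a b b')
  then show ?thesis using bilinear_relsI(2)[of "x \<otimes>\<^bsub>A\<^esub> a" "y \<otimes>\<^bsub>B\<^esub> b" "y \<otimes>\<^bsub>B\<^esub> b'"] assms
    by (simp add: pair_alg_diff B.r_distr)
next
  case (smult_l c a b)
  then show ?thesis using bilinear_relsI(3)[of "x \<otimes>\<^bsub>A\<^esub> a" "y \<otimes>\<^bsub>B\<^esub> b" c] assms
    by (simp add: pair_alg_diff A.smult_mult_r)
next
  case (smult_r c a b)
  then show ?thesis using bilinear_relsI(4)[of "x \<otimes>\<^bsub>A\<^esub> a" "y \<otimes>\<^bsub>B\<^esub> b" c] assms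
    by (simp add: pair_alg_diff B.smult_mult_r)
qed

lemma bilinear_rels_mult_r:
  assumes "s \<in> bilinear_rels A B" "x \<in> carrier A" "y \<in> carrier B"
  shows "s \<otimes>\<^bsub>PA\<^esub> PS x y \<in> bilinear_rels A B"
  using assms(1)
proof (cases rule: bilinear_rels_cases)
  case (add_l a a' b)
  then show ?thesis using bilinear_relsI(1)[of "a \<otimes>\<^bsub>A\<^esub> x" "a' \<otimes>\<^bsub>A\<^esub> x" "b \<otimes>\<^bsub>B\<^esub> y"] assms
    by (simp add: pair_alg_diff A.l_distr)
next
  case (add_r a b b')
  then show ?thesis using bilinear_relsI(2)[of "a \<otimes>\<^bsub>A\<^esub> x" "b \<otimes>\<^bsub>B\<^esub> y" "b' \<otimes>\<^bsub>B\<^esub> y"] assms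
    by (simp add: pair_alg_diff B.l_distr)
next
  case (smult_l c a b)
  then show ?thesis using bilinear_relsI(3)[of "a \<otimes>\<^bsub>A\<^esub> x" "b \<otimes>\<^bsub>B\<^esub> y" c] assms
    by (simp add: pair_alg_diff A.smult_mult_l)
next
  case (smult_r c a b)
  then show ?thesis using bilinear_relsI(4)[of "a \<otimes>\<^bsub>A\<^esub> x" "b \<otimes>\<^bsub>B\<^esub> y" c] assms
    by (simp add: pair_alg_diff B.smult_mult_l)
qed

lemma bilinear_rels_adj:
  assumes "s \<in> bilinear_rels A B"
  shows "adj PA s \<in> bilinear_rels A B"
  using assms(1)
proof (cases rule: bilinear_rels_cases)
  case (add_l a a' b)
  then show ?thesis using bilinear_relsI(1)[of "adj A a" "adj A a'" "adj B b"]
    by (simp add: pair_alg_diff A.adj_add)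
next
  case (add_r a b b')
  then show ?thesis using bilinear_relsI(2)[of "adj A a" "adj B b" "adj B b'"]
    by (simp add: pair_alg_diff B.adj_add)
next
  case (smult_l c a b)
  then show ?thesis using bilinear_relsI(3)[of "adj A a" "adj B b" "cnj c"]
    by (simp add: pair_alg_diff A.adj_smult)
next
  case (smult_r c a b)
  then show ?thesis using bilinear_relsI(4)[of "adj A a" "adj B b" "cnj c"]
    by (simp add: pair_alg_diff B.adj_smult)
qed

lemma pair_alg_induct [consumes 1, case_names add single]:
  assumes "p \<in> carrier PA"
    and "\<And>p q. p \<in> carrier PA \<Longrightarrow> q \<in> carrier PA \<Longrightarrow> Q p \<Longrightarrow> Q q \<Longrightarrow> Q (p \<oplus>\<^bsub>PA\<^esub> q)"
    and "\<And>a b c. a \<in> carrier A \<Longrightarrow> b \<in> carrier B \<Longrightarrow> Q (c \<odot>\<^bsub>PA\<^esub> PS a b)"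
  shows "Q p"
proof -
  have p: "p \<in> carrier (monoid_alg (A \<times>\<times> B) (\<lambda>(a, b). (adj A a, adj B b)))"
    using assms(1) by (simp add: pair_alg_def)
  show ?thesis using p
  proof (induction p rule: monoid_alg_induct)
    case (add p q)
    then show ?case using assms(2)[of p q] by (simp add: pair_alg_def)
  next
    case (single u c)
    then show ?case using assms(3)[of "fst u" "snd u" c] by (cases u) (auto simp: DirProd_def)
  qed (simp add: DirProd_def)
qed

lemma tensor_null_closed: "x \<in> tensor_null A B \<Longrightarrow> x \<in> carrier PA"
  unfolding tensor_null_def
  by (induction rule: lin_span.induct) (auto intro: bilinear_rels_closed P.a_closed P.smult_closed P.zero_closed simp del: pair_alg_simps)

lemma tensor_null_mult:
  assumes "s \<in> tensor_null A B" "x \<in> carrier PA"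
  shows "x \<otimes>\<^bsub>PA\<^esub> s \<in> tensor_null A B \<and> s \<otimes>\<^bsub>PA\<^esub> x \<in> tensor_null A B"
  using assms(2)
proof (induction x rule: pair_alg_induct)
  case (add p q)
  note c = tensor_null_closed[OF assms(1)]
  show ?case using add c
    unfolding P.l_distr[OF add(1,2) c] P.r_distr[OF add(1,2) c]
    by (simp add: tensor_null_def lin_span.add del: pair_alg_simps)
next
  case (single a b c)
  have ps: "PS a b \<in> carrier PA" using single by simp
  have "PS a b \<otimes>\<^bsub>PA\<^esub> s \<in> tensor_null A B \<and> s \<otimes>\<^bsub>PA\<^esub> PS a b \<in> tensor_null A B"
    using assms(1) unfolding tensor_null_def
  proof (induction rule: lin_span.induct)
    case zero
    then show ?case using P.l_null[OF ps] P.r_null[OF ps] lin_span.zero by metis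
  next
    case (base s)
    then show ?case using single bilinear_rels_mult_l bilinear_rels_mult_r lin_span.base by metis
  next
    case (add x y)
    then have "x \<in> carrier PA" "y \<in> carrier PA" using tensor_null_closed unfolding tensor_null_def by auto
    then show ?case using add P.l_distr[of x y "PS a b"] P.r_distr[of x y "PS a b"] ps lin_span.add by metis
  next
    case (scale x c)
    then have "x \<in> carrier PA" using tensor_null_closed unfolding tensor_null_def by auto
    then show ?case using scale P.smult_mult_l[of x "PS a b" c] P.smult_mult_r[of "PS a b" x c] ps lin_span.scale by metis
  qed
  then show ?case using P.smult_mult_l[OF ps tensor_null_closed[OF assms(1)], of c]
    P.smult_mult_r[OF tensor_null_closed[OF assms(1)] ps, of c] lin_span.scale unfolding tensor_null_def by metis
qed

lemma star_ideal_tensor_null: "star_ideal PA (tensor_null A B)"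
proof -
  have "ideal (tensor_null A B) PA"
  proof (rule idealI)
    show "subgroup (tensor_null A B) (add_monoid PA)"
    proof (rule P.add.subgroupI)
      show "tensor_null A B \<subseteq> carrier PA" using tensor_null_closed by blast
      show "tensor_null A B \<noteq> {}" using lin_span.zero unfolding tensor_null_def by blast
      show "\<ominus>\<^bsub>PA\<^esub> a \<in> tensor_null A B" if "a \<in> tensor_null A B" for a
        using P.smult_neg_one[OF tensor_null_closed[OF that]] lin_span.scale that unfolding tensor_null_def by metis
      show "a \<oplus>\<^bsub>PA\<^esub> b \<in> tensor_null A B" if "a \<in> tensor_null A B" "b \<in> tensor_null A B" for a b
        using that lin_span.add unfolding tensor_null_def by metis
    qed
  qed (use tensor_null_mult P.ring_axioms in blast)+
  then interpret ideal "tensor_null A B" PA .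
  have "adj PA s \<in> tensor_null A B" if "s \<in> tensor_null A B" for s
    using that unfolding tensor_null_def
  proof (induction rule: lin_span.induct)
    case zero
    then show ?case using P.adj_zero lin_span.zero by metis
  next
    case (base s)
    then show ?case using bilinear_rels_adj lin_span.base by metis
  next
    case (add x y)
    then show ?case using P.adj_add[of x y] tensor_null_closed lin_span.add unfolding tensor_null_def by metis
  next
    case (scale x c)
    then show ?case using P.adj_smult[of x c] tensor_null_closed lin_span.scale unfolding tensor_null_def by metis
  qed
  then show ?thesis by unfold_locales
qed

interpretation I: star_ideal PA "tensor_null A B" by (rule star_ideal_tensor_null)

lemma star_algebra_tensor: "star_algebra (tensor A B)"
  unfolding tensor_def by (rule I.star_algebra_star_quot)

interpretation T: star_algebra "tensor A B" by (rule star_algebra_tensor)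

lemma tens_eq: "tens A B a b = I.cls (PS a b)"
  by (simp add: tens_def)

lemma tens_closed [simp, intro]: "a \<in> carrier A \<Longrightarrow> b \<in> carrier B \<Longrightarrow> tens A B a b \<in> carrier (tensor A B)"
  unfolding tens_eq tensor_def I.star_quot_simps(1) by (rule imageI) simp

lemma tens_eqI:
  assumes "x - y \<in> bilinear_rels A B" "x \<in> carrier PA" "y \<in> carrier PA"
  shows "I.cls x = I.cls y"
  using assms pair_alg_minus[OF assms(2,3)] I.cls_eq_iff[OF assms(2,3)] lin_span.base[of "x - y" "bilinear_rels A B" PA]
  unfolding tensor_null_def by simp

lemma PS_closed: "a \<in> carrier A \<Longrightarrow> b \<in> carrier B \<Longrightarrow> PS a b \<in> carrier PA"
  by simp

lemma tens_add_l:
  assumes "a \<in> carrier A" "a' \<in> carrier A" "b \<in> carrier B"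
  shows "tens A B (a \<oplus>\<^bsub>A\<^esub> a') b = tens A B a b \<oplus>\<^bsub>tensor A B\<^esub> tens A B a' b"
proof -
  have "I.cls (PS (a \<oplus>\<^bsub>A\<^esub> a') b) = I.cls (PS a b \<oplus>\<^bsub>PA\<^esub> PS a' b)"
    using bilinear_relsI(1)[OF assms] assms by (intro tens_eqI PS_closed P.a_closed) auto
  then show ?thesis using I.star_quot_simps(3)[OF PS_closed PS_closed] assms by (simp add: tens_eq tensor_def del: pair_alg_simps)
qed

lemma tens_add_r:
  assumes "a \<in> carrier A" "b \<in> carrier B" "b' \<in> carrier B"
  shows "tens A B a (b \<oplus>\<^bsub>B\<^esub> b') = tens A B a b \<oplus>\<^bsub>tensor A B\<^esub> tens A B a b'"
proof -
  have "I.cls (PS a (b \<oplus>\<^bsub>B\<^esub> b')) = I.cls (PS a b \<oplus>\<^bsub>PA\<^esub> PS a b')"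
    using bilinear_relsI(2)[OF assms] assms by (intro tens_eqI PS_closed P.a_closed) auto
  then show ?thesis using I.star_quot_simps(3)[OF PS_closed PS_closed] assms by (simp add: tens_eq tensor_def del: pair_alg_simps)
qed

lemma tens_smult_l:
  assumes "a \<in> carrier A" "b \<in> carrier B"
  shows "tens A B (c \<odot>\<^bsub>A\<^esub> a) b = c \<odot>\<^bsub>tensor A B\<^esub> tens A B a b"
proof -
  have "I.cls (PS (c \<odot>\<^bsub>A\<^esub> a) b) = I.cls (c \<odot>\<^bsub>PA\<^esub> PS a b)"
    using bilinear_relsI(3)[OF assms] assms by (intro tens_eqI PS_closed P.smult_closed) auto
  then show ?thesis using I.star_quot_simps(6)[OF PS_closed] assms by (simp add: tens_eq tensor_def del: pair_alg_simps)
qed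

lemma tens_smult_r:
  assumes "a \<in> carrier A" "b \<in> carrier B"
  shows "tens A B a (c \<odot>\<^bsub>B\<^esub> b) = c \<odot>\<^bsub>tensor A B\<^esub> tens A B a b"
proof -
  have "I.cls (PS a (c \<odot>\<^bsub>B\<^esub> b)) = I.cls (c \<odot>\<^bsub>PA\<^esub> PS a b)"
    using bilinear_relsI(4)[OF assms] assms by (intro tens_eqI PS_closed P.smult_closed) auto
  then show ?thesis using I.star_quot_simps(6)[OF PS_closed] assms by (simp add: tens_eq tensor_def del: pair_alg_simps)
qed

lemma tens_mult:
  assumes "a \<in> carrier A" "b \<in> carrier B" "a' \<in> carrier A" "b' \<in> carrier B"
  shows "tens A B a b \<otimes>\<^bsub>tensor A B\<^esub> tens A B a' b' = tens A B (a \<otimes>\<^bsub>A\<^esub> a') (b \<otimes>\<^bsub>B\<^esub> b')"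
  using I.star_quot_simps(2)[OF PS_closed[OF assms(1,2)] PS_closed[OF assms(3,4)]]
  by (simp add: tens_eq tensor_def)

lemma tens_adj:
  assumes "a \<in> carrier A" "b \<in> carrier B"
  shows "adj (tensor A B) (tens A B a b) = tens A B (adj A a) (adj B b)"
  using I.star_quot_simps(7)[OF PS_closed[OF assms]] by (simp add: tens_eq tensor_def)

lemma tens_one: "tens A B \<one>\<^bsub>A\<^esub> \<one>\<^bsub>B\<^esub> = \<one>\<^bsub>tensor A B\<^esub>"
  using I.star_quot_simps(4) by (simp add: tens_eq tensor_def)

lemma tens_zero_l: "b \<in> carrier B \<Longrightarrow> tens A B \<zero>\<^bsub>A\<^esub> b = \<zero>\<^bsub>tensor A B\<^esub>"
  using tens_smult_l[of "\<zero>\<^bsub>A\<^esub>" b 0] by simp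

lemma tens_zero_r: "a \<in> carrier A \<Longrightarrow> tens A B a \<zero>\<^bsub>B\<^esub> = \<zero>\<^bsub>tensor A B\<^esub>"
  using tens_smult_r[of a "\<zero>\<^bsub>B\<^esub>" 0] by simp

text \<open>A scalar can be moved into the first leg, so simple tensors and sums exhaust
  everything.\<close>

lemma tensor_induct [consumes 1, case_names tens add]:
  assumes "y \<in> carrier (tensor A B)"
    and tens: "\<And>a b. a \<in> carrier A \<Longrightarrow> b \<in> carrier B \<Longrightarrow> Q (tens A B a b)"
    and add: "\<And>x y. x \<in> carrier (tensor A B) \<Longrightarrow> y \<in> carrier (tensor A B) \<Longrightarrow> Q x \<Longrightarrow> Q y \<Longrightarrow> Q (x \<oplus>\<^bsub>tensor A B\<^esub> y)"
  shows "Q y"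
proof -
  obtain p where p: "p \<in> carrier PA" "y = I.cls p"
    using assms(1) unfolding tensor_def I.star_quot_simps(1) by blast
  from p(1) have "Q (I.cls p)"
  proof (induction p rule: pair_alg_induct)
    case (add p q)
    then show ?case using assms(3)[of "I.cls p" "I.cls q"] I.star_quot_simps(3)[of p q]
      unfolding tensor_def I.star_quot_simps(1) by auto
  next
    case (single a b c)
    then show ?case using tens[of "c \<odot>\<^bsub>A\<^esub> a" b] tens_smult_l[of a b c] I.star_quot_simps(6)[OF PS_closed[of a b], of c]
      by (simp add: tens_eq tensor_def)
  qed
  then show ?thesis using p(2) by simp
qed

text \<open>The universal property for bilinear maps. Besides product functionals it supplies the
  slice maps that evaluate one leg by a character.\<close>

lemma tensor_lift_linear:
  assumes "complex_alg E" and F: "\<And>a b. a \<in> carrier A \<Longrightarrow> b \<in> carrier B \<Longrightarrow> F a b \<in> carrier E"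
    and bilinear: "\<And>a. a \<in> carrier A \<Longrightarrow> F a \<in> linear_map B E" "\<And>b. b \<in> carrier B \<Longrightarrow> (\<lambda>a. F a b) \<in> linear_map A E"
  obtains h where "h \<in> linear_map (tensor A B) E"
    "\<And>a b. a \<in> carrier A \<Longrightarrow> b \<in> carrier B \<Longrightarrow> h (tens A B a b) = F a b"
proof -
  interpret E: complex_alg E by fact
  let ?h = "monoid_alg_lift E (\<lambda>(a, b). F a b)"
  have F': "(\<lambda>(a, b). F a b) u \<in> carrier E" if "u \<in> carrier (A \<times>\<times> B)" for u
    using that F by (auto simp: DirProd_def)
  have L: "?h \<in> linear_map PA E" unfolding pair_alg_def by (rule monoid_alg_lift_linear[OF assms(1) F'])
  have h: "?h (PS a b) = F a b" if "a \<in> carrier A" "b \<in> carrier B" for a b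
    using monoid_alg_lift_single[where M = "A \<times>\<times> B" and u = "(a, b)" and c = 1, OF assms(1) F'] that F by (simp add: DirProd_def)
  note m = linear_map_minus[OF P.complex_alg_axioms assms(1) L] and l = linear_mapD[OF L]
  have kill: "?h s = \<zero>\<^bsub>E\<^esub>" if "s \<in> tensor_null A B" for s
    using that unfolding tensor_null_def
  proof (induction rule: lin_span.induct)
    case zero
    show ?case by (rule linear_map_zero[OF P.complex_alg_axioms assms(1) L])
  next
    case (base s)
    then show ?case
    proof (cases rule: bilinear_rels_cases)
      case (add_l a a' b)
      have "?h s = ?h (PS (a \<oplus>\<^bsub>A\<^esub> a') b \<ominus>\<^bsub>PA\<^esub> (PS a b \<oplus>\<^bsub>PA\<^esub> PS a' b))"
        using add_l by (subst pair_alg_minus) (auto dest: keys_addD)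
      also have "\<dots> = ?h (PS (a \<oplus>\<^bsub>A\<^esub> a') b) \<ominus>\<^bsub>E\<^esub> (?h (PS a b) \<oplus>\<^bsub>E\<^esub> ?h (PS a' b))"
        using add_l PS_closed P.a_closed by (subst m, (auto simp del: pair_alg_simps)[2], subst l(2)) (auto simp del: pair_alg_simps)
      also have "\<dots> = \<zero>\<^bsub>E\<^esub>"
        using add_l linear_mapD(2)[OF bilinear(2)[of b], of a a'] F by (simp add: h)
      finally show ?thesis .
    next
      case (add_r a b b')
      have "?h s = ?h (PS a (b \<oplus>\<^bsub>B\<^esub> b') \<ominus>\<^bsub>PA\<^esub> (PS a b \<oplus>\<^bsub>PA\<^esub> PS a b'))"
        using add_r by (subst pair_alg_minus) (auto dest: keys_addD)
      also have "\<dots> = ?h (PS a (b \<oplus>\<^bsub>B\<^esub> b')) \<ominus>\<^bsub>E\<^esub> (?h (PS a b) \<oplus>\<^bsub>E\<^esub> ?h (PS a b'))"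
        using add_r PS_closed P.a_closed by (subst m, (auto simp del: pair_alg_simps)[2], subst l(2)) (auto simp del: pair_alg_simps)
      also have "\<dots> = \<zero>\<^bsub>E\<^esub>"
        using add_r linear_mapD(2)[OF bilinear(1)[of a], of b b'] F by (simp add: h)
      finally show ?thesis .
    next
      case (smult_l c a b)
      have "?h s = ?h (PS (c \<odot>\<^bsub>A\<^esub> a) b \<ominus>\<^bsub>PA\<^esub> c \<odot>\<^bsub>PA\<^esub> PS a b)"
        using smult_l by (subst pair_alg_minus) auto
      also have "\<dots> = ?h (PS (c \<odot>\<^bsub>A\<^esub> a) b) \<ominus>\<^bsub>E\<^esub> c \<odot>\<^bsub>E\<^esub> ?h (PS a b)"
        using smult_l PS_closed P.smult_closed by (subst m, (auto simp del: pair_alg_simps)[2], subst l(3)) (auto simp del: pair_alg_simps)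
      also have "\<dots> = \<zero>\<^bsub>E\<^esub>"
        using smult_l linear_mapD(3)[OF bilinear(2)[of b], of a c] F by (simp add: h)
      finally show ?thesis .
    next
      case (smult_r c a b)
      have "?h s = ?h (PS a (c \<odot>\<^bsub>B\<^esub> b) \<ominus>\<^bsub>PA\<^esub> c \<odot>\<^bsub>PA\<^esub> PS a b)"
        using smult_r by (subst pair_alg_minus) auto
      also have "\<dots> = ?h (PS a (c \<odot>\<^bsub>B\<^esub> b)) \<ominus>\<^bsub>E\<^esub> c \<odot>\<^bsub>E\<^esub> ?h (PS a b)"
        using smult_r PS_closed P.smult_closed by (subst m, (auto simp del: pair_alg_simps)[2], subst l(3)) (auto simp del: pair_alg_simps)
      also have "\<dots> = \<zero>\<^bsub>E\<^esub>"
        using smult_r linear_mapD(3)[OF bilinear(1)[of a], of b c] F by (simp add: h)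
      finally show ?thesis .
    qed
  next
    case (add x y)
    then have "x \<in> carrier PA" "y \<in> carrier PA" using tensor_null_closed unfolding tensor_null_def by auto
    then show ?case using add l(2)[of x y] by (simp del: pair_alg_simps)
  next
    case (scale x c)
    then have "x \<in> carrier PA" using tensor_null_closed unfolding tensor_null_def by auto
    then show ?case using scale l(3)[of x c] by (simp del: pair_alg_simps)
  qed
  from I.star_quot_lift_linear[OF assms(1) L kill]
  obtain k where k: "k \<in> linear_map (tensor A B) E" "\<And>x. x \<in> carrier PA \<Longrightarrow> k (I.cls x) = ?h x"
    unfolding tensor_def by metis
  show ?thesis
    by (rule that[OF k(1)]) (simp add: tens_eq k(2)[OF PS_closed] h del: pair_alg_simps)
qed

text \<open>Discharges the definite description: existence by the universal property, uniqueness
  because a linear functional is determined on simple tensors and the description fixes it off the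
  carrier.\<close>

lemma tensor_functional:
  assumes "linear_functional A \<phi>" "linear_functional B \<psi>"
  shows "linear_functional (tensor A B) (tensor_functional A B \<phi> \<psi>)"
    and "\<And>a b. a \<in> carrier A \<Longrightarrow> b \<in> carrier B \<Longrightarrow> tensor_functional A B \<phi> \<psi> (tens A B a b) = \<phi> a * \<psi> b"
proof -
  let ?Q = "\<lambda>h. h \<in> extensional (carrier (tensor A B)) \<and> linear_functional (tensor A B) h \<and>
     (\<forall>a \<in> carrier A. \<forall>b \<in> carrier B. h (tens A B a b) = \<phi> a * \<psi> b)"
  interpret C: star_algebra complex_star by (rule star_algebra_complex_star)
  obtain h where h: "h \<in> linear_map (tensor A B) complex_star"
    "\<And>a b. a \<in> carrier A \<Longrightarrow> b \<in> carrier B \<Longrightarrow> h (tens A B a b) = \<phi> a * \<psi> b"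
    by (rule tensor_lift_linear[OF C.complex_alg_axioms, of "\<lambda>a b. \<phi> a * \<psi> b"])
      (use assms in \<open>auto simp: linear_map_def linear_functional_def algebra_simps\<close>)
  let ?h = "restrict h (carrier (tensor A B))"
  have "\<exists>!h. ?Q h"
  proof (rule ex1I[of _ ?h])
    show "?Q ?h" using h by (auto simp: linear_functional_def linear_map_def)
  next
    fix g assume g: "?Q g"
    show "g = ?h"
    proof
      fix y
      show "g y = ?h y"
      proof (cases "y \<in> carrier (tensor A B)")
        case True
        then have "g y = h y"
        proof (induction y rule: tensor_induct)
          case (tens a b)
          then show ?case using g h(2) by simp
        next
          case (add x y)
          then show ?case using g linear_mapD(2)[OF h(1)] by (simp add: linear_functional_def)
        qed
        with True show ?thesis by simp
      next
        case False
        then show ?thesis using g by (simp add: extensional_def)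
      qed
    qed
  qed
  from theI'[OF this]
  show "linear_functional (tensor A B) (tensor_functional A B \<phi> \<psi>)"
    "\<And>a b. a \<in> carrier A \<Longrightarrow> b \<in> carrier B \<Longrightarrow> tensor_functional A B \<phi> \<psi> (tens A B a b) = \<phi> a * \<psi> b"
    unfolding tensor_functional_def by blast+
qed

end

section \<open>Positive kernels and states\<close>

definition psd :: "'i set \<Rightarrow> ('i \<Rightarrow> 'i \<Rightarrow> complex) \<Rightarrow> bool" where
  "psd I A \<longleftrightarrow> (\<forall>c. (\<Sum>i\<in>I. \<Sum>j\<in>I. cnj (c i) * c j * A i j) \<in> \<real>\<^sub>\<ge>\<^sub>0)"

lemma psd_subset:
  assumes "finite I" "psd I A" "J \<subseteq> I"
  shows "psd J A"
  unfolding psd_def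
proof
  fix c :: "'a \<Rightarrow> complex"
  let ?c = "\<lambda>k. if k \<in> J then c k else 0"
  have "(\<Sum>i\<in>I. \<Sum>j\<in>I. cnj (?c i) * ?c j * A i j) = (\<Sum>i\<in>I. \<Sum>j\<in>J. cnj (?c i) * ?c j * A i j)"
    using assms by (intro sum.cong refl sum.mono_neutral_right) auto
  also have "\<dots> = (\<Sum>i\<in>J. \<Sum>j\<in>J. cnj (?c i) * ?c j * A i j)"
    using assms by (intro sum.mono_neutral_right) auto
  also have "\<dots> = (\<Sum>i\<in>J. \<Sum>j\<in>J. cnj (c i) * c j * A i j)"
    by (intro sum.cong) auto
  finally show "(\<Sum>i\<in>J. \<Sum>j\<in>J. cnj (c i) * c j * A i j) \<in> \<real>\<^sub>\<ge>\<^sub>0"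
    using assms(2)[unfolded psd_def, THEN spec, of ?c] by (rule subst)
qed

lemma psd_diag:
  assumes "finite I" "psd I A" "i \<in> I"
  shows "A i i \<in> \<real>\<^sub>\<ge>\<^sub>0"
proof -
  have "psd {i} A" using psd_subset[OF assms(1,2)] assms(3) by auto
  then show ?thesis unfolding psd_def by (auto dest: spec[of _ "\<lambda>_. 1"])
qed

lemma psd_pair:
  assumes "finite I" "psd I A" "i \<in> I" "j \<in> I" "i \<noteq> j"
  shows "cnj x * x * A i i + cnj x * y * A i j + cnj y * x * A j i + cnj y * y * A j j \<in> \<real>\<^sub>\<ge>\<^sub>0"
proof -
  have "psd {i, j} A" using psd_subset[OF assms(1,2)] assms(3,4) by auto
  from this[unfolded psd_def, rule_format, of "\<lambda>k. if k = i then x else y"] assms(5)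
  show ?thesis by (simp add: algebra_simps)
qed

text \<open>Over the complex numbers, reality of the quadratic form already forces symmetry: the
  coefficient pairs (1, 1) and (1, \<i>) control the imaginary part of the sum and the real part of
  the difference of the two off-diagonal entries.\<close>

lemma psd_hermitian:
  assumes "finite I" "psd I A" "i \<in> I" "j \<in> I"
  shows "A j i = cnj (A i j)"
proof (cases "i = j")
  case True
  then show ?thesis using psd_diag[OF assms(1-3)]
    by (auto simp: complex_nonneg_Reals_iff complex_eq_iff)
next
  case False
  note d = psd_diag[OF assms(1-3)] psd_diag[OF assms(1,2,4)]
  from psd_pair[OF assms False, of 1 1] psd_pair[OF assms False, of 1 \<i>] d
  show ?thesis by (auto simp: complex_nonneg_Reals_iff complex_eq_iff)
qed

lemma psd_zero_diag:
  assumes "finite I" "psd I A" "i \<in> I" "j \<in> I" "A i i = 0"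
  shows "A i j = 0"
proof (cases "i = j")
  case True
  then show ?thesis using assms by simp
next
  case False
  show ?thesis
  proof (rule ccontr)
    assume nz: "A i j \<noteq> 0"
    define n where "n = (cmod (A i j))\<^sup>2"
    have n: "n > 0" "A i j * cnj (A i j) = of_real n"
      using nz by (auto simp: n_def complex_norm_square[symmetric])
    \<comment> \<open>With this multiple the form equals \<open>A j j\<close> minus
      \<open>Re (A j j) + 1\<close>, whose real part is -1.\<close>
    define s where "s = (Re (A j j) + 1) / (2 * n)"
    have "cnj (- of_real s * A i j) * 1 * A i j + cnj 1 * (- of_real s * A i j) * A j i + cnj 1 * 1 * A j j \<in> \<real>\<^sub>\<ge>\<^sub>0"
      using psd_pair[OF assms(1-4) False, of "- of_real s * A i j" 1] assms(5) by simp
    also have "cnj (- of_real s * A i j) * 1 * A i j + cnj 1 * (- of_real s * A i j) * A j i + cnj 1 * 1 * A j j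
        = A j j - 2 * of_real s * (A i j * cnj (A i j))"
      unfolding psd_hermitian[OF assms(1-4)] by (simp add: algebra_simps)
    also have "\<dots> = A j j - of_real (2 * s * n)" by (simp add: n)
    also have "2 * s * n = Re (A j j) + 1" using n by (simp add: s_def)
    finally show False by (simp add: complex_nonneg_Reals_iff)
  qed
qed

text \<open>The Schur product theorem, by eliminating one index with a Schur complement.\<close>

lemma psd_schur_sum:
  assumes "finite I" "psd I A" "psd I B"
  shows "(\<Sum>i\<in>I. \<Sum>j\<in>I. A i j * B i j) \<in> \<real>\<^sub>\<ge>\<^sub>0"
  using assms
proof (induction I arbitrary: A rule: finite_induct)
  case empty
  then show ?case by simp
next
  case (insert k I)
  let ?K = "insert k I"
  have fin: "finite ?K" using insert by simp
  have BI: "psd I B" using psd_subset[OF fin insert(5)] by blast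
  show ?case
  proof (cases "A k k = 0")
    case True
    \<comment> \<open>With a zero diagonal entry there is nothing to eliminate: the whole row and
      column vanish.\<close>
    have z: "A k j = 0" if "j \<in> I" for j
      using psd_zero_diag[OF fin insert(4) _ _ True] that by blast
    have z': "A j k = 0" if "j \<in> I" for j
      using psd_hermitian[OF fin insert(4), of k j] z[OF that] that by simp
    have "(\<Sum>i\<in>?K. \<Sum>j\<in>?K. A i j * B i j) = (\<Sum>i\<in>I. \<Sum>j\<in>I. A i j * B i j)"
      using insert(1,2) True by (simp add: z z')
    then show ?thesis using insert(3)[OF psd_subset[OF fin insert(4)] BI] by auto
  next
    case False
    define r where "r = Re (A k k)"
    have r: "A k k = of_real r" "r > 0"
      using psd_diag[OF fin insert(4), of k] False
      by (auto simp: r_def complex_nonneg_Reals_iff complex_eq_iff)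
    \<comment> \<open>The Schur complement of the entry k. Its row and column at k vanish, so its
      sum over the larger index set is its sum over \<open>I\<close>.\<close>
    define A' where "A' = (\<lambda>i j. A i j - A i k * A k j / of_real r)"
    have herm: "A i k = cnj (A k i)" if "i \<in> I" for i
      using psd_hermitian[OF fin insert(4), of k i] that by simp
    have "psd I A'" unfolding psd_def
    proof
      fix c
      define S where "S = (\<Sum>j\<in>I. c j * A k j)"
      define F where "F = (\<Sum>i\<in>I. \<Sum>j\<in>I. cnj (c i) * c j * A i j)"
      \<comment> \<open>The coefficient at k that completes the square: the form of \<open>A\<close>
        at \<open>d\<close> is the form of the Schur complement at \<open>c\<close>.\<close>
      define d where "d = c(k := - S / of_real r)"
      have S': "(\<Sum>i\<in>I. cnj (c i) * A i k) = cnj S" by (simp add: S_def herm)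
      have dI: "d i = c i" if "i \<in> I" for i using that insert(2) by (auto simp: d_def)
      have "(\<Sum>i\<in>?K. \<Sum>j\<in>?K. cnj (d i) * d j * A i j) =
          cnj (d k) * d k * A k k + (\<Sum>j\<in>I. cnj (d k) * c j * A k j)
           + ((\<Sum>i\<in>I. cnj (c i) * d k * A i k) + F)"
        using insert(1,2) by (simp add: sum.distrib dI F_def)
      also have "(\<Sum>j\<in>I. cnj (d k) * c j * A k j) = cnj (d k) * S"
        by (simp add: S_def sum_distrib_left mult.assoc)
      also have "(\<Sum>i\<in>I. cnj (c i) * d k * A i k) = d k * cnj S"
        unfolding S'[symmetric] by (simp add: sum_distrib_left mult_ac)
      also have "cnj (d k) * d k * A k k + cnj (d k) * S + (d k * cnj S + F) = F - cnj S * S / of_real r"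
        using r by (simp add: d_def field_simps)
      also have "\<dots> = (\<Sum>i\<in>I. \<Sum>j\<in>I. cnj (c i) * c j * A' i j)"
        unfolding S'[symmetric] unfolding S_def F_def A'_def sum_product sum_divide_distrib
          sum_subtractf[symmetric] by (intro sum.cong refl) (simp add: algebra_simps)
      finally show "(\<Sum>i\<in>I. \<Sum>j\<in>I. cnj (c i) * c j * A' i j) \<in> \<real>\<^sub>\<ge>\<^sub>0"
        using insert(4)[unfolded psd_def, THEN spec, of d] by (rule subst)
    qed
    then have 1: "(\<Sum>i\<in>I. \<Sum>j\<in>I. A' i j * B i j) \<in> \<real>\<^sub>\<ge>\<^sub>0" by (rule insert(3)[OF _ BI])
    have A'k: "A' k j = 0" "A' j k = 0" for j using r by (simp_all add: A'_def)
    have "(\<Sum>i\<in>?K. \<Sum>j\<in>?K. A i j * B i j) = (\<Sum>i\<in>?K. \<Sum>j\<in>?K. A' i j * B i j) +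
        (\<Sum>i\<in>?K. \<Sum>j\<in>?K. A i k * A k j * B i j) / of_real r"
      unfolding A'_def sum_divide_distrib sum.distrib[symmetric]
      by (intro sum.cong refl) (simp add: algebra_simps)
    also have "(\<Sum>i\<in>?K. \<Sum>j\<in>?K. A' i j * B i j) = (\<Sum>i\<in>I. \<Sum>j\<in>I. A' i j * B i j)"
      using insert(1,2) by (simp add: A'k)
    \<comment> \<open>The rank-one remainder, paired with \<open>B\<close>, is the quadratic form of
      \<open>B\<close> at the vector \<open>A k\<close>.\<close>
    also have "(\<Sum>i\<in>?K. \<Sum>j\<in>?K. A i k * A k j * B i j) = (\<Sum>i\<in>?K. \<Sum>j\<in>?K. cnj (A k i) * A k j * B i j)"
      using psd_hermitian[OF fin insert(4), of k] by (intro sum.cong refl) auto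
    finally show ?thesis
      using 1 insert(5) r(2) unfolding psd_def divide_inverse
      by (auto intro!: nonneg_Reals_add_I nonneg_Reals_mult_I simp flip: of_real_inverse)
  qed
qed

text \<open>The coefficients are absorbed into \<open>A\<close>, which stays positive, and the
  summed form is applied.\<close>

lemma psd_schur:
  assumes "finite I" "psd I A" "psd I B"
  shows "psd I (\<lambda>i j. A i j * B i j)"
  unfolding psd_def
proof
  fix c
  have "psd I (\<lambda>i j. cnj (c i) * c j * A i j)"
    unfolding psd_def
  proof
    fix d
    have "(\<Sum>i\<in>I. \<Sum>j\<in>I. cnj (c i * d i) * (c j * d j) * A i j) \<in> \<real>\<^sub>\<ge>\<^sub>0"
      using assms(2) unfolding psd_def by (rule spec)
    then show "(\<Sum>i\<in>I. \<Sum>j\<in>I. cnj (d i) * d j * (cnj (c i) * c j * A i j)) \<in> \<real>\<^sub>\<ge>\<^sub>0"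
      by (simp add: mult_ac)
  qed
  from psd_schur_sum[OF assms(1) this assms(3)]
  show "(\<Sum>i\<in>I. \<Sum>j\<in>I. cnj (c i) * c j * (A i j * B i j)) \<in> \<real>\<^sub>\<ge>\<^sub>0" by (simp add: mult_ac)
qed

lemma psd_one: "psd I (\<lambda>i j. 1)"
proof -
  have "(\<Sum>i\<in>I. \<Sum>j\<in>I. cnj (c i) * c j) \<in> \<real>\<^sub>\<ge>\<^sub>0" for c
  proof -
    have "(\<Sum>i\<in>I. \<Sum>j\<in>I. cnj (c i) * c j) = sum c I * cnj (sum c I)"
      unfolding cnj_sum sum_product by (subst sum.swap) (simp add: mult.commute)
    also have "\<dots> = of_real ((cmod (sum c I))\<^sup>2)" by (rule complex_norm_square[symmetric])
    finally show ?thesis by simp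
  qed
  then show ?thesis by (simp add: psd_def)
qed

lemma psd_prod:
  assumes "finite I" "finite S" "\<And>k. k \<in> S \<Longrightarrow> psd I (A k)"
  shows "psd I (\<lambda>i j. \<Prod>k\<in>S. A k i j)"
  using assms(2,3) by (induction S rule: finite_induct) (simp_all add: psd_one psd_schur assms(1))

section \<open>States, their Gram matrices, and tensor products of states\<close>

lemma state_iff: "state A \<phi> \<longleftrightarrow> \<phi> \<in> linear_map A complex_star \<and> \<phi> \<one>\<^bsub>A\<^esub> = 1 \<and>
    (\<forall>x\<in>carrier A. \<phi> (adj A x \<otimes>\<^bsub>A\<^esub> x) \<in> \<real>\<^sub>\<ge>\<^sub>0)"
  by (auto simp: state_def linear_functional_iff complex_nonneg_Reals_iff)

lemma linear_map_mult_l: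
  assumes "complex_alg A" "x \<in> carrier A"
  shows "(\<lambda>y. x \<otimes>\<^bsub>A\<^esub> y) \<in> linear_map A A"
proof -
  interpret A: complex_alg A by fact
  show ?thesis using assms(2) by (auto simp: linear_map_def A.r_distr A.smult_mult_r)
qed

lemma linear_map_mult_r:
  assumes "complex_alg A" "x \<in> carrier A"
  shows "(\<lambda>y. y \<otimes>\<^bsub>A\<^esub> x) \<in> linear_map A A"
proof -
  interpret A: complex_alg A by fact
  show ?thesis using assms(2) by (auto simp: linear_map_def A.l_distr A.smult_mult_l)
qed

lemma functional_square_finsum:
  assumes "star_algebra A" "\<phi> \<in> linear_map A complex_star" "t \<in> I \<rightarrow> carrier A"
  shows "\<phi> (adj A (finsum A t I) \<otimes>\<^bsub>A\<^esub> finsum A t I) = (\<Sum>i\<in>I. \<Sum>j\<in>I. \<phi> (adj A (t i) \<otimes>\<^bsub>A\<^esub> t j))"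
proof -
  interpret A: star_algebra A by fact
  interpret C: star_algebra complex_star by (rule star_algebra_complex_star)
  let ?x = "finsum A t I"
  have x: "?x \<in> carrier A" using assms(3) by (rule A.finsum_closed)
  have ta: "(\<lambda>i. adj A (t i)) \<in> I \<rightarrow> carrier A" using assms(3) by auto
  have "\<phi> (adj A ?x \<otimes>\<^bsub>A\<^esub> ?x) = (\<Sum>i\<in>I. \<phi> (adj A (t i) \<otimes>\<^bsub>A\<^esub> ?x))"
    using linear_map_finsum[OF A.complex_alg_axioms C.complex_alg_axioms
        linear_map_compose[OF assms(2) linear_map_mult_r[OF A.complex_alg_axioms x]] ta]
    by (simp add: finsum_complex_star A.adj_finsum[OF assms(3)])
  also have "\<dots> = (\<Sum>i\<in>I. \<Sum>j\<in>I. \<phi> (adj A (t i) \<otimes>\<^bsub>A\<^esub> t j))"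
  proof (rule sum.cong[OF refl])
    fix i assume "i \<in> I"
    then have "adj A (t i) \<in> carrier A" using assms(3) by auto
    from linear_map_finsum[OF A.complex_alg_axioms C.complex_alg_axioms
        linear_map_compose[OF assms(2) linear_map_mult_l[OF A.complex_alg_axioms this]] assms(3)]
    show "\<phi> (adj A (t i) \<otimes>\<^bsub>A\<^esub> ?x) = (\<Sum>j\<in>I. \<phi> (adj A (t i) \<otimes>\<^bsub>A\<^esub> t j))"
      by (simp add: finsum_complex_star)
  qed
  finally show ?thesis .
qed

text \<open>The form at the coefficients \<open>c\<close> is the value of \<phi> on adj x times x,
  where x is the combination of the \<open>a i\<close> with these coefficients.\<close>

lemma psd_state:
  assumes "star_algebra A" "state A \<phi>" "a \<in> I \<rightarrow> carrier A"
  shows "psd I (\<lambda>i j. \<phi> (adj A (a i) \<otimes>\<^bsub>A\<^esub> a j))"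
  unfolding psd_def
proof
  fix c
  interpret A: star_algebra A by fact
  have L: "\<phi> \<in> linear_map A complex_star" using assms(2) by (simp add: state_iff)
  let ?t = "\<lambda>i. c i \<odot>\<^bsub>A\<^esub> a i"
  have t: "?t \<in> I \<rightarrow> carrier A" using assms(3) by auto
  have a: "a i \<in> carrier A" if "i \<in> I" for i using that assms(3) by auto
  have "\<phi> (adj A (finsum A ?t I) \<otimes>\<^bsub>A\<^esub> finsum A ?t I) \<in> \<real>\<^sub>\<ge>\<^sub>0"
    using assms(2) A.finsum_closed[OF t] by (auto simp: state_iff)
  also have "\<phi> (adj A (finsum A ?t I) \<otimes>\<^bsub>A\<^esub> finsum A ?t I) =
      (\<Sum>i\<in>I. \<Sum>j\<in>I. \<phi> (adj A (?t i) \<otimes>\<^bsub>A\<^esub> ?t j))"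
    by (rule functional_square_finsum[OF assms(1) L t])
  also have "\<dots> = (\<Sum>i\<in>I. \<Sum>j\<in>I. cnj (c i) * c j * \<phi> (adj A (a i) \<otimes>\<^bsub>A\<^esub> a j))"
    by (intro sum.cong refl)
      (simp add: a A.adj_smult A.smult_mult_l A.smult_mult_r A.smult_assoc linear_mapD(3)[OF L] mult_ac)
  finally show "(\<Sum>i\<in>I. \<Sum>j\<in>I. cnj (c i) * c j * \<phi> (adj A (a i) \<otimes>\<^bsub>A\<^esub> a j)) \<in> \<real>\<^sub>\<ge>\<^sub>0" .
qed

text \<open>Writing y as a sum of simple tensors turns the value on adj y times y into the sum of
  the entries of an entrywise product of two Gram matrices, to which the Schur theorem
  applies.\<close>

lemma state_tensor:
  assumes A: "star_algebra A" and B: "star_algebra B" and "state A \<phi>" "state B \<psi>"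
  shows "state (tensor A B) (tensor_functional A B \<phi> \<psi>)"
proof -
  interpret A: star_algebra A by fact
  interpret B: star_algebra B by fact
  interpret T: star_algebra "tensor A B" by (rule star_algebra_tensor[OF A B])
  let ?h = "tensor_functional A B \<phi> \<psi>"
  have lf: "linear_functional A \<phi>" "linear_functional B \<psi>" using assms(3,4) by (auto simp: state_def)
  note h = tensor_functional[OF A B lf]
  have L: "?h \<in> linear_map (tensor A B) complex_star" using h(1) by (simp add: linear_functional_iff)
  have "?h (adj (tensor A B) y \<otimes>\<^bsub>tensor A B\<^esub> y) \<in> \<real>\<^sub>\<ge>\<^sub>0" if y: "y \<in> carrier (tensor A B)" for y
  proof -
    have "\<exists>n a b. a \<in> {..<n::nat} \<rightarrow> carrier A \<and> b \<in> {..<n} \<rightarrow> carrier B \<and>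
        y = (\<Oplus>\<^bsub>tensor A B\<^esub>i\<in>{..<n}. tens A B (a i) (b i))"
      using y
    proof (induction y rule: tensor_induct[OF A B, consumes 1])
      case (1 a b)
      then show ?case
        by (intro exI[of _ 1] exI[of _ "\<lambda>_. a"] exI[of _ "\<lambda>_. b"]) (auto simp: lessThan_Suc tens_closed[OF A B])
    next
      case (2 x y)
      then obtain n a b n' a' b' where n: "a \<in> {..<n::nat} \<rightarrow> carrier A" "b \<in> {..<n} \<rightarrow> carrier B"
          "x = (\<Oplus>\<^bsub>tensor A B\<^esub>i\<in>{..<n}. tens A B (a i) (b i))"
        and n': "a' \<in> {..<n'::nat} \<rightarrow> carrier A" "b' \<in> {..<n'} \<rightarrow> carrier B"
          "y = (\<Oplus>\<^bsub>tensor A B\<^esub>i\<in>{..<n'}. tens A B (a' i) (b' i))"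
        by auto
      let ?a = "\<lambda>i. if i < n then a i else a' (i - n)" and ?b = "\<lambda>i. if i < n then b i else b' (i - n)"
      have split: "{..<n + n'} = {..<n} \<union> (+) n ` {..<n'}"
        by (simp add: lessThan_atLeast0 add.commute ivl_disj_un_two(3))
      have c: "?a \<in> {..<n + n'} \<rightarrow> carrier A" "?b \<in> {..<n + n'} \<rightarrow> carrier B"
        using n(1,2) n'(1,2) by (auto simp: Pi_iff)
      then have tc: "tens A B (?a i) (?b i) \<in> carrier (tensor A B)" if "i < n + n'" for i
        using that unfolding Pi_iff by (intro tens_closed[OF A B]) blast+
      have "(\<Oplus>\<^bsub>tensor A B\<^esub>i\<in>{..<n + n'}. tens A B (?a i) (?b i)) =
          (\<Oplus>\<^bsub>tensor A B\<^esub>i\<in>{..<n}. tens A B (?a i) (?b i)) \<oplus>\<^bsub>tensor A B\<^esub>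
          (\<Oplus>\<^bsub>tensor A B\<^esub>i\<in>(+) n ` {..<n'}. tens A B (?a i) (?b i))"
        unfolding split by (rule T.finsum_Un_disjoint) (auto intro!: tc split del: if_split)
      also have "(\<Oplus>\<^bsub>tensor A B\<^esub>i\<in>{..<n}. tens A B (?a i) (?b i)) = x"
        unfolding n(3) by (rule T.finsum_cong') (use n(1,2) in \<open>auto intro: tens_closed[OF A B]\<close>)
      also have "(\<Oplus>\<^bsub>tensor A B\<^esub>i\<in>(+) n ` {..<n'}. tens A B (?a i) (?b i)) =
          (\<Oplus>\<^bsub>tensor A B\<^esub>i\<in>{..<n'}. tens A B (?a (n + i)) (?b (n + i)))"
        by (rule T.finsum_reindex) (auto intro!: tc split del: if_split)
      also have "\<dots> = y"
        unfolding n'(3) by (rule T.finsum_cong') (use n'(1,2) in \<open>auto intro: tens_closed[OF A B]\<close>)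
      finally have "x \<oplus>\<^bsub>tensor A B\<^esub> y = (\<Oplus>\<^bsub>tensor A B\<^esub>i\<in>{..<n + n'}. tens A B (?a i) (?b i))" by (rule sym)
      with c show ?case by (intro exI[of _ "n + n'"] exI[of _ ?a] exI[of _ ?b] conjI)
    qed
    then obtain n a b where n: "a \<in> {..<n::nat} \<rightarrow> carrier A" "b \<in> {..<n} \<rightarrow> carrier B"
      "y = (\<Oplus>\<^bsub>tensor A B\<^esub>i\<in>{..<n}. tens A B (a i) (b i))" by blast
    have ab: "a i \<in> carrier A" "b i \<in> carrier B" if "i \<in> {..<n}" for i using n(1,2) that by auto
    have t: "(\<lambda>i. tens A B (a i) (b i)) \<in> {..<n} \<rightarrow> carrier (tensor A B)"
      using ab by (auto intro: tens_closed[OF A B])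
    have "?h (adj (tensor A B) y \<otimes>\<^bsub>tensor A B\<^esub> y) = (\<Sum>i<n. \<Sum>j<n.
        ?h (adj (tensor A B) (tens A B (a i) (b i)) \<otimes>\<^bsub>tensor A B\<^esub> tens A B (a j) (b j)))"
      unfolding n(3) by (rule functional_square_finsum[OF T.star_algebra_axioms L t])
    also have "\<dots> = (\<Sum>i<n. \<Sum>j<n. \<phi> (adj A (a i) \<otimes>\<^bsub>A\<^esub> a j) * \<psi> (adj B (b i) \<otimes>\<^bsub>B\<^esub> b j))"
      by (intro sum.cong refl) (use ab in \<open>simp add: tens_adj[OF A B] tens_mult[OF A B] h(2)\<close>)
    also have "\<dots> \<in> \<real>\<^sub>\<ge>\<^sub>0"
      by (rule psd_schur_sum[OF _ psd_state[OF A assms(3) n(1)] psd_state[OF B assms(4) n(2)]]) simp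
    finally show ?thesis .
  qed
  moreover have "?h \<one>\<^bsub>tensor A B\<^esub> = 1"
    using h(2)[of "\<one>\<^bsub>A\<^esub>" "\<one>\<^bsub>B\<^esub>"] assms(3,4) by (simp add: state_def tens_one[OF A B])
  ultimately show ?thesis using L by (auto simp: state_iff)
qed

text \<open>Cauchy-Schwarz as a 2 by 2 Gram matrix for \<open>p\<close> and the adjoint of
  \<open>x\<close>: a zero on the diagonal kills the off-diagonal entries.\<close>

lemma state_supportD:
  assumes "star_algebra A" "state A \<phi>" "p \<in> carrier A" "\<phi> (adj A p \<otimes>\<^bsub>A\<^esub> p) = 0" "x \<in> carrier A"
  shows "\<phi> (x \<otimes>\<^bsub>A\<^esub> p) = 0"
proof -
  interpret A: star_algebra A by fact
  let ?a = "\<lambda>b. if b then p else adj A x"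
  have P: "psd UNIV (\<lambda>i j. \<phi> (adj A (?a i) \<otimes>\<^bsub>A\<^esub> ?a j))"
    by (rule psd_state[OF assms(1,2)]) (use assms in auto)
  have z: "\<phi> (adj A (?a True) \<otimes>\<^bsub>A\<^esub> ?a False) = 0"
    using psd_zero_diag[OF _ P, of True False] assms(4) by simp
  have "\<phi> (adj A (?a False) \<otimes>\<^bsub>A\<^esub> ?a True) = cnj (\<phi> (adj A (?a True) \<otimes>\<^bsub>A\<^esub> ?a False))"
    using psd_hermitian[OF _ P, of True False] by simp
  then show ?thesis using z assms(5) by simp
qed

section \<open>The monotone closure\<close>

lemma eventually_const_cong:
  assumes "eventually (\<lambda>n. f n = g n) F" "\<exists>a. eventually (\<lambda>n. g n = a) F"
  shows "\<exists>a. eventually (\<lambda>n. f n = a) F"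
proof -
  obtain a where "eventually (\<lambda>n. g n = a) F" using assms(2) by blast
  with assms(1) have "eventually (\<lambda>n. f n = a) F" by eventually_elim simp
  then show ?thesis by blast
qed

text \<open>The last two axioms carry the theory. \<open>proj_commute\<close> makes products of
  eventually constant sequences eventually constant; \<open>proj_separating\<close> provides the
  largest projection in \<open>proj_preimage\<close> when its condition holds at every finite
  level.\<close>

locale mtower = star_algebra C for C :: "('c, 'x) tower_scheme" (structure) +
  assumes stage_closed: "x \<in> stage C m \<Longrightarrow> x \<in> carrier C"
    and stage_one: "\<one> \<in> stage C m"
    and stage_add: "x \<in> stage C m \<Longrightarrow> y \<in> stage C m \<Longrightarrow> x \<oplus> y \<in> stage C m"
    and stage_smult: "x \<in> stage C m \<Longrightarrow> c \<odot> x \<in> stage C m"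
    and stage_mult: "x \<in> stage C m \<Longrightarrow> y \<in> stage C m \<Longrightarrow> x \<otimes> y \<in> stage C m"
    and stage_adj: "x \<in> stage C m \<Longrightarrow> adj C x \<in> stage C m"
    and stage_mono: "m \<le> n \<Longrightarrow> stage C m \<subseteq> stage C n"
    and stage_ex: "x \<in> carrier C \<Longrightarrow> \<exists>m. x \<in> stage C m"
    and proj_stage: "tproj C i \<in> stage C 0"
    and proj_adj: "adj C (tproj C i) = tproj C i"
    and proj_mult: "tproj C i \<otimes> tproj C j = tproj C (min i j)"
    and proj_0: "tproj C 0 = \<zero>"
    and proj_inf: "tproj C \<infinity> = \<one>"
    and proj_inj: "inj (tproj C)"
    and proj_commute: "x \<in> stage C m \<Longrightarrow> m < n \<Longrightarrow> x \<otimes> tproj C (enat n) = tproj C (enat n) \<otimes> x"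
    and proj_separating: "x \<in> carrier C \<Longrightarrow> (\<And>n. x \<otimes> tproj C (enat n) = \<zero>) \<Longrightarrow> x = \<zero>"
begin

abbreviation c :: "enat \<Rightarrow> 'c" where "c \<equiv> tproj C"

lemma proj_closed [simp, intro]: "c i \<in> carrier C"
  using proj_stage stage_closed by blast

lemma proj_le_iff [simp]: "proj_le C (c i) (c j) \<longleftrightarrow> i \<le> j"
  using proj_inj by (auto simp: proj_le_def proj_mult inj_eq min_def)

lemma mult_proj_proj: "x \<in> carrier C \<Longrightarrow> x \<otimes> c i \<otimes> c j = x \<otimes> c (min i j)"
  by (simp add: m_assoc proj_mult)

lemma mult_proj_le:
  assumes "x \<otimes> c j = y \<otimes> c j" "i \<le> j" "x \<in> carrier C" "y \<in> carrier C"
  shows "x \<otimes> c i = y \<otimes> c i"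
  using arg_cong[OF assms(1), of "\<lambda>z. z \<otimes> c i"] assms(2-) by (simp add: mult_proj_proj min_absorb2)

text \<open>The supremum condition becomes unboundedness of the indices: if they never reached
  \<open>i\<close>, then \<open>c i\<close> would be an upper bound different from the unit.\<close>

lemma msddE:
  assumes "msdd C e"
  obtains \<iota> where "\<And>m. m \<ge> 1 \<Longrightarrow> e m = c (\<iota> m)" "\<And>m n. 1 \<le> m \<Longrightarrow> m \<le> n \<Longrightarrow> \<iota> m \<le> \<iota> n"
    "\<And>i::nat. \<forall>\<^sub>F n in sequentially. enat i \<le> \<iota> n"
proof -
  have "\<forall>m. \<exists>i. m \<ge> 1 \<longrightarrow> e m = c i" using assms by (auto simp: msdd_def projs_def)
  then obtain \<iota> where \<iota>: "\<And>m. m \<ge> 1 \<Longrightarrow> e m = c (\<iota> m)" by metis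
  have mono: "\<iota> m \<le> \<iota> n" if "1 \<le> m" "m \<le> n" for m n
    using assms that \<iota>[of m] \<iota>[of n] unfolding msdd_def by (metis proj_le_iff order_trans)
  have "\<exists>m\<ge>1. enat i \<le> \<iota> m" for i
  proof (rule ccontr)
    assume *: "\<not> (\<exists>m\<ge>1. enat i \<le> \<iota> m)"
    have "proj_le C (e m) (c (enat i))" if "m \<ge> 1" for m
    proof -
      have "\<iota> m \<le> enat i" using * that linear by blast
      then show ?thesis by (simp add: \<iota>[OF that])
    qed
    then have "c (enat i) = c \<infinity>" using assms unfolding msdd_def projs_def proj_inf by blast
    then show False using proj_inj by (auto dest: injD)
  qed
  then have "\<forall>\<^sub>F n in sequentially. enat i \<le> \<iota> n" for i
    unfolding eventually_sequentially by (meson mono order_trans)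
  with \<iota> mono that show ?thesis by blast
qed

lemma msddI:
  assumes "\<And>m. m \<ge> 1 \<Longrightarrow> e m = c (\<iota> m)" "\<And>m n. 1 \<le> m \<Longrightarrow> m \<le> n \<Longrightarrow> \<iota> m \<le> \<iota> n"
    "\<And>i::nat. \<forall>\<^sub>F n in sequentially. enat i \<le> \<iota> n"
  shows "msdd C e"
  unfolding msdd_def
proof (intro conjI ballI impI allI)
  fix g assume "g \<in> projs C" and le: "\<forall>m\<ge>1. proj_le C (e m) g"
  then obtain j where j: "g = c j" by (auto simp: projs_def)
  have "enat i \<le> j" for i
  proof -
    from assms(3)[of i] obtain n where "n \<ge> 1" "enat i \<le> \<iota> n"
      unfolding eventually_sequentially by (metis nat_le_linear)
    then show ?thesis using le assms(1)[of n] j by (auto intro: order_trans)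
  qed
  then have "j = \<infinity>" by (metis enat_ord_simps(1) not_less_eq_eq order_refl enat.exhaust)
  then show "g = \<one>" using j proj_inf by simp
qed (use assms in \<open>auto simp: projs_def intro: order_trans\<close>)

text \<open>The largest index below \<open>m\<close> from which on a property is settled gives a domain.\<close>

lemma msdd_of_eventually:
  assumes "\<And>n. P 0 n" "\<And>i. \<forall>\<^sub>F n in sequentially. P i n"
  obtains \<iota> :: "nat \<Rightarrow> nat" where "msdd C (\<lambda>m. c (enat (\<iota> m)))" "\<And>m n. m \<le> n \<Longrightarrow> P (\<iota> m) n"
proof -
  define S where "S m = {i. i \<le> m \<and> (\<forall>n\<ge>m. P i n)}" for m :: nat
  have fin: "finite (S m)" for m by (rule finite_subset[of _ "{..m}"]) (auto simp: S_def)
  have ne: "0 \<in> S m" for m using assms(1) by (auto simp: S_def)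
  define \<iota> where "\<iota> m = Max (S m)" for m
  have mem: "\<iota> m \<in> S m" for m unfolding \<iota>_def using fin ne by (metis Max_in empty_iff)
  have mono: "\<iota> m \<le> \<iota> n" if "m \<le> n" for m n
    unfolding \<iota>_def[of n] using mem[of m] that by (intro Max_ge fin) (auto simp: S_def)
  have "\<forall>\<^sub>F n in sequentially. enat i \<le> enat (\<iota> n)" for i
  proof -
    obtain N where "\<forall>n\<ge>N. P i n" using assms(2)[of i] by (auto simp: eventually_sequentially)
    then have "i \<in> S n" if "n \<ge> max N i" for n using that by (auto simp: S_def)
    then have "i \<le> \<iota> n" if "n \<ge> max N i" for n using that unfolding \<iota>_def by (intro Max_ge fin) auto
    then show ?thesis unfolding eventually_sequentially by (intro exI[of _ "max N i"]) auto
  qed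
  then have "msdd C (\<lambda>m. c (enat (\<iota> m)))"
    by (intro msddI[of _ "\<lambda>m. enat (\<iota> m)"]) (auto intro: mono)
  moreover have "P (\<iota> m) n" if "m \<le> n" for m n using mem[of m] that by (auto simp: S_def)
  ultimately show ?thesis using that by blast
qed

text \<open>Up to equivalence, an operator with monotone closure is a sequence that is eventually
  constant, together with its adjoint, on each projection; the domain carries no information.\<close>

definition coherent :: "(nat \<Rightarrow> 'c) \<Rightarrow> bool" where
  "coherent x \<longleftrightarrow> (\<forall>m\<ge>1. x m \<in> stage C m) \<and>
     (\<forall>i::nat. \<exists>a. \<forall>\<^sub>F n in sequentially. x n \<otimes> c i = a) \<and>
     (\<forall>i::nat. \<exists>a. \<forall>\<^sub>F n in sequentially. adj C (x n) \<otimes> c i = a)"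

definition agree :: "(nat \<Rightarrow> 'c) \<Rightarrow> (nat \<Rightarrow> 'c) \<Rightarrow> bool" where
  "agree x y \<longleftrightarrow> (\<forall>i::nat. \<forall>\<^sub>F n in sequentially. x n \<otimes> c i = y n \<otimes> c i \<and>
     adj C (x n) \<otimes> c i = adj C (y n) \<otimes> c i)"

text \<open>Takes only the sequence; the domain part of a representative is left free, so
  computations with classes do not mention domains.\<close>

definition mcls :: "(nat \<Rightarrow> 'c) \<Rightarrow> 'c mco" where
  "mcls x = {(y, f). (y, f) \<in> owmc C \<and> agree x y}"

lemma agree_refl [simp, intro]: "agree x x"
  by (simp add: agree_def)

lemma agree_sym: "agree x y \<Longrightarrow> agree y x"
  by (simp add: agree_def eq_commute)

lemma agree_trans:
  assumes "agree x y" "agree y z" shows "agree x z"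
  unfolding agree_def
proof
  fix i :: nat
  from assms[unfolded agree_def, THEN spec, of i]
  show "\<forall>\<^sub>F n in sequentially. x n \<otimes> c i = z n \<otimes> c i \<and> adj C (x n) \<otimes> c i = adj C (z n) \<otimes> c i"
    by eventually_elim simp
qed

lemma agree_eventually: "\<forall>\<^sub>F n in sequentially. x n = y n \<Longrightarrow> agree x y"
  unfolding agree_def by (auto elim: eventually_mono)

lemma owmcD:
  assumes "(x, e) \<in> owmc C"
  shows "m \<ge> 1 \<Longrightarrow> x m \<in> stage C m" "m \<ge> 1 \<Longrightarrow> x m \<in> carrier C" "msdd C e"
    "1 \<le> m \<Longrightarrow> m \<le> n \<Longrightarrow> x n \<otimes> e m = x m \<otimes> e m"
    "1 \<le> m \<Longrightarrow> m \<le> n \<Longrightarrow> adj C (x n) \<otimes> e m = adj C (x m) \<otimes> e m"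
  using assms stage_closed by (auto simp: owmc_def le_less)

lemma coherentD:
  assumes "coherent x"
  shows "m \<ge> 1 \<Longrightarrow> x m \<in> stage C m" "m \<ge> 1 \<Longrightarrow> x m \<in> carrier C"
  using assms stage_closed by (auto simp: coherent_def)

text \<open>A fixed finite projection lies below \<open>e N\<close> for some N, and there the
  sequence no longer moves after N.\<close>

lemma owmc_coherent:
  assumes "(x, e) \<in> owmc C"
  shows "coherent x"
proof -
  note o = owmcD[OF assms]
  obtain \<iota> where \<iota>: "\<And>m. m \<ge> 1 \<Longrightarrow> e m = c (\<iota> m)" "\<And>i::nat. \<forall>\<^sub>F n in sequentially. enat i \<le> \<iota> n"
    using msddE[OF o(3)] by metis
  have "(\<exists>a. \<forall>\<^sub>F n in sequentially. x n \<otimes> c i = a) \<and> (\<exists>a. \<forall>\<^sub>F n in sequentially. adj C (x n) \<otimes> c i = a)"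
    for i :: nat
  proof -
    obtain N where N: "N \<ge> 1" "enat i \<le> \<iota> N"
      using \<iota>(2)[of i] unfolding eventually_sequentially by (metis nat_le_linear)
    have "x n \<otimes> c i = x N \<otimes> c i" "adj C (x n) \<otimes> c i = adj C (x N) \<otimes> c i" if "n \<ge> N" for n
      using o(4,5)[OF N(1) that] o(2)[of n] o(2)[of N] N that unfolding \<iota>(1)[OF N(1)]
      by (auto intro: mult_proj_le)
    then show ?thesis
      by (intro conjI exI[of _ "x N \<otimes> c i"] exI[of _ "adj C (x N) \<otimes> c i"] eventually_sequentiallyI[of N])
  qed
  then show ?thesis unfolding coherent_def using o(1) by simp
qed

text \<open>The times at which \<open>x n\<close> settles on the successive projections yield a
  domain by \<open>msdd_of_eventually\<close>.\<close>

lemma coherent_owmc: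
  assumes "coherent x"
  shows "\<exists>e. (x, e) \<in> owmc C"
proof -
  have "\<exists>a::nat \<Rightarrow> 'c. \<forall>i. \<forall>\<^sub>F n in sequentially. x n \<otimes> c i = a i"
    "\<exists>b::nat \<Rightarrow> 'c. \<forall>i. \<forall>\<^sub>F n in sequentially. adj C (x n) \<otimes> c i = b i"
    by (rule choice; use assms in \<open>simp add: coherent_def\<close>)+
  then obtain a b :: "nat \<Rightarrow> 'c" where ab: "\<And>i::nat. \<forall>\<^sub>F n in sequentially. x n \<otimes> c i = a i"
    "\<And>i::nat. \<forall>\<^sub>F n in sequentially. adj C (x n) \<otimes> c i = b i" by blast
  \<comment> \<open>Level 0 is made vacuous because \<open>c 0\<close> is zero, and the index n = 0
    because sequences carry no information there.\<close>
  define P where "P i n \<longleftrightarrow> n \<ge> 1 \<and> i > 0 \<longrightarrow> x n \<otimes> c (enat i) = a i \<and> adj C (x n) \<otimes> c (enat i) = b i" for i n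
  have P0: "P 0 n" for n by (simp add: P_def)
  have P: "\<forall>\<^sub>F n in sequentially. P i n" for i
    using ab[of i] by eventually_elim (simp add: P_def)
  obtain \<iota> :: "nat \<Rightarrow> nat" where \<iota>: "msdd C (\<lambda>m. c (enat (\<iota> m)))" "\<And>m n. m \<le> n \<Longrightarrow> P (\<iota> m) n"
    by (rule msdd_of_eventually[of P, OF P0 P]) (rule that)
  have "x n \<otimes> c (\<iota> m) = x m \<otimes> c (\<iota> m) \<and> adj C (x n) \<otimes> c (\<iota> m) = adj C (x m) \<otimes> c (\<iota> m)"
    if "1 \<le> m" "m < n" for m n
  proof (cases "\<iota> m = 0")
    case True
    then have "c (\<iota> m) = \<zero>" using proj_0 by (simp add: zero_enat_def)
    then show ?thesis using coherentD[OF assms] that by simp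
  next
    case False
    then show ?thesis using \<iota>(2)[of m n] \<iota>(2)[of m m] that by (simp add: P_def)
  qed
  then have "(x, \<lambda>m. c (\<iota> m)) \<in> owmc C"
    using \<iota>(1) coherentD(1)[OF assms] by (auto simp: owmc_def)
  then show ?thesis by (rule exI[of _ "\<lambda>m. c (\<iota> m)"])
qed

text \<open>A common domain passes every finite level and thus gives eventual agreement there;
  conversely the times of agreement form a domain. Hence the relation does not see the domains of
  the representatives.\<close>

lemma owmc_rel_iff:
  "((x, e), (y, f)) \<in> owmc_rel C \<longleftrightarrow> (x, e) \<in> owmc C \<and> (y, f) \<in> owmc C \<and> agree x y"
proof (cases "(x, e) \<in> owmc C \<and> (y, f) \<in> owmc C")
  case True
  note o = owmcD[OF conjunct1[OF True]] owmcD[OF conjunct2[OF True]]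
  have "(\<exists>g. msdd C g \<and> (\<forall>m\<ge>1. x m \<otimes> g m = y m \<otimes> g m \<and> adj C (x m) \<otimes> g m = adj C (y m) \<otimes> g m))
      \<longleftrightarrow> agree x y"
  proof
    assume "\<exists>g. msdd C g \<and> (\<forall>m\<ge>1. x m \<otimes> g m = y m \<otimes> g m \<and> adj C (x m) \<otimes> g m = adj C (y m) \<otimes> g m)"
    then obtain g where g: "msdd C g" "\<And>m. m \<ge> 1 \<Longrightarrow> x m \<otimes> g m = y m \<otimes> g m"
      "\<And>m. m \<ge> 1 \<Longrightarrow> adj C (x m) \<otimes> g m = adj C (y m) \<otimes> g m" by blast
    obtain \<iota> where \<iota>: "\<And>m. m \<ge> 1 \<Longrightarrow> g m = c (\<iota> m)" "\<And>i::nat. \<forall>\<^sub>F n in sequentially. enat i \<le> \<iota> n"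
      using msddE[OF g(1)] by metis
    show "agree x y" unfolding agree_def
    proof
      fix i :: nat
      show "\<forall>\<^sub>F n in sequentially. x n \<otimes> c i = y n \<otimes> c i \<and> adj C (x n) \<otimes> c i = adj C (y n) \<otimes> c i"
        using \<iota>(2)[of i] eventually_ge_at_top[of 1]
      proof eventually_elim
        case (elim n)
        then show ?case using g(2,3)[OF elim(2)] o(2)[OF elim(2)] o(7)[OF elim(2)]
          unfolding \<iota>(1)[OF elim(2)] by (auto intro: mult_proj_le)
      qed
    qed
  next
    assume "agree x y"
    define P where "P i n \<longleftrightarrow> n \<ge> 1 \<and> i > 0 \<longrightarrow> x n \<otimes> c (enat i) = y n \<otimes> c (enat i) \<and>
       adj C (x n) \<otimes> c (enat i) = adj C (y n) \<otimes> c (enat i)" for i n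
    have P0: "P 0 n" for n by (simp add: P_def)
    have P: "\<forall>\<^sub>F n in sequentially. P i n" for i
      using \<open>agree x y\<close>[unfolded agree_def, THEN spec, of i] by eventually_elim (simp add: P_def)
    obtain \<iota> :: "nat \<Rightarrow> nat" where \<iota>: "msdd C (\<lambda>m. c (enat (\<iota> m)))" "\<And>m n. m \<le> n \<Longrightarrow> P (\<iota> m) n"
      by (rule msdd_of_eventually[of P, OF P0 P]) (rule that)
    have "x m \<otimes> c (\<iota> m) = y m \<otimes> c (\<iota> m) \<and> adj C (x m) \<otimes> c (\<iota> m) = adj C (y m) \<otimes> c (\<iota> m)"
      if "1 \<le> m" for m
    proof (cases "\<iota> m = 0")
      case True
      then have "c (\<iota> m) = \<zero>" using proj_0 by (simp add: zero_enat_def)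
      then show ?thesis using o(2)[OF that] o(7)[OF that] by simp
    next
      case False
      then show ?thesis using \<iota>(2)[of m m] that by (simp add: P_def)
    qed
    with \<iota>(1) show "\<exists>g. msdd C g \<and> (\<forall>m\<ge>1. x m \<otimes> g m = y m \<otimes> g m \<and> adj C (x m) \<otimes> g m = adj C (y m) \<otimes> g m)"
      by (intro exI[of _ "\<lambda>m. c (enat (\<iota> m))"]) simp
  qed
  with True show ?thesis by (simp add: owmc_rel_def)
qed (auto simp: owmc_rel_def)

lemma mco_eq: "(x, e) \<in> owmc C \<Longrightarrow> mco C x e = mcls x"
  by (auto simp: mco_def mcls_def owmc_rel_iff)

lemma mcls_eqI: "agree x y \<Longrightarrow> mcls x = mcls y"
  unfolding mcls_def using agree_trans agree_sym by blast

lemma mcls_memD: "(y, f) \<in> mcls x \<Longrightarrow> (y, f) \<in> owmc C \<and> coherent y \<and> agree x y"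
  using owmc_coherent by (auto simp: mcls_def)

lemma mcls_nonempty: "coherent x \<Longrightarrow> mcls x \<noteq> {}"
  using coherent_owmc[of x] by (auto simp: mcls_def)

lemma carrier_mclosure: "carrier (mclosure C) = mcls ` Collect coherent"
proof -
  have eq: "owmc_rel C `` {(x, e)} = mcls x" if "(x, e) \<in> owmc C" for x e
    using mco_eq[OF that] by (simp add: mco_def)
  show ?thesis unfolding mclosure_def quotient_def
    using eq coherent_owmc owmc_coherent by (auto simp: image_iff) metis+
qed

text \<open>The operations of \<open>mclosure\<close> are unions over representatives; this
  evaluates such a union once all its members coincide.\<close>

lemma UN_mcls:
  assumes "coherent x" "\<And>x' e. (x', e) \<in> owmc C \<Longrightarrow> coherent x' \<Longrightarrow> agree x x' \<Longrightarrow> F x' e = K"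
  shows "(\<Union>(x', e)\<in>mcls x. F x' e) = K"
  by (rule SUP_eq_const[OF mcls_nonempty[OF assms(1)]]) (auto dest!: mcls_memD simp: assms(2))

text \<open>The eventual value is \<open>y N \<otimes> c i\<close> for a single N, and
  \<open>y N\<close> commutes with later projections, so a large \<open>c l\<close> acts as a left
  unit on it. In a product the left factor is then seen only through
  \<open>x n \<otimes> c l\<close>, which is eventually constant as well.\<close>

lemma coherent_absorb:
  assumes "coherent y"
  obtains b and l :: nat where "b \<in> carrier C" "\<forall>\<^sub>F n in sequentially. y n \<otimes> c (enat i) = b" "c l \<otimes> b = b"
proof -
  obtain a where "\<forall>\<^sub>F n in sequentially. y n \<otimes> c (enat i) = a" using assms unfolding coherent_def by blast
  then have a: "\<forall>\<^sub>F n in sequentially. y n \<otimes> c (enat i) = a \<and> n \<ge> 1"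
    using eventually_ge_at_top[of 1] by eventually_elim simp
  then obtain N where N: "y N \<otimes> c (enat i) = a" "N \<ge> 1" unfolding eventually_sequentially by blast
  \<comment> \<open>Beyond N for the commutation, and at least i so that \<open>c i\<close> is not
    cut down.\<close>
  let ?l = "max (Suc N) i"
  have y: "y N \<in> stage C N" "y N \<in> carrier C" using coherentD[OF assms, of N] N by auto
  have "c ?l \<otimes> a = y N \<otimes> c ?l \<otimes> c i"
    using proj_commute[OF y(1), of ?l] y(2) unfolding N(1)[symmetric] by (simp add: m_assoc)
  also have "\<dots> = a" using y(2) N(1) by (simp add: mult_proj_proj min_def)
  finally have "c ?l \<otimes> a = a" .
  moreover have "\<forall>\<^sub>F n in sequentially. y n \<otimes> c (enat i) = a" using a by eventually_elim simp
  moreover have "a \<in> carrier C" using y(2) N(1) by auto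
  ultimately show ?thesis using that by blast
qed

section \<open>Algebraic operations on coherent sequences\<close>

lemma coherent_adj: "coherent x \<Longrightarrow> coherent (\<lambda>m. adj C (x m))"
proof -
  assume x: "coherent x"
  have "\<exists>a. \<forall>\<^sub>F n in sequentially. adj C (adj C (x n)) \<otimes> c (enat i) = a" for i
  proof (rule eventually_const_cong)
    show "\<forall>\<^sub>F n in sequentially. adj C (adj C (x n)) \<otimes> c (enat i) = x n \<otimes> c (enat i)"
      using eventually_ge_at_top[of 1] by eventually_elim (use coherentD(2)[OF x] in simp)
  qed (use x in \<open>simp add: coherent_def\<close>)
  then show ?thesis using x stage_adj unfolding coherent_def by simp
qed

lemma agree_adj: "coherent x \<Longrightarrow> coherent y \<Longrightarrow> agree x y \<Longrightarrow> agree (\<lambda>m. adj C (x m)) (\<lambda>m. adj C (y m))"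
  unfolding agree_def
proof
  fix i :: nat
  assume c: "coherent x" "coherent y"
    and "\<forall>i::nat. \<forall>\<^sub>F n in sequentially. x n \<otimes> c i = y n \<otimes> c i \<and> adj C (x n) \<otimes> c i = adj C (y n) \<otimes> c i"
  from this(3)[THEN spec, of i] eventually_ge_at_top[of 1]
  show "\<forall>\<^sub>F n in sequentially. adj C (x n) \<otimes> c i = adj C (y n) \<otimes> c i \<and>
      adj C (adj C (x n)) \<otimes> c i = adj C (adj C (y n)) \<otimes> c i"
    by eventually_elim (use coherentD(2)[OF c(1)] coherentD(2)[OF c(2)] in simp)
qed

lemma mult_eventually_const:
  assumes "coherent x" "coherent y"
  shows "\<exists>a. \<forall>\<^sub>F n in sequentially. x n \<otimes> y n \<otimes> c (enat i) = a"
proof -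
  obtain b l where b: "b \<in> carrier C" "\<forall>\<^sub>F n in sequentially. y n \<otimes> c (enat i) = b" "c (enat l) \<otimes> b = b"
    using coherent_absorb[OF assms(2)] .
  obtain a where "\<forall>\<^sub>F n in sequentially. x n \<otimes> c (enat l) = a" using assms(1) unfolding coherent_def by blast
  with b(2) eventually_ge_at_top[of 1]
  have "\<forall>\<^sub>F n in sequentially. x n \<otimes> y n \<otimes> c (enat i) = a \<otimes> b"
  proof eventually_elim
    case (elim n)
    then have xy: "x n \<in> carrier C" "y n \<in> carrier C" using coherentD assms by auto
    then have "x n \<otimes> y n \<otimes> c (enat i) = x n \<otimes> (c (enat l) \<otimes> b)" using elim b by (simp add: m_assoc)
    also have "\<dots> = a \<otimes> b" unfolding elim(3)[symmetric] using xy b(1) by (simp add: m_assoc)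
    finally show ?case .
  qed
  then show ?thesis by blast
qed

lemma mult_eventually_eq:
  assumes "coherent x" "coherent y" "coherent x'" "coherent y'" "agree x x'" "agree y y'"
  shows "\<forall>\<^sub>F n in sequentially. x n \<otimes> y n \<otimes> c (enat i) = x' n \<otimes> y' n \<otimes> c (enat i)"
proof -
  obtain b l where b: "b \<in> carrier C" "\<forall>\<^sub>F n in sequentially. y n \<otimes> c (enat i) = b" "c (enat l) \<otimes> b = b"
    using coherent_absorb[OF assms(2)] .
  from assms(5)[unfolded agree_def, THEN spec, of l] assms(6)[unfolded agree_def, THEN spec, of i]
    b(2) eventually_ge_at_top[of 1]
  show ?thesis
  proof eventually_elim
    case (elim n)
    then have xy: "x n \<in> carrier C" "y n \<in> carrier C" "x' n \<in> carrier C" "y' n \<in> carrier C"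
      using coherentD assms by auto
    have yb: "y n \<otimes> c (enat i) = b" "y' n \<otimes> c (enat i) = b" using elim by auto
    have "x n \<otimes> y n \<otimes> c (enat i) = x n \<otimes> (c (enat l) \<otimes> b)" using xy b(3) yb by (simp add: m_assoc)
    also have "\<dots> = x n \<otimes> c (enat l) \<otimes> b" using xy b(1) by (simp add: m_assoc)
    also have "\<dots> = x' n \<otimes> c (enat l) \<otimes> b" using elim(1) by simp
    also have "\<dots> = x' n \<otimes> (c (enat l) \<otimes> b)" using xy b(1) by (simp add: m_assoc)
    also have "\<dots> = x' n \<otimes> y' n \<otimes> c (enat i)" using xy b(3) yb by (simp add: m_assoc)
    finally show ?case .
  qed
qed

text \<open>The adjoint condition is the same convergence statement for the reversed product of the
  adjoint sequences.\<close>

lemma coherent_mult: "coherent x \<Longrightarrow> coherent y \<Longrightarrow> coherent (\<lambda>m. x m \<otimes> y m)"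
proof -
  assume c: "coherent x" "coherent y"
  have "\<exists>a. \<forall>\<^sub>F n in sequentially. adj C (x n \<otimes> y n) \<otimes> c (enat i) = a" for i
  proof (rule eventually_const_cong)
    show "\<forall>\<^sub>F n in sequentially. adj C (x n \<otimes> y n) \<otimes> c (enat i) = adj C (y n) \<otimes> adj C (x n) \<otimes> c (enat i)"
      using eventually_ge_at_top[of 1]
      by eventually_elim (use coherentD(2)[OF c(1)] coherentD(2)[OF c(2)] in \<open>simp add: adj_mult\<close>)
  qed (rule mult_eventually_const[OF coherent_adj[OF c(2)] coherent_adj[OF c(1)]])
  then show ?thesis using mult_eventually_const[OF c] c stage_mult unfolding coherent_def by simp
qed

lemma agree_mult:
  assumes "coherent x" "coherent y" "coherent x'" "coherent y'" "agree x x'" "agree y y'"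
  shows "agree (\<lambda>m. x m \<otimes> y m) (\<lambda>m. x' m \<otimes> y' m)"
  unfolding agree_def
proof
  fix i :: nat
  note ca = coherent_adj[OF assms(1)] coherent_adj[OF assms(2)] coherent_adj[OF assms(3)] coherent_adj[OF assms(4)]
  from mult_eventually_eq[OF assms, of i]
    mult_eventually_eq[OF ca(2,1,4,3) agree_adj[OF assms(2,4,6)] agree_adj[OF assms(1,3,5)], of i]
    eventually_ge_at_top[of 1]
  show "\<forall>\<^sub>F n in sequentially. x n \<otimes> y n \<otimes> c i = x' n \<otimes> y' n \<otimes> c i \<and>
      adj C (x n \<otimes> y n) \<otimes> c i = adj C (x' n \<otimes> y' n) \<otimes> c i"
    by eventually_elim (use coherentD(2)[OF assms(1)] coherentD(2)[OF assms(2)]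
        coherentD(2)[OF assms(3)] coherentD(2)[OF assms(4)] in \<open>simp add: adj_mult\<close>)
qed

lemma coherent_add: "coherent x \<Longrightarrow> coherent y \<Longrightarrow> coherent (\<lambda>m. x m \<oplus> y m)"
proof -
  assume c: "coherent x" "coherent y"
  have "\<exists>a. \<forall>\<^sub>F n in sequentially. (x n \<oplus> y n) \<otimes> c (enat i) = a" if c: "coherent x" "coherent y" for x y i
  proof -
    obtain a b where ab: "\<forall>\<^sub>F n in sequentially. x n \<otimes> c (enat i) = a" "\<forall>\<^sub>F n in sequentially. y n \<otimes> c (enat i) = b"
      using c unfolding coherent_def by blast
    from ab eventually_ge_at_top[of 1] have "\<forall>\<^sub>F n in sequentially. (x n \<oplus> y n) \<otimes> c (enat i) = a \<oplus> b"
      by eventually_elim (use coherentD(2)[OF c(1)] coherentD(2)[OF c(2)] in \<open>simp add: l_distr\<close>)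
    then show ?thesis by blast
  qed
  note * = this[OF c] this[OF coherent_adj[OF c(1)] coherent_adj[OF c(2)]]
  have "\<exists>a. \<forall>\<^sub>F n in sequentially. adj C (x n \<oplus> y n) \<otimes> c (enat i) = a" for i
  proof (rule eventually_const_cong)
    show "\<forall>\<^sub>F n in sequentially. adj C (x n \<oplus> y n) \<otimes> c (enat i) = (adj C (x n) \<oplus> adj C (y n)) \<otimes> c (enat i)"
      using eventually_ge_at_top[of 1]
      by eventually_elim (use coherentD(2)[OF c(1)] coherentD(2)[OF c(2)] in \<open>simp add: adj_add\<close>)
  qed (rule *(2))
  then show ?thesis using *(1) c stage_add unfolding coherent_def by simp
qed

lemma coherent_smult: "coherent x \<Longrightarrow> coherent (\<lambda>m. z \<odot> x m)"
proof -
  assume c: "coherent x"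
  have "\<exists>a. \<forall>\<^sub>F n in sequentially. (z \<odot> x n) \<otimes> c (enat i) = a" if c: "coherent x" for x i z
  proof -
    obtain a where ab: "\<forall>\<^sub>F n in sequentially. x n \<otimes> c (enat i) = a" using c unfolding coherent_def by blast
    from ab eventually_ge_at_top[of 1] have "\<forall>\<^sub>F n in sequentially. (z \<odot> x n) \<otimes> c (enat i) = z \<odot> a"
      by eventually_elim (use coherentD(2)[OF c] in \<open>simp add: smult_mult_l\<close>)
    then show ?thesis by blast
  qed
  note * = this[OF c] this[OF coherent_adj[OF c]]
  have "\<exists>a. \<forall>\<^sub>F n in sequentially. adj C (z \<odot> x n) \<otimes> c (enat i) = a" for i
  proof (rule eventually_const_cong)
    show "\<forall>\<^sub>F n in sequentially. adj C (z \<odot> x n) \<otimes> c (enat i) = (cnj z \<odot> adj C (x n)) \<otimes> c (enat i)"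
      using eventually_ge_at_top[of 1]
      by eventually_elim (use coherentD(2)[OF c] in \<open>simp add: adj_smult\<close>)
  qed (rule *(2))
  then show ?thesis using *(1) c stage_smult unfolding coherent_def by simp
qed

lemma coherent_eventually_const:
  assumes "\<And>m. m \<ge> 1 \<Longrightarrow> x m \<in> stage C m" "\<forall>\<^sub>F n in sequentially. x n = a"
  shows "coherent x"
proof -
  have "\<forall>\<^sub>F n in sequentially. x n \<otimes> c i = a \<otimes> c i" "\<forall>\<^sub>F n in sequentially. adj C (x n) \<otimes> c i = adj C a \<otimes> c i" for i
    using assms(2) by (auto elim: eventually_mono)
  then show ?thesis unfolding coherent_def using assms(1) by blast
qed

lemma coherent_one: "coherent (\<lambda>m. \<one>)"
  by (rule coherent_eventually_const) (auto intro: stage_one)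

lemma agree_add:
  assumes "coherent x" "coherent y" "coherent x'" "coherent y'" "agree x x'" "agree y y'"
  shows "agree (\<lambda>m. x m \<oplus> y m) (\<lambda>m. x' m \<oplus> y' m)"
  unfolding agree_def
proof
  fix i :: nat
  from assms(5)[unfolded agree_def, THEN spec, of i] assms(6)[unfolded agree_def, THEN spec, of i]
    eventually_ge_at_top[of 1]
  show "\<forall>\<^sub>F n in sequentially. (x n \<oplus> y n) \<otimes> c i = (x' n \<oplus> y' n) \<otimes> c i \<and>
      adj C (x n \<oplus> y n) \<otimes> c i = adj C (x' n \<oplus> y' n) \<otimes> c i"
    by eventually_elim (use coherentD(2)[OF assms(1)] coherentD(2)[OF assms(2)]
        coherentD(2)[OF assms(3)] coherentD(2)[OF assms(4)] in \<open>simp add: adj_add l_distr\<close>)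
qed

lemma agree_smult:
  assumes "coherent x" "coherent x'" "agree x x'"
  shows "agree (\<lambda>m. z \<odot> x m) (\<lambda>m. z \<odot> x' m)"
  unfolding agree_def
proof
  fix i :: nat
  from assms(3)[unfolded agree_def, THEN spec, of i] eventually_ge_at_top[of 1]
  show "\<forall>\<^sub>F n in sequentially. (z \<odot> x n) \<otimes> c i = (z \<odot> x' n) \<otimes> c i \<and>
      adj C (z \<odot> x n) \<otimes> c i = adj C (z \<odot> x' n) \<otimes> c i"
    by eventually_elim (use coherentD(2)[OF assms(1)] coherentD(2)[OF assms(2)]
        in \<open>simp add: adj_smult smult_mult_l\<close>)
qed

text \<open>The admissible indices are closed downwards. If all finite ones are admissible, the
  separating axiom makes \<infinity> admissible; otherwise a finite index bounds them, they form a
  finite set containing 0, and there is a largest.\<close>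

lemma proj_preimage:
  assumes x: "x \<in> carrier C"
  obtains g where "proj_preimage C x (c j) = c g" "c j \<otimes> x \<otimes> c g = x \<otimes> c g"
    "\<And>h. c j \<otimes> x \<otimes> c h = x \<otimes> c h \<Longrightarrow> h \<le> g"
proof -
  let ?S = "{h. c j \<otimes> x \<otimes> c h = x \<otimes> c h}"
  have down: "h' \<in> ?S" if "h \<in> ?S" "h' \<le> h" for h h'
    using that mult_proj_le[of "c j \<otimes> x" h x h'] x by simp
  have "\<exists>g\<in>?S. \<forall>h\<in>?S. h \<le> g"
  proof (cases "\<forall>n. enat n \<in> ?S")
    case True
    have "c j \<otimes> x \<ominus> x = \<zero>"
      by (rule proj_separating) (use True x in \<open>auto simp: minus_mult_l\<close>)
    then have "c j \<otimes> x = x" using minus_eq_zeroD[of "c j \<otimes> x" x] x by simp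
    then show ?thesis by (intro bexI[of _ \<infinity>]) simp_all
  next
    case False
    then obtain n where n: "enat n \<notin> ?S" by blast
    have le: "h \<le> enat n" if "h \<in> ?S" for h using n down[OF that, of "enat n"] linear by blast
    then have fin: "finite ?S" by (intro finite_enat_bounded) blast
    have "0 \<in> ?S" using x by (simp add: proj_0)
    then have "Max ?S \<in> ?S" "\<forall>h\<in>?S. h \<le> Max ?S" using fin Max_in Max_ge by blast+
    then show ?thesis by blast
  qed
  then obtain g where g: "g \<in> ?S" "\<And>h. h \<in> ?S \<Longrightarrow> h \<le> g" by blast
  have "proj_preimage C x (c j) = c g"
    unfolding proj_preimage_def projs_def
  proof (rule the_equality)
    show "c g \<in> range c \<and> c j \<otimes> x \<otimes> c g = x \<otimes> c g \<and>
        (\<forall>h\<in>range c. c j \<otimes> x \<otimes> h = x \<otimes> h \<longrightarrow> proj_le C h (c g))" using g by auto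
  next
    fix g' assume g': "g' \<in> range c \<and> c j \<otimes> x \<otimes> g' = x \<otimes> g' \<and>
        (\<forall>h\<in>range c. c j \<otimes> x \<otimes> h = x \<otimes> h \<longrightarrow> proj_le C h g')"
    then obtain k where k: "g' = c k" by blast
    have "k \<le> g" "g \<le> k" using g' g k by auto
    then show "g' = c g" using k by simp
  qed
  with g that show ?thesis by blast
qed

text \<open>Below \<open>f m\<close> the factor \<open>y\<close> is frozen, and since
  \<open>e m\<close> absorbs \<open>y m \<otimes> k\<close>, the factor \<open>x\<close> acts only
  where it is frozen too.\<close>

lemma mult_preimage_compat:
  assumes "(x, e) \<in> owmc C" "(y, f) \<in> owmc C" "1 \<le> m" "m \<le> n"
    and k: "k \<in> projs C" "f m \<otimes> k = k" "e m \<otimes> y m \<otimes> k = y m \<otimes> k"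
  shows "y n \<otimes> k = y m \<otimes> k" "x n \<otimes> y n \<otimes> k = x m \<otimes> y m \<otimes> k"
proof -
  note x = owmcD[OF assms(1)] and y = owmcD[OF assms(2)]
  have c: "x m \<in> carrier C" "x n \<in> carrier C" "y m \<in> carrier C" "y n \<in> carrier C"
    using x(2)[of m] x(2)[of n] y(2)[of m] y(2)[of n] assms(3,4) by auto
  have p: "k \<in> carrier C" "e m \<in> carrier C" "f m \<in> carrier C"
    using k(1) x(3) y(3) assms(3) by (auto simp: msdd_def projs_def)
  have "y n \<otimes> k = y n \<otimes> f m \<otimes> k" using k(2) c p by (simp add: m_assoc)
  also have "\<dots> = y m \<otimes> f m \<otimes> k" using y(4)[OF assms(3,4)] by simp
  also have "\<dots> = y m \<otimes> k" using k(2) c p by (simp add: m_assoc)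
  finally show yk: "y n \<otimes> k = y m \<otimes> k" .
  have "x n \<otimes> y n \<otimes> k = x n \<otimes> (e m \<otimes> y m \<otimes> k)" using yk c p k(3) by (simp add: m_assoc)
  also have "\<dots> = x n \<otimes> e m \<otimes> (y m \<otimes> k)" using c p by (simp add: m_assoc)
  also have "\<dots> = x m \<otimes> e m \<otimes> (y m \<otimes> k)" using x(4)[OF assms(3,4)] by simp
  also have "\<dots> = x m \<otimes> (e m \<otimes> y m \<otimes> k)" using c p by (simp add: m_assoc)
  also have "\<dots> = x m \<otimes> y m \<otimes> k" using k(3) c p by (simp add: m_assoc)
  finally show "x n \<otimes> y n \<otimes> k = x m \<otimes> y m \<otimes> k" .
qed

lemma owmc_adj: "(x, e) \<in> owmc C \<Longrightarrow> (\<lambda>m. adj C (x m), e) \<in> owmc C"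
proof -
  assume x: "(x, e) \<in> owmc C"
  note o = owmcD[OF x]
  have "adj C (adj C (x n)) \<otimes> e m = adj C (adj C (x m)) \<otimes> e m" if "1 \<le> m" "m < n" for m n
    using o(2)[of m] o(2)[of n] o(4)[of m n] that by simp
  moreover have "adj C (x n) \<otimes> e m = adj C (x m) \<otimes> e m" if "1 \<le> m" "m < n" for m n
    using o(5)[of m n] that by simp
  ultimately show ?thesis using o(1,3) stage_adj unfolding owmc_def by simp
qed

text \<open>Monotonicity of the preimage indices is claimed only below \<open>\<phi> m\<close>,
  because \<open>y n\<close> and \<open>y m\<close> agree only under \<open>f m\<close>. This
  suffices once the preimage is intersected with the domain of \<open>y\<close>.\<close>

lemma preimage_indices:
  assumes "(x, e) \<in> owmc C" "(y, f) \<in> owmc C"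
    and \<epsilon>: "\<And>m. m \<ge> 1 \<Longrightarrow> e m = c (\<epsilon> m)" "\<And>i::nat. \<forall>\<^sub>F n in sequentially. enat i \<le> \<epsilon> n"
      "\<And>m n. 1 \<le> m \<Longrightarrow> m \<le> n \<Longrightarrow> \<epsilon> m \<le> \<epsilon> n"
    and \<phi>: "\<And>m. m \<ge> 1 \<Longrightarrow> f m = c (\<phi> m)"
  obtains g where "\<And>m. m \<ge> 1 \<Longrightarrow> proj_preimage C (y m) (e m) = c (g m)"
    "\<And>m. m \<ge> 1 \<Longrightarrow> e m \<otimes> y m \<otimes> c (g m) = y m \<otimes> c (g m)"
    "\<And>i::nat. \<forall>\<^sub>F n in sequentially. enat i \<le> g n"
    "\<And>m n k. 1 \<le> m \<Longrightarrow> m \<le> n \<Longrightarrow> k \<le> g m \<Longrightarrow> k \<le> \<phi> m \<Longrightarrow> k \<le> g n"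
proof -
  note y = owmcD[OF assms(2)]
  have "\<forall>m. \<exists>g. m \<ge> 1 \<longrightarrow> proj_preimage C (y m) (e m) = c g \<and> e m \<otimes> y m \<otimes> c g = y m \<otimes> c g \<and>
      (\<forall>h. e m \<otimes> y m \<otimes> c h = y m \<otimes> c h \<longrightarrow> h \<le> g)"
    using proj_preimage[OF y(2)] \<epsilon>(1) by metis
  then obtain g where g: "\<And>m. m \<ge> 1 \<Longrightarrow> proj_preimage C (y m) (e m) = c (g m)"
    "\<And>m. m \<ge> 1 \<Longrightarrow> e m \<otimes> y m \<otimes> c (g m) = y m \<otimes> c (g m)"
    "\<And>m h. m \<ge> 1 \<Longrightarrow> e m \<otimes> y m \<otimes> c h = y m \<otimes> c h \<Longrightarrow> h \<le> g m" by metis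
  have "\<forall>\<^sub>F n in sequentially. enat i \<le> g n" for i
  proof -
    obtain b l where b: "b \<in> carrier C" "\<forall>\<^sub>F n in sequentially. y n \<otimes> c (enat i) = b" "c (enat l) \<otimes> b = b"
      using coherent_absorb[OF owmc_coherent[OF assms(2)]] .
    from b(2) \<epsilon>(2)[of l] eventually_ge_at_top[of 1] show ?thesis
    proof eventually_elim
      case (elim n)
      have "e n \<otimes> y n \<otimes> c (enat i) = c (\<epsilon> n) \<otimes> (c (enat l) \<otimes> b)"
        using y(2)[OF elim(3)] elim \<epsilon>(1)[OF elim(3)] b(3) by (simp add: m_assoc)
      also have "\<dots> = c (\<epsilon> n) \<otimes> c (enat l) \<otimes> b" using b(1) by (simp add: m_assoc)
      also have "\<dots> = b" using elim(2) b(3) by (simp add: proj_mult min_absorb2)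
      finally show ?case using g(3)[OF elim(3), of "enat i"] elim by simp
    qed
  qed
  moreover have "k \<le> g n" if mn: "1 \<le> m" "m \<le> n" and k: "k \<le> g m" "k \<le> \<phi> m" for m n k
  proof -
    have c: "y m \<in> carrier C" "y n \<in> carrier C" using y(2)[of m] y(2)[of n] mn by auto
    have 1: "e m \<otimes> y m \<otimes> c k = y m \<otimes> c k"
      using mult_proj_le[of "e m \<otimes> y m" "g m" "y m" k] g(2)[OF mn(1)] c k \<epsilon>(1)[OF mn(1)] by simp
    have 2: "y n \<otimes> c k = y m \<otimes> c k"
      using k(2) \<phi>[OF mn(1)] 1
      by (intro mult_preimage_compat(1)[OF assms(1,2) mn]) (auto simp: projs_def proj_mult min_absorb2)
    have "e n \<otimes> y n \<otimes> c k = e n \<otimes> (e m \<otimes> y m \<otimes> c k)" using 1 2 c \<epsilon>(1)[of n] mn by (simp add: m_assoc)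
    also have "\<dots> = e n \<otimes> e m \<otimes> (y m \<otimes> c k)" using c \<epsilon>(1)[of n] \<epsilon>(1)[of m] mn by (simp add: m_assoc)
    also have "\<dots> = e m \<otimes> (y m \<otimes> c k)"
      using \<epsilon>(1)[of n] \<epsilon>(1)[of m] mn \<epsilon>(3)[OF mn] by (simp add: proj_mult min_absorb2)
    also have "\<dots> = y n \<otimes> c k" using 1 2 c \<epsilon>(1)[of m] mn by (simp add: m_assoc)
    finally show ?thesis using g(3)[of n k] mn by auto
  qed
  ultimately show ?thesis using that g by blast
qed

text \<open>Each factor of the prescribed domain has a task: \<open>f\<close> and the preimage under
  \<open>y\<close> freeze the product, while \<open>e\<close> and the preimage under the adjoint of
  \<open>x\<close> freeze its adjoint, by the same argument for the reversed pair of
  adjoints.\<close>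

lemma owmc_mult:
  assumes x: "(x, e) \<in> owmc C" and y: "(y, f) \<in> owmc C"
  shows "(\<lambda>m. x m \<otimes> y m, \<lambda>m. f m \<otimes> proj_preimage C (y m) (e m) \<otimes> e m
      \<otimes> proj_preimage C (adj C (x m)) (f m)) \<in> owmc C" (is "(_, ?k) \<in> _")
proof -
  note ox = owmcD[OF x] and oy = owmcD[OF y]
  obtain \<epsilon> where \<epsilon>: "\<And>m. m \<ge> 1 \<Longrightarrow> e m = c (\<epsilon> m)" "\<And>m n. 1 \<le> m \<Longrightarrow> m \<le> n \<Longrightarrow> \<epsilon> m \<le> \<epsilon> n"
    "\<And>i::nat. \<forall>\<^sub>F n in sequentially. enat i \<le> \<epsilon> n" using msddE[OF ox(3)] by metis
  obtain \<phi> where \<phi>: "\<And>m. m \<ge> 1 \<Longrightarrow> f m = c (\<phi> m)" "\<And>m n. 1 \<le> m \<Longrightarrow> m \<le> n \<Longrightarrow> \<phi> m \<le> \<phi> n"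
    "\<And>i::nat. \<forall>\<^sub>F n in sequentially. enat i \<le> \<phi> n" using msddE[OF oy(3)] by metis
  obtain g where g: "\<And>m. m \<ge> 1 \<Longrightarrow> proj_preimage C (y m) (e m) = c (g m)"
    "\<And>m. m \<ge> 1 \<Longrightarrow> e m \<otimes> y m \<otimes> c (g m) = y m \<otimes> c (g m)"
    "\<And>i::nat. \<forall>\<^sub>F n in sequentially. enat i \<le> g n"
    "\<And>m n k. 1 \<le> m \<Longrightarrow> m \<le> n \<Longrightarrow> k \<le> g m \<Longrightarrow> k \<le> \<phi> m \<Longrightarrow> k \<le> g n"
    using preimage_indices[OF x y \<epsilon>(1,3,2) \<phi>(1)] by metis
  obtain g' where g': "\<And>m. m \<ge> 1 \<Longrightarrow> proj_preimage C (adj C (x m)) (f m) = c (g' m)"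
    "\<And>m. m \<ge> 1 \<Longrightarrow> f m \<otimes> adj C (x m) \<otimes> c (g' m) = adj C (x m) \<otimes> c (g' m)"
    "\<And>i::nat. \<forall>\<^sub>F n in sequentially. enat i \<le> g' n"
    "\<And>m n k. 1 \<le> m \<Longrightarrow> m \<le> n \<Longrightarrow> k \<le> g' m \<Longrightarrow> k \<le> \<epsilon> m \<Longrightarrow> k \<le> g' n"
    using preimage_indices[OF owmc_adj[OF y] owmc_adj[OF x] \<phi>(1,3,2) \<epsilon>(1)] by metis
  define \<kappa> where "\<kappa> m = min (min (min (\<phi> m) (g m)) (\<epsilon> m)) (g' m)" for m
  have le: "\<kappa> m \<le> \<phi> m" "\<kappa> m \<le> g m" "\<kappa> m \<le> \<epsilon> m" "\<kappa> m \<le> g' m" for m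
    by (simp_all add: \<kappa>_def min.coboundedI1 min.coboundedI2)
  have k: "?k m = c (\<kappa> m)" if "m \<ge> 1" for m
    unfolding g(1)[OF that] g'(1)[OF that] by (simp add: \<epsilon>(1)[OF that] \<phi>(1)[OF that] proj_mult \<kappa>_def)
  have "msdd C ?k"
  proof (rule msddI[of _ \<kappa>])
    fix m n :: nat assume mn: "1 \<le> m" "m \<le> n"
    have "\<kappa> m \<le> \<phi> n" "\<kappa> m \<le> g n" "\<kappa> m \<le> \<epsilon> n" "\<kappa> m \<le> g' n"
      using le[of m] \<epsilon>(2)[OF mn] \<phi>(2)[OF mn] g(4)[OF mn] g'(4)[OF mn] by (blast intro: order_trans)+
    then show "\<kappa> m \<le> \<kappa> n" unfolding \<kappa>_def[of n] by simp
  next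
    fix i :: nat
    from \<epsilon>(3)[of i] \<phi>(3)[of i] g(3)[of i] g'(3)[of i]
    show "\<forall>\<^sub>F n in sequentially. enat i \<le> \<kappa> n" by eventually_elim (simp add: \<kappa>_def)
  qed (rule k)
  moreover have "x n \<otimes> y n \<otimes> ?k m = x m \<otimes> y m \<otimes> ?k m \<and>
      adj C (x n \<otimes> y n) \<otimes> ?k m = adj C (x m \<otimes> y m) \<otimes> ?k m" if mn: "1 \<le> m" "m < n" for m n
  proof -
    have c: "x m \<in> carrier C" "x n \<in> carrier C" "y m \<in> carrier C" "y n \<in> carrier C"
      using ox(2)[of m] ox(2)[of n] oy(2)[of m] oy(2)[of n] mn by auto
    have "x n \<otimes> y n \<otimes> c (\<kappa> m) = x m \<otimes> y m \<otimes> c (\<kappa> m)"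
      by (rule mult_preimage_compat(2)[OF x y])
        (use mn le[of m] c g(2)[OF mn(1)] mult_proj_le[of "e m \<otimes> y m" "g m" "y m"] in
         \<open>auto simp: projs_def \<phi>(1) \<epsilon>(1) proj_mult min_absorb2\<close>)
    moreover have "adj C (y n) \<otimes> adj C (x n) \<otimes> c (\<kappa> m) = adj C (y m) \<otimes> adj C (x m) \<otimes> c (\<kappa> m)"
      by (rule mult_preimage_compat(2)[OF owmc_adj[OF y] owmc_adj[OF x]])
        (use mn le[of m] c g'(2)[OF mn(1)] mult_proj_le[of "f m \<otimes> adj C (x m)" "g' m" "adj C (x m)"] in
         \<open>auto simp: projs_def \<phi>(1) \<epsilon>(1) proj_mult min_absorb2\<close>)
    ultimately show ?thesis unfolding k[OF mn(1)] using c by (simp add: adj_mult)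
  qed
  ultimately show ?thesis using ox(1) oy(1) stage_mult by (auto simp: owmc_def)
qed

lemma owmc_add:
  assumes x: "(x, e) \<in> owmc C" and y: "(y, f) \<in> owmc C"
  shows "(\<lambda>m. x m \<oplus> y m, \<lambda>m. e m \<otimes> f m) \<in> owmc C"
proof -
  note ox = owmcD[OF x] and oy = owmcD[OF y]
  obtain \<epsilon> where \<epsilon>: "\<And>m. m \<ge> 1 \<Longrightarrow> e m = c (\<epsilon> m)" "\<And>m n. 1 \<le> m \<Longrightarrow> m \<le> n \<Longrightarrow> \<epsilon> m \<le> \<epsilon> n"
    "\<And>i::nat. \<forall>\<^sub>F n in sequentially. enat i \<le> \<epsilon> n" using msddE[OF ox(3)] by metis
  obtain \<phi> where \<phi>: "\<And>m. m \<ge> 1 \<Longrightarrow> f m = c (\<phi> m)" "\<And>m n. 1 \<le> m \<Longrightarrow> m \<le> n \<Longrightarrow> \<phi> m \<le> \<phi> n"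
    "\<And>i::nat. \<forall>\<^sub>F n in sequentially. enat i \<le> \<phi> n" using msddE[OF oy(3)] by metis
  have "msdd C (\<lambda>m. e m \<otimes> f m)"
  proof (rule msddI[of _ "\<lambda>m. min (\<epsilon> m) (\<phi> m)"])
    fix m n :: nat assume mn: "1 \<le> m" "m \<le> n"
    show "min (\<epsilon> m) (\<phi> m) \<le> min (\<epsilon> n) (\<phi> n)" by (rule min.mono[OF \<epsilon>(2)[OF mn] \<phi>(2)[OF mn]])
  next
    fix i :: nat
    from \<epsilon>(3)[of i] \<phi>(3)[of i]
    show "\<forall>\<^sub>F n in sequentially. enat i \<le> min (\<epsilon> n) (\<phi> n)" by eventually_elim simp
  qed (simp add: \<epsilon>(1) \<phi>(1) proj_mult)
  moreover have "(x n \<oplus> y n) \<otimes> (e m \<otimes> f m) = (x m \<oplus> y m) \<otimes> (e m \<otimes> f m) \<and>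
      adj C (x n \<oplus> y n) \<otimes> (e m \<otimes> f m) = adj C (x m \<oplus> y m) \<otimes> (e m \<otimes> f m)" if mn: "1 \<le> m" "m < n" for m n
  proof -
    have c: "x m \<in> carrier C" "x n \<in> carrier C" "y m \<in> carrier C" "y n \<in> carrier C"
      using ox(2)[of m] ox(2)[of n] oy(2)[of m] oy(2)[of n] mn by auto
    have mn': "m \<le> n" using mn by simp
    note h = mult_proj_le[OF _ min.cobounded1[of "\<epsilon> m" "\<phi> m"]] mult_proj_le[OF _ min.cobounded2[of "\<epsilon> m" "\<phi> m"]]
    show ?thesis
      using ox(4,5)[OF mn(1) mn'] oy(4,5)[OF mn(1) mn'] c
      by (simp add: \<epsilon>(1)[OF mn(1)] \<phi>(1)[OF mn(1)] proj_mult l_distr adj_add h(1)[of "x n" "x m"]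
          h(2)[of "y n" "y m"] h(1)[of "adj C (x n)" "adj C (x m)"] h(2)[of "adj C (y n)" "adj C (y m)"])
  qed
  ultimately show ?thesis using ox(1) oy(1) stage_add by (auto simp: owmc_def)
qed

lemma owmc_smult: "(x, e) \<in> owmc C \<Longrightarrow> (\<lambda>m. z \<odot> x m, e) \<in> owmc C"
proof -
  assume x: "(x, e) \<in> owmc C"
  note o = owmcD[OF x]
  have e: "e m \<in> carrier C" if "m \<ge> 1" for m using o(3) that by (auto simp: msdd_def projs_def)
  have "(z \<odot> x n) \<otimes> e m = (z \<odot> x m) \<otimes> e m \<and> adj C (z \<odot> x n) \<otimes> e m = adj C (z \<odot> x m) \<otimes> e m"
    if mn: "1 \<le> m" "m < n" for m n
    using o(4,5)[of m n] o(2)[of m] o(2)[of n] e[of m] mn by (simp add: smult_mult_l adj_smult)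
  then show ?thesis using o(1,3) stage_smult by (auto simp: owmc_def)
qed

text \<open>\<open>owmc_mult\<close> certifies that the prescribed pair is an admissible
  representative; the class is then determined by the product sequence, and agreeing factors have
  agreeing products.\<close>

lemma mclosure_mult:
  assumes "coherent x" "coherent y"
  shows "mcls x \<otimes>\<^bsub>mclosure C\<^esub> mcls y = mcls (\<lambda>m. x m \<otimes> y m)"
  unfolding mclosure_def
  by (simp, intro UN_mcls assms)
    (auto simp: mco_eq[OF owmc_mult] intro!: mcls_eqI agree_mult intro: agree_sym assms)

lemma mclosure_add:
  assumes "coherent x" "coherent y"
  shows "mcls x \<oplus>\<^bsub>mclosure C\<^esub> mcls y = mcls (\<lambda>m. x m \<oplus> y m)"
  unfolding mclosure_def
  by (simp, intro UN_mcls assms)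
    (auto simp: mco_eq[OF owmc_add] intro!: mcls_eqI agree_add intro: agree_sym assms)

lemma mclosure_smult:
  assumes "coherent x"
  shows "z \<odot>\<^bsub>mclosure C\<^esub> mcls x = mcls (\<lambda>m. z \<odot> x m)"
  unfolding mclosure_def
  by (simp, intro UN_mcls assms)
    (auto simp: mco_eq[OF owmc_smult] intro!: mcls_eqI agree_smult intro: agree_sym assms)

lemma mclosure_adj:
  assumes "coherent x"
  shows "adj (mclosure C) (mcls x) = mcls (\<lambda>m. adj C (x m))"
  unfolding mclosure_def
  by (simp, intro UN_mcls assms)
    (auto simp: mco_eq[OF owmc_adj] intro!: mcls_eqI agree_adj intro: agree_sym assms)

lemma mco_embed:
  assumes "x \<in> carrier C"
  obtains k where "coherent (\<lambda>m. if m \<le> k then \<zero> else x)"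
    "mco_embed C x = mcls (\<lambda>m. if m \<le> k then \<zero> else x)"
proof -
  define k where "k = (LEAST k. x \<in> stage C k)"
  have k: "x \<in> stage C k" unfolding k_def using stage_ex[OF assms] by (rule LeastI_ex)
  have z: "\<zero> \<in> stage C m" for m using stage_smult[OF stage_one, of 0] by simp
  have st: "(if m \<le> k then \<zero> else x) \<in> stage C m" for m
    using k z stage_mono[of k m] by auto
  have "msdd C (\<lambda>m. if m \<le> k then \<zero> else \<one>)"
  proof (rule msddI[of _ "\<lambda>m. if m \<le> k then 0 else \<infinity>"])
    show "\<forall>\<^sub>F n in sequentially. enat i \<le> (if n \<le> k then 0 else \<infinity>)" for i
      using eventually_gt_at_top[of k] by eventually_elim simp
  qed (auto simp: proj_0 proj_inf)
  then have o: "(\<lambda>m. if m \<le> k then \<zero> else x, \<lambda>m. if m \<le> k then \<zero> else \<one>) \<in> owmc C"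
    using st assms by (auto simp: owmc_def)
  then have "mco_embed C x = mcls (\<lambda>m. if m \<le> k then \<zero> else x)"
    unfolding mco_embed_def k_def[symmetric] Let_def by (rule mco_eq)
  with owmc_coherent[OF o] that show ?thesis by blast
qed

lemma mclosure_one: "\<one>\<^bsub>mclosure C\<^esub> = mcls (\<lambda>m. \<one>)"
proof -
  obtain k where k: "coherent (\<lambda>m. if m \<le> k then \<zero> else \<one>)"
    "mco_embed C \<one> = mcls (\<lambda>m. if m \<le> k then \<zero> else \<one>)" using mco_embed[OF one_closed] .
  have "\<forall>\<^sub>F n in sequentially. (if n \<le> k then \<zero> else \<one>) = \<one>"
    using eventually_gt_at_top[of k] by eventually_elim simp
  then show ?thesis unfolding mclosure_def using k(2) mcls_eqI[OF agree_eventually] by simp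
qed

text \<open>The operations on classes are computed termwise, so homomorphisms given level by level
  pass to the limit. Both \<tau> and the homomorphism of the theorem arise like this.\<close>

lemma star_hom_mclosure:
  assumes h: "\<And>m. h m \<in> star_hom A C" and co: "\<And>a. a \<in> carrier A \<Longrightarrow> coherent (\<lambda>m. h m a)"
  shows "(\<lambda>a. mcls (\<lambda>m. h m a)) \<in> star_hom A (mclosure C)"
proof -
  note hd = alg_homD[OF star_hom_alg_hom[OF h]] star_homD[OF h]
  show ?thesis
    unfolding star_hom_iff alg_hom_def linear_map_def
    using co by (auto simp: carrier_mclosure mclosure_mult mclosure_add mclosure_smult mclosure_adj mclosure_one hd)
qed

text \<open>Coherent sequences are closed under all operations, so the generators decide.\<close>

lemma coherent_free_hom:
  assumes h: "\<And>m. h m \<in> star_hom (free_alg G) C" and co: "\<And>X. X \<in> G \<Longrightarrow> coherent (\<lambda>m. h m (letter (Gen X)))"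
    and a: "a \<in> carrier (free_alg G)"
  shows "coherent (\<lambda>m. h m a)"
  using a
proof (induction a rule: free_alg_induct)
  note d = alg_homD(2-6)[OF star_hom_alg_hom[OF h]]
  case one
  show ?case unfolding d(5) by (rule coherent_one)
next
  case (letter l)
  then obtain X where X: "X \<in> G" "l = Gen X \<or> l = Adj X" by blast
  have g: "letter (Gen X) \<in> carrier (free_alg G)" using X(1) by simp
  have "h m (letter (Adj X)) = adj C (h m (letter (Gen X)))" for m using star_homD[OF h g] by simp
  then show ?case using X co[OF X(1)] coherent_adj[OF co[OF X(1)]] by auto
next
  note d = alg_homD(2-6)[OF star_hom_alg_hom[OF h]]
  case (add p q)
  show ?case unfolding d(2)[OF add(1,2)] by (rule coherent_add[OF add(3,4)])
next
  note d = alg_homD(2-6)[OF star_hom_alg_hom[OF h]]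
  case (smult p c)
  show ?case unfolding d(3)[OF smult(1)] by (rule coherent_smult[OF smult(2)])
next
  note d = alg_homD(2-6)[OF star_hom_alg_hom[OF h]]
  case (mult p q)
  show ?case unfolding d(4)[OF mult(1,2)] by (rule coherent_mult[OF mult(3,4)])
qed

end

section \<open>Extension of states to the monotone closure\<close>

definition mlim :: "('c \<Rightarrow> complex) \<Rightarrow> 'c mco \<Rightarrow> complex" where
  "mlim \<phi> U = (THE z. \<forall>(w, r) \<in> U. (\<lambda>m. \<phi> (w m)) \<longlonglongrightarrow> z)"

locale tower_state = mtower +
  fixes \<phi> assumes state: "state C \<phi>" and support: "\<phi> (tproj C 1) = 1"
begin

lemma linear: "\<phi> \<in> linear_map C complex_star"
  using state by (simp add: state_iff)

text \<open>The complement of \<open>c 1\<close> is a projection of expectation 0, so Cauchy-Schwarz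
  removes it from the right of any element. As \<open>x n \<otimes> c 1\<close> settles along a
  coherent sequence, so does the value of the state.\<close>

lemma state_mult_proj: "x \<in> carrier C \<Longrightarrow> \<phi> (x \<otimes> c 1) = \<phi> x"
proof -
  assume x: "x \<in> carrier C"
  let ?p = "\<one> \<ominus> c 1"
  have "?p \<otimes> ?p = ?p" by (simp add: minus_mult_l minus_mult_r proj_mult)
  then have "\<phi> (adj C ?p \<otimes> ?p) = 0"
    using state linear_map_minus[OF complex_alg_axioms star_algebra.axioms(1)[OF star_algebra_complex_star] linear, of \<one> "c 1"]
    by (simp add: adj_minus proj_adj support state_def)
  then have "\<phi> (x \<otimes> ?p) = 0" using state_supportD[OF star_algebra_axioms state _ _ x, of ?p] by simp
  then show ?thesis using x
      linear_map_minus[OF complex_alg_axioms star_algebra.axioms(1)[OF star_algebra_complex_star] linear, of x "x \<otimes> c 1"]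
    by (simp add: minus_mult_r)
qed

lemma state_eventually_eq:
  assumes "coherent x" "coherent y" "agree x y"
  shows "\<forall>\<^sub>F n in sequentially. \<phi> (x n) = \<phi> (y n)"
  using assms(3)[unfolded agree_def, THEN spec, of 1] eventually_ge_at_top[of 1]
proof eventually_elim
  case (elim n)
  then have "x n \<in> carrier C" "y n \<in> carrier C" using coherentD assms by auto
  with elim show ?case using state_mult_proj[of "x n"] state_mult_proj[of "y n"] by (simp add: one_enat_def)
qed

lemma mlim_eventually:
  assumes x: "coherent x"
  shows "\<forall>\<^sub>F n in sequentially. \<phi> (x n) = mlim \<phi> (mcls x)"
    and "\<forall>(w, r) \<in> mcls x. (\<lambda>m. \<phi> (w m)) \<longlonglongrightarrow> mlim \<phi> (mcls x)"
proof -
  obtain a where "\<forall>\<^sub>F n in sequentially. x n \<otimes> c (enat 1) = a" using x unfolding coherent_def by blast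
  with eventually_ge_at_top[of 1] have a: "\<forall>\<^sub>F n in sequentially. \<phi> (x n) = \<phi> a"
  proof eventually_elim
    case (elim n)
    then show ?case using state_mult_proj[of "x n"] coherentD(2)[OF x, of n] by (simp add: one_enat_def)
  qed
  have *: "(\<lambda>m. \<phi> (w m)) \<longlonglongrightarrow> \<phi> a" if "(w, r) \<in> mcls x" for w r
  proof (rule tendsto_eventually)
    from that have "coherent w" "agree x w" by (auto dest: mcls_memD)
    from state_eventually_eq[OF x this] a show "\<forall>\<^sub>F n in sequentially. \<phi> (w n) = \<phi> a"
      by eventually_elim simp
  qed
  obtain w r where wr: "(w, r) \<in> mcls x" using mcls_nonempty[OF x] by auto
  have "mlim \<phi> (mcls x) = \<phi> a" unfolding mlim_def
    by (rule the_equality) (use * wr in \<open>auto intro: LIMSEQ_unique\<close>)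
  with a * show "\<forall>\<^sub>F n in sequentially. \<phi> (x n) = mlim \<phi> (mcls x)"
    "\<forall>(w, r) \<in> mcls x. (\<lambda>m. \<phi> (w m)) \<longlonglongrightarrow> mlim \<phi> (mcls x)" by auto
qed

lemma mlim_eqI:
  assumes "coherent x" "\<forall>\<^sub>F n in sequentially. \<phi> (x n) = z"
  shows "mlim \<phi> (mcls x) = z"
proof -
  have "\<forall>\<^sub>F n in sequentially. mlim \<phi> (mcls x) = z"
    using mlim_eventually(1)[OF assms(1)] assms(2) by eventually_elim simp
  then show ?thesis by simp
qed

text \<open>The identities and the positivity hold at each level m \<ge> 1, and the values are
  eventually constant, so they carry over to the limit.\<close>

lemma state_mlim: "state (mclosure C) (mlim \<phi>)"
  unfolding state_iff
proof (intro conjI ballI)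
  note L = linear_mapD(2,3)[OF linear, unfolded complex_star_simps]
  have "mlim \<phi> (mcls x \<oplus>\<^bsub>mclosure C\<^esub> mcls y) = mlim \<phi> (mcls x) + mlim \<phi> (mcls y)"
    if c: "coherent x" "coherent y" for x y
    unfolding mclosure_add[OF c]
    by (rule mlim_eqI[OF coherent_add[OF c]])
      (use mlim_eventually(1)[OF c(1)] mlim_eventually(1)[OF c(2)] eventually_ge_at_top[of 1] in
       \<open>eventually_elim, simp add: L coherentD(2)[OF c(1)] coherentD(2)[OF c(2)]\<close>)
  moreover have "mlim \<phi> (z \<odot>\<^bsub>mclosure C\<^esub> mcls x) = z * mlim \<phi> (mcls x)" if c: "coherent x" for x z
    unfolding mclosure_smult[OF c]
    by (rule mlim_eqI[OF coherent_smult[OF c]])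
      (use mlim_eventually(1)[OF c] eventually_ge_at_top[of 1] in
       \<open>eventually_elim, simp add: L coherentD(2)[OF c]\<close>)
  ultimately show "mlim \<phi> \<in> linear_map (mclosure C) complex_star"
    by (auto simp: linear_map_def carrier_mclosure)
  show "mlim \<phi> \<one>\<^bsub>mclosure C\<^esub> = 1"
    unfolding mclosure_one by (rule mlim_eqI[OF coherent_one]) (use state in \<open>simp add: state_def\<close>)
  fix U assume "U \<in> carrier (mclosure C)"
  then obtain x where x: "coherent x" "U = mcls x" by (auto simp: carrier_mclosure)
  note c = coherent_mult[OF coherent_adj[OF x(1)] x(1)]
  have "\<forall>\<^sub>F n in sequentially. mlim \<phi> (mcls (\<lambda>m. adj C (x m) \<otimes> x m)) \<in> \<real>\<^sub>\<ge>\<^sub>0"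
    using mlim_eventually(1)[OF c] eventually_ge_at_top[of 1]
  proof eventually_elim
    case (elim n)
    then have "\<phi> (adj C (x n) \<otimes> x n) \<in> \<real>\<^sub>\<ge>\<^sub>0" using state coherentD(2)[OF x(1), of n] by (auto simp: state_iff)
    then show ?case using elim by simp
  qed
  then show "mlim \<phi> (adj (mclosure C) U \<otimes>\<^bsub>mclosure C\<^esub> U) \<in> \<real>\<^sub>\<ge>\<^sub>0"
    unfolding x(2) mclosure_adj[OF x(1)] mclosure_mult[OF coherent_adj[OF x(1)] x(1)] by simp
qed

lemma mlim_embed: "x \<in> carrier C \<Longrightarrow> mlim \<phi> (mco_embed C x) = \<phi> x"
proof -
  assume x: "x \<in> carrier C"
  obtain k where k: "coherent (\<lambda>m. if m \<le> k then \<zero> else x)"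
    "mco_embed C x = mcls (\<lambda>m. if m \<le> k then \<zero> else x)" using mco_embed[OF x] .
  show ?thesis unfolding k(2)
    by (rule mlim_eqI[OF k(1)]) (use eventually_gt_at_top[of k] in \<open>eventually_elim, simp\<close>)
qed

end

section \<open>The algebra \<open>\<F>\<^sub>0(\<G>)\<close>\<close>

declare free_alg_simps(1) [simp del] pair_alg_simps(1) [simp del]

abbreviation xa :: "'g set \<Rightarrow> 'g letter \<Rightarrow> nat \<Rightarrow> 'g fgen star_poly set" where
  "xa G l k \<equiv> fcls G (x1_elt l k)"

abbreviation xb :: "'g set \<Rightarrow> 'g letter \<Rightarrow> nat \<Rightarrow> 'g fgen star_poly set" where
  "xb G l k \<equiv> fcls G (x2_elt l k)"

abbreviation qq :: "'g set \<Rightarrow> nat \<Rightarrow> 'g fgen star_poly set" where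
  "qq G k \<equiv> fcls G (q_elt k)"

lemma fgens_letters [simp]:
  "XI X k \<in> fgens G \<longleftrightarrow> X \<in> G \<and> k \<ge> 1"
  "XII X k \<in> fgens G \<longleftrightarrow> X \<in> G \<and> k \<ge> 1"
  "Pj k \<in> fgens G \<longleftrightarrow> k \<ge> 1"
  by (auto simp: fgens_def)

text \<open>Groups the generators by letters over \<open>G\<close>, so that X and its adjoint are
  treated alike; only the adjoints of the projections need a case of their own.\<close>

lemma fgens_letter_cases:
  assumes "l \<in> letters (fgens G)"
  obtains l' k where "l' \<in> letters G" "k \<ge> 1" "letter l = x1_elt l' k"
    | l' k where "l' \<in> letters G" "k \<ge> 1" "letter l = x2_elt l' k"
    | k where "k \<ge> 1" "l = Gen (Pj k)"
    | k where "k \<ge> 1" "l = Adj (Pj k)"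
proof -
  from assms obtain s where s: "s \<in> fgens G" "l = Gen s \<or> l = Adj s" by blast
  show ?thesis
  proof (cases s)
    case (XI X k)
    then show ?thesis using s that(1)[of "Gen X" k] that(1)[of "Adj X" k] by auto
  next
    case (XII X k)
    then show ?thesis using s that(2)[of "Gen X" k] that(2)[of "Adj X" k] by auto
  next
    case (Pj k)
    then show ?thesis using s that(3,4)[of k] by auto
  qed
qed

lemma elt_closed:
  "l \<in> letters G \<Longrightarrow> k \<ge> 1 \<Longrightarrow> x1_elt l k \<in> carrier (free_alg (fgens G))"
  "l \<in> letters G \<Longrightarrow> k \<ge> 1 \<Longrightarrow> x2_elt l k \<in> carrier (free_alg (fgens G))"
  "k \<ge> 1 \<Longrightarrow> p_elt k \<in> carrier (free_alg (fgens G))"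
  by (cases l; auto simp: p_elt_def)+

lemma q_elt_0: "q_elt 0 = 0" and q_elt_Suc: "q_elt (Suc m) = q_elt m + p_elt (Suc m)"
  by (simp_all add: q_elt_def)

lemma q_elt_closed: "q_elt m \<in> carrier (free_alg (fgens G))"
proof -
  interpret F: star_algebra "free_alg (fgens G)" by (rule star_algebra_free_alg)
  show ?thesis
  proof (induction m)
    case 0
    show ?case using F.zero_closed by (simp add: q_elt_0)
  next
    case (Suc m)
    show ?case using F.a_closed[OF Suc elt_closed(3)[of "Suc m"]] by (simp add: q_elt_Suc)
  qed
qed

lemma elt_adj:
  "adj (free_alg S) (x1_elt l k) = x1_elt (flip l) k"
  "adj (free_alg S) (x2_elt l k) = x2_elt (flip l) k"
  by (cases l; simp)+

lemma frels_cases [consumes 1, case_names x2 pp padj x1q x2q x12]: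
  assumes "r \<in> frels G"
  obtains X where "X \<in> G" "r = x2_elt (Gen X) 1"
    | k l where "k \<ge> 1" "l \<ge> 1" "r = p_elt k \<otimes>\<^bsub>free_alg (fgens G)\<^esub> p_elt l - (if k = l then p_elt k else 0)"
    | k where "k \<ge> 1" "r = adj (free_alg (fgens G)) (p_elt k) - p_elt k"
    | m l k where "l \<in> letters G" "1 \<le> k" "k < m"
        "r = (\<one>\<^bsub>free_alg (fgens G)\<^esub> - q_elt m) \<otimes>\<^bsub>free_alg (fgens G)\<^esub> x1_elt l k"
    | m l k where "l \<in> letters G" "1 \<le> k" "k < m"
        "r = (\<one>\<^bsub>free_alg (fgens G)\<^esub> - q_elt m) \<otimes>\<^bsub>free_alg (fgens G)\<^esub> x2_elt l k"
    | m l k where "l \<in> letters G" "1 \<le> k" "m < k"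
        "r = q_elt m \<otimes>\<^bsub>free_alg (fgens G)\<^esub> (x1_elt l k - x2_elt l k)"
  using assms unfolding frels_def Let_def
  by (elim UnE CollectE exE conjE) (rule that; (assumption | (rule UnI1, assumption) | (rule UnI2, assumption)))+

lemma frelsI:
  "X \<in> G \<Longrightarrow> x2_elt (Gen X) 1 \<in> frels G"
  "k \<ge> 1 \<Longrightarrow> l \<ge> 1 \<Longrightarrow> p_elt k \<otimes>\<^bsub>free_alg (fgens G)\<^esub> p_elt l - (if k = l then p_elt k else 0) \<in> frels G"
  "k \<ge> 1 \<Longrightarrow> adj (free_alg (fgens G)) (p_elt k) - p_elt k \<in> frels G"
  "l' \<in> letters G \<Longrightarrow> 1 \<le> k \<Longrightarrow> k < m \<Longrightarrow> (\<one>\<^bsub>free_alg (fgens G)\<^esub> - q_elt m) \<otimes>\<^bsub>free_alg (fgens G)\<^esub> x1_elt l' k \<in> frels G"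
  "l' \<in> letters G \<Longrightarrow> 1 \<le> k \<Longrightarrow> k < m \<Longrightarrow> (\<one>\<^bsub>free_alg (fgens G)\<^esub> - q_elt m) \<otimes>\<^bsub>free_alg (fgens G)\<^esub> x2_elt l' k \<in> frels G"
  "l' \<in> letters G \<Longrightarrow> 1 \<le> k \<Longrightarrow> m < k \<Longrightarrow> q_elt m \<otimes>\<^bsub>free_alg (fgens G)\<^esub> (x1_elt l' k - x2_elt l' k) \<in> frels G"
  unfolding frels_def Let_def
  subgoal by (rule UnI1, rule UnI1, rule UnI1, rule UnI1, rule UnI1, rule CollectI, intro exI conjI, rule refl; assumption)
  subgoal by (rule UnI1, rule UnI1, rule UnI1, rule UnI1, rule UnI2, rule CollectI, intro exI conjI, rule refl; assumption)
  subgoal by (rule UnI1, rule UnI1, rule UnI1, rule UnI2, rule CollectI, intro exI conjI, rule refl; assumption)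
  subgoal by (rule UnI1, rule UnI1, rule UnI2, rule CollectI, intro exI conjI, rule refl; assumption)
  subgoal by (rule UnI1, rule UnI2, rule CollectI, intro exI conjI, rule refl; assumption)
  subgoal by (rule UnI2, rule CollectI, intro exI conjI, rule refl; assumption)
  done

context
  fixes G :: "'g set"
begin

interpretation F: star_algebra "free_alg (fgens G)" by (rule star_algebra_free_alg)

lemma frels_closed: "frels G \<subseteq> carrier (free_alg (fgens G))"
proof
  fix r assume "r \<in> frels G"
  then show "r \<in> carrier (free_alg (fgens G))"
    by (cases rule: frels_cases)
      (auto intro!: free_alg_diff_closed F.m_closed F.adj_closed elt_closed q_elt_closed F.one_closed F.zero_closed
        simp del: free_alg_simps simp: free_alg_simps(3)[symmetric, of "fgens G"])
qed

lemma F0_simps: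
  "carrier (F0 G) = carrier (F0_alg G)" "mult (F0 G) = mult (F0_alg G)" "one (F0 G) = one (F0_alg G)"
  "zero (F0 G) = zero (F0_alg G)" "add (F0 G) = add (F0_alg G)" "smult (F0 G) = smult (F0_alg G)"
  "adj (F0 G) = adj (F0_alg G)" "tproj (F0 G) = F0_q G"
  by (simp_all add: F0_def star_alg.extend_def tower.fields_def)

lemma stage_F0: "stage (F0 G) m = star_gen (F0_alg G) ({fcls G (p_elt j) | j. j \<ge> 1} \<union>
        {xa G (Gen X) k | X k. X \<in> G \<and> 1 \<le> k \<and> k \<le> m} \<union>
        {xb G (Gen X) k | X k. X \<in> G \<and> 1 \<le> k \<and> k \<le> m})"
  by (simp add: F0_def star_alg.extend_def tower.fields_def)

lemma star_algebra_F0: "star_algebra (F0 G)"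
  by (rule star_algebra_cong[of "F0_alg G"])
    (use star_algebra_presented[OF frels_closed] in \<open>simp_all add: F0_alg_def F0_simps\<close>)

interpretation A: star_algebra "F0 G" by (rule star_algebra_F0)

lemma fcls_star_hom: "fcls G \<in> star_hom (free_alg (fgens G)) (F0 G)"
  using pres_class_star_hom[OF frels_closed]
  by (simp add: star_hom_def ring_hom_def fcls_def F0_alg_def F0_simps)

lemmas fcls_hom = alg_homD(2-6)[OF star_hom_alg_hom[OF fcls_star_hom]]

lemma fcls_diff:
  assumes "p \<in> carrier (free_alg (fgens G))" "q \<in> carrier (free_alg (fgens G))"
  shows "fcls G (p - q) = fcls G p \<ominus>\<^bsub>F0 G\<^esub> fcls G q"
  using linear_map_minus[OF F.complex_alg_axioms A.complex_alg_axioms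
      alg_homD(1)[OF star_hom_alg_hom[OF fcls_star_hom]] assms]
  by (simp add: free_alg_minus[OF assms])

lemma fcls_zero: "fcls G 0 = \<zero>\<^bsub>F0 G\<^esub>"
  using linear_map_zero[OF F.complex_alg_axioms A.complex_alg_axioms
      alg_homD(1)[OF star_hom_alg_hom[OF fcls_star_hom]]] by simp

lemma fcls_rel: "r \<in> frels G \<Longrightarrow> fcls G r = \<zero>\<^bsub>F0 G\<^esub>"
  using pres_class_rel[OF frels_closed] by (simp add: fcls_def F0_alg_def F0_simps)

lemma xa_closed [simp, intro]: "l \<in> letters G \<Longrightarrow> k \<ge> 1 \<Longrightarrow> xa G l k \<in> carrier (F0 G)"
  by (rule fcls_hom(1)[OF elt_closed(1)])

lemma xb_closed [simp, intro]: "l \<in> letters G \<Longrightarrow> k \<ge> 1 \<Longrightarrow> xb G l k \<in> carrier (F0 G)"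
  by (rule fcls_hom(1)[OF elt_closed(2)])

lemma pp_closed [simp, intro]: "k \<ge> 1 \<Longrightarrow> fcls G (p_elt k) \<in> carrier (F0 G)"
  by (rule fcls_hom(1)[OF elt_closed(3)])

lemma qq_closed [simp, intro]: "qq G m \<in> carrier (F0 G)"
  by (rule fcls_hom(1)[OF q_elt_closed])

lemma pp_mult:
  "k \<ge> 1 \<Longrightarrow> l \<ge> 1 \<Longrightarrow> fcls G (p_elt k) \<otimes>\<^bsub>F0 G\<^esub> fcls G (p_elt l) =
     (if k = l then fcls G (p_elt k) else \<zero>\<^bsub>F0 G\<^esub>)"
proof -
  assume kl: "k \<ge> 1" "l \<ge> 1"
  let ?r = "if k = l then p_elt k else 0 :: 'g fgen star_poly"
  have c: "?r \<in> carrier (free_alg (fgens G))" "p_elt k \<otimes>\<^bsub>free_alg (fgens G)\<^esub> p_elt l \<in> carrier (free_alg (fgens G))"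
    using elt_closed(3)[OF kl(1)] elt_closed(3)[OF kl(2)] F.zero_closed F.m_closed by auto
  have "fcls G (p_elt k) \<otimes>\<^bsub>F0 G\<^esub> fcls G (p_elt l) \<ominus>\<^bsub>F0 G\<^esub> fcls G ?r = \<zero>\<^bsub>F0 G\<^esub>"
    using fcls_rel[OF frelsI(2)[OF kl]] fcls_diff[OF c(2,1)] fcls_hom(4)[OF elt_closed(3)[OF kl(1)] elt_closed(3)[OF kl(2)]]
    by simp
  then have "fcls G (p_elt k) \<otimes>\<^bsub>F0 G\<^esub> fcls G (p_elt l) = fcls G ?r"
    using A.minus_eq_zeroD[OF A.m_closed[OF pp_closed[OF kl(1)] pp_closed[OF kl(2)]] fcls_hom(1)[OF c(1)]] by blast
  then show ?thesis by (simp add: fcls_zero)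
qed

lemma pp_adj: "k \<ge> 1 \<Longrightarrow> adj (F0 G) (fcls G (p_elt k)) = fcls G (p_elt k)"
proof -
  assume k: "k \<ge> 1"
  note e = elt_closed(3)[OF k, of G]
  have "adj (F0 G) (fcls G (p_elt k)) \<ominus>\<^bsub>F0 G\<^esub> fcls G (p_elt k) = \<zero>\<^bsub>F0 G\<^esub>"
    using fcls_rel[OF frelsI(3)[OF k]] fcls_diff[OF F.adj_closed[OF e] e] star_homD[OF fcls_star_hom e] by simp
  then show ?thesis by (rule A.minus_eq_zeroD[OF A.adj_closed[OF pp_closed[OF k]] pp_closed[OF k]])
qed

lemma qq_0: "qq G 0 = \<zero>\<^bsub>F0 G\<^esub>"
  by (simp add: q_elt_0 fcls_zero)

lemma qq_Suc: "qq G (Suc m) = qq G m \<oplus>\<^bsub>F0 G\<^esub> fcls G (p_elt (Suc m))"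
  using fcls_hom(2)[OF q_elt_closed elt_closed(3)[of "Suc m"]] by (simp add: q_elt_Suc)

lemma qq_pp: "k \<ge> 1 \<Longrightarrow> qq G m \<otimes>\<^bsub>F0 G\<^esub> fcls G (p_elt k) = (if k \<le> m then fcls G (p_elt k) else \<zero>\<^bsub>F0 G\<^esub>)"
  "k \<ge> 1 \<Longrightarrow> fcls G (p_elt k) \<otimes>\<^bsub>F0 G\<^esub> qq G m = (if k \<le> m then fcls G (p_elt k) else \<zero>\<^bsub>F0 G\<^esub>)"
proof -
  assume k: "k \<ge> 1"
  show "qq G m \<otimes>\<^bsub>F0 G\<^esub> fcls G (p_elt k) = (if k \<le> m then fcls G (p_elt k) else \<zero>\<^bsub>F0 G\<^esub>)"
  proof (induction m)
    case 0
    then show ?case using k pp_closed[OF k] A.l_null[of "fcls G (p_elt k)"] unfolding qq_0 by simp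
  next
    case (Suc m)
    show ?case unfolding qq_Suc A.l_distr[OF qq_closed pp_closed pp_closed[OF k], of "Suc m" m, simplified] Suc
      using pp_mult[of "Suc m" k] k pp_closed[OF k] A.l_zero[of "fcls G (p_elt k)"] A.r_zero[of "fcls G (p_elt k)"]
        A.r_zero[OF A.zero_closed] by auto
  qed
  show "fcls G (p_elt k) \<otimes>\<^bsub>F0 G\<^esub> qq G m = (if k \<le> m then fcls G (p_elt k) else \<zero>\<^bsub>F0 G\<^esub>)"
  proof (induction m)
    case 0
    then show ?case using k pp_closed[OF k] A.r_null[of "fcls G (p_elt k)"] unfolding qq_0 by simp
  next
    case (Suc m)
    show ?case unfolding qq_Suc A.r_distr[OF qq_closed pp_closed pp_closed[OF k], of "Suc m" m, simplified] Suc
      using pp_mult[of k "Suc m"] k pp_closed[OF k] A.l_zero[of "fcls G (p_elt k)"] A.r_zero[of "fcls G (p_elt k)"]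
        A.r_zero[OF A.zero_closed] by auto
  qed
qed

lemma qq_mult: "qq G i \<otimes>\<^bsub>F0 G\<^esub> qq G j = qq G (min i j)"
proof (induction j)
  case 0
  then show ?case using A.r_null[OF qq_closed] by (simp add: qq_0)
next
  case (Suc j)
  have "qq G i \<otimes>\<^bsub>F0 G\<^esub> qq G (Suc j) = qq G (min i j) \<oplus>\<^bsub>F0 G\<^esub> qq G i \<otimes>\<^bsub>F0 G\<^esub> fcls G (p_elt (Suc j))"
    unfolding qq_Suc using A.r_distr[OF qq_closed pp_closed qq_closed] Suc by simp
  also have "\<dots> = qq G (min i (Suc j))"
  proof (cases "Suc j \<le> i")
    case True
    then have "min i j = j" "min i (Suc j) = Suc j" by auto
    then show ?thesis using True by (simp only: qq_pp(1)[of "Suc j" i] if_True qq_Suc)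
  next
    case False
    then have "min i j = i" "min i (Suc j) = i" by auto
    then show ?thesis using False A.r_zero[OF qq_closed] by (simp only: qq_pp(1)[of "Suc j" i] if_False)
  qed
  finally show ?case .
qed

lemma qq_adj: "adj (F0 G) (qq G m) = qq G m"
proof (induction m)
  case 0
  show ?case unfolding qq_0 by (rule A.adj_zero)
next
  case (Suc m)
  show ?case unfolding qq_Suc A.adj_add[OF qq_closed pp_closed] Suc
    using pp_adj[of "Suc m"] A.adj_add[OF qq_closed[of m] pp_closed[of "Suc m"]] Suc by simp
qed

text \<open>Lets the p_k be handled through the chain of the q_k, whose products are simply minima
  of indices.\<close>

lemma pp_eq: "k \<ge> 1 \<Longrightarrow> fcls G (p_elt k) = qq G k \<ominus>\<^bsub>F0 G\<^esub> qq G (k - 1)"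
proof -
  assume k: "k \<ge> 1"
  then have "qq G k = qq G (k - 1) \<oplus>\<^bsub>F0 G\<^esub> fcls G (p_elt k)" using qq_Suc[of "k - 1"] by simp
  then show ?thesis
    using A.a_comm[OF qq_closed[of "k - 1"] pp_closed[OF k]] pp_closed[OF k] qq_closed[of "k - 1"]
    by (simp only: a_minus_def A.a_assoc A.r_neg A.r_zero A.a_inv_closed)
qed

lemma xa_adj: "l \<in> letters G \<Longrightarrow> k \<ge> 1 \<Longrightarrow> adj (F0 G) (xa G l k) = xa G (flip l) k"
  and xb_adj: "l \<in> letters G \<Longrightarrow> k \<ge> 1 \<Longrightarrow> adj (F0 G) (xb G l k) = xb G (flip l) k"
  using star_homD[OF fcls_star_hom elt_closed(1)] star_homD[OF fcls_star_hom elt_closed(2)]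
  by (simp_all add: elt_adj)

lemma xb_1: "l \<in> letters G \<Longrightarrow> xb G l 1 = \<zero>\<^bsub>F0 G\<^esub>"
proof -
  assume l: "l \<in> letters G"
  then obtain X where X: "X \<in> G" "l = Gen X \<or> l = Adj X" by blast
  have z: "xb G (Gen X) 1 = \<zero>\<^bsub>F0 G\<^esub>" using fcls_rel[OF frelsI(1)[OF X(1)]] .
  have "xb G (Adj X) 1 = adj (F0 G) (xb G (Gen X) 1)" using xb_adj[of "Gen X" 1] X(1) by auto
  then have "xb G (Adj X) 1 = \<zero>\<^bsub>F0 G\<^esub>" unfolding z by (simp only: A.adj_zero)
  with z X(2) show ?thesis by auto
qed

lemma qq_x:
  assumes "l \<in> letters G" "1 \<le> k" "k < m"
  shows "qq G m \<otimes>\<^bsub>F0 G\<^esub> xa G l k = xa G l k" "qq G m \<otimes>\<^bsub>F0 G\<^esub> xb G l k = xb G l k"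
    "xa G l k \<otimes>\<^bsub>F0 G\<^esub> qq G m = xa G l k" "xb G l k \<otimes>\<^bsub>F0 G\<^esub> qq G m = xb G l k"
proof -
  have c: "\<one>\<^bsub>free_alg (fgens G)\<^esub> - q_elt m \<in> carrier (free_alg (fgens G))"
    by (rule free_alg_diff_closed[OF F.one_closed q_elt_closed])
  have d: "fcls G (\<one>\<^bsub>free_alg (fgens G)\<^esub> - q_elt m) = \<one>\<^bsub>F0 G\<^esub> \<ominus>\<^bsub>F0 G\<^esub> qq G m"
    using fcls_diff[OF F.one_closed q_elt_closed] fcls_hom(5) by simp
  have *: "qq G m \<otimes>\<^bsub>F0 G\<^esub> fcls G x = fcls G x"
    if x: "x \<in> carrier (free_alg (fgens G))"
      and r: "(\<one>\<^bsub>free_alg (fgens G)\<^esub> - q_elt m) \<otimes>\<^bsub>free_alg (fgens G)\<^esub> x \<in> frels G" for x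
  proof -
    note xc = fcls_hom(1)[OF x]
    have "\<zero>\<^bsub>F0 G\<^esub> = (\<one>\<^bsub>F0 G\<^esub> \<ominus>\<^bsub>F0 G\<^esub> qq G m) \<otimes>\<^bsub>F0 G\<^esub> fcls G x"
      using fcls_rel[OF r] fcls_hom(4)[OF c x] d by simp
    also have "\<dots> = fcls G x \<ominus>\<^bsub>F0 G\<^esub> qq G m \<otimes>\<^bsub>F0 G\<^esub> fcls G x"
      using A.minus_mult_l[OF A.one_closed qq_closed xc] A.l_one[OF xc] by simp
    finally show ?thesis using A.minus_eq_zeroD[OF xc A.m_closed[OF qq_closed xc]] by metis
  qed
  have a: "qq G m \<otimes>\<^bsub>F0 G\<^esub> xa G l k = xa G l k" "qq G m \<otimes>\<^bsub>F0 G\<^esub> xb G l k = xb G l k"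
    if l: "l \<in> letters G" for l
    by (rule *[OF elt_closed(1)[OF l assms(2)] frelsI(4)[OF l assms(2,3)]],
        rule *[OF elt_closed(2)[OF l assms(2)] frelsI(5)[OF l assms(2,3)]])
  show "qq G m \<otimes>\<^bsub>F0 G\<^esub> xa G l k = xa G l k" "qq G m \<otimes>\<^bsub>F0 G\<^esub> xb G l k = xb G l k"
    by (rule a[OF assms(1)])+
  have f: "flip l \<in> letters G" using assms(1) by simp
  show "xa G l k \<otimes>\<^bsub>F0 G\<^esub> qq G m = xa G l k"
    using arg_cong[OF a(1)[OF f], of "adj (F0 G)"] A.adj_mult[OF qq_closed xa_closed[OF f assms(2)]]
      xa_adj[OF f assms(2)] qq_adj by simp
  show "xb G l k \<otimes>\<^bsub>F0 G\<^esub> qq G m = xb G l k"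
    using arg_cong[OF a(2)[OF f], of "adj (F0 G)"] A.adj_mult[OF qq_closed xb_closed[OF f assms(2)]]
      xb_adj[OF f assms(2)] qq_adj by simp
qed

lemma qq_x_eq:
  assumes "l \<in> letters G" "m < k"
  shows "qq G m \<otimes>\<^bsub>F0 G\<^esub> xa G l k = qq G m \<otimes>\<^bsub>F0 G\<^esub> xb G l k"
    "xa G l k \<otimes>\<^bsub>F0 G\<^esub> qq G m = xb G l k \<otimes>\<^bsub>F0 G\<^esub> qq G m"
proof -
  have k: "1 \<le> k" using assms by simp
  have *: "qq G m \<otimes>\<^bsub>F0 G\<^esub> xa G l k = qq G m \<otimes>\<^bsub>F0 G\<^esub> xb G l k" if l: "l \<in> letters G" for l
  proof -
    note e = elt_closed(1,2)[OF l k] and x = xa_closed[OF l k] xb_closed[OF l k]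
    have "\<zero>\<^bsub>F0 G\<^esub> = qq G m \<otimes>\<^bsub>F0 G\<^esub> (xa G l k \<ominus>\<^bsub>F0 G\<^esub> xb G l k)"
      using fcls_rel[OF frelsI(6)[OF l k assms(2)]] fcls_hom(4)[OF q_elt_closed free_alg_diff_closed[OF e]]
        fcls_diff[OF e] by simp
    also have "\<dots> = qq G m \<otimes>\<^bsub>F0 G\<^esub> xa G l k \<ominus>\<^bsub>F0 G\<^esub> qq G m \<otimes>\<^bsub>F0 G\<^esub> xb G l k"
      by (rule A.minus_mult_r[OF x qq_closed])
    finally show ?thesis using A.minus_eq_zeroD[OF A.m_closed[OF qq_closed x(1)] A.m_closed[OF qq_closed x(2)]] by metis
  qed
  have f: "flip l \<in> letters G" using assms(1) by simp
  show "xa G l k \<otimes>\<^bsub>F0 G\<^esub> qq G m = xb G l k \<otimes>\<^bsub>F0 G\<^esub> qq G m"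
    using arg_cong[OF *[OF f], of "adj (F0 G)"] A.adj_mult[OF qq_closed xa_closed[OF f k]]
      A.adj_mult[OF qq_closed xb_closed[OF f k]] xa_adj[OF f k] xb_adj[OF f k] qq_adj by simp
  show "qq G m \<otimes>\<^bsub>F0 G\<^esub> xa G l k = qq G m \<otimes>\<^bsub>F0 G\<^esub> xb G l k" by (rule *[OF assms(1)])
qed

lemma F0_induct [consumes 1, case_names one xa xb pp add smult mult]:
  assumes x: "x \<in> carrier (F0 G)"
    and one: "P \<one>\<^bsub>F0 G\<^esub>"
    and xa: "\<And>l k. l \<in> letters G \<Longrightarrow> k \<ge> 1 \<Longrightarrow> P (xa G l k)"
    and xb: "\<And>l k. l \<in> letters G \<Longrightarrow> k \<ge> 1 \<Longrightarrow> P (xb G l k)"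
    and pp: "\<And>k. k \<ge> 1 \<Longrightarrow> P (fcls G (p_elt k))"
    and add: "\<And>x y. x \<in> carrier (F0 G) \<Longrightarrow> y \<in> carrier (F0 G) \<Longrightarrow> P x \<Longrightarrow> P y \<Longrightarrow> P (x \<oplus>\<^bsub>F0 G\<^esub> y)"
    and smult: "\<And>x c. x \<in> carrier (F0 G) \<Longrightarrow> P x \<Longrightarrow> P (c \<odot>\<^bsub>F0 G\<^esub> x)"
    and mult: "\<And>x y. x \<in> carrier (F0 G) \<Longrightarrow> y \<in> carrier (F0 G) \<Longrightarrow> P x \<Longrightarrow> P y \<Longrightarrow> P (x \<otimes>\<^bsub>F0 G\<^esub> y)"
  shows "P x"
proof -
  have "x \<in> carrier (presented (fgens G) (frels G))" using x by (simp add: F0_alg_def F0_simps)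
  then show ?thesis
  proof (induction x rule: presented_induct[OF frels_closed, consumes 1, case_names one letter add smult mult])
    case (letter l)
    have P: "P (fcls G (letter l))" using letter
    proof (cases rule: fgens_letter_cases)
      case (4 k)
      have "fcls G (letter l) = adj (F0 G) (fcls G (p_elt k))"
        using star_homD[OF fcls_star_hom elt_closed(3)[OF 4(1)]] 4 by (simp add: p_elt_def)
      then show ?thesis using pp[OF 4(1)] pp_adj[OF 4(1)] by simp
    qed (use xa xb pp in \<open>auto simp: p_elt_def\<close>)
    then show ?case by (simp add: fcls_def)
  qed (use one add smult mult in \<open>simp_all add: F0_alg_def F0_simps\<close>)
qed

text \<open>The universal property restated with the chain \<open>Q\<close> in place of the p_k. The
  one-sided relations appear in both orders because the target has no adjoint that would exchange
  them.\<close>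

lemma F0_lift:
  assumes E: "complex_alg E"
    and u: "\<And>l k. l \<in> letters G \<Longrightarrow> k \<ge> 1 \<Longrightarrow> u1 l k \<in> carrier E" "\<And>l k. l \<in> letters G \<Longrightarrow> k \<ge> 1 \<Longrightarrow> u2 l k \<in> carrier E"
    and Q: "\<And>m::nat. Q m \<in> carrier E" "Q 0 = \<zero>\<^bsub>E\<^esub>" "\<And>i j. Q i \<otimes>\<^bsub>E\<^esub> Q j = Q (min i j)"
    and u2: "\<And>l. l \<in> letters G \<Longrightarrow> u2 l 1 = \<zero>\<^bsub>E\<^esub>"
    and uQ: "\<And>l k m. l \<in> letters G \<Longrightarrow> 1 \<le> k \<Longrightarrow> k < m \<Longrightarrow> Q m \<otimes>\<^bsub>E\<^esub> u1 l k = u1 l k"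
      "\<And>l k m. l \<in> letters G \<Longrightarrow> 1 \<le> k \<Longrightarrow> k < m \<Longrightarrow> Q m \<otimes>\<^bsub>E\<^esub> u2 l k = u2 l k"
      "\<And>l k m. l \<in> letters G \<Longrightarrow> 1 \<le> k \<Longrightarrow> k < m \<Longrightarrow> u1 l k \<otimes>\<^bsub>E\<^esub> Q m = u1 l k"
      "\<And>l k m. l \<in> letters G \<Longrightarrow> 1 \<le> k \<Longrightarrow> k < m \<Longrightarrow> u2 l k \<otimes>\<^bsub>E\<^esub> Q m = u2 l k"
      "\<And>l k m. l \<in> letters G \<Longrightarrow> m < k \<Longrightarrow> Q m \<otimes>\<^bsub>E\<^esub> u1 l k = Q m \<otimes>\<^bsub>E\<^esub> u2 l k"
      "\<And>l k m. l \<in> letters G \<Longrightarrow> m < k \<Longrightarrow> u1 l k \<otimes>\<^bsub>E\<^esub> Q m = u2 l k \<otimes>\<^bsub>E\<^esub> Q m"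
  obtains h where "h \<in> alg_hom (F0 G) E"
    "\<And>l k. l \<in> letters G \<Longrightarrow> k \<ge> 1 \<Longrightarrow> h (xa G l k) = u1 l k"
    "\<And>l k. l \<in> letters G \<Longrightarrow> k \<ge> 1 \<Longrightarrow> h (xb G l k) = u2 l k"
    "\<And>k. h (qq G k) = Q k"
proof -
  interpret E: complex_alg E by fact
  let ?F = "free_alg (fgens G)"
  \<comment> \<open>The images of the p_k are the successive differences of the chain; that they are
    orthogonal idempotents follows from \<open>Q i \<otimes> Q j = Q (min i j)\<close>.\<close>
  define P where "P k = Q k \<ominus>\<^bsub>E\<^esub> Q (k - 1)" for k
  have Pc: "P k \<in> carrier E" for k using Q(1) by (auto simp: P_def)
  define f where "f l = (case l of
      Gen s \<Rightarrow> (case s of XI X k \<Rightarrow> u1 (Gen X) k | XII X k \<Rightarrow> u2 (Gen X) k | Pj k \<Rightarrow> P k)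
    | Adj s \<Rightarrow> (case s of XI X k \<Rightarrow> u1 (Adj X) k | XII X k \<Rightarrow> u2 (Adj X) k | Pj k \<Rightarrow> P k))" for l
  have f: "f l \<in> carrier E" if "l \<in> letters (fgens G)" for l
    using that u Pc by (auto simp: f_def fgens_def)
  let ?e = "free_lift E f"
  have lift: "?e \<in> alg_hom ?F E" by (rule free_lift_alg_hom[OF E]) (rule f)
  note e = alg_homD(2-6)[OF lift]
  have elet: "?e (letter l) = f l" if "l \<in> letters (fgens G)" for l
    by (rule free_lift_letter[OF E _ that]) (rule f)
  have ed: "?e (p - q) = ?e p \<ominus>\<^bsub>E\<^esub> ?e q" if "p \<in> carrier ?F" "q \<in> carrier ?F" for p q
    by (rule free_lift_diff[OF E _ that]) (rule f)
  have ez: "?e 0 = \<zero>\<^bsub>E\<^esub>" by (rule free_lift_zero[where S = "fgens G", OF E]) (rule f)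
  have ex1: "?e (x1_elt l k) = u1 l k" and ex2: "?e (x2_elt l k) = u2 l k"
    if "l \<in> letters G" "k \<ge> 1" for l k
    using that by (cases l; auto simp: elet f_def)+
  have epp: "?e (p_elt k) = P k" "?e (adj ?F (p_elt k)) = P k" if "k \<ge> 1" for k
    using that by (auto simp: p_elt_def elet f_def)
  have PQ: "Q m = Q (m - 1) \<oplus>\<^bsub>E\<^esub> P m" for m
  proof -
    have "Q (m - 1) \<oplus>\<^bsub>E\<^esub> P m = Q (m - 1) \<oplus>\<^bsub>E\<^esub> (\<ominus>\<^bsub>E\<^esub> Q (m - 1) \<oplus>\<^bsub>E\<^esub> Q m)"
      using E.a_comm[of "Q m" "\<ominus>\<^bsub>E\<^esub> Q (m - 1)"] Q(1) by (simp add: P_def a_minus_def)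
    also have "\<dots> = Q m" using Q(1) by (simp add: E.a_assoc[symmetric] E.r_neg)
    finally show ?thesis by simp
  qed
  have eq: "?e (q_elt m) = Q m \<and> ?e (adj ?F (q_elt m)) = Q m" for m
  proof (induction m)
    case 0
    show ?case using ez Q(2) F.adj_zero by (simp add: q_elt_0)
  next
    case (Suc m)
    have 1: "?e (q_elt (Suc m)) = ?e (q_elt m) \<oplus>\<^bsub>E\<^esub> ?e (p_elt (Suc m))"
      using e(2)[OF q_elt_closed elt_closed(3), of "Suc m" m] by (simp add: q_elt_Suc)
    have "adj ?F (q_elt (Suc m)) = adj ?F (q_elt m) \<oplus>\<^bsub>?F\<^esub> adj ?F (p_elt (Suc m))"
      using F.adj_add[OF q_elt_closed elt_closed(3), of "Suc m" m] by (simp add: q_elt_Suc)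
    then have 2: "?e (adj ?F (q_elt (Suc m))) = ?e (adj ?F (q_elt m)) \<oplus>\<^bsub>E\<^esub> ?e (adj ?F (p_elt (Suc m)))"
      using e(2)[OF F.adj_closed[OF q_elt_closed] F.adj_closed[OF elt_closed(3)], of "Suc m" m] by simp
    show ?case using 1 2 Suc epp[of "Suc m"] PQ[of "Suc m"] by simp
  qed
  have PP: "P k \<otimes>\<^bsub>E\<^esub> P l = (if k = l then P k else \<zero>\<^bsub>E\<^esub>)" if "k \<ge> 1" "l \<ge> 1" for k l
  proof -
    have "P k \<otimes>\<^bsub>E\<^esub> P l = Q (min k l) \<ominus>\<^bsub>E\<^esub> Q (min (k - 1) l) \<ominus>\<^bsub>E\<^esub> (Q (min k (l - 1)) \<ominus>\<^bsub>E\<^esub> Q (min (k - 1) (l - 1)))"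
      unfolding P_def using Q(1) by (simp add: E.minus_mult_r E.minus_mult_l Q(3))
    also have "\<dots> = (if k = l then P k else \<zero>\<^bsub>E\<^esub>)"
    proof (cases k l rule: linorder_cases)
      case less
      then have "min k l = k" "min (k - 1) l = k - 1" "min k (l - 1) = k" "min (k - 1) (l - 1) = k - 1" using that by auto
      then show ?thesis using less Pc[of k] unfolding P_def by simp
    next
      case equal
      then have "min k l = k" "min (k - 1) l = k - 1" "min k (l - 1) = k - 1" "min (k - 1) (l - 1) = k - 1" using that by auto
      then show ?thesis using equal Pc[of k] Q(1) unfolding P_def by simp
    next
      case greater
      then have "min k l = l" "min (k - 1) l = l" "min k (l - 1) = l - 1" "min (k - 1) (l - 1) = l - 1" using that by auto
      then show ?thesis using greater Q(1) by simp
    qed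
    finally show ?thesis .
  qed
  have adiff: "adj ?F (p - q) = adj ?F p - adj ?F q" for p q :: "'g fgen star_poly"
    by (simp add: free_alg_def monoid_alg_adj_diff)
  have az: "adj ?F 0 = 0" using F.adj_zero by simp
  note cl = elt_closed q_elt_closed F.one_closed F.zero_closed F.m_closed F.adj_closed free_alg_diff_closed
  have dq: "\<one>\<^bsub>?F\<^esub> - q_elt m \<in> carrier ?F" for m by (intro cl)
  have kill: "?e r = \<zero>\<^bsub>E\<^esub> \<and> ?e (adj ?F r) = \<zero>\<^bsub>E\<^esub>" if "r \<in> frels G" for r
    using that
  proof (cases rule: frels_cases)
    case (x2 X)
    then show ?thesis using ex2[of "Gen X" 1] ex2[of "Adj X" 1] u2[of "Gen X"] u2[of "Adj X"] by (simp add: elt_adj)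
  next
    case (pp k l)
    note c = elt_closed(3)[OF pp(1), of G] elt_closed(3)[OF pp(2), of G]
    note c' = F.m_closed[OF c] F.adj_closed[OF c(1)] F.adj_closed[OF c(2)]
    let ?r = "if k = l then p_elt k else 0 :: 'g fgen star_poly"
    have r: "?r \<in> carrier ?F" "?e ?r = (if k = l then P k else \<zero>\<^bsub>E\<^esub>)" "?e (adj ?F ?r) = (if k = l then P k else \<zero>\<^bsub>E\<^esub>)"
      using c(1) F.zero_closed epp[OF pp(1)] ez az by auto
    have 1: "?e r = P k \<otimes>\<^bsub>E\<^esub> P l \<ominus>\<^bsub>E\<^esub> ?e ?r"
      unfolding pp(3) using ed[OF c'(1) r(1)] e(4)[OF c] epp(1)[OF pp(1)] epp(1)[OF pp(2)] by simp
    have 2: "?e (adj ?F r) = P l \<otimes>\<^bsub>E\<^esub> P k \<ominus>\<^bsub>E\<^esub> ?e (adj ?F ?r)"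
      unfolding pp(3) adiff
      using ed[OF F.adj_closed[OF c'(1)] F.adj_closed[OF r(1)]] F.adj_mult[OF c] e(4)[OF c'(3,2)] epp(2)[OF pp(1)] epp(2)[OF pp(2)]
      by simp
    show ?thesis unfolding 1 2 r PP[OF pp(1,2)] PP[OF pp(2,1)] using Pc by auto
  next
    case (padj k)
    note c = elt_closed(3)[OF padj(1), of G]
    show ?thesis unfolding padj(2) adiff F.adj_adj[OF c]
      using ed[OF F.adj_closed[OF c] c] ed[OF c F.adj_closed[OF c]] epp[OF padj(1)] Pc by simp
  next
    case (x1q m l k)
    note c = elt_closed(1)[OF x1q(1,2)]
    have f: "flip l \<in> letters G" using x1q(1) by simp
    have 1: "?e r = (\<one>\<^bsub>E\<^esub> \<ominus>\<^bsub>E\<^esub> Q m) \<otimes>\<^bsub>E\<^esub> u1 l k"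
      unfolding x1q(4) using e(4)[OF dq c] ed[OF F.one_closed q_elt_closed] e(5) eq ex1[OF x1q(1,2)] by simp
    have 2: "?e (adj ?F r) = u1 (flip l) k \<otimes>\<^bsub>E\<^esub> (\<one>\<^bsub>E\<^esub> \<ominus>\<^bsub>E\<^esub> Q m)"
      unfolding x1q(4) F.adj_mult[OF dq c] adiff F.adj_one elt_adj
      using e(4)[OF elt_closed(1)[OF f x1q(2)] free_alg_diff_closed[OF F.one_closed F.adj_closed[OF q_elt_closed]]]
        ed[OF F.one_closed F.adj_closed[OF q_elt_closed]] e(5) eq ex1[OF f x1q(2)] by simp
    show ?thesis unfolding 1 2
      using u(1)[OF x1q(1,2)] u(1)[OF f x1q(2)] Q(1) uQ(1)[OF x1q(1-3)] uQ(3)[OF f x1q(2,3)]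
      by (simp add: E.minus_mult_l E.minus_mult_r)
  next
    case (x2q m l k)
    note c = elt_closed(2)[OF x2q(1,2)]
    have f: "flip l \<in> letters G" using x2q(1) by simp
    have 1: "?e r = (\<one>\<^bsub>E\<^esub> \<ominus>\<^bsub>E\<^esub> Q m) \<otimes>\<^bsub>E\<^esub> u2 l k"
      unfolding x2q(4) using e(4)[OF dq c] ed[OF F.one_closed q_elt_closed] e(5) eq ex2[OF x2q(1,2)] by simp
    have 2: "?e (adj ?F r) = u2 (flip l) k \<otimes>\<^bsub>E\<^esub> (\<one>\<^bsub>E\<^esub> \<ominus>\<^bsub>E\<^esub> Q m)"
      unfolding x2q(4) F.adj_mult[OF dq c] adiff F.adj_one elt_adj
      using e(4)[OF elt_closed(2)[OF f x2q(2)] free_alg_diff_closed[OF F.one_closed F.adj_closed[OF q_elt_closed]]]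
        ed[OF F.one_closed F.adj_closed[OF q_elt_closed]] e(5) eq ex2[OF f x2q(2)] by simp
    show ?thesis unfolding 1 2
      using u(2)[OF x2q(1,2)] u(2)[OF f x2q(2)] Q(1) uQ(2)[OF x2q(1-3)] uQ(4)[OF f x2q(2,3)]
      by (simp add: E.minus_mult_l E.minus_mult_r)
  next
    case (x12 m l k)
    note c = elt_closed(1,2)[OF x12(1,2)]
    have f: "flip l \<in> letters G" using x12(1) by simp
    note cf = elt_closed(1,2)[OF f x12(2)]
    have 1: "?e r = Q m \<otimes>\<^bsub>E\<^esub> (u1 l k \<ominus>\<^bsub>E\<^esub> u2 l k)"
      unfolding x12(4) using e(4)[OF q_elt_closed free_alg_diff_closed[OF c]] ed[OF c] eq ex1[OF x12(1,2)] ex2[OF x12(1,2)]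
      by simp
    have 2: "?e (adj ?F r) = (u1 (flip l) k \<ominus>\<^bsub>E\<^esub> u2 (flip l) k) \<otimes>\<^bsub>E\<^esub> Q m"
      unfolding x12(4) F.adj_mult[OF q_elt_closed free_alg_diff_closed[OF c]] adiff elt_adj
      using e(4)[OF free_alg_diff_closed[OF cf] F.adj_closed[OF q_elt_closed]] ed[OF cf] eq ex1[OF f x12(2)] ex2[OF f x12(2)]
      by simp
    show ?thesis unfolding 1 2
      using u(1)[OF x12(1,2)] u(1)[OF f x12(2)] u(2)[OF x12(1,2)] u(2)[OF f x12(2)] Q(1)
        uQ(5)[OF x12(1,3)] uQ(6)[OF f x12(3)]
      by (simp add: E.minus_mult_l E.minus_mult_r)
  qed
  have k1: "?e r = \<zero>\<^bsub>E\<^esub>" and k2: "?e (adj ?F r) = \<zero>\<^bsub>E\<^esub>" if "r \<in> frels G" for r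
    using kill[OF that] by blast+
  obtain h where h: "h \<in> alg_hom (presented (fgens G) (frels G)) E"
    "\<And>p. p \<in> carrier ?F \<Longrightarrow> h (pres_class (fgens G) (frels G) p) = ?e p"
    by (rule presented_lift_alg_hom[OF frels_closed E, of f]) (use f k1 k2 in blast)+
  have h2: "h (fcls G p) = ?e p" if "p \<in> carrier ?F" for p
    using h(2)[OF that] by (simp add: fcls_def)
  have "h \<in> alg_hom (F0 G) E" using h(1) by (simp add: alg_hom_def linear_map_def F0_alg_def F0_simps)
  then show ?thesis
    by (rule that) (simp_all add: h2[OF elt_closed(1)] h2[OF elt_closed(2)] h2[OF q_elt_closed] ex1 ex2 eq)
qed

lemma alg_hom_F0_star:
  assumes "star_algebra E" "h \<in> alg_hom (F0 G) E"
    and "\<And>l k. l \<in> letters G \<Longrightarrow> k \<ge> 1 \<Longrightarrow> h (xa G (flip l) k) = adj E (h (xa G l k))"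
    and "\<And>l k. l \<in> letters G \<Longrightarrow> k \<ge> 1 \<Longrightarrow> h (xb G (flip l) k) = adj E (h (xb G l k))"
    and q: "\<And>k. adj E (h (qq G k)) = h (qq G k)"
  shows "h \<in> star_hom (F0 G) E"
proof -
  interpret E: star_algebra E by fact
  note h = alg_homD(2-6)[OF assms(2)]
  have "h (adj (F0 G) x) = adj E (h x)" if "x \<in> carrier (F0 G)" for x
    using that
  proof (induction x rule: F0_induct)
    case one
    show ?case unfolding A.adj_one h(5) E.adj_one ..
  next
    case (xa l k)
    then show ?case using assms(3) by (simp only: xa_adj)
  next
    case (xb l k)
    then show ?case using assms(4) by (simp only: xb_adj)
  next
    case (pp k)
    have "h (fcls G (p_elt k)) = h (qq G k) \<ominus>\<^bsub>E\<^esub> h (qq G (k - 1))"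
      unfolding pp_eq[OF pp] by (rule linear_map_minus[OF A.complex_alg_axioms E.complex_alg_axioms
          alg_homD(1)[OF assms(2)] qq_closed qq_closed])
    then show ?case unfolding pp_adj[OF pp] using q h(1)[OF qq_closed] by (simp add: E.adj_minus)
  next
    case (add x y)
    then show ?case by (simp only: A.adj_add E.adj_add h A.adj_closed)
  next
    case (smult x c)
    then show ?case by (simp only: A.adj_smult E.adj_smult h A.adj_closed)
  next
    case (mult x y)
    then show ?case by (simp only: A.adj_mult E.adj_mult h A.adj_closed)
  qed
  then show ?thesis using assms(2) by (simp add: star_hom_iff)
qed

lemma star_hom_F0_eqI:
  assumes "complex_alg E" "g \<in> star_hom (F0 G) E" "h \<in> star_hom (F0 G) E"
    and "\<And>X k. X \<in> G \<Longrightarrow> k \<ge> 1 \<Longrightarrow> g (xa G (Gen X) k) = h (xa G (Gen X) k)"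
    and "\<And>X k. X \<in> G \<Longrightarrow> k \<ge> 1 \<Longrightarrow> g (xb G (Gen X) k) = h (xb G (Gen X) k)"
    and "\<And>k. g (qq G k) = h (qq G k)" and x: "x \<in> carrier (F0 G)"
  shows "g x = h x"
proof -
  have sh: "k \<in> star_hom (presented (fgens G) (frels G)) E" if "k \<in> star_hom (F0 G) E" for k
    using that by (simp add: star_hom_def ring_hom_def F0_alg_def F0_simps)
  have "g (fcls G (letter (Gen s))) = h (fcls G (letter (Gen s)))" if "s \<in> fgens G" for s
  proof (cases s)
    case (XI X k)
    then show ?thesis using assms(4)[of X k] that by simp
  next
    case (XII X k)
    then show ?thesis using assms(5)[of X k] that by simp
  next
    case (Pj k)
    then have k: "k \<ge> 1" using that by simp
    note m = linear_map_minus[OF A.complex_alg_axioms assms(1) alg_homD(1)[OF star_hom_alg_hom] qq_closed qq_closed]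
    show ?thesis using m[OF assms(2)] m[OF assms(3)] assms(6) pp_eq[OF k] Pj by (simp add: p_elt_def)
  qed
  then show ?thesis
    using star_hom_presented_eqI[OF frels_closed sh[OF assms(2)] sh[OF assms(3)], of x] x
    by (simp add: fcls_def F0_alg_def F0_simps)
qed

text \<open>One-dimensional representations that send all X'(k) and X''(k) to 0, p_n to 1 and the
  other p_k to 0. They separate the projections and detect the scalar part at infinity.\<close>

lemma F0_character:
  assumes "n \<ge> 1"
  obtains \<chi> where "\<chi> \<in> alg_hom (F0 G) complex_star" "\<And>k. \<chi> (qq G k) = (if n \<le> k then 1 else 0)"
proof -
  interpret C: star_algebra complex_star by (rule star_algebra_complex_star)
  show ?thesis
    by (rule F0_lift[OF C.complex_alg_axioms, of "\<lambda>_ _. 0" "\<lambda>_ _. 0" "\<lambda>k. if n \<le> k then 1 else 0"])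
      (use assms that in auto)
qed

text \<open>Modulo the projections, every element of \<open>\<F>\<^sub>0\<close> is a scalar.\<close>

lemma F0_scalar_at_infinity:
  assumes "x \<in> carrier (F0 G)"
  shows "\<exists>z N. \<forall>n\<ge>N. x \<otimes>\<^bsub>F0 G\<^esub> (\<one>\<^bsub>F0 G\<^esub> \<ominus>\<^bsub>F0 G\<^esub> qq G n) = z \<odot>\<^bsub>F0 G\<^esub> (\<one>\<^bsub>F0 G\<^esub> \<ominus>\<^bsub>F0 G\<^esub> qq G n)"
proof -
  let ?R = "\<lambda>n. \<one>\<^bsub>F0 G\<^esub> \<ominus>\<^bsub>F0 G\<^esub> qq G n"
  have R: "?R n \<in> carrier (F0 G)" for n by (rule A.minus_closed[OF A.one_closed qq_closed])
  \<comment> \<open>Generators are absorbed by q_n for large n and therefore have scalar 0; only the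
    unit contributes.\<close>
  have z: "x \<otimes>\<^bsub>F0 G\<^esub> ?R n = 0 \<odot>\<^bsub>F0 G\<^esub> ?R n" if "x \<otimes>\<^bsub>F0 G\<^esub> qq G n = x" "x \<in> carrier (F0 G)" for x n
    using that A.minus_mult_r[OF A.one_closed qq_closed that(2)] A.minus_self[OF that(2)] A.r_one[OF that(2)] A.smult_zero_l[OF R]
    by simp
  show ?thesis using assms
  proof (induction x rule: F0_induct)
    case one
    show ?case using A.l_one[OF R] A.smult_one[OF R] by (intro exI[of _ 1] exI[of _ 0] allI impI) simp
  next
    case (xa l k)
    show ?case
      by (intro exI[of _ 0] exI[of _ "Suc k"] allI impI, rule z) (use qq_x(3)[OF xa] xa_closed[OF xa] in auto)
  next
    case (xb l k)
    show ?case
      by (intro exI[of _ 0] exI[of _ "Suc k"] allI impI, rule z) (use qq_x(4)[OF xb] xb_closed[OF xb] in auto)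
  next
    case (pp k)
    show ?case
      by (intro exI[of _ 0] exI[of _ k] allI impI, rule z) (use qq_pp(2)[OF pp] pp_closed[OF pp] in auto)
  next
    case (add x y)
    then obtain z N z' N' where "\<forall>n\<ge>N. x \<otimes>\<^bsub>F0 G\<^esub> ?R n = z \<odot>\<^bsub>F0 G\<^esub> ?R n" "\<forall>n\<ge>N'. y \<otimes>\<^bsub>F0 G\<^esub> ?R n = z' \<odot>\<^bsub>F0 G\<^esub> ?R n"
      by blast
    then have "(x \<oplus>\<^bsub>F0 G\<^esub> y) \<otimes>\<^bsub>F0 G\<^esub> ?R n = (z + z') \<odot>\<^bsub>F0 G\<^esub> ?R n" if "n \<ge> max N N'" for n
      using that unfolding A.l_distr[OF add(1,2) R] A.smult_l_distr[OF R] by simp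
    then show ?case by blast
  next
    case (smult x c)
    then obtain z N where "\<forall>n\<ge>N. x \<otimes>\<^bsub>F0 G\<^esub> ?R n = z \<odot>\<^bsub>F0 G\<^esub> ?R n" by blast
    then have "(c \<odot>\<^bsub>F0 G\<^esub> x) \<otimes>\<^bsub>F0 G\<^esub> ?R n = (c * z) \<odot>\<^bsub>F0 G\<^esub> ?R n" if "n \<ge> N" for n
      using that unfolding A.smult_mult_l[OF smult(1) R] A.smult_assoc[OF R, symmetric] by simp
    then show ?case by blast
  next
    case (mult x y)
    then obtain z N z' N' where "\<forall>n\<ge>N. x \<otimes>\<^bsub>F0 G\<^esub> ?R n = z \<odot>\<^bsub>F0 G\<^esub> ?R n" "\<forall>n\<ge>N'. y \<otimes>\<^bsub>F0 G\<^esub> ?R n = z' \<odot>\<^bsub>F0 G\<^esub> ?R n"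
      by blast
    then have "(x \<otimes>\<^bsub>F0 G\<^esub> y) \<otimes>\<^bsub>F0 G\<^esub> ?R n = (z' * z) \<odot>\<^bsub>F0 G\<^esub> ?R n" if "n \<ge> max N N'" for n
      using that unfolding A.m_assoc[OF mult(1,2) R] A.smult_assoc[OF R, symmetric]
      using A.smult_mult_r[OF mult(1) R] by simp
    then show ?case by blast
  qed
qed

lemma qq_decompose:
  "\<one>\<^bsub>F0 G\<^esub> = qq G n \<oplus>\<^bsub>F0 G\<^esub> (\<one>\<^bsub>F0 G\<^esub> \<ominus>\<^bsub>F0 G\<^esub> qq G n)"
proof -
  have "qq G n \<oplus>\<^bsub>F0 G\<^esub> (\<one>\<^bsub>F0 G\<^esub> \<ominus>\<^bsub>F0 G\<^esub> qq G n) = qq G n \<oplus>\<^bsub>F0 G\<^esub> (\<ominus>\<^bsub>F0 G\<^esub> qq G n \<oplus>\<^bsub>F0 G\<^esub> \<one>\<^bsub>F0 G\<^esub>)"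
    unfolding a_minus_def using A.a_comm[OF A.one_closed A.a_inv_closed[OF qq_closed]] by simp
  also have "\<dots> = \<one>\<^bsub>F0 G\<^esub>"
    by (simp only: A.a_assoc[OF qq_closed A.a_inv_closed[OF qq_closed] A.one_closed, symmetric]
        A.r_neg[OF qq_closed] A.l_zero[OF A.one_closed])
  finally show ?thesis by (rule sym)
qed

end

section \<open>The towers of \<open>\<F>\<close> and of its tensor square\<close>

lemma lin_span_mono: "S \<subseteq> T \<Longrightarrow> x \<in> lin_span A S \<Longrightarrow> x \<in> lin_span A T"
  by (rotate_tac, induction rule: lin_span.induct) (auto intro: lin_span.intros)

lemma tensor_tower_simps:
  "carrier (tensor_tower C D) = carrier (tensor C D)" "mult (tensor_tower C D) = mult (tensor C D)"
  "one (tensor_tower C D) = one (tensor C D)" "zero (tensor_tower C D) = zero (tensor C D)"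
  "add (tensor_tower C D) = add (tensor C D)" "smult (tensor_tower C D) = smult (tensor C D)"
  "adj (tensor_tower C D) = adj (tensor C D)"
  "stage (tensor_tower C D) m = lin_span (tensor C D) {tens C D a b | a b. a \<in> stage C m \<and> b \<in> stage D m}"
  "tproj (tensor_tower C D) k = tens C D (tproj C k) (tproj D k)"
  by (simp_all add: tensor_tower_def star_alg.extend_def tower.fields_def)

lemma F0_q_simps [simp]: "F0_q G (enat m) = qq G m" "F0_q G \<infinity> = \<one>\<^bsub>F0 G\<^esub>"
  by (simp_all add: F0_q_def F0_simps)

abbreviation tt :: "'g set \<Rightarrow> 'g fgen star_poly set \<Rightarrow> 'g fgen star_poly set \<Rightarrow>
    ('g fgen star_poly set \<times> 'g fgen star_poly set \<Rightarrow>\<^sub>0 complex) set" where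
  "tt G \<equiv> tens (F0 G) (F0 G)"

context
  fixes G :: "'g set"
begin

interpretation A: star_algebra "F0 G" by (rule star_algebra_F0)

lemma stage_F0_rules:
  "\<one>\<^bsub>F0 G\<^esub> \<in> stage (F0 G) m"
  "k \<ge> 1 \<Longrightarrow> fcls G (p_elt k) \<in> stage (F0 G) m"
  "X \<in> G \<Longrightarrow> 1 \<le> k \<Longrightarrow> k \<le> m \<Longrightarrow> xa G (Gen X) k \<in> stage (F0 G) m"
  "X \<in> G \<Longrightarrow> 1 \<le> k \<Longrightarrow> k \<le> m \<Longrightarrow> xb G (Gen X) k \<in> stage (F0 G) m"
  "x \<in> stage (F0 G) m \<Longrightarrow> y \<in> stage (F0 G) m \<Longrightarrow> x \<oplus>\<^bsub>F0 G\<^esub> y \<in> stage (F0 G) m"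
  "x \<in> stage (F0 G) m \<Longrightarrow> c \<odot>\<^bsub>F0 G\<^esub> x \<in> stage (F0 G) m"
  "x \<in> stage (F0 G) m \<Longrightarrow> y \<in> stage (F0 G) m \<Longrightarrow> x \<otimes>\<^bsub>F0 G\<^esub> y \<in> stage (F0 G) m"
  "x \<in> stage (F0 G) m \<Longrightarrow> adj (F0 G) x \<in> stage (F0 G) m"
  unfolding stage_F0 F0_simps
  subgoal by (rule star_gen.one)
  subgoal by (rule star_gen.base, rule UnI1, rule UnI1, rule CollectI, intro exI conjI, rule refl)
  subgoal by (rule star_gen.base, rule UnI1, rule UnI2, rule CollectI, intro exI conjI, rule refl)
  subgoal by (rule star_gen.base, rule UnI2, rule CollectI, intro exI conjI, rule refl)
  subgoal by (rule star_gen.add)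
  subgoal by (rule star_gen.scale)
  subgoal by (rule star_gen.mult)
  subgoal by (rule star_gen.adj)
  done

lemma stage_F0_induct [consumes 1, case_names one pp xa xb add smult mult adj]:
  assumes "x \<in> stage (F0 G) m"
    and "P \<one>\<^bsub>F0 G\<^esub>" "\<And>k. k \<ge> 1 \<Longrightarrow> P (fcls G (p_elt k))"
    and "\<And>X k. X \<in> G \<Longrightarrow> 1 \<le> k \<Longrightarrow> k \<le> m \<Longrightarrow> P (xa G (Gen X) k)"
    and "\<And>X k. X \<in> G \<Longrightarrow> 1 \<le> k \<Longrightarrow> k \<le> m \<Longrightarrow> P (xb G (Gen X) k)"
    and "\<And>x y. x \<in> carrier (F0 G) \<Longrightarrow> y \<in> carrier (F0 G) \<Longrightarrow> P x \<Longrightarrow> P y \<Longrightarrow> P (x \<oplus>\<^bsub>F0 G\<^esub> y)"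
    and "\<And>x c. x \<in> carrier (F0 G) \<Longrightarrow> P x \<Longrightarrow> P (c \<odot>\<^bsub>F0 G\<^esub> x)"
    and "\<And>x y. x \<in> carrier (F0 G) \<Longrightarrow> y \<in> carrier (F0 G) \<Longrightarrow> P x \<Longrightarrow> P y \<Longrightarrow> P (x \<otimes>\<^bsub>F0 G\<^esub> y)"
    and "\<And>x. x \<in> carrier (F0 G) \<Longrightarrow> P x \<Longrightarrow> P (adj (F0 G) x)"
  shows "P x \<and> x \<in> carrier (F0 G)"
  using assms(1) unfolding stage_F0
proof (induction rule: star_gen.induct)
  case one
  show ?case using assms(2) A.one_closed by (simp add: F0_simps)
next
  case (base s)
  then consider k where "k \<ge> 1" "s = fcls G (p_elt k)"
    | X k where "X \<in> G" "1 \<le> k" "k \<le> m" "s = xa G (Gen X) k"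
    | X k where "X \<in> G" "1 \<le> k" "k \<le> m" "s = xb G (Gen X) k" by (elim UnE CollectE exE conjE) metis+
  then show ?case
  proof cases
    case 1
    then show ?thesis using assms(3) pp_closed by auto
  next
    case 2
    then show ?thesis using assms(4) xa_closed[of "Gen X" G k] by auto
  next
    case 3
    then show ?thesis using assms(5) xb_closed[of "Gen X" G k] by auto
  qed
next
  case (add x y)
  then show ?case using assms(6)[of x y] A.a_closed[of x y] by (simp add: F0_simps)
next
  case (scale x c)
  then show ?case using assms(7)[of x c] A.smult_closed[of x c] by (simp add: F0_simps)
next
  case (mult x y)
  then show ?case using assms(8)[of x y] A.m_closed[of x y] by (simp add: F0_simps)
next
  case (adj x)
  then show ?case using assms(9)[of x] A.adj_closed[of x] by (simp add: F0_simps)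
qed

lemma stage_F0_zero: "\<zero>\<^bsub>F0 G\<^esub> \<in> stage (F0 G) m"
  using stage_F0_rules(6)[OF stage_F0_rules(1), of 0 m] by simp

lemma stage_F0_qq: "qq G n \<in> stage (F0 G) m"
proof (induction n)
  case 0
  then show ?case by (simp add: qq_0 stage_F0_zero)
next
  case (Suc n)
  then show ?case unfolding qq_Suc by (intro stage_F0_rules(5) stage_F0_rules(2)) auto
qed

lemma stage_F0_closed: "x \<in> stage (F0 G) m \<Longrightarrow> x \<in> carrier (F0 G)"
  using stage_F0_induct[of x m "\<lambda>_. True"] by blast

lemma stage_F0_mono:
  assumes "m \<le> n"
  shows "stage (F0 G) m \<subseteq> stage (F0 G) n"
proof
  fix x assume "x \<in> stage (F0 G) m"
  then have "x \<in> stage (F0 G) n \<and> x \<in> carrier (F0 G)"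
    by (induction x rule: stage_F0_induct)
      (blast intro: stage_F0_rules order_trans[OF _ assms])+
  then show "x \<in> stage (F0 G) n" ..
qed

lemma stage_F0_letters:
  assumes "l \<in> letters G" "1 \<le> k" "k \<le> m"
  shows "xa G l k \<in> stage (F0 G) m" "xb G l k \<in> stage (F0 G) m"
proof -
  obtain X where X: "X \<in> G" "l = Gen X \<or> l = Adj X" using assms(1) by blast
  have G: "Gen X \<in> letters G" using X by simp
  show "xa G l k \<in> stage (F0 G) m"
    using X(2) stage_F0_rules(3)[OF X(1) assms(2,3)] stage_F0_rules(8)[OF stage_F0_rules(3)[OF X(1) assms(2,3)]]
      xa_adj[OF G assms(2)] by auto
  show "xb G l k \<in> stage (F0 G) m"
    using X(2) stage_F0_rules(4)[OF X(1) assms(2,3)] stage_F0_rules(8)[OF stage_F0_rules(4)[OF X(1) assms(2,3)]]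
      xb_adj[OF G assms(2)] by auto
qed

lemma stage_F0_ex: "x \<in> carrier (F0 G) \<Longrightarrow> \<exists>m. x \<in> stage (F0 G) m"
proof (induction x rule: F0_induct)
  case one
  show ?case using stage_F0_rules(1) by blast
next
  case (xa l k)
  show ?case using stage_F0_letters(1)[OF xa order_refl] by blast
next
  case (xb l k)
  show ?case using stage_F0_letters(2)[OF xb order_refl] by blast
next
  case (pp k)
  show ?case using stage_F0_rules(2)[OF pp] by blast
next
  case (add x y)
  then obtain m n where "x \<in> stage (F0 G) m" "y \<in> stage (F0 G) n" by blast
  then have "x \<in> stage (F0 G) (max m n)" "y \<in> stage (F0 G) (max m n)"
    using stage_F0_mono[of m "max m n"] stage_F0_mono[of n "max m n"] by auto
  then show ?case using stage_F0_rules(5) by blast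
next
  case (smult x c)
  then show ?case using stage_F0_rules(6) by blast
next
  case (mult x y)
  then obtain m n where "x \<in> stage (F0 G) m" "y \<in> stage (F0 G) n" by blast
  then have "x \<in> stage (F0 G) (max m n)" "y \<in> stage (F0 G) (max m n)"
    using stage_F0_mono[of m "max m n"] stage_F0_mono[of n "max m n"] by auto
  then show ?case using stage_F0_rules(7) by blast
qed

lemma F0_q_separated:
  assumes "i < j"
  obtains \<chi> where "\<chi> \<in> alg_hom (F0 G) complex_star" "\<chi> (F0_q G i) = 0" "\<chi> (F0_q G j) = 1"
proof -
  obtain a where a: "i = enat a" using assms by (cases i) auto
  obtain \<chi> where \<chi>: "\<chi> \<in> alg_hom (F0 G) complex_star" "\<And>k. \<chi> (qq G k) = (if Suc a \<le> k then 1 else 0)"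
    using F0_character[of "Suc a" G] by auto
  have "\<chi> (F0_q G j) = 1"
  proof (cases j)
    case (enat b)
    then show ?thesis using assms a \<chi>(2) by simp
  next
    case infinity
    then show ?thesis using alg_homD(6)[OF \<chi>(1)] by simp
  qed
  with \<chi> a that show ?thesis by auto
qed

lemma F0_q_mult: "F0_q G i \<otimes>\<^bsub>F0 G\<^esub> F0_q G j = F0_q G (min i j)"
proof (cases i)
  case i: (enat a)
  show ?thesis
  proof (cases j)
    case (enat b)
    then show ?thesis using i qq_mult[of G a b] by (simp add: min_def split: if_splits)
  qed (simp add: i A.r_one[OF qq_closed])
next
  case i: infinity
  show ?thesis
  proof (cases j)
    case (enat b)
    then show ?thesis using i by (simp add: A.l_one[OF qq_closed])
  qed (simp add: i A.l_one[OF A.one_closed])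
qed

lemma F0_q_closed [simp, intro]: "F0_q G i \<in> carrier (F0 G)"
  by (cases i) (auto intro: qq_closed A.one_closed)

lemma F0_q_adj: "adj (F0 G) (F0_q G i) = F0_q G i"
  by (cases i) (simp_all add: qq_adj A.adj_one)

text \<open>Since x q_N = 0, the scalar at infinity gives x = c (1 - q_N). Multiplication by q_(N+1)
  leaves c p_(N+1), and a character with value 1 on p_(N+1) forces c = 0.\<close>

lemma F0_separating:
  assumes x: "x \<in> carrier (F0 G)" and z: "\<And>n. x \<otimes>\<^bsub>F0 G\<^esub> qq G n = \<zero>\<^bsub>F0 G\<^esub>"
  shows "x = \<zero>\<^bsub>F0 G\<^esub>"
proof -
  interpret C: star_algebra complex_star by (rule star_algebra_complex_star)
  let ?R = "\<lambda>n. \<one>\<^bsub>F0 G\<^esub> \<ominus>\<^bsub>F0 G\<^esub> qq G n"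
  have R: "?R n \<in> carrier (F0 G)" for n by (rule A.minus_closed[OF A.one_closed qq_closed])
  obtain c N where c: "x \<otimes>\<^bsub>F0 G\<^esub> ?R N = c \<odot>\<^bsub>F0 G\<^esub> ?R N" using F0_scalar_at_infinity[OF x] by blast
  have xR: "x = c \<odot>\<^bsub>F0 G\<^esub> ?R N"
    using c A.minus_mult_r[OF A.one_closed qq_closed x, of N] z[of N] A.r_one[OF x] A.minus_zero_r[OF x] by simp
  have "\<zero>\<^bsub>F0 G\<^esub> = c \<odot>\<^bsub>F0 G\<^esub> (?R N \<otimes>\<^bsub>F0 G\<^esub> qq G (Suc N))"
    using z[of "Suc N"] A.smult_mult_l[OF R qq_closed] unfolding xR by metis
  also have "?R N \<otimes>\<^bsub>F0 G\<^esub> qq G (Suc N) = qq G (Suc N) \<ominus>\<^bsub>F0 G\<^esub> qq G N"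
    by (simp add: qq_mult A.minus_mult_l[OF A.one_closed qq_closed qq_closed] A.l_one[OF qq_closed])
  finally have e: "c \<odot>\<^bsub>F0 G\<^esub> (qq G (Suc N) \<ominus>\<^bsub>F0 G\<^esub> qq G N) = \<zero>\<^bsub>F0 G\<^esub>" by simp
  obtain \<chi> where \<chi>: "\<chi> \<in> alg_hom (F0 G) complex_star" "\<And>k. \<chi> (qq G k) = (if Suc N \<le> k then 1 else 0)"
    using F0_character[of "Suc N" G] by auto
  have "\<chi> (c \<odot>\<^bsub>F0 G\<^esub> (qq G (Suc N) \<ominus>\<^bsub>F0 G\<^esub> qq G N)) = c"
    by (simp add: alg_homD(4)[OF \<chi>(1) A.minus_closed[OF qq_closed qq_closed]] \<chi>(2)
      linear_map_minus[OF A.complex_alg_axioms C.complex_alg_axioms alg_homD(1)[OF \<chi>(1)] qq_closed qq_closed])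
  moreover have "\<chi> \<zero>\<^bsub>F0 G\<^esub> = 0"
    using linear_map_zero[OF A.complex_alg_axioms C.complex_alg_axioms alg_homD(1)[OF \<chi>(1)]] by simp
  ultimately have "c = 0" using e by simp
  then show ?thesis using xR A.smult_zero_l[OF R] by simp
qed

text \<open>Generators X'(k), X''(k) with k \<le> m are absorbed by q_n on both sides for n > m, and
  the p_k commute with the whole chain.\<close>

lemma stage_F0_commute:
  assumes "x \<in> stage (F0 G) m" "m < n"
  shows "x \<otimes>\<^bsub>F0 G\<^esub> qq G n = qq G n \<otimes>\<^bsub>F0 G\<^esub> x"
proof -
  have "x \<otimes>\<^bsub>F0 G\<^esub> qq G n = qq G n \<otimes>\<^bsub>F0 G\<^esub> x \<and> x \<in> carrier (F0 G)" using assms(1)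
  proof (induction x rule: stage_F0_induct)
    case one
    show ?case using A.l_one[OF qq_closed] A.r_one[OF qq_closed] by simp
  next
    case (pp k)
    show ?case by (simp only: qq_pp[OF pp])
  next
    case (xa X k)
    then have "Gen X \<in> letters G" "k < n" using assms(2) by auto
    then show ?case using qq_x(1,3)[of "Gen X" G k n] xa by simp
  next
    case (xb X k)
    then have "Gen X \<in> letters G" "k < n" using assms(2) by auto
    then show ?case using qq_x(2,4)[of "Gen X" G k n] xb by simp
  next
    case (add x y)
    show ?case by (simp only: A.l_distr[OF add(1,2) qq_closed] A.r_distr[OF add(1,2) qq_closed] add(3,4))
  next
    case (smult x c)
    show ?case by (simp only: A.smult_mult_l[OF smult(1) qq_closed] A.smult_mult_r[OF qq_closed smult(1)] smult(2))
  next
    case (mult x y)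
    have "x \<otimes>\<^bsub>F0 G\<^esub> y \<otimes>\<^bsub>F0 G\<^esub> qq G n = x \<otimes>\<^bsub>F0 G\<^esub> (qq G n \<otimes>\<^bsub>F0 G\<^esub> y)"
      by (simp only: A.m_assoc[OF mult(1,2) qq_closed] mult(4))
    also have "\<dots> = qq G n \<otimes>\<^bsub>F0 G\<^esub> x \<otimes>\<^bsub>F0 G\<^esub> y"
      by (simp only: A.m_assoc[OF mult(1) qq_closed mult(2), symmetric] mult(3))
    also have "\<dots> = qq G n \<otimes>\<^bsub>F0 G\<^esub> (x \<otimes>\<^bsub>F0 G\<^esub> y)" by (rule A.m_assoc[OF qq_closed mult(1,2)])
    finally show ?case .
  next
    case (adj x)
    show ?case using arg_cong[OF adj(2), of "adj (F0 G)"]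
      by (simp only: qq_adj A.adj_mult[OF adj(1) qq_closed] A.adj_mult[OF qq_closed adj(1)])
  qed
  then show ?thesis ..
qed

lemma mtower_F0: "mtower (F0 G)"
proof (rule mtower.intro[OF star_algebra_F0], unfold_locales, goal_cases)
  case (1 x m) then show ?case by (rule stage_F0_closed)
next
  case (2 m) show ?case by (rule stage_F0_rules)
next
  case (3 x m y) then show ?case by (rule stage_F0_rules)
next
  case (4 x m c) then show ?case by (rule stage_F0_rules)
next
  case (5 x m y) then show ?case by (rule stage_F0_rules)
next
  case (6 x m) then show ?case by (rule stage_F0_rules)
next
  case (7 m n) then show ?case by (rule stage_F0_mono)
next
  case (8 x) then show ?case by (rule stage_F0_ex)
next
  case (9 i) show ?case by (cases i) (simp_all add: F0_simps(8) stage_F0_qq stage_F0_rules(1))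
next
  case (10 i) show ?case using F0_q_adj by (simp add: F0_simps(8))
next
  case (11 i j) show ?case using F0_q_mult by (simp add: F0_simps(8))
next
  case 12 show ?case using qq_0 by (simp add: F0_simps(8) zero_enat_def)
next
  case 13 show ?case by (simp add: F0_simps(8))
next
  case 14
  have neq: "F0_q G i \<noteq> F0_q G j" if ij: "i < j" for i j
  proof -
    obtain \<chi> where "\<chi> (F0_q G i) = (0::complex)" "\<chi> (F0_q G j) = 1" by (rule F0_q_separated[OF ij])
    then show ?thesis by auto
  qed
  show ?case unfolding F0_simps(8)
  proof (rule injI)
    fix i j assume e: "F0_q G i = F0_q G j"
    show "i = j"
      using neq[of i j] neq[of j i] e by (cases i j rule: linorder_cases) auto
  qed
next
  case (15 x m n) show ?case unfolding F0_simps(8) F0_q_simps by (rule stage_F0_commute[OF 15])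
next
  case (16 x)
  show ?case by (rule F0_separating[OF 16(1)]) (use 16(2) in \<open>simp add: F0_simps(8)\<close>)
qed

section \<open>The tower on the tensor square\<close>

lemma star_algebra_F0F0: "star_algebra (F0F0 G)"
  by (rule star_algebra_cong[OF star_algebra_tensor[OF star_algebra_F0 star_algebra_F0]])
    (simp_all add: tensor_tower_simps)

interpretation T: star_algebra "F0F0 G" by (rule star_algebra_F0F0)

lemmas tt_closed [simp, intro] = tens_closed[OF star_algebra_F0 star_algebra_F0, folded tensor_tower_simps]
lemmas tt_add_l = tens_add_l[OF star_algebra_F0 star_algebra_F0, folded tensor_tower_simps]
lemmas tt_add_r = tens_add_r[OF star_algebra_F0 star_algebra_F0, folded tensor_tower_simps]
lemmas tt_smult_l = tens_smult_l[OF star_algebra_F0 star_algebra_F0, folded tensor_tower_simps]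
lemmas tt_smult_r = tens_smult_r[OF star_algebra_F0 star_algebra_F0, folded tensor_tower_simps]
lemmas tt_mult = tens_mult[OF star_algebra_F0 star_algebra_F0, folded tensor_tower_simps]
lemmas tt_adj = tens_adj[OF star_algebra_F0 star_algebra_F0, folded tensor_tower_simps]
lemmas tt_one = tens_one[OF star_algebra_F0 star_algebra_F0, folded tensor_tower_simps]
lemmas tt_zero_l = tens_zero_l[OF star_algebra_F0 star_algebra_F0, folded tensor_tower_simps]
lemmas tt_zero_r = tens_zero_r[OF star_algebra_F0 star_algebra_F0, folded tensor_tower_simps]
lemmas tt_induct [consumes 1, case_names tens add] = tensor_induct[OF star_algebra_F0 star_algebra_F0, folded tensor_tower_simps]

lemma tt_lift_linear:
  assumes "complex_alg E" "\<And>a b. a \<in> carrier (F0 G) \<Longrightarrow> b \<in> carrier (F0 G) \<Longrightarrow> F a b \<in> carrier E"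
    and "\<And>a. a \<in> carrier (F0 G) \<Longrightarrow> F a \<in> linear_map (F0 G) E"
    and "\<And>b. b \<in> carrier (F0 G) \<Longrightarrow> (\<lambda>a. F a b) \<in> linear_map (F0 G) E"
  obtains h where "h \<in> linear_map (F0F0 G) E"
    "\<And>a b. a \<in> carrier (F0 G) \<Longrightarrow> b \<in> carrier (F0 G) \<Longrightarrow> h (tt G a b) = F a b"
proof (rule tensor_lift_linear[OF star_algebra_F0[of G] star_algebra_F0[of G] assms(1), of F])
  fix h assume h: "h \<in> linear_map (tensor (F0 G) (F0 G)) E"
    "\<And>a b. a \<in> carrier (F0 G) \<Longrightarrow> b \<in> carrier (F0 G) \<Longrightarrow> h (tt G a b) = F a b"
  have "h \<in> linear_map (F0F0 G) E" using h(1) by (simp add: linear_map_def tensor_tower_simps)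
  with h(2) show thesis using that by blast
qed (use assms(2-4) in auto)

lemma stage_T_rules:
  "a \<in> stage (F0 G) m \<Longrightarrow> b \<in> stage (F0 G) m \<Longrightarrow> tt G a b \<in> stage (F0F0 G) m"
  "x \<in> stage (F0F0 G) m \<Longrightarrow> y \<in> stage (F0F0 G) m \<Longrightarrow> x \<oplus>\<^bsub>F0F0 G\<^esub> y \<in> stage (F0F0 G) m"
  "x \<in> stage (F0F0 G) m \<Longrightarrow> c \<odot>\<^bsub>F0F0 G\<^esub> x \<in> stage (F0F0 G) m"
  "\<zero>\<^bsub>F0F0 G\<^esub> \<in> stage (F0F0 G) m"
  unfolding tensor_tower_simps by (auto intro: lin_span.intros)

lemma stage_T_induct [consumes 1, case_names zero tens add smult]:
  assumes "x \<in> stage (F0F0 G) m"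
    and "P \<zero>\<^bsub>F0F0 G\<^esub>" "\<And>a b. a \<in> stage (F0 G) m \<Longrightarrow> b \<in> stage (F0 G) m \<Longrightarrow> P (tt G a b)"
    and "\<And>x y. x \<in> carrier (F0F0 G) \<Longrightarrow> y \<in> carrier (F0F0 G) \<Longrightarrow> P x \<Longrightarrow> P y \<Longrightarrow> P (x \<oplus>\<^bsub>F0F0 G\<^esub> y)"
    and "\<And>x c. x \<in> carrier (F0F0 G) \<Longrightarrow> P x \<Longrightarrow> P (c \<odot>\<^bsub>F0F0 G\<^esub> x)"
  shows "P x \<and> x \<in> carrier (F0F0 G)"
  using assms(1) unfolding tensor_tower_simps(8)
proof (induction rule: lin_span.induct)
  case zero
  show ?case using assms(2) T.zero_closed by (simp add: tensor_tower_simps)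
next
  case (base s)
  then obtain a b where ab: "a \<in> stage (F0 G) m" "b \<in> stage (F0 G) m" "s = tt G a b" by blast
  then show ?case using assms(3)[OF ab(1,2)] tt_closed[OF stage_F0_closed[OF ab(1)] stage_F0_closed[OF ab(2)]] by simp
next
  case (add x y)
  then show ?case using assms(4)[of x y] T.a_closed[of x y] by (simp add: tensor_tower_simps)
next
  case (scale x c)
  then show ?case using assms(5)[of x c] T.smult_closed[of x c] by (simp add: tensor_tower_simps)
qed

lemma stage_T_closed: "x \<in> stage (F0F0 G) m \<Longrightarrow> x \<in> carrier (F0F0 G)"
  using stage_T_induct[of x m "\<lambda>_. True"] by blast

lemma stage_T_mult:
  assumes "x \<in> stage (F0F0 G) m" "y \<in> stage (F0F0 G) m"
  shows "x \<otimes>\<^bsub>F0F0 G\<^esub> y \<in> stage (F0F0 G) m"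
proof -
  have yc: "y \<in> carrier (F0F0 G)" using assms(2) by (rule stage_T_closed)
  have *: "tt G a b \<otimes>\<^bsub>F0F0 G\<^esub> y \<in> stage (F0F0 G) m" if ab: "a \<in> stage (F0 G) m" "b \<in> stage (F0 G) m" for a b
  proof -
    note c = stage_F0_closed[OF ab(1)] stage_F0_closed[OF ab(2)]
    note tc = tt_closed[OF c]
    have "tt G a b \<otimes>\<^bsub>F0F0 G\<^esub> y \<in> stage (F0F0 G) m \<and> y \<in> carrier (F0F0 G)" using assms(2)
    proof (induction y rule: stage_T_induct)
      case zero
      show ?case unfolding T.r_null[OF tc] by (rule stage_T_rules)
    next
      case (tens a' b')
      show ?case unfolding tt_mult[OF c stage_F0_closed[OF tens(1)] stage_F0_closed[OF tens(2)]]
        by (intro stage_T_rules stage_F0_rules ab tens)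
    next
      case (add x y)
      then show ?case unfolding T.r_distr[OF add(1,2) tc] by (intro stage_T_rules)
    next
      case (smult x c)
      then show ?case unfolding T.smult_mult_r[OF tc smult(1)] by (intro stage_T_rules)
    qed
    then show ?thesis ..
  qed
  have "x \<otimes>\<^bsub>F0F0 G\<^esub> y \<in> stage (F0F0 G) m \<and> x \<in> carrier (F0F0 G)" using assms(1)
  proof (induction x rule: stage_T_induct)
    case zero
    show ?case unfolding T.l_null[OF yc] by (rule stage_T_rules)
  next
    case (tens a b)
    then show ?case by (rule *)
  next
    case (add x x')
    then show ?case unfolding T.l_distr[OF add(1,2) yc] by (intro stage_T_rules)
  next
    case (smult x c)
    then show ?case unfolding T.smult_mult_l[OF smult(1) yc] by (intro stage_T_rules)
  qed
  then show ?thesis ..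
qed

lemma stage_T_adj:
  assumes "x \<in> stage (F0F0 G) m"
  shows "adj (F0F0 G) x \<in> stage (F0F0 G) m"
proof -
  have "adj (F0F0 G) x \<in> stage (F0F0 G) m \<and> x \<in> carrier (F0F0 G)" using assms
  proof (induction x rule: stage_T_induct)
    case zero
    show ?case unfolding T.adj_zero by (rule stage_T_rules)
  next
    case (tens a b)
    show ?case unfolding tt_adj[OF stage_F0_closed[OF tens(1)] stage_F0_closed[OF tens(2)]]
      by (intro stage_T_rules stage_F0_rules tens)
  next
    case (add x x')
    then show ?case unfolding T.adj_add[OF add(1,2)] by (intro stage_T_rules)
  next
    case (smult x c)
    then show ?case unfolding T.adj_smult[OF smult(1)] by (intro stage_T_rules)
  qed
  then show ?thesis ..
qed

lemma stage_T_mono: "m \<le> n \<Longrightarrow> stage (F0F0 G) m \<subseteq> stage (F0F0 G) n"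
  unfolding tensor_tower_simps using stage_F0_mono[of m n]
  by (intro subsetI) (rule lin_span_mono, auto)

lemma stage_T_ex: "x \<in> carrier (F0F0 G) \<Longrightarrow> \<exists>m. x \<in> stage (F0F0 G) m"
proof (induction x rule: tt_induct)
  case (tens a b)
  then obtain m n where "a \<in> stage (F0 G) m" "b \<in> stage (F0 G) n" using stage_F0_ex by metis
  then have "a \<in> stage (F0 G) (max m n)" "b \<in> stage (F0 G) (max m n)"
    using stage_F0_mono[of m "max m n"] stage_F0_mono[of n "max m n"] by auto
  then show ?case using stage_T_rules(1) by blast
next
  case (add x y)
  then obtain m n where "x \<in> stage (F0F0 G) m" "y \<in> stage (F0F0 G) n" by blast
  then have "x \<in> stage (F0F0 G) (max m n)" "y \<in> stage (F0F0 G) (max m n)"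
    using stage_T_mono[of m "max m n"] stage_T_mono[of n "max m n"] by auto
  then show ?case using stage_T_rules(2) by blast
qed

lemma stage_T_commute:
  assumes "x \<in> stage (F0F0 G) m" "m < n"
  shows "x \<otimes>\<^bsub>F0F0 G\<^esub> tt G (qq G n) (qq G n) = tt G (qq G n) (qq G n) \<otimes>\<^bsub>F0F0 G\<^esub> x"
proof -
  let ?Q = "tt G (qq G n) (qq G n)"
  have Q: "?Q \<in> carrier (F0F0 G)" by (rule tt_closed[OF qq_closed qq_closed])
  have "x \<otimes>\<^bsub>F0F0 G\<^esub> ?Q = ?Q \<otimes>\<^bsub>F0F0 G\<^esub> x \<and> x \<in> carrier (F0F0 G)" using assms(1)
  proof (induction x rule: stage_T_induct)
    case zero
    show ?case using T.l_null[OF Q] T.r_null[OF Q] by simp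
  next
    case (tens a b)
    note c = stage_F0_closed[OF tens(1)] stage_F0_closed[OF tens(2)]
    show ?case using stage_F0_commute[OF tens(1) assms(2)] stage_F0_commute[OF tens(2) assms(2)]
      by (simp add: tt_mult[OF c qq_closed qq_closed] tt_mult[OF qq_closed qq_closed c])
  next
    case (add x y)
    then show ?case using T.l_distr[OF add(1,2) Q] T.r_distr[OF add(1,2) Q] by simp
  next
    case (smult x c)
    then show ?case using T.smult_mult_l[OF smult(1) Q] T.smult_mult_r[OF Q smult(1)] by simp
  qed
  then show ?thesis ..
qed

text \<open>In the second leg every element is a scalar at infinity, so \<open>w\<close> takes the
  form a \<otimes> (1 - q_N) for a single \<open>a\<close>. Multiplying by 1 \<otimes> q_(N+1) and
  evaluating the second leg with a character isolates \<open>a\<close>, which must vanish.\<close>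

lemma T_separating_r:
  assumes w: "w \<in> carrier (F0F0 G)" and z: "\<And>j. w \<otimes>\<^bsub>F0F0 G\<^esub> tt G \<one>\<^bsub>F0 G\<^esub> (qq G j) = \<zero>\<^bsub>F0F0 G\<^esub>"
  shows "w = \<zero>\<^bsub>F0F0 G\<^esub>"
proof -
  let ?R = "\<lambda>n. \<one>\<^bsub>F0 G\<^esub> \<ominus>\<^bsub>F0 G\<^esub> qq G n" and ?I = "\<one>\<^bsub>F0 G\<^esub>"
  have R: "?R n \<in> carrier (F0 G)" for n by (rule A.minus_closed[OF A.one_closed qq_closed])
  note I = A.one_closed
  have tR: "tt G ?I (?R n) \<in> carrier (F0F0 G)" for n by (rule tt_closed[OF I R])
  have "\<exists>a N. a \<in> carrier (F0 G) \<and> (\<forall>n\<ge>N. w \<otimes>\<^bsub>F0F0 G\<^esub> tt G ?I (?R n) = tt G a (?R n))"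
    using w
  proof (induction w rule: tt_induct)
    case (tens a b)
    obtain c N where c: "\<And>n. n \<ge> N \<Longrightarrow> b \<otimes>\<^bsub>F0 G\<^esub> ?R n = c \<odot>\<^bsub>F0 G\<^esub> ?R n"
      using F0_scalar_at_infinity[OF tens(2)] by blast
    have "tt G a b \<otimes>\<^bsub>F0F0 G\<^esub> tt G ?I (?R n) = tt G (c \<odot>\<^bsub>F0 G\<^esub> a) (?R n)" if "n \<ge> N" for n
      unfolding tt_mult[OF tens I R] c[OF that] A.r_one[OF tens(1)] tt_smult_l[OF tens(1) R] tt_smult_r[OF tens(1) R] ..
    then show ?case using A.smult_closed[OF tens(1)] by blast
  next
    case (add x y)
    then obtain a N b N' where ab: "a \<in> carrier (F0 G)" "\<And>n. n \<ge> N \<Longrightarrow> x \<otimes>\<^bsub>F0F0 G\<^esub> tt G ?I (?R n) = tt G a (?R n)"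
      "b \<in> carrier (F0 G)" "\<And>n. n \<ge> N' \<Longrightarrow> y \<otimes>\<^bsub>F0F0 G\<^esub> tt G ?I (?R n) = tt G b (?R n)" by blast
    have "(x \<oplus>\<^bsub>F0F0 G\<^esub> y) \<otimes>\<^bsub>F0F0 G\<^esub> tt G ?I (?R n) = tt G (a \<oplus>\<^bsub>F0 G\<^esub> b) (?R n)" if "n \<ge> max N N'" for n
      using that ab(2)[of n] ab(4)[of n] unfolding T.l_distr[OF add(1,2) tR] tt_add_l[OF ab(1,3) R] by simp
    then show ?case using A.a_closed[OF ab(1,3)] by blast
  qed
  then obtain a N where a: "a \<in> carrier (F0 G)" "w \<otimes>\<^bsub>F0F0 G\<^esub> tt G ?I (?R N) = tt G a (?R N)" by blast
  have "tt G ?I ?I = tt G ?I (qq G N) \<oplus>\<^bsub>F0F0 G\<^esub> tt G ?I (?R N)"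
    using tt_add_r[OF I qq_closed R, of N N] qq_decompose[of G N] by simp
  then have "w = w \<otimes>\<^bsub>F0F0 G\<^esub> tt G ?I (qq G N) \<oplus>\<^bsub>F0F0 G\<^esub> w \<otimes>\<^bsub>F0F0 G\<^esub> tt G ?I (?R N)"
    using T.r_distr[OF tt_closed[OF I qq_closed] tR w, of N N] T.r_one[OF w] tt_one by metis
  then have wa: "w = tt G a (?R N)" unfolding z a(2) T.l_zero[OF tt_closed[OF a(1) R]] .
  have "\<zero>\<^bsub>F0F0 G\<^esub> = tt G a (?R N \<otimes>\<^bsub>F0 G\<^esub> qq G (Suc N))"
    using z[of "Suc N"] unfolding wa tt_mult[OF a(1) R I qq_closed] A.r_one[OF a(1)] by simp
  also have "?R N \<otimes>\<^bsub>F0 G\<^esub> qq G (Suc N) = qq G (Suc N) \<ominus>\<^bsub>F0 G\<^esub> qq G N"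
    by (simp add: qq_mult A.minus_mult_l[OF A.one_closed qq_closed qq_closed] A.l_one[OF qq_closed])
  finally have e: "tt G a (qq G (Suc N) \<ominus>\<^bsub>F0 G\<^esub> qq G N) = \<zero>\<^bsub>F0F0 G\<^esub>" by simp
  interpret C: star_algebra complex_star by (rule star_algebra_complex_star)
  obtain \<chi> where \<chi>: "\<chi> \<in> alg_hom (F0 G) complex_star" "\<And>k. \<chi> (qq G k) = (if Suc N \<le> k then 1 else 0)"
    using F0_character[of "Suc N" G] by auto
  have \<chi>d: "\<chi> (qq G (Suc N) \<ominus>\<^bsub>F0 G\<^esub> qq G N) = 1"
    by (simp add: \<chi>(2) linear_map_minus[OF A.complex_alg_axioms C.complex_alg_axioms alg_homD(1)[OF \<chi>(1)] qq_closed qq_closed])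
  note \<chi>l = alg_homD(3,4)[OF \<chi>(1)]
  obtain h where h: "h \<in> linear_map (F0F0 G) (F0 G)"
    "\<And>x y. x \<in> carrier (F0 G) \<Longrightarrow> y \<in> carrier (F0 G) \<Longrightarrow> h (tt G x y) = \<chi> y \<odot>\<^bsub>F0 G\<^esub> x"
    by (rule tt_lift_linear[OF A.complex_alg_axioms, of "\<lambda>x y. \<chi> y \<odot>\<^bsub>F0 G\<^esub> x"])
      (auto simp: linear_map_def \<chi>l A.smult_l_distr A.smult_r_distr A.smult_assoc mult.commute)
  have "a = \<zero>\<^bsub>F0 G\<^esub>"
    using h(2)[OF a(1) A.minus_closed[OF qq_closed qq_closed], of "Suc N" N]
      linear_map_zero[OF T.complex_alg_axioms A.complex_alg_axioms h(1)] A.smult_one[OF a(1)]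
    unfolding e \<chi>d by simp
  then show ?thesis using wa tt_zero_l[OF R] by simp
qed

lemma T_separating_l:
  assumes w: "w \<in> carrier (F0F0 G)" and z: "\<And>j. w \<otimes>\<^bsub>F0F0 G\<^esub> tt G (qq G j) \<one>\<^bsub>F0 G\<^esub> = \<zero>\<^bsub>F0F0 G\<^esub>"
  shows "w = \<zero>\<^bsub>F0F0 G\<^esub>"
proof -
  let ?R = "\<lambda>n. \<one>\<^bsub>F0 G\<^esub> \<ominus>\<^bsub>F0 G\<^esub> qq G n" and ?I = "\<one>\<^bsub>F0 G\<^esub>"
  have R: "?R n \<in> carrier (F0 G)" for n by (rule A.minus_closed[OF A.one_closed qq_closed])
  note I = A.one_closed
  have tR: "tt G (?R n) ?I \<in> carrier (F0F0 G)" for n by (rule tt_closed[OF R I])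
  have "\<exists>a N. a \<in> carrier (F0 G) \<and> (\<forall>n\<ge>N. w \<otimes>\<^bsub>F0F0 G\<^esub> tt G (?R n) ?I = tt G (?R n) a)"
    using w
  proof (induction w rule: tt_induct)
    case (tens b a)
    obtain c N where c: "\<And>n. n \<ge> N \<Longrightarrow> b \<otimes>\<^bsub>F0 G\<^esub> ?R n = c \<odot>\<^bsub>F0 G\<^esub> ?R n"
      using F0_scalar_at_infinity[OF tens(1)] by blast
    have "tt G b a \<otimes>\<^bsub>F0F0 G\<^esub> tt G (?R n) ?I = tt G (?R n) (c \<odot>\<^bsub>F0 G\<^esub> a)" if "n \<ge> N" for n
      unfolding tt_mult[OF tens R I] c[OF that] A.r_one[OF tens(2)] tt_smult_l[OF R tens(2)] tt_smult_r[OF R tens(2)] ..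
    then show ?case using A.smult_closed[OF tens(2)] by blast
  next
    case (add x y)
    then obtain a N b N' where ab: "a \<in> carrier (F0 G)" "\<And>n. n \<ge> N \<Longrightarrow> x \<otimes>\<^bsub>F0F0 G\<^esub> tt G (?R n) ?I = tt G (?R n) a"
      "b \<in> carrier (F0 G)" "\<And>n. n \<ge> N' \<Longrightarrow> y \<otimes>\<^bsub>F0F0 G\<^esub> tt G (?R n) ?I = tt G (?R n) b" by blast
    have "(x \<oplus>\<^bsub>F0F0 G\<^esub> y) \<otimes>\<^bsub>F0F0 G\<^esub> tt G (?R n) ?I = tt G (?R n) (a \<oplus>\<^bsub>F0 G\<^esub> b)" if "n \<ge> max N N'" for n
      using that ab(2)[of n] ab(4)[of n] unfolding T.l_distr[OF add(1,2) tR] tt_add_r[OF R ab(1,3)] by simp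
    then show ?case using A.a_closed[OF ab(1,3)] by blast
  qed
  then obtain a N where a: "a \<in> carrier (F0 G)" "w \<otimes>\<^bsub>F0F0 G\<^esub> tt G (?R N) ?I = tt G (?R N) a" by blast
  have "tt G ?I ?I = tt G (qq G N) ?I \<oplus>\<^bsub>F0F0 G\<^esub> tt G (?R N) ?I"
    using tt_add_l[OF qq_closed R I, of N N] qq_decompose[of G N] by simp
  then have "w = w \<otimes>\<^bsub>F0F0 G\<^esub> tt G (qq G N) ?I \<oplus>\<^bsub>F0F0 G\<^esub> w \<otimes>\<^bsub>F0F0 G\<^esub> tt G (?R N) ?I"
    using T.r_distr[OF tt_closed[OF qq_closed I] tR w, of N N] T.r_one[OF w] tt_one by metis
  then have wa: "w = tt G (?R N) a" unfolding z a(2) T.l_zero[OF tt_closed[OF R a(1)]] .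
  have "\<zero>\<^bsub>F0F0 G\<^esub> = tt G (?R N \<otimes>\<^bsub>F0 G\<^esub> qq G (Suc N)) a"
    using z[of "Suc N"] unfolding wa tt_mult[OF R a(1) qq_closed I] A.r_one[OF a(1)] by simp
  also have "?R N \<otimes>\<^bsub>F0 G\<^esub> qq G (Suc N) = qq G (Suc N) \<ominus>\<^bsub>F0 G\<^esub> qq G N"
    by (simp add: qq_mult A.minus_mult_l[OF A.one_closed qq_closed qq_closed] A.l_one[OF qq_closed])
  finally have e: "tt G (qq G (Suc N) \<ominus>\<^bsub>F0 G\<^esub> qq G N) a = \<zero>\<^bsub>F0F0 G\<^esub>" by simp
  interpret C: star_algebra complex_star by (rule star_algebra_complex_star)
  obtain \<chi> where \<chi>: "\<chi> \<in> alg_hom (F0 G) complex_star" "\<And>k. \<chi> (qq G k) = (if Suc N \<le> k then 1 else 0)"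
    using F0_character[of "Suc N" G] by auto
  have \<chi>d: "\<chi> (qq G (Suc N) \<ominus>\<^bsub>F0 G\<^esub> qq G N) = 1"
    by (simp add: \<chi>(2) linear_map_minus[OF A.complex_alg_axioms C.complex_alg_axioms alg_homD(1)[OF \<chi>(1)] qq_closed qq_closed])
  note \<chi>l = alg_homD(3,4)[OF \<chi>(1)]
  obtain h where h: "h \<in> linear_map (F0F0 G) (F0 G)"
    "\<And>x y. x \<in> carrier (F0 G) \<Longrightarrow> y \<in> carrier (F0 G) \<Longrightarrow> h (tt G x y) = \<chi> x \<odot>\<^bsub>F0 G\<^esub> y"
    by (rule tt_lift_linear[OF A.complex_alg_axioms, of "\<lambda>x y. \<chi> x \<odot>\<^bsub>F0 G\<^esub> y"])
      (auto simp: linear_map_def \<chi>l A.smult_l_distr A.smult_r_distr A.smult_assoc mult.commute)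
  have "a = \<zero>\<^bsub>F0 G\<^esub>"
    using h(2)[OF A.minus_closed[OF qq_closed qq_closed] a(1), of "Suc N" N]
      linear_map_zero[OF T.complex_alg_axioms A.complex_alg_axioms h(1)] A.smult_one[OF a(1)]
    unfolding e \<chi>d by simp
  then show ?thesis using wa tt_zero_r[OF R] by simp
qed

lemma T_separating:
  assumes w: "w \<in> carrier (F0F0 G)" and z: "\<And>n. w \<otimes>\<^bsub>F0F0 G\<^esub> tt G (qq G n) (qq G n) = \<zero>\<^bsub>F0F0 G\<^esub>"
  shows "w = \<zero>\<^bsub>F0F0 G\<^esub>"
proof (rule T_separating_l[OF w])
  fix i
  note I = A.one_closed and Q = qq_closed
  let ?w = "w \<otimes>\<^bsub>F0F0 G\<^esub> tt G (qq G i) \<one>\<^bsub>F0 G\<^esub>"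
  have wc: "?w \<in> carrier (F0F0 G)" by (rule T.m_closed[OF w tt_closed[OF Q I]])
  show "?w = \<zero>\<^bsub>F0F0 G\<^esub>"
  proof (rule T_separating_r[OF wc])
    fix j
    \<comment> \<open>Separating one leg after the other leads to q_i \<otimes> q_j, which lies
      below the diagonal projection q_n \<otimes> q_n for this n.\<close>
    let ?n = "max i j"
    have "tt G (qq G i) \<one>\<^bsub>F0 G\<^esub> \<otimes>\<^bsub>F0F0 G\<^esub> tt G \<one>\<^bsub>F0 G\<^esub> (qq G j) =
        tt G (qq G ?n) (qq G ?n) \<otimes>\<^bsub>F0F0 G\<^esub> tt G (qq G i) (qq G j)"
      by (simp add: tt_mult[OF Q I I Q] tt_mult[OF Q Q Q Q] A.l_one[OF Q] A.r_one[OF Q] qq_mult min_def)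
    then have "?w \<otimes>\<^bsub>F0F0 G\<^esub> tt G \<one>\<^bsub>F0 G\<^esub> (qq G j) =
        w \<otimes>\<^bsub>F0F0 G\<^esub> tt G (qq G ?n) (qq G ?n) \<otimes>\<^bsub>F0F0 G\<^esub> tt G (qq G i) (qq G j)"
      using T.m_assoc[OF w tt_closed[OF Q I] tt_closed[OF I Q]] T.m_assoc[OF w tt_closed[OF Q Q] tt_closed[OF Q Q]] by simp
    also have "\<dots> = \<zero>\<^bsub>F0F0 G\<^esub>" unfolding z by (rule T.l_null[OF tt_closed[OF Q Q]])
    finally show "?w \<otimes>\<^bsub>F0F0 G\<^esub> tt G \<one>\<^bsub>F0 G\<^esub> (qq G j) = \<zero>\<^bsub>F0F0 G\<^esub>" .
  qed
qed

lemma tproj_T: "tproj (F0F0 G) i = tt G (F0_q G i) (F0_q G i)"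
  by (simp add: tensor_tower_simps F0_simps(8))

lemma mtower_F0F0: "mtower (F0F0 G)"
proof (rule mtower.intro[OF star_algebra_F0F0], unfold_locales, goal_cases)
  case (1 x m) then show ?case by (rule stage_T_closed)
next
  case (2 m) show ?case unfolding tt_one[symmetric] by (intro stage_T_rules stage_F0_rules)
next
  case (3 x m y) then show ?case by (rule stage_T_rules)
next
  case (4 x m c) then show ?case by (rule stage_T_rules)
next
  case (5 x m y) then show ?case by (rule stage_T_mult)
next
  case (6 x m) then show ?case by (rule stage_T_adj)
next
  case (7 m n) then show ?case by (rule stage_T_mono)
next
  case (8 x) then show ?case by (rule stage_T_ex)
next
  case (9 i) show ?case unfolding tproj_T
    by (cases i) (auto intro!: stage_T_rules(1) stage_F0_qq stage_F0_rules(1))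
next
  case (10 i) show ?case by (simp add: tproj_T tt_adj F0_q_adj)
next
  case (11 i j) show ?case by (simp add: tproj_T tt_mult F0_q_mult)
next
  case 12 show ?case by (simp add: tproj_T zero_enat_def qq_0 tt_zero_l)
next
  case 13 show ?case by (simp add: tproj_T tt_one)
next
  case 14
  have neq: "tproj (F0F0 G) i \<noteq> tproj (F0F0 G) j" if ij: "i < j" for i j
  proof -
    obtain \<chi> where \<chi>: "\<chi> \<in> alg_hom (F0 G) complex_star" "\<chi> (F0_q G i) = 0" "\<chi> (F0_q G j) = 1"
      by (rule F0_q_separated[OF ij])
    have "linear_functional (F0 G) \<chi>" using alg_homD(1)[OF \<chi>(1)] by (simp add: linear_functional_iff)
    \<comment> \<open>The tensor square of one separating character separates the diagonal
      projections.\<close>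
    note f = tensor_functional(2)[OF star_algebra_F0 star_algebra_F0 this this, OF F0_q_closed F0_q_closed]
    show ?thesis using f[of i i] f[of j j] \<chi>(2,3) by (auto simp: tproj_T)
  qed
  show ?case
  proof (rule injI)
    fix i j assume e: "tproj (F0F0 G) i = tproj (F0F0 G) j"
    show "i = j"
      using neq[of i j] neq[of j i] e by (cases i j rule: linorder_cases) auto
  qed
next
  case (15 x m n) show ?case unfolding tproj_T F0_q_simps by (rule stage_T_commute[OF 15])
next
  case (16 x)
  show ?case by (rule T_separating[OF 16(1)]) (use 16(2) in \<open>simp add: tproj_T\<close>)
qed


section \<open>The comultiplication\<close>

text \<open>For k < m the factors q_k and q_(k-1) lie below q_m, so absorption by q_m \<otimes> q_m
  reduces to absorption of X'(k) and X''(k) by q_m. For m < k both factors are cut down to q_m, also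
  the smaller one since m \<le> k - 1, and then the images of X'(k) and X''(k) agree.\<close>

lemma comult0_exists:
  "\<exists>h. h \<in> star_hom (F0 G) (F0F0 G) \<and>
    (\<forall>l\<in>letters G. \<forall>k\<ge>1. h (xa G l k) = tt G (xa G l k) (qq G k) \<oplus>\<^bsub>F0F0 G\<^esub> tt G (qq G k) (xa G l k)) \<and>
    (\<forall>l\<in>letters G. \<forall>k\<ge>1.
       h (xb G l k) = tt G (xb G l k) (qq G (k - 1)) \<oplus>\<^bsub>F0F0 G\<^esub> tt G (qq G (k - 1)) (xb G l k)) \<and>
    (\<forall>k. h (qq G k) = tt G (qq G k) (qq G k))"
proof -
  note Q = qq_closed
  let ?u1 = "\<lambda>l k. tt G (xa G l k) (qq G k) \<oplus>\<^bsub>F0F0 G\<^esub> tt G (qq G k) (xa G l k)"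
  let ?u2 = "\<lambda>l k. tt G (xb G l k) (qq G (k - 1)) \<oplus>\<^bsub>F0F0 G\<^esub> tt G (qq G (k - 1)) (xb G l k)"
  let ?Q = "\<lambda>k. tt G (qq G k) (qq G k)"
  have QQ: "?Q m \<in> carrier (F0F0 G)" for m by (rule tt_closed[OF Q Q])
  have sum_l: "?Q m \<otimes>\<^bsub>F0F0 G\<^esub> (tt G x (qq G k) \<oplus>\<^bsub>F0F0 G\<^esub> tt G (qq G k) x) =
      tt G (qq G m \<otimes>\<^bsub>F0 G\<^esub> x) (qq G (min m k)) \<oplus>\<^bsub>F0F0 G\<^esub> tt G (qq G (min m k)) (qq G m \<otimes>\<^bsub>F0 G\<^esub> x)"
    if x: "x \<in> carrier (F0 G)" for x m k
    unfolding T.r_distr[OF tt_closed[OF x Q] tt_closed[OF Q x] QQ] tt_mult[OF Q Q x Q] tt_mult[OF Q Q Q x] qq_mult ..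
  have sum_r: "(tt G x (qq G k) \<oplus>\<^bsub>F0F0 G\<^esub> tt G (qq G k) x) \<otimes>\<^bsub>F0F0 G\<^esub> ?Q m =
      tt G (x \<otimes>\<^bsub>F0 G\<^esub> qq G m) (qq G (min m k)) \<oplus>\<^bsub>F0F0 G\<^esub> tt G (qq G (min m k)) (x \<otimes>\<^bsub>F0 G\<^esub> qq G m)"
    if x: "x \<in> carrier (F0 G)" for x m k
    unfolding T.l_distr[OF tt_closed[OF x Q] tt_closed[OF Q x] QQ] tt_mult[OF x Q Q Q] tt_mult[OF Q x Q Q] qq_mult
    by (simp add: min.commute)
  have sum_adj: "adj (F0F0 G) (tt G x (qq G k) \<oplus>\<^bsub>F0F0 G\<^esub> tt G (qq G k) x) =
      tt G (adj (F0 G) x) (qq G k) \<oplus>\<^bsub>F0F0 G\<^esub> tt G (qq G k) (adj (F0 G) x)" if x: "x \<in> carrier (F0 G)" for x k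
    unfolding T.adj_add[OF tt_closed[OF x Q] tt_closed[OF Q x]] tt_adj[OF x Q] tt_adj[OF Q x] qq_adj ..
  obtain h where h: "h \<in> alg_hom (F0 G) (F0F0 G)"
    "\<And>l k. l \<in> letters G \<Longrightarrow> k \<ge> 1 \<Longrightarrow> h (xa G l k) = ?u1 l k"
    "\<And>l k. l \<in> letters G \<Longrightarrow> k \<ge> 1 \<Longrightarrow> h (xb G l k) = ?u2 l k"
    "\<And>k. h (qq G k) = ?Q k"
  proof (rule F0_lift[where G = G and E = "F0F0 G" and ?u1.0 = ?u1 and ?u2.0 = ?u2 and Q = ?Q], goal_cases)
    case 1 show ?case by (rule T.complex_alg_axioms)
  next
    case (2 l k) then show ?case by (intro T.a_closed tt_closed xa_closed Q)
  next
    case (3 l k) then show ?case by (intro T.a_closed tt_closed xb_closed Q)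
  next
    case (4 m) show ?case by (rule QQ)
  next
    case 5 show ?case by (simp only: qq_0 tt_zero_l[OF A.zero_closed])
  next
    case (6 i j) show ?case by (simp only: tt_mult[OF Q Q Q Q] qq_mult)
  next
    case (7 l) show ?case
      unfolding xb_1[OF 7(2)] by (simp only: tt_zero_l[OF Q] tt_zero_r[OF Q] T.l_zero[OF T.zero_closed])
  next
    case (8 l k m)
    then have "min m k = k" by simp
    then show ?case unfolding sum_l[OF xa_closed[OF 8(2,3)]] qq_x[OF 8(2-4)] by simp
  next
    case (9 l k m)
    then have "min m (k - 1) = k - 1" by simp
    then show ?case unfolding sum_l[OF xb_closed[OF 9(2,3)]] qq_x[OF 9(2-4)] by simp
  next
    case (10 l k m)
    then have "min m k = k" by simp
    then show ?case unfolding sum_r[OF xa_closed[OF 10(2,3)]] qq_x[OF 10(2-4)] by simp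
  next
    case (11 l k m)
    then have "min m (k - 1) = k - 1" by simp
    then show ?case unfolding sum_r[OF xb_closed[OF 11(2,3)]] qq_x[OF 11(2-4)] by simp
  next
    case (12 l k m)
    then have "min m k = m" "min m (k - 1) = m" "1 \<le> k" by auto
    then show ?case unfolding sum_l[OF xa_closed[OF 12(2) \<open>1 \<le> k\<close>]] sum_l[OF xb_closed[OF 12(2) \<open>1 \<le> k\<close>]] qq_x_eq[OF 12(2,3)] by simp
  next
    case (13 l k m)
    then have "min m k = m" "min m (k - 1) = m" "1 \<le> k" by auto
    then show ?case unfolding sum_r[OF xa_closed[OF 13(2) \<open>1 \<le> k\<close>]] sum_r[OF xb_closed[OF 13(2) \<open>1 \<le> k\<close>]] qq_x_eq[OF 13(2,3)] by simp
  next
    case (14 h) then show ?case by blast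
  qed
  have "h \<in> star_hom (F0 G) (F0F0 G)"
  proof (rule alg_hom_F0_star[OF star_algebra_F0F0 h(1)])
    fix l k assume lk: "l \<in> letters G" "1 \<le> (k::nat)"
    then have f: "flip l \<in> letters G" by simp
    show "h (xa G (flip l) k) = adj (F0F0 G) (h (xa G l k))"
      unfolding h(2)[OF lk] h(2)[OF f lk(2)] sum_adj[OF xa_closed[OF lk]] xa_adj[OF lk] ..
    show "h (xb G (flip l) k) = adj (F0F0 G) (h (xb G l k))"
      unfolding h(3)[OF lk] h(3)[OF f lk(2)] sum_adj[OF xb_closed[OF lk]] xb_adj[OF lk] ..
  next
    fix k show "adj (F0F0 G) (h (qq G k)) = h (qq G k)"
      unfolding h(4) tt_adj[OF Q Q] qq_adj ..
  qed
  then show ?thesis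
    by (intro exI[of _ h] conjI ballI allI impI) (rule h(2) h(3) h(4) | assumption)+
qed

lemma comult0:
  shows "comult0 G \<in> star_hom (F0 G) (F0F0 G)"
    and "X \<in> G \<Longrightarrow> k \<ge> 1 \<Longrightarrow> comult0 G (xa G (Gen X) k) =
       tt G (xa G (Gen X) k) (qq G k) \<oplus>\<^bsub>F0F0 G\<^esub> tt G (qq G k) (xa G (Gen X) k)"
    and "X \<in> G \<Longrightarrow> k \<ge> 1 \<Longrightarrow> comult0 G (xb G (Gen X) k) =
       tt G (xb G (Gen X) k) (qq G (k - 1)) \<oplus>\<^bsub>F0F0 G\<^esub> tt G (qq G (k - 1)) (xb G (Gen X) k)"
    and "comult0 G (qq G k) = tt G (qq G k) (qq G k)"
proof -
  let ?P = "\<lambda>h. h \<in> extensional (carrier (F0 G)) \<and> h \<in> star_hom (F0 G) (F0F0 G) \<and>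
    (\<forall>X\<in>G. \<forall>k\<ge>1. h (xa G (Gen X) k) = tt G (xa G (Gen X) k) (qq G k) \<oplus>\<^bsub>F0F0 G\<^esub> tt G (qq G k) (xa G (Gen X) k)) \<and>
    (\<forall>X\<in>G. \<forall>k\<ge>1. h (xb G (Gen X) k) = tt G (xb G (Gen X) k) (qq G (k - 1)) \<oplus>\<^bsub>F0F0 G\<^esub> tt G (qq G (k - 1)) (xb G (Gen X) k)) \<and>
    (\<forall>k. h (qq G k) = tt G (qq G k) (qq G k))"
  obtain h where h: "h \<in> star_hom (F0 G) (F0F0 G)"
    "\<forall>l\<in>letters G. \<forall>k\<ge>1. h (xa G l k) = tt G (xa G l k) (qq G k) \<oplus>\<^bsub>F0F0 G\<^esub> tt G (qq G k) (xa G l k)"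
    "\<forall>l\<in>letters G. \<forall>k\<ge>1.
       h (xb G l k) = tt G (xb G l k) (qq G (k - 1)) \<oplus>\<^bsub>F0F0 G\<^esub> tt G (qq G (k - 1)) (xb G l k)"
    "\<forall>k. h (qq G k) = tt G (qq G k) (qq G k)"
    using comult0_exists by (elim exE conjE) (rule that)
  have hX: "h (xa G (Gen X) k) = tt G (xa G (Gen X) k) (qq G k) \<oplus>\<^bsub>F0F0 G\<^esub> tt G (qq G k) (xa G (Gen X) k)"
    "h (xb G (Gen X) k) = tt G (xb G (Gen X) k) (qq G (k - 1)) \<oplus>\<^bsub>F0F0 G\<^esub> tt G (qq G (k - 1)) (xb G (Gen X) k)"
    if "X \<in> G" "k \<ge> 1" for X k
    using h(2)[rule_format, of "Gen X" k] h(3)[rule_format, of "Gen X" k] that by auto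
  let ?h = "restrict h (carrier (F0 G))"
  have rs: "?h \<in> star_hom (F0 G) (F0F0 G)"
    using h(1) A.one_closed by (auto simp: star_hom_iff alg_hom_def linear_map_def)
  have "\<exists>!h. ?P h"
  proof (rule ex1I[of _ ?h])
    have "xa G (Gen X) k \<in> carrier (F0 G)" "xb G (Gen X) k \<in> carrier (F0 G)" "Gen X \<in> letters G"
      if "X \<in> G" "1 \<le> k" for X k
      using that xa_closed[of "Gen X" G k] xb_closed[of "Gen X" G k] by auto
    then show "?P ?h" using rs hX h(4) by simp
  next
    fix g assume g: "?P g"
    show "g = ?h"
    proof (rule extensionalityI[of _ "carrier (F0 G)"])
      fix x assume x: "x \<in> carrier (F0 G)"
      have "g x = h x"
        by (rule star_hom_F0_eqI[OF T.complex_alg_axioms _ h(1) _ _ _ x])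
          (use g hX h(4) in simp_all)
      then show "g x = ?h x" using x by simp
    qed (use g in auto)
  qed
  from theI'[OF this] have P: "?P (comult0 G)" unfolding comult0_def Let_def .
  show "comult0 G \<in> star_hom (F0 G) (F0F0 G)" using conjunct1[OF conjunct2[OF P]] .
  show "comult0 G (xa G (Gen X) k) = tt G (xa G (Gen X) k) (qq G k) \<oplus>\<^bsub>F0F0 G\<^esub> tt G (qq G k) (xa G (Gen X) k)"
    if "X \<in> G" "k \<ge> 1"
    using conjunct1[OF conjunct2[OF conjunct2[OF P]]] that by simp
  show "comult0 G (xb G (Gen X) k) = tt G (xb G (Gen X) k) (qq G (k - 1)) \<oplus>\<^bsub>F0F0 G\<^esub> tt G (qq G (k - 1)) (xb G (Gen X) k)"
    if "X \<in> G" "k \<ge> 1"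
    using conjunct1[OF conjunct2[OF conjunct2[OF conjunct2[OF P]]]] that by simp
  show "comult0 G (qq G k) = tt G (qq G k) (qq G k)"
    using conjunct2[OF conjunct2[OF conjunct2[OF conjunct2[OF P]]]] by (rule spec)
qed

lemma comult0_proj: "comult0 G (tproj (F0 G) i) = tproj (F0F0 G) i"
  using comult0(4) alg_homD(6)[OF star_hom_alg_hom[OF comult0(1)]]
  by (cases i) (simp_all add: tproj_T F0_simps(8) tt_one)

lemma comult0_stage:
  assumes "x \<in> stage (F0 G) m"
  shows "comult0 G x \<in> stage (F0F0 G) m"
proof -
  note d = alg_homD(2-6)[OF star_hom_alg_hom[OF comult0(1)]]
  note q = stage_F0_qq
  have "comult0 G x \<in> stage (F0F0 G) m \<and> x \<in> carrier (F0 G)" using assms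
  proof (induction x rule: stage_F0_induct)
    case one
    show ?case unfolding d(5) tt_one[symmetric] by (intro stage_T_rules stage_F0_rules)
  next
    case (pp k)
    have t: "tt G (qq G k) (qq G k) \<in> stage (F0F0 G) m" for k by (intro stage_T_rules q)
    have "comult0 G (fcls G (p_elt k)) = tt G (qq G k) (qq G k) \<ominus>\<^bsub>F0F0 G\<^esub> tt G (qq G (k - 1)) (qq G (k - 1))"
      unfolding pp_eq[OF pp] comult0(4)[symmetric]
      by (rule linear_map_minus[OF A.complex_alg_axioms T.complex_alg_axioms
            alg_homD(1)[OF star_hom_alg_hom[OF comult0(1)]] qq_closed qq_closed])
    also have "\<dots> \<in> stage (F0F0 G) m"
      unfolding T.minus_eq_smult[OF tt_closed[OF qq_closed qq_closed] tt_closed[OF qq_closed qq_closed]]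
      by (intro stage_T_rules q)
    finally show ?case .
  next
    case (xa X k)
    show ?case unfolding comult0(2)[OF xa(1,2)] by (intro stage_T_rules q stage_F0_rules xa)
  next
    case (xb X k)
    show ?case unfolding comult0(3)[OF xb(1,2)] by (intro stage_T_rules q stage_F0_rules xb)
  next
    case (add x y)
    then show ?case unfolding d(2)[OF add(1,2)] by (intro stage_T_rules)
  next
    case (smult x c)
    then show ?case unfolding d(3)[OF smult(1)] by (intro stage_T_rules)
  next
    case (mult x y)
    then show ?case unfolding d(4)[OF mult(1,2)] by (intro stage_T_mult)
  next
    case (adj x)
    then show ?case unfolding star_homD[OF comult0(1) adj(1)] by (intro stage_T_adj)
  qed
  then show ?thesis ..
qed

interpretation C: mtower "F0 G" by (rule mtower_F0)
interpretation D: mtower "F0F0 G" by (rule mtower_F0F0)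

lemma comult0_owmc:
  assumes "(y, f) \<in> owmc (F0 G)"
  shows "(\<lambda>m. comult0 G (y m), \<lambda>m. comult0 G (f m)) \<in> owmc (F0F0 G)"
proof -
  note o = C.owmcD[OF assms] and d = alg_homD(2-6)[OF star_hom_alg_hom[OF comult0(1)]]
  obtain \<iota> where \<iota>: "\<And>m. m \<ge> 1 \<Longrightarrow> f m = tproj (F0 G) (\<iota> m)" "\<And>m n. 1 \<le> m \<Longrightarrow> m \<le> n \<Longrightarrow> \<iota> m \<le> \<iota> n"
    "\<And>i::nat. \<forall>\<^sub>F n in sequentially. enat i \<le> \<iota> n" using C.msddE[OF o(3)] by metis
  have "msdd (F0F0 G) (\<lambda>m. comult0 G (f m))"
    by (rule D.msddI[of _ \<iota>]) (simp_all add: \<iota> comult0_proj)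
  moreover have "comult0 G (y n) \<otimes>\<^bsub>F0F0 G\<^esub> comult0 G (f m) = comult0 G (y m) \<otimes>\<^bsub>F0F0 G\<^esub> comult0 G (f m) \<and>
      adj (F0F0 G) (comult0 G (y n)) \<otimes>\<^bsub>F0F0 G\<^esub> comult0 G (f m) =
      adj (F0F0 G) (comult0 G (y m)) \<otimes>\<^bsub>F0F0 G\<^esub> comult0 G (f m)" if mn: "1 \<le> m" "m < n" for m n
  proof -
    have c: "y m \<in> carrier (F0 G)" "y n \<in> carrier (F0 G)" "f m \<in> carrier (F0 G)"
      using o(2)[of m] o(2)[of n] mn \<iota>(1)[of m] C.proj_closed by auto
    have mn': "m \<le> n" using mn by simp
    show ?thesis
      unfolding star_homD[OF comult0(1) c(1), symmetric] star_homD[OF comult0(1) c(2), symmetric]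
        d(4)[OF c(1,3), symmetric] d(4)[OF c(2,3), symmetric]
        d(4)[OF A.adj_closed[OF c(1)] c(3), symmetric] d(4)[OF A.adj_closed[OF c(2)] c(3), symmetric]
        o(4)[OF mn(1) mn'] o(5)[OF mn(1) mn'] by simp
  qed
  ultimately show ?thesis using comult0_stage o(1) by (simp add: owmc_def)
qed

text \<open>\<Delta> maps each projection of the chain to the one of the same index, so it preserves
  domains and eventual agreement, and the union over representatives collapses.\<close>

lemma comult_mcls:
  assumes x: "C.coherent x"
  shows "comult G (C.mcls x) = D.mcls (\<lambda>m. comult0 G (x m))"
  unfolding comult_def
proof (rule C.UN_mcls[OF x])
  fix y f assume y: "(y, f) \<in> owmc (F0 G)" "C.coherent y" "C.agree x y"
  note d = alg_homD(2-6)[OF star_hom_alg_hom[OF comult0(1)]]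
  have "D.agree (\<lambda>m. comult0 G (x m)) (\<lambda>m. comult0 G (y m))"
    unfolding D.agree_def
  proof
    fix i :: nat
    from y(3)[unfolded C.agree_def, THEN spec, of i] eventually_ge_at_top[of 1]
    show "\<forall>\<^sub>F n in sequentially.
        comult0 G (x n) \<otimes>\<^bsub>F0F0 G\<^esub> tproj (F0F0 G) (enat i) = comult0 G (y n) \<otimes>\<^bsub>F0F0 G\<^esub> tproj (F0F0 G) (enat i) \<and>
        adj (F0F0 G) (comult0 G (x n)) \<otimes>\<^bsub>F0F0 G\<^esub> tproj (F0F0 G) (enat i) =
        adj (F0F0 G) (comult0 G (y n)) \<otimes>\<^bsub>F0F0 G\<^esub> tproj (F0F0 G) (enat i)"
    proof eventually_elim
      case (elim n)
      have c: "x n \<in> carrier (F0 G)" "y n \<in> carrier (F0 G)"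
        using C.coherentD(2)[OF x elim(2)] C.coherentD(2)[OF y(2) elim(2)] .
      show ?case
        unfolding comult0_proj[symmetric] star_homD[OF comult0(1) c(1), symmetric] star_homD[OF comult0(1) c(2), symmetric]
          d(4)[OF c(1) C.proj_closed, symmetric] d(4)[OF c(2) C.proj_closed, symmetric]
          d(4)[OF A.adj_closed[OF c(1)] C.proj_closed, symmetric] d(4)[OF A.adj_closed[OF c(2)] C.proj_closed, symmetric]
        using elim(1) by simp
    qed
  qed
  then show "mco (F0F0 G) (\<lambda>m. comult0 G (y m)) (\<lambda>m. comult0 G (f m)) = D.mcls (\<lambda>m. comult0 G (x m))"
    unfolding D.mco_eq[OF comult0_owmc[OF y(1)]] by (rule D.mcls_eqI[OF D.agree_sym])
qed

end

section \<open>Free products\<close>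

lemma hom_relations_cases [consumes 1, case_names add mult smult adj one]:
  assumes "r \<in> hom_relations S A \<iota>"
  obtains a b where "a \<in> carrier A" "b \<in> carrier A"
      "r = letter (Gen (\<iota> (a \<oplus>\<^bsub>A\<^esub> b))) - (letter (Gen (\<iota> a)) + letter (Gen (\<iota> b)))"
    | a b where "a \<in> carrier A" "b \<in> carrier A"
      "r = letter (Gen (\<iota> (a \<otimes>\<^bsub>A\<^esub> b))) - letter (Gen (\<iota> a)) \<otimes>\<^bsub>free_alg S\<^esub> letter (Gen (\<iota> b))"
    | c a where "a \<in> carrier A"
      "r = letter (Gen (\<iota> (c \<odot>\<^bsub>A\<^esub> a))) - c \<odot>\<^bsub>free_alg S\<^esub> letter (Gen (\<iota> a))"
    | a where "a \<in> carrier A"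
      "r = letter (Gen (\<iota> (adj A a))) - adj (free_alg S) (letter (Gen (\<iota> a)))"
    | "r = letter (Gen (\<iota> \<one>\<^bsub>A\<^esub>)) - \<one>\<^bsub>free_alg S\<^esub>"
  using assms unfolding hom_relations_def Let_def
  by (elim UnE CollectE exE conjE singletonE) (rule that; assumption)+

lemma hom_relationsI:
  "a \<in> carrier A \<Longrightarrow> b \<in> carrier A \<Longrightarrow>
     letter (Gen (\<iota> (a \<oplus>\<^bsub>A\<^esub> b))) - (letter (Gen (\<iota> a)) + letter (Gen (\<iota> b))) \<in> hom_relations S A \<iota>"
  "a \<in> carrier A \<Longrightarrow> b \<in> carrier A \<Longrightarrow>
     letter (Gen (\<iota> (a \<otimes>\<^bsub>A\<^esub> b))) - letter (Gen (\<iota> a)) \<otimes>\<^bsub>free_alg S\<^esub> letter (Gen (\<iota> b)) \<in> hom_relations S A \<iota>"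
  "a \<in> carrier A \<Longrightarrow>
     letter (Gen (\<iota> (c \<odot>\<^bsub>A\<^esub> a))) - c \<odot>\<^bsub>free_alg S\<^esub> letter (Gen (\<iota> a)) \<in> hom_relations S A \<iota>"
  "a \<in> carrier A \<Longrightarrow>
     letter (Gen (\<iota> (adj A a))) - adj (free_alg S) (letter (Gen (\<iota> a))) \<in> hom_relations S A \<iota>"
  "letter (Gen (\<iota> \<one>\<^bsub>A\<^esub>)) - \<one>\<^bsub>free_alg S\<^esub> \<in> hom_relations S A \<iota>"
  unfolding hom_relations_def Let_def
  subgoal by (rule UnI1, rule UnI1, rule UnI1, rule UnI1, rule CollectI, intro exI conjI, rule refl; assumption)
  subgoal by (rule UnI1, rule UnI1, rule UnI1, rule UnI2, rule CollectI, intro exI conjI, rule refl; assumption)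
  subgoal by (rule UnI1, rule UnI1, rule UnI2, rule CollectI, intro exI conjI, rule refl; assumption)
  subgoal by (rule UnI1, rule UnI2, rule CollectI, intro exI conjI, rule refl; assumption)
  subgoal by (rule UnI2, rule singletonI)
  done

context
  fixes S :: "'s set" and A :: "('a, 'x) star_alg_scheme" and \<iota> :: "'a \<Rightarrow> 's"
  assumes A: "star_algebra A" and \<iota>: "\<And>a. a \<in> carrier A \<Longrightarrow> \<iota> a \<in> S"
begin

interpretation A: star_algebra A by (rule A)
interpretation F: star_algebra "free_alg S" by (rule star_algebra_free_alg)

lemma gen_closed: "a \<in> carrier A \<Longrightarrow> letter (Gen (\<iota> a)) \<in> carrier (free_alg S)"
  using \<iota>[of a] by simp

lemma free_alg_plus: "p + q = p \<oplus>\<^bsub>free_alg S\<^esub> q"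
  by simp

lemma hom_relations_closed: "hom_relations S A \<iota> \<subseteq> carrier (free_alg S)"
proof
  fix r assume "r \<in> hom_relations S A \<iota>"
  then show "r \<in> carrier (free_alg S)"
  proof (cases rule: hom_relations_cases)
    case (add a b)
    show ?thesis unfolding add(3) free_alg_plus
      by (intro free_alg_diff_closed F.a_closed gen_closed A.a_closed add)
  next
    case (mult a b)
    show ?thesis unfolding mult(3) by (intro free_alg_diff_closed F.m_closed gen_closed A.m_closed mult)
  next
    case (smult c a)
    show ?thesis unfolding smult(2) by (intro free_alg_diff_closed F.smult_closed gen_closed A.smult_closed smult)
  next
    case (adj a)
    show ?thesis unfolding adj(2) by (intro free_alg_diff_closed F.adj_closed gen_closed A.adj_closed adj)
  next
    case one
    show ?thesis unfolding one by (intro free_alg_diff_closed F.one_closed gen_closed A.one_closed)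
  qed
qed

lemma hom_relations_kill:
  assumes E: "star_algebra E" and e: "e \<in> star_hom (free_alg S) E"
    and h: "h \<in> star_hom A E" "\<And>a. a \<in> carrier A \<Longrightarrow> e (letter (Gen (\<iota> a))) = h a"
    and r: "r \<in> hom_relations S A \<iota>"
  shows "e r = \<zero>\<^bsub>E\<^esub>"
proof -
  interpret E: star_algebra E by fact
  note eh = alg_homD(2-6)[OF star_hom_alg_hom[OF e]] and hh = alg_homD(2-6)[OF star_hom_alg_hom[OF h(1)]]
  have d: "e (p - q) = e p \<ominus>\<^bsub>E\<^esub> e q" if c: "p \<in> carrier (free_alg S)" "q \<in> carrier (free_alg S)" for p q
    unfolding free_alg_minus[OF c, symmetric]
    by (rule linear_map_minus[OF F.complex_alg_axioms E.complex_alg_axioms alg_homD(1)[OF star_hom_alg_hom[OF e]] c])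
  from r show ?thesis
  proof (cases rule: hom_relations_cases)
    case (add a b)
    note g = gen_closed[OF add(1)] gen_closed[OF add(2)]
    show ?thesis unfolding add(3) free_alg_plus d[OF gen_closed[OF A.a_closed[OF add(1,2)]] F.a_closed[OF g]] eh(2)[OF g]
        h(2)[OF add(1)] h(2)[OF add(2)] h(2)[OF A.a_closed[OF add(1,2)]] hh(2)[OF add(1,2)]
      by (rule E.minus_self[OF E.a_closed[OF hh(1)[OF add(1)] hh(1)[OF add(2)]]])
  next
    case (mult a b)
    note g = gen_closed[OF mult(1)] gen_closed[OF mult(2)]
    show ?thesis unfolding mult(3) d[OF gen_closed[OF A.m_closed[OF mult(1,2)]] F.m_closed[OF g]] eh(4)[OF g]
        h(2)[OF mult(1)] h(2)[OF mult(2)] h(2)[OF A.m_closed[OF mult(1,2)]] hh(4)[OF mult(1,2)]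
      by (rule E.minus_self[OF E.m_closed[OF hh(1)[OF mult(1)] hh(1)[OF mult(2)]]])
  next
    case (smult c a)
    note g = gen_closed[OF smult(1)]
    show ?thesis unfolding smult(2) d[OF gen_closed[OF A.smult_closed[OF smult(1)]] F.smult_closed[OF g]] eh(3)[OF g]
        h(2)[OF smult(1)] h(2)[OF A.smult_closed[OF smult(1)]] hh(3)[OF smult(1)]
      by (rule E.minus_self[OF E.smult_closed[OF hh(1)[OF smult(1)]]])
  next
    case (adj a)
    note g = gen_closed[OF adj(1)]
    show ?thesis unfolding adj(2) d[OF gen_closed[OF A.adj_closed[OF adj(1)]] F.adj_closed[OF g]] star_homD[OF e g]
        h(2)[OF adj(1)] h(2)[OF A.adj_closed[OF adj(1)]] star_homD[OF h(1) adj(1)]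
      by (rule E.minus_self[OF E.adj_closed[OF hh(1)[OF adj(1)]]])
  next
    case one
    show ?thesis unfolding one d[OF gen_closed[OF A.one_closed] F.one_closed] h(2)[OF A.one_closed] hh(5) eh(5)
      by (rule E.minus_self[OF E.one_closed])
  qed
qed

lemma hom_relations_incl:
  assumes R: "R \<subseteq> carrier (free_alg S)" "hom_relations S A \<iota> \<subseteq> R"
  shows "(\<lambda>a. pres_class S R (letter (Gen (\<iota> a)))) \<in> star_hom A (presented S R)"
proof -
  interpret E: star_algebra "presented S R" by (rule star_algebra_presented[OF R(1)])
  let ?e = "pres_class S R"
  have e: "?e \<in> star_hom (free_alg S) (presented S R)" by (rule pres_class_star_hom[OF R(1)])
  note eh = alg_homD(2-6)[OF star_hom_alg_hom[OF e]]
  have d: "?e p = ?e q" if c: "p \<in> carrier (free_alg S)" "q \<in> carrier (free_alg S)" and r: "p - q \<in> hom_relations S A \<iota>" for p q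
  proof -
    have "?e p \<ominus>\<^bsub>presented S R\<^esub> ?e q = ?e (p - q)"
      unfolding free_alg_minus[OF c, symmetric]
      by (rule linear_map_minus[OF F.complex_alg_axioms E.complex_alg_axioms alg_homD(1)[OF star_hom_alg_hom[OF e]] c, symmetric])
    also have "\<dots> = \<zero>\<^bsub>presented S R\<^esub>" using r R(2) by (intro pres_class_rel[OF R(1)]) blast
    finally show ?thesis by (rule E.minus_eq_zeroD[OF eh(1)[OF c(1)] eh(1)[OF c(2)]])
  qed
  show ?thesis
    unfolding star_hom_iff alg_hom_def linear_map_def
  proof (intro conjI IntI CollectI ballI allI funcsetI)
    fix a assume a: "a \<in> carrier A"
    show "?e (letter (Gen (\<iota> a))) \<in> carrier (presented S R)" by (rule eh(1)[OF gen_closed[OF a]])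
    show "?e (letter (Gen (\<iota> (adj A a)))) = adj (presented S R) (?e (letter (Gen (\<iota> a))))"
      unfolding star_homD[OF e gen_closed[OF a], symmetric]
      by (rule d[OF gen_closed[OF A.adj_closed[OF a]] F.adj_closed[OF gen_closed[OF a]] hom_relationsI(4)[OF a]])
    fix c
    show "?e (letter (Gen (\<iota> (c \<odot>\<^bsub>A\<^esub> a)))) = c \<odot>\<^bsub>presented S R\<^esub> ?e (letter (Gen (\<iota> a)))"
      unfolding eh(3)[OF gen_closed[OF a], symmetric]
      by (rule d[OF gen_closed[OF A.smult_closed[OF a]] F.smult_closed[OF gen_closed[OF a]] hom_relationsI(3)[OF a]])
  next
    fix a b assume ab: "a \<in> carrier A" "b \<in> carrier A"
    note g = gen_closed[OF ab(1)] gen_closed[OF ab(2)]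
    show "?e (letter (Gen (\<iota> (a \<oplus>\<^bsub>A\<^esub> b)))) = ?e (letter (Gen (\<iota> a))) \<oplus>\<^bsub>presented S R\<^esub> ?e (letter (Gen (\<iota> b)))"
      unfolding eh(2)[OF g, symmetric]
      by (rule d[OF gen_closed[OF A.a_closed[OF ab]] F.a_closed[OF g]])
        (use hom_relationsI(1)[where S = S and \<iota> = \<iota>, OF ab] in simp)
    show "?e (letter (Gen (\<iota> (a \<otimes>\<^bsub>A\<^esub> b)))) = ?e (letter (Gen (\<iota> a))) \<otimes>\<^bsub>presented S R\<^esub> ?e (letter (Gen (\<iota> b)))"
      unfolding eh(4)[OF g, symmetric]
      by (rule d[OF gen_closed[OF A.m_closed[OF ab]] F.m_closed[OF g] hom_relationsI(2)[OF ab]])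
  next
    show "?e (letter (Gen (\<iota> \<one>\<^bsub>A\<^esub>))) = \<one>\<^bsub>presented S R\<^esub>"
      unfolding eh(5)[symmetric] by (rule d[OF gen_closed[OF A.one_closed] F.one_closed hom_relationsI(5)])
  qed
qed

end

context
  fixes A :: "('a, 'x) star_alg_scheme" and B :: "('b, 'y) star_alg_scheme"
  assumes A: "star_algebra A" and B: "star_algebra B"
begin

interpretation A: star_algebra A by (rule A)
interpretation B: star_algebra B by (rule B)

lemma Inl_gens: "a \<in> carrier A \<Longrightarrow> Inl a \<in> fp_gens A B" and Inr_gens: "b \<in> carrier B \<Longrightarrow> Inr b \<in> fp_gens A B"
  by (simp_all add: fp_gens_def)

lemma fp_rels_closed: "fp_rels A B \<subseteq> carrier (free_alg (fp_gens A B))"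
  unfolding fp_rels_def
  by (rule Un_least; rule hom_relations_closed[OF A Inl_gens] hom_relations_closed[OF B Inr_gens])

lemma star_algebra_free_product: "star_algebra (free_product A B)"
  unfolding free_product_def by (rule star_algebra_presented[OF fp_rels_closed])

interpretation P: star_algebra "free_product A B" by (rule star_algebra_free_product)

lemma fp_incl_l: "(\<lambda>a. fp_incl A B (Inl a)) \<in> star_hom A (free_product A B)"
  unfolding free_product_def fp_incl_def
  by (rule hom_relations_incl[OF A Inl_gens fp_rels_closed]) (simp_all add: fp_rels_def)

lemma fp_incl_r: "(\<lambda>b. fp_incl A B (Inr b)) \<in> star_hom B (free_product A B)"
  unfolding free_product_def fp_incl_def
  by (rule hom_relations_incl[OF B Inr_gens fp_rels_closed]) (simp_all add: fp_rels_def)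

lemma fp_gens_cases:
  assumes "s \<in> fp_gens A B"
  obtains a where "a \<in> carrier A" "s = Inl a" | b where "b \<in> carrier B" "s = Inr b"
  using assms unfolding fp_gens_def by blast

lemma fp_incl_closed: "s \<in> fp_gens A B \<Longrightarrow> fp_incl A B s \<in> carrier (free_product A B)"
  using alg_homD(2)[OF star_hom_alg_hom[OF fp_incl_l]] alg_homD(2)[OF star_hom_alg_hom[OF fp_incl_r]]
  by (auto elim: fp_gens_cases)

text \<open>The universal property of the free product: the relations express that the inclusions
  are homomorphisms, so they die under a pair of homomorphisms.\<close>

lemma fp_lift:
  assumes E: "star_algebra E" and h: "h1 \<in> star_hom A E" "h2 \<in> star_hom B E"
  shows "\<exists>h. h \<in> star_hom (free_product A B) E \<and> (\<forall>a\<in>carrier A. h (fp_incl A B (Inl a)) = h1 a) \<and>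
    (\<forall>b\<in>carrier B. h (fp_incl A B (Inr b)) = h2 b)"
proof -
  interpret E: star_algebra E by fact
  let ?S = "fp_gens A B"
  define f where "f l = (case l of Gen s \<Rightarrow> case_sum h1 h2 s | Adj s \<Rightarrow> adj E (case_sum h1 h2 s))" for l
  have g: "case_sum h1 h2 s \<in> carrier E" if "s \<in> ?S" for s
    using that alg_homD(2)[OF star_hom_alg_hom[OF h(1)]] alg_homD(2)[OF star_hom_alg_hom[OF h(2)]]
    by (auto elim: fp_gens_cases)
  have f: "f l \<in> carrier E" "f (flip l) = adj E (f l)" if "l \<in> letters ?S" for l
    using that g E.adj_closed E.adj_adj by (auto simp: f_def)
  have e: "free_lift E f \<in> star_hom (free_alg ?S) E"
    by (rule free_lift_star_hom[OF E.complex_alg_axioms _ E]) (rule f; assumption)+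
  have el: "free_lift E f (letter l) = f l" if "l \<in> letters ?S" for l
    by (rule free_lift_letter[OF E.complex_alg_axioms _ that]) (rule f)
  have l: "free_lift E f (letter (Gen (Inl a))) = h1 a" if "a \<in> carrier A" for a
    using el[of "Gen (Inl a)"] Inl_gens[OF that] by (simp add: f_def)
  have r: "free_lift E f (letter (Gen (Inr b))) = h2 b" if "b \<in> carrier B" for b
    using el[of "Gen (Inr b)"] Inr_gens[OF that] by (simp add: f_def)
  have kill: "free_lift E f x = \<zero>\<^bsub>E\<^esub>" if "x \<in> fp_rels A B" for x
    using that unfolding fp_rels_def
  proof (elim UnE)
    assume x: "x \<in> hom_relations ?S A Inl"
    show ?thesis by (rule hom_relations_kill[OF A _ E e h(1) _ x]) (rule Inl_gens l; assumption)+
  next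
    assume x: "x \<in> hom_relations ?S B Inr"
    show ?thesis by (rule hom_relations_kill[OF B _ E e h(2) _ x]) (rule Inr_gens r; assumption)+
  qed
  obtain k where k: "k \<in> star_hom (presented ?S (fp_rels A B)) E"
    "\<And>p. p \<in> carrier (free_alg ?S) \<Longrightarrow> k (pres_class ?S (fp_rels A B) p) = free_lift E f p"
    by (rule presented_lift_star_hom[OF fp_rels_closed E, of f]) (use f kill in blast)+
  have "k (fp_incl A B (Inl a)) = h1 a" if "a \<in> carrier A" for a
    unfolding fp_incl_def using k(2)[of "letter (Gen (Inl a))"] l[OF that] Inl_gens[OF that] by simp
  moreover have "k (fp_incl A B (Inr b)) = h2 b" if "b \<in> carrier B" for b
    unfolding fp_incl_def using k(2)[of "letter (Gen (Inr b))"] r[OF that] Inr_gens[OF that] by simp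
  ultimately show ?thesis using k(1) unfolding free_product_def by (intro exI[of _ k] conjI ballI)
qed

lemma fp_induct [consumes 1, case_names one incl add smult mult]:
  assumes z: "z \<in> carrier (free_product A B)"
    and one: "P \<one>\<^bsub>free_product A B\<^esub>"
    and incl: "\<And>s. s \<in> fp_gens A B \<Longrightarrow> P (fp_incl A B s)"
    and add: "\<And>x y. x \<in> carrier (free_product A B) \<Longrightarrow> y \<in> carrier (free_product A B) \<Longrightarrow> P x \<Longrightarrow> P y \<Longrightarrow> P (x \<oplus>\<^bsub>free_product A B\<^esub> y)"
    and smult: "\<And>x c. x \<in> carrier (free_product A B) \<Longrightarrow> P x \<Longrightarrow> P (c \<odot>\<^bsub>free_product A B\<^esub> x)"
    and mult: "\<And>x y. x \<in> carrier (free_product A B) \<Longrightarrow> y \<in> carrier (free_product A B) \<Longrightarrow> P x \<Longrightarrow> P y \<Longrightarrow> P (x \<otimes>\<^bsub>free_product A B\<^esub> y)"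
  shows "P z"
proof -
  let ?S = "fp_gens A B"
  have z': "z \<in> carrier (presented ?S (fp_rels A B))" using z by (simp add: free_product_def)
  show ?thesis using z'
  proof (induction z rule: presented_induct[OF fp_rels_closed, consumes 1, case_names one letter add smult mult])
    case (letter l)
    then obtain s where s: "s \<in> ?S" "l = Gen s \<or> l = Adj s" by blast
    have "letter (Gen s) \<in> carrier (free_alg ?S)" using s(1) by simp
    from star_homD[OF pres_class_star_hom[OF fp_rels_closed] this]
    have adj: "pres_class ?S (fp_rels A B) (letter (Adj s)) = adj (free_product A B) (fp_incl A B s)"
      by (simp add: fp_incl_def free_product_def)
    have "\<exists>t\<in>?S. adj (free_product A B) (fp_incl A B s) = fp_incl A B t"
      using s(1)
    proof (cases rule: fp_gens_cases)
      case (1 a)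
      then show ?thesis using star_homD[OF fp_incl_l 1(1)] Inl_gens[OF A.adj_closed[OF 1(1)]] by auto
    next
      case (2 b)
      then show ?thesis using star_homD[OF fp_incl_r 2(1)] Inr_gens[OF B.adj_closed[OF 2(1)]] by auto
    qed
    with adj s incl show ?case by (auto simp: fp_incl_def)
  qed (use one add smult mult in \<open>simp_all add: free_product_def\<close>)
qed

abbreviation (input) fprod :: "('a + 'b) list \<Rightarrow> ('a + 'b) star_poly set" where
  "fprod ss \<equiv> foldr (\<lambda>s z. fp_incl A B s \<otimes>\<^bsub>free_product A B\<^esub> z) ss \<one>\<^bsub>free_product A B\<^esub>"

lemma fprod_closed: "set ss \<subseteq> fp_gens A B \<Longrightarrow> fprod ss \<in> carrier (free_product A B)"
  by (induction ss) (auto intro: P.m_closed fp_incl_closed)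

text \<open>Centering and merging of neighbouring factors reduce every word to alternating centered ones.\<close>

context
  fixes \<mu> :: "'a \<Rightarrow> complex" and \<nu> :: "'b \<Rightarrow> complex"
  assumes \<mu>: "\<mu> \<in> linear_map A complex_star" "\<mu> \<one>\<^bsub>A\<^esub> = 1"
    and \<nu>: "\<nu> \<in> linear_map B complex_star" "\<nu> \<one>\<^bsub>B\<^esub> = 1"
begin

abbreviation (input) alt :: "('a + 'b) list \<Rightarrow> bool" where
  "alt \<equiv> alternating_centered A B \<mu> \<nu>"

lemma alt_gens: "alt ss \<Longrightarrow> set ss \<subseteq> fp_gens A B"
  unfolding alternating_centered_def fp_gens_def by blast

lemma alt_Cons:
  assumes "s \<in> Inl ` {a \<in> carrier A. \<mu> a = 0} \<union> Inr ` {b \<in> carrier B. \<nu> b = 0}"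
    and "ss = [] \<or> alt ss \<and> isl (hd ss) \<noteq> isl s"
  shows "alt (s # ss)"
  unfolding alternating_centered_def
proof (intro conjI allI impI)
  show "set (s # ss) \<subseteq> Inl ` {a \<in> carrier A. \<mu> a = 0} \<union> Inr ` {b \<in> carrier B. \<nu> b = 0}"
    using assms by (auto simp: alternating_centered_def)
  fix j assume j: "Suc j < length (s # ss)"
  show "isl ((s # ss) ! j) \<noteq> isl ((s # ss) ! Suc j)"
  proof (cases j)
    case 0
    then show ?thesis using assms(2) j by (cases ss) auto
  next
    case (Suc i)
    then show ?thesis using assms(2) j by (auto simp: alternating_centered_def)
  qed
qed simp

lemma alt_ConsD:
  assumes "alt (s # ss)"
  shows "ss = [] \<or> alt ss \<and> isl (hd ss) \<noteq> isl s"
    and "s \<in> Inl ` {a \<in> carrier A. \<mu> a = 0} \<union> Inr ` {b \<in> carrier B. \<nu> b = 0}"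
proof -
  have j: "isl ((s # ss) ! j) \<noteq> isl ((s # ss) ! Suc j)" if "Suc j < length (s # ss)" for j
    using assms that by (simp add: alternating_centered_def)
  show "ss = [] \<or> alt ss \<and> isl (hd ss) \<noteq> isl s"
  proof (cases ss)
    case (Cons t ts)
    have "isl (ss ! i) \<noteq> isl (ss ! Suc i)" if "Suc i < length ss" for i using j[of "Suc i"] that by simp
    then have "alt ss" using assms Cons by (simp add: alternating_centered_def)
    then show ?thesis using j[of 0] Cons by auto
  qed simp
  show "s \<in> Inl ` {a \<in> carrier A. \<mu> a = 0} \<union> Inr ` {b \<in> carrier B. \<nu> b = 0}"
    using assms by (simp add: alternating_centered_def)
qed

text \<open>The expectation times the unit is split off; as the units of the two algebras are
  identified, this part is a scalar of the free product.\<close>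

lemma fp_center:
  assumes "s \<in> fp_gens A B"
  obtains t z where "t \<in> Inl ` {a \<in> carrier A. \<mu> a = 0} \<union> Inr ` {b \<in> carrier B. \<nu> b = 0}" "isl t = isl s"
    "fp_incl A B s = fp_incl A B t \<oplus>\<^bsub>free_product A B\<^esub> z \<odot>\<^bsub>free_product A B\<^esub> \<one>\<^bsub>free_product A B\<^esub>"
  using assms
proof (cases rule: fp_gens_cases)
  case (1 a)
  let ?a = "a \<oplus>\<^bsub>A\<^esub> (- \<mu> a) \<odot>\<^bsub>A\<^esub> \<one>\<^bsub>A\<^esub>"
  note h = alg_homD(2-6)[OF star_hom_alg_hom[OF fp_incl_l]]
  have c: "?a \<in> carrier A" using 1 by auto
  have "\<mu> ?a = 0" using linear_mapD(2,3)[OF \<mu>(1)] \<mu>(2) 1 A.one_closed A.smult_closed[OF A.one_closed] by simp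
  moreover have "a = ?a \<oplus>\<^bsub>A\<^esub> \<mu> a \<odot>\<^bsub>A\<^esub> \<one>\<^bsub>A\<^esub>"
    using 1 A.smult_l_distr[OF A.one_closed, of "- \<mu> a" "\<mu> a"] by (simp add: A.a_assoc)
  then have "fp_incl A B (Inl a) = fp_incl A B (Inl ?a) \<oplus>\<^bsub>free_product A B\<^esub> \<mu> a \<odot>\<^bsub>free_product A B\<^esub> \<one>\<^bsub>free_product A B\<^esub>"
    using h(2)[OF c A.smult_closed[OF A.one_closed], of "\<mu> a"] h(3)[OF A.one_closed, of "\<mu> a"] h(5) by simp
  ultimately show ?thesis using that[of "Inl ?a" "\<mu> a"] c 1 by simp
next
  case (2 b)
  let ?b = "b \<oplus>\<^bsub>B\<^esub> (- \<nu> b) \<odot>\<^bsub>B\<^esub> \<one>\<^bsub>B\<^esub>"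
  note h = alg_homD(2-6)[OF star_hom_alg_hom[OF fp_incl_r]]
  have c: "?b \<in> carrier B" using 2 by auto
  have "\<nu> ?b = 0" using linear_mapD(2,3)[OF \<nu>(1)] \<nu>(2) 2 B.one_closed B.smult_closed[OF B.one_closed] by simp
  moreover have "b = ?b \<oplus>\<^bsub>B\<^esub> \<nu> b \<odot>\<^bsub>B\<^esub> \<one>\<^bsub>B\<^esub>"
    using 2 B.smult_l_distr[OF B.one_closed, of "- \<nu> b" "\<nu> b"] by (simp add: B.a_assoc)
  then have "fp_incl A B (Inr b) = fp_incl A B (Inr ?b) \<oplus>\<^bsub>free_product A B\<^esub> \<nu> b \<odot>\<^bsub>free_product A B\<^esub> \<one>\<^bsub>free_product A B\<^esub>"
    using h(2)[OF c B.smult_closed[OF B.one_closed], of "\<nu> b"] h(3)[OF B.one_closed, of "\<nu> b"] h(5) by simp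
  ultimately show ?thesis using that[of "Inr ?b" "\<nu> b"] c 2 by simp
qed

lemma fp_merge:
  assumes "s \<in> fp_gens A B" "t \<in> fp_gens A B" "isl s = isl t"
  obtains r where "r \<in> fp_gens A B" "isl r = isl s"
    "fp_incl A B s \<otimes>\<^bsub>free_product A B\<^esub> fp_incl A B t = fp_incl A B r"
  using assms(1)
proof (cases rule: fp_gens_cases)
  case (1 a)
  then obtain b where b: "b \<in> carrier A" "t = Inl b" using assms(2,3) by (auto elim!: fp_gens_cases)
  show ?thesis
    by (rule that[of "Inl (a \<otimes>\<^bsub>A\<^esub> b)"])
      (use 1 b Inl_gens[OF A.m_closed[OF 1(1) b(1)]] alg_homD(5)[OF star_hom_alg_hom[OF fp_incl_l] 1(1) b(1)] in simp_all)
next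
  case (2 a)
  then obtain b where b: "b \<in> carrier B" "t = Inr b" using assms(2,3) by (auto elim!: fp_gens_cases)
  show ?thesis
    by (rule that[of "Inr (a \<otimes>\<^bsub>B\<^esub> b)"])
      (use 2 b Inr_gens[OF B.m_closed[OF 2(1) b(1)]] alg_homD(5)[OF star_hom_alg_hom[OF fp_incl_r] 2(1) b(1)] in simp_all)
qed

text \<open>The span is stable under left multiplication by a generator: one from the other algebra
  than the first factor is centered, and one from the same algebra is first merged with that factor,
  which exposes a shorter word. Hence the span is a left ideal, and it contains the unit.\<close>

lemma fp_alternating_span:
  assumes "z \<in> carrier (free_product A B)"
  shows "z \<in> lin_span (free_product A B) ({\<one>\<^bsub>free_product A B\<^esub>} \<union> {fprod ss | ss. alt ss})"
proof -
  let ?P = "free_product A B"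
  let ?G = "{\<one>\<^bsub>?P\<^esub>} \<union> {fprod ss | ss. alt ss}"
  let ?V = "lin_span ?P ?G"
  have Vc: "v \<in> carrier ?P" if "v \<in> ?V" for v
    using that by (induction rule: lin_span.induct) (use fprod_closed alt_gens in auto)
  have fV: "fprod ss \<in> ?V" if "ss = [] \<or> alt ss" for ss
    using that by (auto intro!: lin_span.base)
  have step: "fp_incl A B s \<otimes>\<^bsub>?P\<^esub> fprod ss \<in> ?V"
    if s: "s \<in> fp_gens A B" and ss: "ss = [] \<or> alt ss \<and> isl (hd ss) \<noteq> isl s" for s ss
  proof -
    obtain t z where t: "t \<in> Inl ` {a \<in> carrier A. \<mu> a = 0} \<union> Inr ` {b \<in> carrier B. \<nu> b = 0}" "isl t = isl s"
      "fp_incl A B s = fp_incl A B t \<oplus>\<^bsub>?P\<^esub> z \<odot>\<^bsub>?P\<^esub> \<one>\<^bsub>?P\<^esub>" by (rule fp_center[OF s])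
    have tc: "fp_incl A B t \<in> carrier ?P" using t(1) by (intro fp_incl_closed) (auto simp: fp_gens_def)
    have fc: "fprod ss \<in> carrier ?P" by (rule Vc[OF fV]) (use ss in blast)
    have "fp_incl A B s \<otimes>\<^bsub>?P\<^esub> fprod ss = fprod (t # ss) \<oplus>\<^bsub>?P\<^esub> z \<odot>\<^bsub>?P\<^esub> fprod ss"
      unfolding t(3) using tc fc P.one_closed by (simp add: P.l_distr P.smult_mult_l)
    moreover have "alt (t # ss)" by (rule alt_Cons[OF t(1)]) (use ss t(2) in simp)
    ultimately show ?thesis using lin_span.add[OF fV[of "t # ss"] lin_span.scale[OF fV[of ss]]] ss by auto
  qed
  have left: "fp_incl A B s \<otimes>\<^bsub>?P\<^esub> v \<in> ?V" if s: "s \<in> fp_gens A B" and v: "v \<in> ?V" for s v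
    using v
  proof (induction rule: lin_span.induct)
    case zero
    show ?case using P.r_null[OF fp_incl_closed[OF s]] lin_span.zero[of ?P ?G] by simp
  next
    case (base v)
    obtain ss where ss: "ss = [] \<or> alt ss" "v = fprod ss"
    proof (cases "v = \<one>\<^bsub>?P\<^esub>")
      case True
      then show ?thesis using that[of "[]"] by simp
    next
      case False
      then show ?thesis using base that by blast
    qed
    \<comment> \<open>Merging is the alternative when the first factor lies in the same algebra as
      the generator; the rest of the word then starts in the other algebra, and the centering step
      applies.\<close>
    show ?case
    proof (cases "ss = [] \<or> isl (hd ss) \<noteq> isl s")
      case True
      then show ?thesis using step[OF s, of ss] ss by auto
    next
      case False
      then obtain t ts where tts: "ss = t # ts" "isl t = isl s" by (cases ss) auto
      have a: "alt (t # ts)" using ss tts by auto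
      have tg: "t \<in> fp_gens A B" "set ts \<subseteq> fp_gens A B" using alt_gens[OF a] by auto
      obtain r where r: "r \<in> fp_gens A B" "isl r = isl s" "fp_incl A B s \<otimes>\<^bsub>?P\<^esub> fp_incl A B t = fp_incl A B r"
        using fp_merge[OF s tg(1)] tts(2) by metis
      have "fp_incl A B s \<otimes>\<^bsub>?P\<^esub> v = fp_incl A B r \<otimes>\<^bsub>?P\<^esub> fprod ts"
        using P.m_assoc[OF fp_incl_closed[OF s] fp_incl_closed[OF tg(1)] fprod_closed[OF tg(2)]] r(3) ss(2) tts(1) by simp
      moreover have "ts = [] \<or> alt ts \<and> isl (hd ts) \<noteq> isl r" using alt_ConsD(1)[OF a] r(2) tts(2) by simp
      ultimately show ?thesis using step[OF r(1), of ts] by simp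
    qed
  next
    case (add x y)
    show ?case unfolding P.r_distr[OF Vc[OF add(1)] Vc[OF add(2)] fp_incl_closed[OF s]]
      by (rule lin_span.add[OF add(3,4)])
  next
    case (scale x c)
    show ?case unfolding P.smult_mult_r[OF fp_incl_closed[OF s] Vc[OF scale(1)]]
      by (rule lin_span.scale[OF scale(2)])
  qed
  have "\<forall>v\<in>?V. z \<otimes>\<^bsub>?P\<^esub> v \<in> ?V" using assms
  proof (induction z rule: fp_induct)
    case one
    show ?case using P.l_one[OF Vc] by simp
  next
    case (incl s)
    then show ?case using left by blast
  next
    case (add x y)
    show ?case
    proof
      fix v assume v: "v \<in> ?V"
      show "(x \<oplus>\<^bsub>?P\<^esub> y) \<otimes>\<^bsub>?P\<^esub> v \<in> ?V" unfolding P.l_distr[OF add(1,2) Vc[OF v]]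
        by (rule lin_span.add[OF bspec[OF add(3) v] bspec[OF add(4) v]])
    qed
  next
    case (smult x c)
    show ?case
    proof
      fix v assume v: "v \<in> ?V"
      show "(c \<odot>\<^bsub>?P\<^esub> x) \<otimes>\<^bsub>?P\<^esub> v \<in> ?V" unfolding P.smult_mult_l[OF smult(1) Vc[OF v]]
        by (rule lin_span.scale[OF bspec[OF smult(2) v]])
    qed
  next
    case (mult x y)
    show ?case
    proof
      fix v assume v: "v \<in> ?V"
      show "x \<otimes>\<^bsub>?P\<^esub> y \<otimes>\<^bsub>?P\<^esub> v \<in> ?V" unfolding P.m_assoc[OF mult(1,2) Vc[OF v]]
        by (rule bspec[OF mult(3) bspec[OF mult(4) v]])
    qed
  qed
  from bspec[OF this fV[of "[]"]] show ?thesis using P.r_one[OF assms] by simp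
qed

text \<open>Uniqueness comes from the spanning lemma. Existence is witnessed by \<chi> itself, cut
  off outside the carrier, so the description is resolved by any functional with these
  properties.\<close>

lemma free_product_state_eqI:
  assumes st: "state (free_product A B) \<chi>"
    and l: "\<And>a. a \<in> carrier A \<Longrightarrow> \<chi> (fp_incl A B (Inl a)) = \<mu> a"
    and r: "\<And>b. b \<in> carrier B \<Longrightarrow> \<chi> (fp_incl A B (Inr b)) = \<nu> b"
    and alt: "\<And>ss. alt ss \<Longrightarrow> \<chi> (fprod ss) = 0"
    and z: "z \<in> carrier (free_product A B)"
  shows "free_product_state A B \<mu> \<nu> z = \<chi> z"
proof -
  let ?P = "free_product A B"
  let ?Q = "\<lambda>\<chi>. \<chi> \<in> extensional (carrier ?P) \<and> state ?P \<chi> \<and>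
     (\<forall>a \<in> carrier A. \<chi> (fp_incl A B (Inl a)) = \<mu> a) \<and>
     (\<forall>b \<in> carrier B. \<chi> (fp_incl A B (Inr b)) = \<nu> b) \<and> (\<forall>ss. alt ss \<longrightarrow> \<chi> (fprod ss) = 0)"
  let ?\<chi> = "restrict \<chi> (carrier ?P)"
  have res: "?\<chi> x = \<chi> x" if "x \<in> carrier ?P" for x using that by simp
  have st': "state ?P ?\<chi>"
    using st P.a_closed P.smult_closed P.one_closed P.m_closed[OF P.adj_closed]
    unfolding state_def linear_functional_def by simp
  have Q: "?Q ?\<chi>"
    using st' l r alt res[OF fp_incl_closed[OF Inl_gens]] res[OF fp_incl_closed[OF Inr_gens]] res[OF fprod_closed[OF alt_gens]]
    by simp
  have uniq: "g x = \<chi> x" if g: "?Q g" and x: "x \<in> carrier ?P" for g x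
  proof -
    have L: "g \<in> linear_map ?P complex_star" "\<chi> \<in> linear_map ?P complex_star"
      and one: "g \<one>\<^bsub>?P\<^esub> = 1" "\<chi> \<one>\<^bsub>?P\<^esub> = 1" using g st by (simp_all add: state_iff)
    have galt: "g (fprod ss) = 0" if "alt ss" for ss using g that by simp
    have "g x = \<chi> x \<and> x \<in> carrier ?P" using fp_alternating_span[OF x]
    proof (induction rule: lin_span.induct)
      case zero
      show ?case using linear_mapD(3)[OF L(1) P.zero_closed, of 0] linear_mapD(3)[OF L(2) P.zero_closed, of 0] P.zero_closed
        by simp
    next
      case (base s)
      then consider "s = \<one>\<^bsub>?P\<^esub>" | ss where "alt ss" "s = fprod ss" by blast
      then show ?case
      proof cases
        case 1
        then show ?thesis using one P.one_closed by simp
      next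
        case 2
        then show ?thesis using galt[OF 2(1)] alt[OF 2(1)] fprod_closed[OF alt_gens[OF 2(1)]] by simp
      qed
    next
      case (add x y)
      then show ?case using linear_mapD(2)[OF L(1), of x y] linear_mapD(2)[OF L(2), of x y] P.a_closed[of x y] by simp
    next
      case (scale x c)
      then show ?case using linear_mapD(3)[OF L(1), of x c] linear_mapD(3)[OF L(2), of x c] P.smult_closed[of x c] by simp
    qed
    then show ?thesis ..
  qed
  have "free_product_state A B \<mu> \<nu> = ?\<chi>"
    unfolding free_product_state_def
  proof (rule the_equality)
    show "?Q ?\<chi>" by (rule Q)
    fix g assume g: "?Q g"
    show "g = ?\<chi>"
      by (rule extensionalityI[of _ "carrier ?P"]) (use g uniq[OF g] in auto)
  qed
  then show ?thesis using z by simp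
qed

end

end

section \<open>The state of \<open>\<F>\<close> attached to a state of the free algebra\<close>

text \<open>Only the algebra structure matters here; the adjoint is a dummy.\<close>

definition lin_op :: "(('b \<Rightarrow> complex) \<Rightarrow> 'b \<Rightarrow> complex) \<Rightarrow> bool" where
  "lin_op T \<longleftrightarrow> (\<forall>u v. T (\<lambda>f. u f + v f) = (\<lambda>f. T u f + T v f)) \<and> (\<forall>c u. T (\<lambda>f. c * u f) = (\<lambda>f. c * T u f))"

definition op_alg :: "(('b \<Rightarrow> complex) \<Rightarrow> 'b \<Rightarrow> complex) star_alg" where
  "op_alg = \<lparr>carrier = {T. lin_op T}, mult = (\<lambda>S T u. S (T u)), one = (\<lambda>u. u), zero = (\<lambda>u f. 0),
     add = (\<lambda>S T u f. S u f + T u f), smult = (\<lambda>c T u f. c * T u f), adj = (\<lambda>T. T)\<rparr>"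

lemma op_alg_simps [simp]:
  "carrier op_alg = {T. lin_op T}" "mult op_alg = (\<lambda>S T u. S (T u))" "one op_alg = (\<lambda>u. u)"
  "zero op_alg = (\<lambda>u f. 0)" "add op_alg = (\<lambda>S T u f. S u f + T u f)" "smult op_alg = (\<lambda>c T u f. c * T u f)"
  by (simp_all add: op_alg_def)

lemma lin_opD:
  assumes "lin_op T"
  shows "T (\<lambda>f. u f + v f) = (\<lambda>f. T u f + T v f)" "T (\<lambda>f. c * u f) = (\<lambda>f. c * T u f)"
  using assms by (auto simp: lin_op_def)

lemma lin_op_zero: "lin_op T \<Longrightarrow> T (\<lambda>f. 0) = (\<lambda>f. 0)"
  using lin_opD(2)[of T 0 "\<lambda>f. 0"] by simp

lemma complex_alg_op_alg: "complex_alg (op_alg :: (('b \<Rightarrow> complex) \<Rightarrow> 'b \<Rightarrow> complex) star_alg)"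
proof -
  have "ring (op_alg :: (('b \<Rightarrow> complex) \<Rightarrow> 'b \<Rightarrow> complex) star_alg)"
  proof (rule ringI)
    show "abelian_group (op_alg :: (('b \<Rightarrow> complex) \<Rightarrow> 'b \<Rightarrow> complex) star_alg)"
    proof (rule abelian_groupI)
      fix T :: "('b \<Rightarrow> complex) \<Rightarrow> 'b \<Rightarrow> complex" assume "T \<in> carrier op_alg"
      then show "\<exists>S\<in>carrier op_alg. S \<oplus>\<^bsub>op_alg\<^esub> T = \<zero>\<^bsub>op_alg\<^esub>"
        by (intro bexI[of _ "\<lambda>u f. - T u f"]) (auto simp: lin_op_def)
    qed (auto simp: lin_op_def algebra_simps)
    show "Group.monoid (op_alg :: (('b \<Rightarrow> complex) \<Rightarrow> 'b \<Rightarrow> complex) star_alg)"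
      by (rule monoidI) (auto simp: lin_op_def)
  qed (auto simp: lin_op_def)
  then interpret ring "op_alg :: (('b \<Rightarrow> complex) \<Rightarrow> 'b \<Rightarrow> complex) star_alg" .
  show ?thesis by unfold_locales (auto simp: lin_op_def algebra_simps)
qed

section \<open>Coloured words and their moments\<close>

type_synonym 'g cword = "('g letter \<times> nat) list"

text \<open>Tensor independence makes different colours commute, so only the order of the letters
  within each colour matters.\<close>

definition site :: "nat \<Rightarrow> 'g cword \<Rightarrow> 'g letter list" where
  "site k f = map fst (filter (\<lambda>x. snd x = k) f)"

definition lo :: "nat \<Rightarrow> 'g cword \<Rightarrow> 'g cword" where "lo j = filter (\<lambda>x. snd x < j)"
definition hi :: "nat \<Rightarrow> 'g cword \<Rightarrow> 'g cword" where "hi j = filter (\<lambda>x. j \<le> snd x)"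
definition cstar :: "'g cword \<Rightarrow> 'g cword" where "cstar f = rev (map (\<lambda>x. (flip (fst x), snd x)) f)"

lemma site_simps [simp]:
  "site k [] = []" "site k (f @ g) = site k f @ site k g"
  "site k (lo j f) = (if k < j then site k f else [])" "site k (hi j f) = (if k < j then [] else site k f)"
  "site k (cstar f) = rev (map flip (site k f))" "site k (map (\<lambda>l. (l, j)) w) = (if j = k then w else [])"
  by (simp_all add: site_def lo_def hi_def filter_empty_conv)
    (auto simp: cstar_def rev_filter[symmetric] filter_map comp_def rev_map intro!: arg_cong[of _ _ "map fst"] filter_cong)

lemma lo_hi_simps [simp]:
  "lo j [] = []" "hi j [] = []" "lo j (f @ g) = lo j f @ lo j g" "hi j (f @ g) = hi j f @ hi j g"
  "lo i (lo j f) = lo (min i j) f" "hi i (hi j f) = hi (max i j) f"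
  "lo j [(l, k)] = (if k < j then [(l, k)] else [])" "hi j [(l, k)] = (if j \<le> k then [(l, k)] else [])"
  "lo j (cstar f) = cstar (lo j f)" "hi j (cstar f) = cstar (hi j f)"
  "lo j (map (\<lambda>l. (l, k)) w) = (if k < j then map (\<lambda>l. (l, k)) w else [])"
  by (auto simp: lo_def hi_def cstar_def rev_filter[symmetric] filter_map comp_def filter_empty_conv conj_commute)

lemma cstar_simps [simp]: "cstar [] = []" "cstar (x # f) = cstar f @ [(flip (fst x), snd x)]"
  by (simp_all add: cstar_def)

text \<open>A moment functional on words, extended to coloured words so that the colours are
  tensor independent copies of it.\<close>

locale moments =
  fixes m :: "'g letter list \<Rightarrow> complex"
  assumes m_Nil: "m [] = 1"
    and m_psd: "\<And>(I :: nat set) w. finite I \<Longrightarrow> psd I (\<lambda>i j. m (rev (map flip (w i)) @ w j))"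
begin

text \<open>The moment functional of the infinite tensor power of \<open>m\<close>; colours that do
  not occur would contribute \<open>m [] = 1\<close>.\<close>

definition M :: "'g cword \<Rightarrow> complex" where "M f = (\<Prod>k\<in>snd ` set f. m (site k f))"

lemma M_superset: "finite S \<Longrightarrow> snd ` set f \<subseteq> S \<Longrightarrow> M f = (\<Prod>k\<in>S. m (site k f))"
proof -
  assume S: "finite S" "snd ` set f \<subseteq> S"
  have "m (site k f) = 1" if "k \<notin> snd ` set f" for k
  proof -
    have "site k f = []" using that by (force simp: site_def filter_empty_conv)
    then show ?thesis by (simp add: m_Nil)
  qed
  then show "M f = (\<Prod>k\<in>S. m (site k f))"
    unfolding M_def by (intro prod.mono_neutral_left S) blast
qed

lemma M_Nil [simp]: "M [] = 1"
  by (simp add: M_def)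

lemma snd_lo_hi: "snd ` set (lo j f) \<subseteq> snd ` set f" "snd ` set (hi j f) \<subseteq> snd ` set f"
  by (auto simp: lo_def hi_def)

lemma M_split: "M f = M (lo j f) * M (hi j f)"
proof -
  let ?S = "snd ` set f"
  have "M (lo j f) * M (hi j f) = (\<Prod>k\<in>?S. m (site k (lo j f)) * m (site k (hi j f)))"
    using M_superset[of ?S "lo j f"] M_superset[of ?S "hi j f"] snd_lo_hi[of j f] by (simp add: prod.distrib)
  also have "\<dots> = M f" unfolding M_def by (rule prod.cong) (auto simp: m_Nil)
  finally show ?thesis by simp
qed

lemma M_colour: "M (map (\<lambda>l. (l, j)) w) = m w"
  by (subst M_superset[of "{j}"]) auto

lemma M_lo_append: "M (lo j f @ g) = M (lo j f @ lo j g) * M (hi j g)"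
proof -
  have "hi j (lo j f) = []" by (auto simp: hi_def lo_def filter_empty_conv)
  then show ?thesis using M_split[of "lo j f @ g" j] by simp
qed

lemma M_append_lo: "M (f @ lo j g) = M (hi j f) * M (lo j f @ lo j g)"
proof -
  have "hi j (lo j g) = []" by (auto simp: hi_def lo_def filter_empty_conv)
  then show ?thesis using M_split[of "f @ lo j g" j] by simp
qed

text \<open>Colour by colour this is a positive kernel of \<open>m\<close>; the kernel of
  \<open>M\<close> is their entrywise product, hence positive by the Schur theorem.\<close>

lemma M_psd: "finite I \<Longrightarrow> psd I (\<lambda>i j. M (cstar (g i) @ g j))" for I :: "nat set"
proof -
  assume I: "finite I"
  let ?S = "\<Union>i\<in>I. snd ` set (g i)"
  have "psd I (\<lambda>i j. \<Prod>k\<in>?S. m (rev (map flip (site k (g i))) @ site k (g j)))"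
    using I by (intro psd_prod m_psd) auto
  moreover have "M (cstar (g i) @ g j) = (\<Prod>k\<in>?S. m (rev (map flip (site k (g i))) @ site k (g j)))"
    if "i \<in> I" "j \<in> I" for i j
  proof -
    have "snd ` set (cstar (g i)) = snd ` set (g i)" by (simp add: cstar_def image_image)
    then have "snd ` set (cstar (g i) @ g j) \<subseteq> ?S" unfolding set_append image_Un using that by blast
    then show ?thesis using I by (subst M_superset[of ?S]) auto
  qed
  ultimately show ?thesis by (simp add: psd_def cong: sum.cong)
qed

text \<open>Hermitian symmetry of the 2 by 2 kernel of the words \<open>f\<close> and
  \<open>[]\<close>.\<close>

lemma M_cstar: "M (cstar f) = cnj (M f)"
proof -
  let ?g = "\<lambda>i::nat. if i = 0 then f else []"
  have P: "psd {0, 1} (\<lambda>i j. M (cstar (?g i) @ ?g j))" by (rule M_psd) simp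
  have "M (cstar (?g 1) @ ?g 0) = cnj (M (cstar (?g 0) @ ?g 1))"
    by (rule psd_hermitian[OF _ P]) auto
  then show ?thesis by simp
qed

text \<open>A function \<open>u\<close> stands for a vector by letting \<open>u f\<close> be the
  expectation of \<open>f\<close> applied to that vector; acting with a letter on the vector
  therefore appends it to the argument. The vacuum is \<open>M\<close>.\<close>

definition App :: "'g letter \<Rightarrow> nat \<Rightarrow> ('g cword \<Rightarrow> complex) \<Rightarrow> 'g cword \<Rightarrow> complex" where
  "App l k u = (\<lambda>f. u (f @ [(l, k)]))"

text \<open>Moving the self-adjoint q_j onto the word \<open>f\<close> replaces its colours from j
  on by their expectation, which is the factor \<open>M (hi j f)\<close>. At j = 0 the formula would
  give the projection onto the vacuum instead of 0, hence the separate case.\<close>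

definition Qop :: "nat \<Rightarrow> ('g cword \<Rightarrow> complex) \<Rightarrow> 'g cword \<Rightarrow> complex" where
  "Qop j u = (if j = 0 then (\<lambda>f. 0) else (\<lambda>f. M (hi j f) * u (lo j f)))"

lemma lin_op_App: "lin_op (App l k)" and lin_op_Qop: "lin_op (Qop j)"
  by (auto simp: lin_op_def App_def Qop_def algebra_simps)

lemma App_Qop: "k < j \<Longrightarrow> App l k (Qop j u) = Qop j (App l k u)"
  by (auto simp: App_def Qop_def)

lemma Qop_Qop: "Qop i (Qop j u) = Qop (min i j) u"
proof (cases "i = 0 \<or> j = 0")
  case True
  then show ?thesis by (auto simp: Qop_def)
next
  case False
  have "M (hi i f) * M (hi j (lo i f)) = M (hi (min i j) f)" for f
  proof (cases "j < i")
    case True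
    then have e: "lo i (hi j f) = hi j (lo i f)" "max i j = i" "min i j = j"
      by (auto simp: lo_def hi_def intro!: filter_cong)
    have "M (hi j f) = M (lo i (hi j f)) * M (hi i (hi j f))" by (rule M_split)
    then show ?thesis unfolding e(1) using e(2,3) by simp
  next
    case F: False
    then have "hi j (lo i f) = []" "min i j = i" by (auto simp: lo_def hi_def filter_empty_conv)
    then show ?thesis by simp
  qed
  then show ?thesis using False by (auto simp: Qop_def mult.assoc[symmetric] min.commute)
qed

lemma Qop_M: "Qop 1 M [] = 1" "j \<ge> 1 \<Longrightarrow> Qop j M = M"
proof -
  show "Qop 1 M [] = 1" by (simp add: Qop_def)
  show "Qop j M = M" if "j \<ge> 1"
  proof
    fix f
    show "Qop j M f = M f" using that M_split[of f j] by (simp add: Qop_def mult.commute)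
  qed
qed

text \<open>A one-sided compression is enough: a letter of colour k commutes with q_(k+1), as
  \<open>xop_alt\<close> records, so the operator is compressed on both sides.\<close>

definition xop :: "'g letter \<Rightarrow> nat \<Rightarrow> ('g cword \<Rightarrow> complex) \<Rightarrow> 'g cword \<Rightarrow> complex" where
  "xop l k u = App l k (Qop (Suc k) u)"

lemma xop_alt: "xop l k u = Qop (Suc k) (App l k u)"
  by (simp add: xop_def App_Qop)

lemma lin_op_xop: "lin_op (xop l k)"
  using lin_op_App[of l k] lin_op_Qop[of "Suc k"] by (simp add: lin_op_def xop_def)

text \<open>\<open>comb L v\<close> says that \<open>v\<close> is the vector of a linear combination of words and \<open>L\<close> the pairing with
  it, so that positivity can be proved without constructing the inner product.\<close>

definition comb :: "(('g cword \<Rightarrow> complex) \<Rightarrow> complex) \<Rightarrow> ('g cword \<Rightarrow> complex) \<Rightarrow> bool" where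
  "comb L v \<longleftrightarrow> (\<exists>ps. L = (\<lambda>u. \<Sum>(a, g)\<leftarrow>ps. cnj a * u (cstar g)) \<and> v = (\<lambda>f. \<Sum>(a, g)\<leftarrow>ps. a * M (f @ g)))"

text \<open>The value is the quadratic form of the kernel in \<open>M_psd\<close> at the
  coefficients of the combination.\<close>

lemma comb_nonneg: "comb L v \<Longrightarrow> L v \<in> \<real>\<^sub>\<ge>\<^sub>0"
proof -
  assume "comb L v"
  then obtain ps where ps: "L = (\<lambda>u. \<Sum>(a, g)\<leftarrow>ps. cnj a * u (cstar g))" "v = (\<lambda>f. \<Sum>(a, g)\<leftarrow>ps. a * M (f @ g))"
    unfolding comb_def by blast
  let ?n = "length ps" and ?a = "\<lambda>i. fst (ps ! i)" and ?g = "\<lambda>i. snd (ps ! i)"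
  have "L v = (\<Sum>i\<in>{0..<?n}. cnj (?a i) * (\<Sum>j\<in>{0..<?n}. ?a j * M (cstar (?g i) @ ?g j)))"
    unfolding ps by (simp add: sum_list_sum_nth case_prod_unfold)
  also have "\<dots> = (\<Sum>i\<in>{0..<?n}. \<Sum>j\<in>{0..<?n}. cnj (?a i) * ?a j * M (cstar (?g i) @ ?g j))"
    by (simp add: sum_distrib_left mult.assoc)
  also have "\<dots> \<in> \<real>\<^sub>\<ge>\<^sub>0"
    using M_psd[of "{0..<?n}" ?g] by (simp add: psd_def)
  finally show ?thesis .
qed

lemma comb_linear:
  assumes "comb L v"
  shows "L (\<lambda>f. u f + u' f) = L u + L u'" "L (\<lambda>f. c * u f) = c * L u"
proof -
  obtain ps where ps: "L = (\<lambda>u. \<Sum>(a, g)\<leftarrow>ps. cnj a * u (cstar g))"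
    using assms unfolding comb_def by blast
  show "L (\<lambda>f. u f + u' f) = L u + L u'" "L (\<lambda>f. c * u f) = c * L u"
    unfolding ps by (induction ps) (auto simp: algebra_simps)
qed

lemma comb_add:
  assumes "comb L v" "comb L' v'"
  shows "comb (\<lambda>u. L u + L' u) (\<lambda>f. v f + v' f)"
proof -
  obtain ps qs where "L = (\<lambda>u. \<Sum>(a, g)\<leftarrow>ps. cnj a * u (cstar g))" "v = (\<lambda>f. \<Sum>(a, g)\<leftarrow>ps. a * M (f @ g))"
    "L' = (\<lambda>u. \<Sum>(a, g)\<leftarrow>qs. cnj a * u (cstar g))" "v' = (\<lambda>f. \<Sum>(a, g)\<leftarrow>qs. a * M (f @ g))"
    using assms unfolding comb_def by blast
  then show ?thesis unfolding comb_def by (intro exI[of _ "ps @ qs"]) simp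
qed

text \<open>\<open>T\<close> acts on combinations by replacing each term \<open>(a, g)\<close> with
  \<open>(\<alpha> a g, \<gamma> g)\<close>, and \<open>S\<close> is its formal adjoint. Scalars,
  letters and projections are all of this kind.\<close>

lemma comb_transform:
  assumes "comb L v"
    and L: "\<And>u a g. cnj (\<alpha> a g) * u (cstar (\<gamma> g)) = cnj a * S u (cstar g)"
    and v: "\<And>f ps. (\<Sum>(a, g)\<leftarrow>ps. \<alpha> a g * M (f @ \<gamma> g)) = T (\<lambda>f. \<Sum>(a, g)\<leftarrow>ps. a * M (f @ g)) f"
  shows "comb (\<lambda>u. L (S u)) (T v)"
proof -
  obtain ps where ps: "L = (\<lambda>u. \<Sum>(a, g)\<leftarrow>ps. cnj a * u (cstar g))" "v = (\<lambda>f. \<Sum>(a, g)\<leftarrow>ps. a * M (f @ g))"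
    using assms(1) unfolding comb_def by blast
  have "L (S u) = (\<Sum>(a, g)\<leftarrow>map (\<lambda>(a, g). (\<alpha> a g, \<gamma> g)) ps. cnj a * u (cstar g))" for u
    unfolding ps(1) by (simp add: comp_def case_prod_unfold L)
  moreover have "T v f = (\<Sum>(a, g)\<leftarrow>map (\<lambda>(a, g). (\<alpha> a g, \<gamma> g)) ps. a * M (f @ g))" for f
    unfolding ps(2) v[symmetric] by (simp add: comp_def case_prod_unfold)
  ultimately show ?thesis unfolding comb_def
    by (intro exI[of _ "map (\<lambda>(a, g). (\<alpha> a g, \<gamma> g)) ps"] conjI ext)
qed

lemma comb_scale: "comb L v \<Longrightarrow> comb (\<lambda>u. cnj c * L u) (\<lambda>f. c * v f)"
proof -
  assume c: "comb L v"
  have "comb (\<lambda>u. L (\<lambda>f. cnj c * u f)) (\<lambda>f. c * v f)"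
    by (rule comb_transform[OF c, of "\<lambda>a g. c * a" "\<lambda>g. g" "\<lambda>u f. cnj c * u f" "\<lambda>u f. c * u f"])
      (auto simp: sum_list_const_mult[symmetric] case_prod_unfold mult_ac)
  then show ?thesis by (simp add: comb_linear(2)[OF c])
qed

lemma comb_App: "comb L v \<Longrightarrow> comb (\<lambda>u. L (App (flip l) k u)) (App l k v)"
  by (rule comb_transform[of L v "\<lambda>a g. a" "\<lambda>g. (l, k) # g"]) (auto simp: App_def)

lemma comb_zero: "comb L v \<Longrightarrow> comb (\<lambda>u. L (\<lambda>f. 0)) (\<lambda>f. 0)"
  using comb_linear(2)[of L v 0 "\<lambda>f. 0"] by (auto simp: comb_def intro!: exI[of _ "[]"])

lemma comb_Qop:
  assumes c: "comb L v"
  shows "comb (\<lambda>u. L (Qop j u)) (Qop j v)"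
proof (cases "j = 0")
  case True
  then show ?thesis using comb_zero[OF c] by (simp add: Qop_def)
next
  case False
  have v: "(\<Sum>(a, g)\<leftarrow>ps. a * M (hi j g) * M (f @ lo j g)) = Qop j (\<lambda>f. \<Sum>(a, g)\<leftarrow>ps. a * M (f @ g)) f" for f ps
  proof -
    \<comment> \<open>Up to the factor \<open>a\<close>, both sides are the moments of the high
      parts of \<open>f\<close> and \<open>g\<close> times the mixed moment of their low parts. This
      symmetry makes \<open>Qop j\<close> its own formal adjoint.\<close>
    have key: "M (hi j f) * (a * M (lo j f @ g)) = a * M (hi j g) * M (f @ lo j g)" for a g
      unfolding M_lo_append[of j f g] M_append_lo[of f j g] by (simp only: mult_ac)
    have "Qop j (\<lambda>f. \<Sum>(a, g)\<leftarrow>ps. a * M (f @ g)) f = (\<Sum>(a, g)\<leftarrow>ps. M (hi j f) * (a * M (lo j f @ g)))"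
      using False by (simp add: Qop_def sum_list_const_mult[symmetric] case_prod_unfold)
    then show ?thesis by (simp only: key)
  qed
  show ?thesis
    by (rule comb_transform[OF c, of "\<lambda>a g. a * M (hi j g)" "lo j"])
      (use False v in \<open>auto simp: Qop_def M_cstar\<close>)
qed

lemma comb_xop: "comb L v \<Longrightarrow> comb (\<lambda>u. L (xop (flip l) k u)) (xop l k v)"
  using comb_App[OF comb_Qop, of L v "Suc k" l k] unfolding xop_alt[of "flip l"] xop_def[of l] .

lemma comb_vacuum: "comb (\<lambda>u. u []) M"
  unfolding comb_def by (intro exI[of _ "[(1, [])]"]) simp

end

text \<open>The properties of the constructed state that the freeness computation uses: \<open>V x\<close> stands for
  the vector \<open>x \<Omega>\<close>, and the copy \<open>\<sigma>\<^sub>j\<close> of \<open>\<A>\<close> is generated by the \<open>X'(j)\<close>.\<close>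

abbreviation copy :: "'g set \<Rightarrow> nat \<Rightarrow> 'g star_poly \<Rightarrow> 'g fgen star_poly set" where
  "copy G j \<equiv> free_lift (F0 G) (\<lambda>l. xa G l j)"

locale vacuum_rep =
  fixes G :: "'g set" and \<mu> :: "'g star_poly \<Rightarrow> complex"
    and \<phi> :: "'g fgen star_poly set \<Rightarrow> complex"
    and V :: "'g fgen star_poly set \<Rightarrow> 'b \<Rightarrow> complex" and vac :: 'b
  assumes st: "state (F0 G) \<phi>" and supp: "\<phi> (qq G 1) = 1"
    and \<phi>_V: "x \<in> carrier (F0 G) \<Longrightarrow> \<phi> x = V x vac"
    and V_smult: "x \<in> carrier (F0 G) \<Longrightarrow> V (c \<odot>\<^bsub>F0 G\<^esub> x) = (\<lambda>f. c * V x f)"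
    and V_cong: "z \<in> carrier (F0 G) \<Longrightarrow> x \<in> carrier (F0 G) \<Longrightarrow> y \<in> carrier (F0 G) \<Longrightarrow> V x = V y \<Longrightarrow>
       V (z \<otimes>\<^bsub>F0 G\<^esub> x) = V (z \<otimes>\<^bsub>F0 G\<^esub> y)"
    and V_xb: "l \<in> letters G \<Longrightarrow> k \<ge> 2 \<Longrightarrow> x \<in> carrier (F0 G) \<Longrightarrow>
       V (xb G l k \<otimes>\<^bsub>F0 G\<^esub> x) = V (xa G l k \<otimes>\<^bsub>F0 G\<^esub> x)"
    and V_one: "j \<ge> 1 \<Longrightarrow> V (qq G j) = V \<one>\<^bsub>F0 G\<^esub>"
    and V_qq_vac: "x \<in> carrier (F0 G) \<Longrightarrow> V (qq G 1 \<otimes>\<^bsub>F0 G\<^esub> x) vac = V x vac"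
    and V_center: "j \<ge> 1 \<Longrightarrow> x \<in> carrier (F0 G) \<Longrightarrow> V (qq G j \<otimes>\<^bsub>F0 G\<^esub> x) = V x \<Longrightarrow> a \<in> carrier (free_alg G) \<Longrightarrow>
       V (qq G j \<otimes>\<^bsub>F0 G\<^esub> (copy G j a \<otimes>\<^bsub>F0 G\<^esub> x)) = (\<lambda>f. \<mu> a * V x f)"

text \<open>Words with letters outside \<open>G\<close> get moment 0, which makes the functional
  total. A flipped word followed by a word stays over \<open>G\<close> exactly when both words do,
  so the kernel is a Gram matrix of \<mu> padded with zeros.\<close>

lemma moments_of_state:
  assumes "state (free_alg G) \<mu>"
  shows "moments (\<lambda>w. if w \<in> lists (letters G) then \<mu> (Poly_Mapping.single w 1) else 0)"
proof
  let ?m = "\<lambda>w. if w \<in> lists (letters G) then \<mu> (Poly_Mapping.single w 1) else 0"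
  show "?m [] = 1" using assms by (simp add: state_def)
  fix I :: "nat set" and w assume I: "finite I"
  let ?J = "{i \<in> I. w i \<in> lists (letters G)}"
  have a: "(\<lambda>i. Poly_Mapping.single (w i) 1) \<in> ?J \<rightarrow> carrier (free_alg G)" by (auto simp: free_alg_simps(1))
  have flips: "rev (map flip v) \<in> lists (letters G) \<longleftrightarrow> v \<in> lists (letters G)" for v :: "'a letter list"
    unfolding in_lists_conv_set by simp
  have eq: "?m (rev (map flip (w i)) @ w j) =
      \<mu> (adj (free_alg G) (Poly_Mapping.single (w i) 1) \<otimes>\<^bsub>free_alg G\<^esub> Poly_Mapping.single (w j) 1)"
    if "i \<in> ?J" "j \<in> ?J" for i j
  proof -
    have "rev (map flip (w i)) @ w j \<in> lists (letters G)"
      using that flips[of "w i"] by (simp only: append_in_lists_conv mem_Collect_eq)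
    then show ?thesis by (simp only: if_True free_alg_simps complex_cnj_one mult_1)
  qed
  have zero: "?m (rev (map flip (w i)) @ w j) = 0" if "i \<notin> ?J \<or> j \<notin> ?J" "i \<in> I" "j \<in> I" for i j
  proof -
    have "rev (map flip (w i)) @ w j \<notin> lists (letters G)"
      using that flips[of "w i"] by (simp only: append_in_lists_conv mem_Collect_eq) blast
    then show ?thesis by (simp only: if_False)
  qed
  have P: "psd ?J (\<lambda>i j. \<mu> (adj (free_alg G) (Poly_Mapping.single (w i) 1) \<otimes>\<^bsub>free_alg G\<^esub> Poly_Mapping.single (w j) 1))"
    by (rule psd_state[OF star_algebra_free_alg assms a])
  define K where "K i j = ?m (rev (map flip (w i)) @ w j)" for i j
  define J where "J = ?J"
  define N where "N i j = \<mu> (adj (free_alg G) (Poly_Mapping.single (w i) 1) \<otimes>\<^bsub>free_alg G\<^esub> Poly_Mapping.single (w j) 1)" for i j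
  have J: "J \<subseteq> I" and KN: "\<And>i j. i \<in> J \<Longrightarrow> j \<in> J \<Longrightarrow> K i j = N i j"
    and K0: "\<And>i j. i \<notin> J \<or> j \<notin> J \<Longrightarrow> i \<in> I \<Longrightarrow> j \<in> I \<Longrightarrow> K i j = 0" and PJ: "psd J N"
    unfolding K_def J_def N_def by (blast, rule eq, assumption+, rule zero, assumption+, rule P)
  have "psd I K" unfolding psd_def
  proof
    fix c :: "nat \<Rightarrow> complex"
    have "(\<Sum>i\<in>I. \<Sum>j\<in>I. cnj (c i) * c j * K i j) = (\<Sum>i\<in>I. \<Sum>j\<in>J. cnj (c i) * c j * K i j)"
      by (intro sum.cong refl sum.mono_neutral_right I J) (simp add: K0)
    also have "\<dots> = (\<Sum>i\<in>J. \<Sum>j\<in>J. cnj (c i) * c j * K i j)"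
    proof (intro sum.mono_neutral_right I J ballI sum.neutral)
      fix i j assume "i \<in> I - J" "j \<in> J"
      then have "K i j = 0" using J by (intro K0) auto
      then show "cnj (c i) * c j * K i j = 0" by simp
    qed
    also have "\<dots> = (\<Sum>i\<in>J. \<Sum>j\<in>J. cnj (c i) * c j * N i j)"
      by (intro sum.cong refl) (simp add: KN)
    finally show "(\<Sum>i\<in>I. \<Sum>j\<in>I. cnj (c i) * c j * K i j) \<in> \<real>\<^sub>\<ge>\<^sub>0"
      using spec[OF PJ[unfolded psd_def], of c] by (simp only:)
  qed
  then show "psd I (\<lambda>i j. ?m (rev (map flip (w i)) @ w j))" unfolding K_def .
qed

text \<open>\<open>\<F>\<^sub>0\<close> acts on functions of coloured words through
  \<open>F0_lift\<close>, and \<phi> evaluates the vector \<open>\<pi> x M\<close> at the empty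
  word. Positivity comes from \<open>comb\<close>, and \<open>V_center\<close> from the independence
  of the colours.\<close>

lemma vacuum_rep_exists:
  fixes G :: "'g set"
  assumes \<mu>: "state (free_alg G) \<mu>"
  shows "\<exists>\<phi> (V :: 'g fgen star_poly set \<Rightarrow> 'g cword \<Rightarrow> complex) vac. vacuum_rep G \<mu> \<phi> V vac"
proof -
  define m where "m w = (if w \<in> lists (letters G) then \<mu> (Poly_Mapping.single w 1) else 0)" for w
  interpret moments m unfolding m_def by (rule moments_of_state[OF \<mu>])
  interpret A: star_algebra "F0 G" by (rule star_algebra_F0)
  let ?E = "op_alg :: (('g cword \<Rightarrow> complex) \<Rightarrow> 'g cword \<Rightarrow> complex) star_alg"
  interpret E: complex_alg ?E by (rule complex_alg_op_alg)
  \<comment> \<open>Equal to \<open>xop\<close> for k > 1, so that the comparison of X'(k) with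
    X''(k) is trivial. At k = 1 the relation X''(1) = 0 forces 0, and the comparison there involves
    only q_0 = 0.\<close>
  define u2 where "u2 l k = (if k = 1 then (\<lambda>u f. 0) else xop l k)" for l k
  have lin0: "lin_op (\<lambda>u f. 0)" by (simp add: lin_op_def)
  have z: "xop l k (\<lambda>f. 0) = (\<lambda>f. 0)" for l k by (rule lin_op_zero[OF lin_op_xop])
  have Qz: "Qop j (\<lambda>f. 0) = (\<lambda>f. 0)" for j by (rule lin_op_zero[OF lin_op_Qop])
  have Qx: "Qop j (xop l k u) = xop l k u" "xop l k (Qop j u) = xop l k u" if "k < j" for j l k u
    using that by (simp_all add: xop_alt Qop_Qop min_absorb2) (simp add: xop_def Qop_Qop xop_alt[symmetric] min_absorb1)
  have Q0: "Qop 0 = (\<lambda>u f. 0)" by (rule ext) (simp add: Qop_def)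
  have "\<exists>\<pi>. \<pi> \<in> alg_hom (F0 G) ?E \<and> (\<forall>l\<in>letters G. \<forall>k\<ge>1. \<pi> (xa G l k) = xop l k) \<and>
      (\<forall>l\<in>letters G. \<forall>k\<ge>1. \<pi> (xb G l k) = u2 l k) \<and> (\<forall>k. \<pi> (qq G k) = Qop k)"
  proof (rule F0_lift[where G = G and E = ?E and ?u1.0 = xop and ?u2.0 = u2 and Q = Qop], goal_cases)
    case 1 show ?case by (rule complex_alg_op_alg)
  next
    case (2 l k) show ?case by (simp add: lin_op_xop)
  next
    case (3 l k) show ?case by (simp add: u2_def lin_op_xop lin0)
  next
    case (4 k) show ?case by (simp add: lin_op_Qop)
  next
    case 5 show ?case by (simp add: Q0)
  next
    case (6 i j) show ?case by (simp add: Qop_Qop)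
  next
    case (7 l) show ?case by (simp add: u2_def)
  next
    case (8 l k j) then show ?case by (simp add: Qx)
  next
    case (9 l k j) then show ?case by (simp add: Qx Qz u2_def)
  next
    case (10 l k j) then show ?case by (simp add: Qx)
  next
    case (11 l k j) then show ?case by (simp add: Qx u2_def)
  next
    case (12 l j k) then show ?case by (cases "j = 0") (auto simp: u2_def Q0)
  next
    case (13 l j k) then show ?case by (cases "j = 0") (auto simp: u2_def Q0 z)
  next
    case (14 h) then show ?case by (intro exI[of _ h] conjI ballI allI impI) simp_all
  qed
  then obtain \<pi> where \<pi>: "\<pi> \<in> alg_hom (F0 G) ?E"
    and a: "\<forall>l\<in>letters G. \<forall>k\<ge>1. \<pi> (xa G l k) = xop l k"
    and b: "\<forall>l\<in>letters G. \<forall>k\<ge>1. \<pi> (xb G l k) = u2 l k"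
    and q: "\<forall>k. \<pi> (qq G k) = Qop k" by (elim exE conjE) (rule that)
  have \<pi>xa: "\<pi> (xa G l k) = xop l k" and \<pi>xb: "\<pi> (xb G l k) = u2 l k"
    if lk: "l \<in> letters G" "k \<ge> 1" for l k
    by (rule a[rule_format, OF lk], rule b[rule_format, OF lk])
  have \<pi>q: "\<pi> (qq G k) = Qop k" for k by (rule spec[OF q])
  note \<pi>h = alg_homD(2-6)[OF \<pi>, unfolded op_alg_simps]
  define V where "V x = \<pi> x M" for x
  define \<phi> where "\<phi> x = V x []" for x
  have Vadd: "V (x \<oplus>\<^bsub>F0 G\<^esub> y) = (\<lambda>f. V x f + V y f)" if "x \<in> carrier (F0 G)" "y \<in> carrier (F0 G)" for x y
    unfolding V_def by (simp only: \<pi>h(2)[OF that])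
  have Vsm: "V (c \<odot>\<^bsub>F0 G\<^esub> x) = (\<lambda>f. c * V x f)" if "x \<in> carrier (F0 G)" for x c
    unfolding V_def by (simp only: \<pi>h(3)[OF that])
  have Vmul: "V (z \<otimes>\<^bsub>F0 G\<^esub> x) = \<pi> z (V x)" if "z \<in> carrier (F0 G)" "x \<in> carrier (F0 G)" for z x
    unfolding V_def by (simp only: \<pi>h(4)[OF that])
  have Vone: "V \<one>\<^bsub>F0 G\<^esub> = M" unfolding V_def by (simp only: \<pi>h(5))
  have Q1: "Qop 1 u [] = u []" for u by (simp add: Qop_def)
  \<comment> \<open>In effect, \<open>\<pi> (adj (F0 G) x)\<close> is the formal adjoint of
    \<open>\<pi> x\<close>. Applied to the vacuum this gives a pairing and a vector for which
    \<open>comb_nonneg\<close> is the positivity of \<phi>.\<close>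
  have good: "\<forall>L v. comb L v \<longrightarrow> comb (\<lambda>u. L (\<pi> (adj (F0 G) x) u)) (\<pi> x v)" if "x \<in> carrier (F0 G)" for x
  proof -
    let ?P = "\<lambda>x. \<forall>L v. comb L v \<longrightarrow> comb (\<lambda>u. L (\<pi> (adj (F0 G) x) u)) (\<pi> x v)"
    have add: "?P (x \<oplus>\<^bsub>F0 G\<^esub> y)" if c: "x \<in> carrier (F0 G)" "y \<in> carrier (F0 G)" and P: "?P x" "?P y" for x y
    proof (intro allI impI)
      fix L v assume L: "comb L v"
      show "comb (\<lambda>u. L (\<pi> (adj (F0 G) (x \<oplus>\<^bsub>F0 G\<^esub> y)) u)) (\<pi> (x \<oplus>\<^bsub>F0 G\<^esub> y) v)"
        using comb_add[OF P(1)[rule_format, OF L] P(2)[rule_format, OF L]]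
        by (simp only: A.adj_add[OF c] \<pi>h(2)[OF c] \<pi>h(2)[OF A.adj_closed[OF c(1)] A.adj_closed[OF c(2)]] comb_linear(1)[OF L])
    qed
    have smult: "?P (c \<odot>\<^bsub>F0 G\<^esub> x)" if c: "x \<in> carrier (F0 G)" and P: "?P x" for x c
    proof (intro allI impI)
      fix L v assume L: "comb L v"
      show "comb (\<lambda>u. L (\<pi> (adj (F0 G) (c \<odot>\<^bsub>F0 G\<^esub> x)) u)) (\<pi> (c \<odot>\<^bsub>F0 G\<^esub> x) v)"
        using comb_scale[OF P[rule_format, OF L], of c]
        by (simp only: A.adj_smult[OF c(1)] \<pi>h(3)[OF c(1)] \<pi>h(3)[OF A.adj_closed[OF c(1)]] comb_linear(2)[OF L])
    qed
    have qq: "?P (qq G k)" for k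
      using comb_Qop by (simp only: qq_adj \<pi>q) simp
    have xa: "?P (xa G l k)" if "l \<in> letters G" "k \<ge> 1" for l k
    proof -
      have "flip l \<in> letters G" using that by simp
      from \<pi>xa[OF this that(2)] show ?thesis using comb_xop by (simp only: xa_adj[OF that] \<pi>xa[OF that]) simp
    qed
    show ?thesis using that
    proof (induction x rule: F0_induct)
      case one
      show ?case by (simp only: A.adj_one \<pi>h(5)) blast
    next
      case (xa l k)
      then show ?case by (rule \<open>\<And>l k. l \<in> letters G \<Longrightarrow> k \<ge> 1 \<Longrightarrow> ?P (xa G l k)\<close>)
    next
      case (xb l k)
      have f: "flip l \<in> letters G" using xb by simp
      show ?case
      proof (intro allI impI)
        fix L v assume L: "comb L v"
        have "comb (\<lambda>u. L (u2 (flip l) k u)) (u2 l k v)"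
          using comb_zero[OF L] comb_xop[OF L, of l k] by (cases "k = 1") (simp_all add: u2_def)
        then show "comb (\<lambda>u. L (\<pi> (adj (F0 G) (xb G l k)) u)) (\<pi> (xb G l k) v)"
          unfolding xb_adj[OF xb] \<pi>xb[OF xb] \<pi>xb[OF f xb(2)] .
      qed
    next
      case (pp k)
      show ?case unfolding pp_eq[OF pp] A.minus_eq_smult[OF qq_closed qq_closed]
        by (intro add smult qq qq_closed A.smult_closed)
    next
      case (add x y)
      then show ?case by (intro \<open>\<And>x y. x \<in> carrier (F0 G) \<Longrightarrow> y \<in> carrier (F0 G) \<Longrightarrow> ?P x \<Longrightarrow> ?P y \<Longrightarrow> ?P (x \<oplus>\<^bsub>F0 G\<^esub> y)\<close>)
    next
      case (smult x c)
      then show ?case by (intro \<open>\<And>x c. x \<in> carrier (F0 G) \<Longrightarrow> ?P x \<Longrightarrow> ?P (c \<odot>\<^bsub>F0 G\<^esub> x)\<close>)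
    next
      case (mult x y)
      show ?case
      proof (intro allI impI)
        fix L v assume L: "comb L v"
        show "comb (\<lambda>u. L (\<pi> (adj (F0 G) (x \<otimes>\<^bsub>F0 G\<^esub> y)) u)) (\<pi> (x \<otimes>\<^bsub>F0 G\<^esub> y) v)"
          using mult(3)[rule_format, OF mult(4)[rule_format, OF L]]
          by (simp only: A.adj_mult[OF mult(1,2)] \<pi>h(4)[OF mult(1,2)] \<pi>h(4)[OF A.adj_closed[OF mult(2)] A.adj_closed[OF mult(1)]])
      qed
    qed
  qed
  have pos: "\<phi> (adj (F0 G) x \<otimes>\<^bsub>F0 G\<^esub> x) \<in> \<real>\<^sub>\<ge>\<^sub>0" if x: "x \<in> carrier (F0 G)" for x
    using comb_nonneg[OF good[OF x, rule_format, OF comb_vacuum]]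
    unfolding \<phi>_def Vmul[OF A.adj_closed[OF x] x] unfolding V_def .
  have state: "state (F0 G) \<phi>"
    unfolding state_iff linear_map_def
    using pos Vadd Vsm Vone by (auto simp: \<phi>_def)
  \<comment> \<open>A vector fixed by q_j does not involve colours from j on, so letters of colour j
    are independent of it and q_j replaces them by their \<mu>-moment.\<close>
  have center: "Qop j (\<pi> (copy G j a) u) = (\<lambda>f. \<mu> a * u f)"
    if j: "j \<ge> 1" and u: "Qop j u = u" and a: "a \<in> carrier (free_alg G)" for j u a
  proof -
    have xc: "\<And>l. l \<in> letters G \<Longrightarrow> xa G l j \<in> carrier (F0 G)" using j by simp
    have cp: "copy G j \<in> alg_hom (free_alg G) (F0 G)" by (rule free_lift_alg_hom[OF A.complex_alg_axioms xc])
    note ch = alg_homD(2-6)[OF cp]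
    have uf: "u f = M (hi j f) * u (lo j f)" for f using fun_cong[OF u, of f] j by (simp add: Qop_def)
    have word: "\<pi> (word_prod (F0 G) (\<lambda>l. xa G l j) w) u = (\<lambda>f. u (f @ map (\<lambda>l. (l, j)) w)) \<and>
        word_prod (F0 G) (\<lambda>l. xa G l j) w \<in> carrier (F0 G)" if "w \<in> lists (letters G)" for w
      using that
    proof (induction w)
      case Nil
      show ?case using A.one_closed by (simp only: word_prod_simps \<pi>h(5)) simp
    next
      case (Cons l w)
      let ?v = "\<lambda>f. u (f @ map (\<lambda>l. (l, j)) w)"
      have IH: "\<pi> (word_prod (F0 G) (\<lambda>l. xa G l j) w) u = ?v" "word_prod (F0 G) (\<lambda>l. xa G l j) w \<in> carrier (F0 G)"
        using Cons by auto
      have l: "l \<in> letters G" using Cons by auto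
      have hj: "hi (Suc j) (map (\<lambda>l. (l, j)) w) = []" by (auto simp: hi_def filter_empty_conv)
      have QS: "Qop (Suc j) u = u" using u Qop_Qop[of "Suc j" j u] by simp
      have uS: "u f = M (hi (Suc j) f) * u (lo (Suc j) f)" for f using fun_cong[OF QS, of f] unfolding Qop_def by simp
      \<comment> \<open>The vector involves only colours up to j, so the compression by q_(j+1)
        inside \<open>xop\<close> is invisible.\<close>
      have "Qop (Suc j) ?v = ?v"
      proof
        fix f
        show "Qop (Suc j) ?v f = ?v f"
          using uS[of "f @ map (\<lambda>l. (l, j)) w"] hj by (simp add: Qop_def)
      qed
      then have "xop l j ?v = (\<lambda>f. u (f @ map (\<lambda>l. (l, j)) (l # w)))" by (simp add: xop_def App_def)
      then show ?case using IH A.m_closed[OF xc[OF l] IH(2)] \<pi>xa[OF l j] \<pi>h(4)[OF xc[OF l] IH(2)] by simp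
    qed
    have L: "Qop j (\<pi> (copy G j p) u) f = \<mu> p * u f" if "p \<in> carrier (free_alg G)" for p f
    proof -
      have l1: "(\<lambda>p. Qop j (\<pi> (copy G j p) u) f) \<in> linear_map (free_alg G) complex_star"
        unfolding linear_map_def
      proof (intro CollectI conjI ballI allI funcsetI)
        fix p q assume pq: "p \<in> carrier (free_alg G)" "q \<in> carrier (free_alg G)"
        show "Qop j (\<pi> (copy G j (p \<oplus>\<^bsub>free_alg G\<^esub> q)) u) f = Qop j (\<pi> (copy G j p) u) f \<oplus>\<^bsub>complex_star\<^esub> Qop j (\<pi> (copy G j q) u) f"
          by (simp only: ch(2)[OF pq] \<pi>h(2)[OF ch(1)[OF pq(1)] ch(1)[OF pq(2)]] lin_opD(1)[OF lin_op_Qop] complex_star_simps)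
      next
        fix c p assume p: "p \<in> carrier (free_alg G)"
        show "Qop j (\<pi> (copy G j (c \<odot>\<^bsub>free_alg G\<^esub> p)) u) f = c \<odot>\<^bsub>complex_star\<^esub> Qop j (\<pi> (copy G j p) u) f"
          by (simp only: ch(3)[OF p] \<pi>h(3)[OF ch(1)[OF p]] lin_opD(2)[OF lin_op_Qop] complex_star_simps)
      qed simp
      have l2: "(\<lambda>p. \<mu> p * u f) \<in> linear_map (free_alg G) complex_star"
        using \<mu> unfolding state_iff linear_map_def by (auto simp: algebra_simps)
      have w: "Qop j (\<pi> (copy G j (Poly_Mapping.single w 1)) u) f = \<mu> (Poly_Mapping.single w 1) * u f"
        if w: "w \<in> lists (letters G)" for w
      proof -
        have "copy G j (Poly_Mapping.single w 1) = 1 \<odot>\<^bsub>F0 G\<^esub> word_prod (F0 G) (\<lambda>l. xa G l j) w"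
          by (rule free_lift_single[OF A.complex_alg_axioms _ w]) (rule xc)
        then have "copy G j (Poly_Mapping.single w 1) = word_prod (F0 G) (\<lambda>l. xa G l j) w"
          using word[OF w] by simp
        then have "Qop j (\<pi> (copy G j (Poly_Mapping.single w 1)) u) f = M (hi j f) * u (lo j f @ map (\<lambda>l. (l, j)) w)"
          using word[OF w] j by (simp add: Qop_def)
        also have "u (lo j f @ map (\<lambda>l. (l, j)) w) = m w * u (lo j f)"
        proof -
          \<comment> \<open>Only the appended letters have colour at least j, so the invariance of
            \<open>u\<close> under q_j splits off exactly their moment.\<close>
          have "hi j (lo j f @ map (\<lambda>l. (l, j)) w) = map (\<lambda>l. (l, j)) w"
            by (auto simp: hi_def lo_def filter_empty_conv)
          then show ?thesis using uf[of "lo j f @ map (\<lambda>l. (l, j)) w"] by (simp add: M_colour)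
        qed
        also have "M (hi j f) * (m w * u (lo j f)) = m w * u f" by (simp add: uf[of f])
        also have "m w = \<mu> (Poly_Mapping.single w 1)" by (simp only: m_def w if_True)
        finally show ?thesis .
      qed
      show ?thesis
        using linear_map_monoid_alg_eqI[OF monoid_words[of G] l1[unfolded free_alg_def] l2[unfolded free_alg_def], of p] w that
        by (simp add: free_alg_def)
    qed
    show ?thesis by (rule ext) (rule L[OF a])
  qed
  have "vacuum_rep G \<mu> \<phi> V []"
  proof
    show "state (F0 G) \<phi>" by (rule state)
    show "\<phi> (qq G 1) = 1" unfolding \<phi>_def V_def \<pi>q by (rule Qop_M(1))
    show "V (qq G j) = V \<one>\<^bsub>F0 G\<^esub>" if "1 \<le> j" for j
      unfolding Vone by (simp only: V_def \<pi>q Qop_M(2)[OF that])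
    show "V (z \<otimes>\<^bsub>F0 G\<^esub> x) = V (z \<otimes>\<^bsub>F0 G\<^esub> y)"
      if "z \<in> carrier (F0 G)" "x \<in> carrier (F0 G)" "y \<in> carrier (F0 G)" "V x = V y" for z x y
      by (simp only: Vmul[OF that(1,2)] Vmul[OF that(1,3)] that(4))
    show "V (xb G l k \<otimes>\<^bsub>F0 G\<^esub> x) = V (xa G l k \<otimes>\<^bsub>F0 G\<^esub> x)"
      if l: "l \<in> letters G" and k: "2 \<le> k" and x: "x \<in> carrier (F0 G)" for l k x
    proof -
      have k1: "1 \<le> k" "k \<noteq> 1" using k by auto
      show ?thesis
        by (simp only: Vmul[OF xb_closed[OF l k1(1)] x] Vmul[OF xa_closed[OF l k1(1)] x] \<pi>xa[OF l k1(1)] \<pi>xb[OF l k1(1)]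
            u2_def k1(2) if_False)
    qed
    show "V (qq G 1 \<otimes>\<^bsub>F0 G\<^esub> x) [] = V x []" if "x \<in> carrier (F0 G)" for x
      by (simp only: Vmul[OF qq_closed that] \<pi>q Q1)
    show "V (qq G j \<otimes>\<^bsub>F0 G\<^esub> (copy G j a \<otimes>\<^bsub>F0 G\<^esub> x)) = (\<lambda>f. \<mu> a * V x f)"
      if j: "1 \<le> j" and x: "x \<in> carrier (F0 G)" and q: "V (qq G j \<otimes>\<^bsub>F0 G\<^esub> x) = V x"
        and a: "a \<in> carrier (free_alg G)" for j x a
    proof -
      have "copy G j \<in> alg_hom (free_alg G) (F0 G)"
        by (rule free_lift_alg_hom[OF A.complex_alg_axioms]) (use j in simp)
      note c = alg_homD(2)[OF this a]
      have "Qop j (V x) = V x" using q by (simp only: Vmul[OF qq_closed x] \<pi>q)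
      from center[OF j this a] show ?thesis
        by (simp only: Vmul[OF qq_closed A.m_closed[OF c x]] Vmul[OF c x] \<pi>q)
    qed
  qed (simp_all add: \<phi>_def Vadd Vsm)
  then show ?thesis by blast
qed

section \<open>The two copies of \<open>\<A>\<close> in the tensor square\<close>

text \<open>The left and the right copy differ only by the order of the tensor legs, so \<open>t\<close> stands for
  either of the two.\<close>

locale tensor_leg =
  fixes G :: "'g set" and t
  assumes t_cases: "t = tt G \<or> t = (\<lambda>x y. tt G y x)"
begin

sublocale A: star_algebra "F0 G" by (rule star_algebra_F0)
sublocale T: star_algebra "F0F0 G" by (rule star_algebra_F0F0)
sublocale C: mtower "F0 G" by (rule mtower_F0)
sublocale D: mtower "F0F0 G" by (rule mtower_F0F0)

lemma t_closed: "x \<in> carrier (F0 G) \<Longrightarrow> y \<in> carrier (F0 G) \<Longrightarrow> t x y \<in> carrier (F0F0 G)"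
  using t_cases by (auto intro: tt_closed)

lemma t_mult: "a \<in> carrier (F0 G) \<Longrightarrow> b \<in> carrier (F0 G) \<Longrightarrow> x \<in> carrier (F0 G) \<Longrightarrow> y \<in> carrier (F0 G) \<Longrightarrow>
    t a b \<otimes>\<^bsub>F0F0 G\<^esub> t x y = t (a \<otimes>\<^bsub>F0 G\<^esub> x) (b \<otimes>\<^bsub>F0 G\<^esub> y)"
  using t_cases by (auto simp: tt_mult)

lemma t_add_l: "a \<in> carrier (F0 G) \<Longrightarrow> b \<in> carrier (F0 G) \<Longrightarrow> y \<in> carrier (F0 G) \<Longrightarrow>
    t (a \<oplus>\<^bsub>F0 G\<^esub> b) y = t a y \<oplus>\<^bsub>F0F0 G\<^esub> t b y"
  using t_cases by (auto simp: tt_add_l tt_add_r)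

lemma t_smult_l: "a \<in> carrier (F0 G) \<Longrightarrow> y \<in> carrier (F0 G) \<Longrightarrow> t (c \<odot>\<^bsub>F0 G\<^esub> a) y = c \<odot>\<^bsub>F0F0 G\<^esub> t a y"
  using t_cases by (auto simp: tt_smult_l tt_smult_r)

lemma t_zero_r: "a \<in> carrier (F0 G) \<Longrightarrow> t a \<zero>\<^bsub>F0 G\<^esub> = \<zero>\<^bsub>F0F0 G\<^esub>"
  using t_cases by (auto simp: tt_zero_l tt_zero_r)

lemma t_adj: "a \<in> carrier (F0 G) \<Longrightarrow> b \<in> carrier (F0 G) \<Longrightarrow> adj (F0F0 G) (t a b) = t (adj (F0 G) a) (adj (F0 G) b)"
  using t_cases by (auto simp: tt_adj)

lemma t_stage: "a \<in> stage (F0 G) m \<Longrightarrow> b \<in> stage (F0 G) m \<Longrightarrow> t a b \<in> stage (F0F0 G) m"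
  using t_cases by (auto intro: stage_T_rules(1))

lemma t_qq: "tt G (qq G i) (qq G i) = t (qq G i) (qq G i)"
  using t_cases by auto

definition leg_term :: "'g letter \<Rightarrow> nat \<Rightarrow> _" where
  "leg_term l k = t (xa G l k) (qq G k) \<ominus>\<^bsub>F0F0 G\<^esub> t (xb G l k) (qq G (k - 1))"

primrec leg_sum :: "nat \<Rightarrow> 'g letter \<Rightarrow> _" where
  "leg_sum 0 l = \<zero>\<^bsub>F0F0 G\<^esub>"
| "leg_sum (Suc m) l = leg_sum m l \<oplus>\<^bsub>F0F0 G\<^esub> leg_term l (Suc m)"

lemma leg_term_closed: "l \<in> letters G \<Longrightarrow> k \<ge> 1 \<Longrightarrow> leg_term l k \<in> carrier (F0F0 G)"
  unfolding leg_term_def by (intro T.minus_closed t_closed xa_closed xb_closed qq_closed)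

lemma leg_sum_closed: "l \<in> letters G \<Longrightarrow> leg_sum m l \<in> carrier (F0F0 G)"
proof (induction m)
  case 0
  show ?case unfolding leg_sum.simps by (rule T.zero_closed)
next
  case (Suc m)
  show ?case unfolding leg_sum.simps by (intro T.a_closed Suc leg_term_closed) simp
qed

lemma leg_term_stage: "l \<in> letters G \<Longrightarrow> 1 \<le> k \<Longrightarrow> k \<le> m \<Longrightarrow> leg_term l k \<in> stage (F0F0 G) m"
proof -
  assume l: "l \<in> letters G" and k: "1 \<le> k" "k \<le> m"
  note c = t_closed[OF xa_closed[OF l k(1)] qq_closed] t_closed[OF xb_closed[OF l k(1)] qq_closed]
  show ?thesis unfolding leg_term_def T.minus_eq_smult[OF c]
    by (intro stage_T_rules t_stage stage_F0_letters l k stage_F0_qq)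
qed

lemma leg_sum_stage: "l \<in> letters G \<Longrightarrow> n \<le> m \<Longrightarrow> leg_sum n l \<in> stage (F0F0 G) m"
proof (induction n)
  case 0
  show ?case unfolding leg_sum.simps by (rule stage_T_rules(4))
next
  case (Suc n)
  show ?case unfolding leg_sum.simps
    by (intro stage_T_rules(2) leg_term_stage Suc) (use Suc in simp_all)
qed

lemma leg_sum_adj: "l \<in> letters G \<Longrightarrow> adj (F0F0 G) (leg_sum m l) = leg_sum m (flip l)"
proof (induction m)
  case 0
  show ?case unfolding leg_sum.simps by (rule T.adj_zero)
next
  case (Suc m)
  note l = Suc(2)
  have k: "Suc m \<ge> 1" by simp
  have "adj (F0F0 G) (leg_term l (Suc m)) = leg_term (flip l) (Suc m)"
    unfolding leg_term_def
      T.adj_minus[OF t_closed[OF xa_closed[OF l k] qq_closed] t_closed[OF xb_closed[OF l k] qq_closed]]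
      t_adj[OF xa_closed[OF l k] qq_closed] t_adj[OF xb_closed[OF l k] qq_closed] xa_adj[OF l k] xb_adj[OF l k] qq_adj ..
  then show ?case
    unfolding leg_sum.simps T.adj_add[OF leg_sum_closed[OF l] leg_term_closed[OF l k]] Suc(1)[OF l] by simp
qed

text \<open>For k > i both q_k and q_(k-1) restrict to q_i, on which X'(k) and X''(k) agree, so the
  later terms vanish on the i-th diagonal projection.\<close>

lemma leg_sum_proj:
  assumes l: "l \<in> letters G" and "i \<le> n"
  shows "leg_sum n l \<otimes>\<^bsub>F0F0 G\<^esub> tproj (F0F0 G) (enat i) = leg_sum i l \<otimes>\<^bsub>F0F0 G\<^esub> tproj (F0F0 G) (enat i)"
  using assms(2)
proof (induction n rule: dec_induct)
  case (step n)
  have k: "Suc n \<ge> 1" by simp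
  let ?Q = "tproj (F0F0 G) (enat i)"
  have Q: "?Q = t (qq G i) (qq G i)" unfolding tproj_T F0_q_simps by (rule t_qq)
  have m: "min (Suc n) i = i" "min (Suc n - 1) i = i" using step by auto
  note c = t_closed[OF xa_closed[OF l k] qq_closed] t_closed[OF xb_closed[OF l k] qq_closed]
  have "leg_term l (Suc n) \<otimes>\<^bsub>F0F0 G\<^esub> ?Q = t (xa G l (Suc n) \<otimes>\<^bsub>F0 G\<^esub> qq G i) (qq G i) \<ominus>\<^bsub>F0F0 G\<^esub>
      t (xb G l (Suc n) \<otimes>\<^bsub>F0 G\<^esub> qq G i) (qq G i)"
    unfolding leg_term_def T.minus_mult_l[OF c D.proj_closed] unfolding Q
      t_mult[OF xa_closed[OF l k] qq_closed qq_closed qq_closed] t_mult[OF xb_closed[OF l k] qq_closed qq_closed qq_closed]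
      qq_mult m ..
  also have "xa G l (Suc n) \<otimes>\<^bsub>F0 G\<^esub> qq G i = xb G l (Suc n) \<otimes>\<^bsub>F0 G\<^esub> qq G i"
    by (rule qq_x_eq(2)[OF l]) (use step in simp)
  also have "t (xb G l (Suc n) \<otimes>\<^bsub>F0 G\<^esub> qq G i) (qq G i) \<ominus>\<^bsub>F0F0 G\<^esub> t (xb G l (Suc n) \<otimes>\<^bsub>F0 G\<^esub> qq G i) (qq G i) = \<zero>\<^bsub>F0F0 G\<^esub>"
    by (rule T.minus_self[OF t_closed[OF A.m_closed[OF xb_closed[OF l k] qq_closed] qq_closed]])
  finally have z: "leg_term l (Suc n) \<otimes>\<^bsub>F0F0 G\<^esub> ?Q = \<zero>\<^bsub>F0F0 G\<^esub>" .
  show ?case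
    unfolding leg_sum.simps T.l_distr[OF leg_sum_closed[OF l] leg_term_closed[OF l k] D.proj_closed] z step(3)
    by (rule T.r_zero[OF T.m_closed[OF leg_sum_closed[OF l] D.proj_closed]])
qed simp

lemma coherent_leg_sum:
  assumes l: "l \<in> letters G"
  shows "D.coherent (\<lambda>m. leg_sum m l)"
proof -
  have f: "flip l \<in> letters G" using l by simp
  show ?thesis
    unfolding D.coherent_def
  proof (intro conjI allI impI)
    show "leg_sum m l \<in> stage (F0F0 G) m" for m by (rule leg_sum_stage[OF l order_refl])
    fix i :: nat
    show "\<exists>a. \<forall>\<^sub>F n in sequentially. leg_sum n l \<otimes>\<^bsub>F0F0 G\<^esub> tproj (F0F0 G) (enat i) = a"
      by (rule exI, rule eventually_sequentiallyI[of i], rule leg_sum_proj[OF l])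
    show "\<exists>a. \<forall>\<^sub>F n in sequentially. adj (F0F0 G) (leg_sum n l) \<otimes>\<^bsub>F0F0 G\<^esub> tproj (F0F0 G) (enat i) = a"
      unfolding leg_sum_adj[OF l] by (rule exI, rule eventually_sequentiallyI[of i], rule leg_sum_proj[OF f])
  qed
qed

definition leg_hom :: "nat \<Rightarrow> 'g star_poly \<Rightarrow> _" where
  "leg_hom m = free_lift (F0F0 G) (leg_sum m)"

lemma leg_hom: "leg_hom m \<in> star_hom (free_alg G) (F0F0 G)"
  unfolding leg_hom_def
proof (rule free_lift_star_hom[OF T.complex_alg_axioms _ star_algebra_F0F0])
  fix l assume "l \<in> letters G"
  then show "leg_sum m l \<in> carrier (F0F0 G)" "leg_sum m (flip l) = adj (F0F0 G) (leg_sum m l)"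
    using leg_sum_closed[of l m] leg_sum_adj[of l m] by simp_all
qed

lemma leg_hom_letter: "l \<in> letters G \<Longrightarrow> leg_hom m (letter l) = leg_sum m l"
  unfolding leg_hom_def by (rule free_lift_letter[OF T.complex_alg_axioms]) (rule leg_sum_closed)

lemmas leg_homD = alg_homD(2-6)[OF star_hom_alg_hom[OF leg_hom]]

lemma coherent_leg_hom: "a \<in> carrier (free_alg G) \<Longrightarrow> D.coherent (\<lambda>m. leg_hom m a)"
proof (rule D.coherent_free_hom[OF leg_hom])
  fix X assume "X \<in> G"
  then have l: "Gen X \<in> letters G" by simp
  show "D.coherent (\<lambda>m. leg_hom m (letter (Gen X)))"
    unfolding leg_hom_letter[OF l] by (rule coherent_leg_sum[OF l])
qed

end

text \<open>\<open>in_proj V j x\<close> says that the vector of \<open>x\<close> lies in the range of \<open>p\<^sub>j\<close>.\<close>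

definition in_proj :: "'g set \<Rightarrow> ('g fgen star_poly set \<Rightarrow> 'b \<Rightarrow> complex) \<Rightarrow> nat \<Rightarrow> 'g fgen star_poly set \<Rightarrow> bool" where
  "in_proj G V j x \<longleftrightarrow> (\<forall>i. V (qq G i \<otimes>\<^bsub>F0 G\<^esub> x) = (if j \<le> i then V x else (\<lambda>f. 0)))"

lemma copy_hom: "j \<ge> 1 \<Longrightarrow> copy G j \<in> alg_hom (free_alg G) (F0 G)"
proof -
  assume j: "j \<ge> 1"
  interpret A: star_algebra "F0 G" by (rule star_algebra_F0)
  show ?thesis by (rule free_lift_alg_hom[OF A.complex_alg_axioms]) (rule xa_closed[OF _ j])
qed

lemma copy_letter: "j \<ge> 1 \<Longrightarrow> l \<in> letters G \<Longrightarrow> copy G j (letter l) = xa G l j"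
proof -
  assume j: "j \<ge> 1" and l: "l \<in> letters G"
  interpret A: star_algebra "F0 G" by (rule star_algebra_F0)
  show ?thesis by (rule free_lift_letter[OF A.complex_alg_axioms _ l]) (rule xa_closed[OF _ j])
qed

lemma copy_stage: "a \<in> carrier (free_alg G) \<Longrightarrow> j \<ge> 1 \<Longrightarrow> copy G j a \<in> stage (F0 G) j"
proof (induction a rule: free_alg_induct)
  case one
  show ?case unfolding alg_homD(6)[OF copy_hom[OF one]] by (rule stage_F0_rules)
next
  case (letter l)
  show ?case unfolding copy_letter[OF letter(2,1)] by (rule stage_F0_letters(1)[OF letter order_refl])
next
  case (add p q)
  show ?case unfolding alg_homD(3)[OF copy_hom[OF add(5)] add(1,2)] by (intro stage_F0_rules add)
next
  case (smult p c)
  show ?case unfolding alg_homD(4)[OF copy_hom[OF smult(3)] smult(1)] by (intro stage_F0_rules smult)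
next
  case (mult p q)
  show ?case unfolding alg_homD(5)[OF copy_hom[OF mult(5)] mult(1,2)] by (intro stage_F0_rules mult)
qed

context vacuum_rep
begin

interpretation A: star_algebra "F0 G" by (rule star_algebra_F0)

lemma V_zero: "V \<zero>\<^bsub>F0 G\<^esub> = (\<lambda>f. 0)"
  using V_smult[OF A.zero_closed, of 0] A.smult_zero_r[of 0] by simp

text \<open>q_0 vanishes while every later q_i fixes the vacuum; colour 1 is thus where an
  alternating word starts.\<close>

lemma in_proj_one: "in_proj G V 1 \<one>\<^bsub>F0 G\<^esub>"
  unfolding in_proj_def
proof
  fix i
  show "V (qq G i \<otimes>\<^bsub>F0 G\<^esub> \<one>\<^bsub>F0 G\<^esub>) = (if 1 \<le> i then V \<one>\<^bsub>F0 G\<^esub> else (\<lambda>f. 0))"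
    using V_one[of i] V_zero by (cases "i = 0") (simp_all add: A.r_one[OF qq_closed] qq_0)
qed

lemma qq_fixed_mono:
  assumes "V (qq G j \<otimes>\<^bsub>F0 G\<^esub> x) = V x" "j \<le> i" "x \<in> carrier (F0 G)"
  shows "V (qq G i \<otimes>\<^bsub>F0 G\<^esub> x) = V x"
proof -
  note c = A.m_closed[OF qq_closed assms(3)]
  have "V (qq G i \<otimes>\<^bsub>F0 G\<^esub> x) = V (qq G i \<otimes>\<^bsub>F0 G\<^esub> (qq G j \<otimes>\<^bsub>F0 G\<^esub> x))"
    by (rule V_cong[OF qq_closed assms(3) c assms(1)[symmetric]])
  also have "qq G i \<otimes>\<^bsub>F0 G\<^esub> (qq G j \<otimes>\<^bsub>F0 G\<^esub> x) = qq G j \<otimes>\<^bsub>F0 G\<^esub> x"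
    unfolding A.m_assoc[OF qq_closed qq_closed assms(3), symmetric] qq_mult min_absorb2[OF assms(2)] ..
  finally show ?thesis unfolding assms(1) .
qed

text \<open>The copy of colour j commutes with q_(j+1), which keeps the vector in the range of
  q_(j+1); by \<open>V_center\<close> its q_j part is \<mu> a times the old vector, hence
  zero.\<close>

lemma in_proj_center:
  assumes j: "j \<ge> 1" and x: "x \<in> carrier (F0 G)" and q: "V (qq G j \<otimes>\<^bsub>F0 G\<^esub> x) = V x"
    and a: "a \<in> carrier (free_alg G)" "\<mu> a = 0"
  shows "in_proj G V (Suc j) (copy G j a \<otimes>\<^bsub>F0 G\<^esub> x)"
proof -
  have cc: "copy G j a \<in> carrier (F0 G)" by (rule stage_F0_closed[OF copy_stage[OF a(1) j]])
  let ?y = "copy G j a \<otimes>\<^bsub>F0 G\<^esub> x"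
  have y: "?y \<in> carrier (F0 G)" by (rule A.m_closed[OF cc x])
  have qS: "V (qq G (Suc j) \<otimes>\<^bsub>F0 G\<^esub> ?y) = V ?y"
  proof -
    have "qq G (Suc j) \<otimes>\<^bsub>F0 G\<^esub> ?y = copy G j a \<otimes>\<^bsub>F0 G\<^esub> (qq G (Suc j) \<otimes>\<^bsub>F0 G\<^esub> x)"
      unfolding A.m_assoc[OF qq_closed cc x, symmetric] A.m_assoc[OF cc qq_closed x, symmetric]
        stage_F0_commute[OF copy_stage[OF a(1) j] lessI] ..
    then show ?thesis
      using V_cong[OF cc A.m_closed[OF qq_closed x] x qq_fixed_mono[OF q le_SucI[OF order_refl] x]] by simp
  qed
  have z: "V (qq G j \<otimes>\<^bsub>F0 G\<^esub> ?y) = V \<zero>\<^bsub>F0 G\<^esub>"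
    unfolding V_center[OF j x q a(1)] V_zero a(2) by simp
  show ?thesis unfolding in_proj_def
  proof
    fix i
    show "V (qq G i \<otimes>\<^bsub>F0 G\<^esub> ?y) = (if Suc j \<le> i then V ?y else (\<lambda>f. 0))"
    proof (cases "Suc j \<le> i")
      case True
      show ?thesis using qq_fixed_mono[OF qS True y] True by simp
    next
      case False
      then have m: "min i j = i" by simp
      have "qq G i \<otimes>\<^bsub>F0 G\<^esub> ?y = qq G i \<otimes>\<^bsub>F0 G\<^esub> (qq G j \<otimes>\<^bsub>F0 G\<^esub> ?y)"
        unfolding A.m_assoc[OF qq_closed qq_closed y, symmetric] qq_mult m ..
      also have "V \<dots> = V (qq G i \<otimes>\<^bsub>F0 G\<^esub> \<zero>\<^bsub>F0 G\<^esub>)"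
        by (rule V_cong[OF qq_closed A.m_closed[OF qq_closed y] A.zero_closed z])
      also have "\<dots> = (\<lambda>f. 0)" unfolding A.r_null[OF qq_closed] by (rule V_zero)
      finally show ?thesis using False by simp
    qed
  qed
qed

text \<open>\<phi> sees a vector only through q_1, which annihilates the range of p_j for j \<ge>
  2.\<close>

lemma \<phi>_in_proj: "in_proj G V j x \<Longrightarrow> j \<ge> 2 \<Longrightarrow> x \<in> carrier (F0 G) \<Longrightarrow> \<phi> x = 0"
  using V_qq_vac[of x] \<phi>_V[of x] by (auto simp: in_proj_def)

end

text \<open>On vectors whose other leg lies in the range of \<open>p\<^sub>j\<close>, the copy of \<open>\<A>\<close> in one leg acts
  as \<open>\<sigma>\<^sub>j\<close>: in \<open>\<Sum>\<^sub>k X'(k) \<otimes> q\<^sub>k - X''(k) \<otimes> q\<^sub>k\<^sub>-\<^sub>1\<close> the terms with \<open>k < j\<close> vanish and those with \<open>k > j\<close> cancel.\<close>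

locale leg_action = tensor_leg G t + L: vacuum_rep G \<mu> \<phi> V\<^sub>1 v\<^sub>1 + R: vacuum_rep G \<nu> \<psi> V\<^sub>2 v\<^sub>2
  for G :: "'g set" and t \<mu> \<phi> V\<^sub>1 v\<^sub>1 \<nu> \<psi> V\<^sub>2 v\<^sub>2 +
  fixes \<Phi>
  assumes \<Phi>: "\<Phi> \<in> linear_map (F0F0 G) complex_star"
    and \<Phi>_t: "x \<in> carrier (F0 G) \<Longrightarrow> y \<in> carrier (F0 G) \<Longrightarrow> \<Phi> (t x y) = \<phi> x * \<psi> y"
begin

lemma t_induct:
  assumes "z \<in> carrier (F0F0 G)" "\<And>a b. a \<in> carrier (F0 G) \<Longrightarrow> b \<in> carrier (F0 G) \<Longrightarrow> P (t a b)"
    "\<And>x y. x \<in> carrier (F0F0 G) \<Longrightarrow> y \<in> carrier (F0F0 G) \<Longrightarrow> P x \<Longrightarrow> P y \<Longrightarrow> P (x \<oplus>\<^bsub>F0F0 G\<^esub> y)"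
  shows "P z"
  using assms(1)
proof (induction z rule: tt_induct)
  case (tens a b)
  then show ?case using t_cases assms(2)[of a b] assms(2)[of b a] by auto
qed (rule assms(3))

text \<open>Equality of vectors in each leg may be used under \<Phi> behind an arbitrary left
  factor. This takes the place of a representation of the tensor square on a space of
  vectors.\<close>

lemma \<Phi>_cong:
  assumes z: "z \<in> carrier (F0F0 G)" and x: "x \<in> carrier (F0 G)" "x' \<in> carrier (F0 G)" "V\<^sub>1 x = V\<^sub>1 x'"
    and y: "y \<in> carrier (F0 G)" "y' \<in> carrier (F0 G)" "V\<^sub>2 y = V\<^sub>2 y'"
  shows "\<Phi> (z \<otimes>\<^bsub>F0F0 G\<^esub> t x y) = \<Phi> (z \<otimes>\<^bsub>F0F0 G\<^esub> t x' y')"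
  using z
proof (rule t_induct)
  fix a b assume ab: "a \<in> carrier (F0 G)" "b \<in> carrier (F0 G)"
  have e: "\<Phi> (t a b \<otimes>\<^bsub>F0F0 G\<^esub> t u w) = V\<^sub>1 (a \<otimes>\<^bsub>F0 G\<^esub> u) v\<^sub>1 * V\<^sub>2 (b \<otimes>\<^bsub>F0 G\<^esub> w) v\<^sub>2"
    if "u \<in> carrier (F0 G)" "w \<in> carrier (F0 G)" for u w
    unfolding t_mult[OF ab that] \<Phi>_t[OF A.m_closed[OF ab(1) that(1)] A.m_closed[OF ab(2) that(2)]]
      L.\<phi>_V[OF A.m_closed[OF ab(1) that(1)]] R.\<phi>_V[OF A.m_closed[OF ab(2) that(2)]] ..
  show "\<Phi> (t a b \<otimes>\<^bsub>F0F0 G\<^esub> t x y) = \<Phi> (t a b \<otimes>\<^bsub>F0F0 G\<^esub> t x' y')"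
    unfolding e[OF x(1) y(1)] e[OF x(2) y(2)] L.V_cong[OF ab(1) x] R.V_cong[OF ab(2) y] ..
next
  fix u w assume c: "u \<in> carrier (F0F0 G)" "w \<in> carrier (F0F0 G)"
    and eq: "\<Phi> (u \<otimes>\<^bsub>F0F0 G\<^esub> t x y) = \<Phi> (u \<otimes>\<^bsub>F0F0 G\<^esub> t x' y')" "\<Phi> (w \<otimes>\<^bsub>F0F0 G\<^esub> t x y) = \<Phi> (w \<otimes>\<^bsub>F0F0 G\<^esub> t x' y')"
  note tx = t_closed[OF x(1) y(1)] t_closed[OF x(2) y(2)]
  show "\<Phi> ((u \<oplus>\<^bsub>F0F0 G\<^esub> w) \<otimes>\<^bsub>F0F0 G\<^esub> t x y) = \<Phi> ((u \<oplus>\<^bsub>F0F0 G\<^esub> w) \<otimes>\<^bsub>F0F0 G\<^esub> t x' y')"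
    unfolding T.l_distr[OF c tx(1)] T.l_distr[OF c tx(2)]
      linear_mapD(2)[OF \<Phi> T.m_closed[OF c(1) tx(1)] T.m_closed[OF c(2) tx(1)]]
      linear_mapD(2)[OF \<Phi> T.m_closed[OF c(1) tx(2)] T.m_closed[OF c(2) tx(2)]] eq ..
qed

lemma \<Phi>_leg_sum:
  assumes l: "l \<in> letters G" and x: "x \<in> carrier (F0 G)" and y: "y \<in> carrier (F0 G)" and z: "z \<in> carrier (F0F0 G)"
    and j: "1 \<le> j" "j \<le> m" and p: "in_proj G V\<^sub>2 j y"
  shows "\<Phi> (z \<otimes>\<^bsub>F0F0 G\<^esub> (leg_sum m l \<otimes>\<^bsub>F0F0 G\<^esub> t x y)) = \<Phi> (z \<otimes>\<^bsub>F0F0 G\<^esub> t (xa G l j \<otimes>\<^bsub>F0 G\<^esub> x) y)"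
proof -
  let ?g = "\<lambda>w. \<Phi> (z \<otimes>\<^bsub>F0F0 G\<^esub> (w \<otimes>\<^bsub>F0F0 G\<^esub> t x y))"
  let ?v = "\<Phi> (z \<otimes>\<^bsub>F0F0 G\<^esub> t (xa G l j \<otimes>\<^bsub>F0 G\<^esub> x) y)"
  have g: "?g \<in> linear_map (F0F0 G) complex_star"
    using linear_map_compose[OF linear_map_compose[OF \<Phi> linear_map_mult_l[OF T.complex_alg_axioms z]]
        linear_map_mult_r[OF T.complex_alg_axioms t_closed[OF x y]]] .
  have gz: "?g \<zero>\<^bsub>F0F0 G\<^esub> = 0"
    using linear_mapD(3)[OF g T.zero_closed, of 0] T.smult_zero_r[of 0] by simp
  have z0: "\<Phi> (z \<otimes>\<^bsub>F0F0 G\<^esub> \<zero>\<^bsub>F0F0 G\<^esub>) = 0"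
    using gz unfolding T.l_null[OF t_closed[OF x y]] .
  have g0: "\<Phi> (z \<otimes>\<^bsub>F0F0 G\<^esub> t u (qq G k \<otimes>\<^bsub>F0 G\<^esub> y)) = 0" if u: "u \<in> carrier (F0 G)" and k: "k < j" for u k
  proof -
    have "V\<^sub>2 (qq G k \<otimes>\<^bsub>F0 G\<^esub> y) = V\<^sub>2 \<zero>\<^bsub>F0 G\<^esub>" using p k unfolding in_proj_def R.V_zero by simp
    from \<Phi>_cong[OF z u u refl A.m_closed[OF qq_closed y] A.zero_closed this] show ?thesis
      unfolding t_zero_r[OF u] z0 .
  qed
  have g1: "\<Phi> (z \<otimes>\<^bsub>F0F0 G\<^esub> t u (qq G k \<otimes>\<^bsub>F0 G\<^esub> y)) = \<Phi> (z \<otimes>\<^bsub>F0F0 G\<^esub> t u y)" if u: "u \<in> carrier (F0 G)" and k: "j \<le> k" for u k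
  proof -
    have "V\<^sub>2 (qq G k \<otimes>\<^bsub>F0 G\<^esub> y) = V\<^sub>2 y" using p k unfolding in_proj_def by simp
    from \<Phi>_cong[OF z u u refl A.m_closed[OF qq_closed y] y this] show ?thesis .
  qed
  have "?g (leg_term l k) = (if k = j then ?v else 0)" if k: "k \<ge> 1" for k
  proof -
    note xs = xa_closed[OF l k] xb_closed[OF l k]
    note xx = A.m_closed[OF xs(1) x] A.m_closed[OF xs(2) x]
    have d: "?g (leg_term l k) = \<Phi> (z \<otimes>\<^bsub>F0F0 G\<^esub> t (xa G l k \<otimes>\<^bsub>F0 G\<^esub> x) (qq G k \<otimes>\<^bsub>F0 G\<^esub> y)) -
        \<Phi> (z \<otimes>\<^bsub>F0F0 G\<^esub> t (xb G l k \<otimes>\<^bsub>F0 G\<^esub> x) (qq G (k - 1) \<otimes>\<^bsub>F0 G\<^esub> y))"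
      unfolding leg_term_def
      using linear_map_minus[OF T.complex_alg_axioms star_algebra.axioms(1)[OF star_algebra_complex_star] g
          t_closed[OF xs(1) qq_closed[of G k]] t_closed[OF xs(2) qq_closed[of G "k - 1"]]]
      by (simp add: t_mult[OF xs(1) qq_closed x y] t_mult[OF xs(2) qq_closed x y])
    show ?thesis
    proof (cases k j rule: linorder_cases)
      case less
      then show ?thesis unfolding d using g0[OF xx(1), of k] g0[OF xx(2), of "k - 1"] by simp
    next
      \<comment> \<open>Only X'(j) \<otimes> q_j survives: the X'' term carries q_(j-1), which kills
        the range of p_j.\<close>
      case equal
      then show ?thesis unfolding d using g1[OF xx(1), of k] g0[OF xx(2), of "k - 1"] j by simp
    next
      case greater
      then have "k \<ge> 2" using j by simp
      from \<Phi>_cong[OF z xx(2,1) L.V_xb[OF l this x] y y refl] show ?thesis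
        unfolding d using g1[OF xx(1), of k] g1[OF xx(2), of "k - 1"] greater by simp
    qed
  qed
  then have "?g (leg_sum n l) = (if j \<le> n then ?v else 0)" for n
  proof (induction n)
    case 0
    show ?case unfolding leg_sum.simps gz using j by simp
  next
    case (Suc n)
    have k: "Suc n \<ge> 1" by simp
    have "?g (leg_sum (Suc n) l) = ?g (leg_sum n l) + ?g (leg_term l (Suc n))"
      unfolding leg_sum.simps using linear_mapD(2)[OF g leg_sum_closed[OF l, of n] leg_term_closed[OF l k]]
      by (simp only: complex_star_simps)
    then show ?case using Suc(1)[OF Suc(2)] Suc(2)[OF k] by auto
  qed
  then show ?thesis using j by simp
qed

text \<open>Generalized over \<open>z\<close> and \<open>x\<close> so that a product splits: the
  left factor is absorbed into \<open>z\<close> while the right one acts on \<open>x\<close>. The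
  vector \<open>y\<close> of the other leg never changes, which keeps the colour fixed.\<close>

lemma \<Phi>_leg_hom:
  assumes a: "a \<in> carrier (free_alg G)" and j: "1 \<le> j" "j \<le> m"
    and y: "y \<in> carrier (F0 G)" "in_proj G V\<^sub>2 j y" and z: "z \<in> carrier (F0F0 G)" and x: "x \<in> carrier (F0 G)"
  shows "\<Phi> (z \<otimes>\<^bsub>F0F0 G\<^esub> (leg_hom m a \<otimes>\<^bsub>F0F0 G\<^esub> t x y)) = \<Phi> (z \<otimes>\<^bsub>F0F0 G\<^esub> t (copy G j a \<otimes>\<^bsub>F0 G\<^esub> x) y)"
  using a z x
proof (induction a arbitrary: z x rule: free_alg_induct)
  note ch = alg_homD(2-6)[OF copy_hom[OF j(1)]]
  case one
  show ?case unfolding leg_homD(5) ch(5) T.l_one[OF t_closed[OF one(2) y(1)]] A.l_one[OF one(2)] ..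
next
  case (letter l)
  show ?case unfolding leg_hom_letter[OF letter(1)] copy_letter[OF j(1) letter(1)]
    by (rule \<Phi>_leg_sum[OF letter(1) letter(3) y(1) letter(2) j y(2)])
next
  note ch = alg_homD(2-6)[OF copy_hom[OF j(1)]]
  case (add p q)
  note z = add(5) and x = add(6)
  note tx = t_closed[OF x y(1)] and c = ch(1)[OF add(1)] ch(1)[OF add(2)]
  note cx = A.m_closed[OF c(1) x] A.m_closed[OF c(2) x] and lh = leg_homD(1)[OF add(1)] leg_homD(1)[OF add(2)]
  note lt = T.m_closed[OF lh(1) tx] T.m_closed[OF lh(2) tx] and tc = t_closed[OF cx(1) y(1)] t_closed[OF cx(2) y(1)]
  show ?case
    unfolding leg_homD(2)[OF add(1,2)] ch(2)[OF add(1,2)] T.l_distr[OF lh tx] A.l_distr[OF c x]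
      t_add_l[OF cx y(1)] T.r_distr[OF lt z] T.r_distr[OF tc z]
      linear_mapD(2)[OF \<Phi> T.m_closed[OF z lt(1)] T.m_closed[OF z lt(2)]]
      linear_mapD(2)[OF \<Phi> T.m_closed[OF z tc(1)] T.m_closed[OF z tc(2)]] add(3)[OF z x] add(4)[OF z x] ..
next
  note ch = alg_homD(2-6)[OF copy_hom[OF j(1)]]
  case (smult p r)
  note z = smult(3) and x = smult(4)
  note tx = t_closed[OF x y(1)] and c = ch(1)[OF smult(1)] and lh = leg_homD(1)[OF smult(1)]
  note cx = A.m_closed[OF c x] and lt = T.m_closed[OF lh tx]
  note tc = t_closed[OF cx y(1)]
  show ?case
    unfolding leg_homD(3)[OF smult(1)] ch(3)[OF smult(1)] T.smult_mult_l[OF lh tx] A.smult_mult_l[OF c x]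
      t_smult_l[OF cx y(1)] T.smult_mult_r[OF z lt] T.smult_mult_r[OF z tc]
      linear_mapD(3)[OF \<Phi> T.m_closed[OF z lt]] linear_mapD(3)[OF \<Phi> T.m_closed[OF z tc]] smult(2)[OF z x] ..
next
  note ch = alg_homD(2-6)[OF copy_hom[OF j(1)]]
  case (mult p q)
  note z = mult(5) and x = mult(6)
  note tx = t_closed[OF x y(1)] and c = ch(1)[OF mult(1)] ch(1)[OF mult(2)]
  note cx = A.m_closed[OF c(2) x] and lh = leg_homD(1)[OF mult(1)] leg_homD(1)[OF mult(2)]
  have "\<Phi> (z \<otimes>\<^bsub>F0F0 G\<^esub> (leg_hom m (p \<otimes>\<^bsub>free_alg G\<^esub> q) \<otimes>\<^bsub>F0F0 G\<^esub> t x y)) =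
      \<Phi> ((z \<otimes>\<^bsub>F0F0 G\<^esub> leg_hom m p) \<otimes>\<^bsub>F0F0 G\<^esub> (leg_hom m q \<otimes>\<^bsub>F0F0 G\<^esub> t x y))"
    unfolding leg_homD(4)[OF mult(1,2)] T.m_assoc[OF lh tx] T.m_assoc[OF z lh(1) T.m_closed[OF lh(2) tx]] ..
  also have "\<dots> = \<Phi> ((z \<otimes>\<^bsub>F0F0 G\<^esub> leg_hom m p) \<otimes>\<^bsub>F0F0 G\<^esub> t (copy G j q \<otimes>\<^bsub>F0 G\<^esub> x) y)"
    by (rule mult(4)[OF T.m_closed[OF z lh(1)] x])
  also have "\<dots> = \<Phi> (z \<otimes>\<^bsub>F0F0 G\<^esub> (leg_hom m p \<otimes>\<^bsub>F0F0 G\<^esub> t (copy G j q \<otimes>\<^bsub>F0 G\<^esub> x) y))"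
    unfolding T.m_assoc[OF z lh(1) t_closed[OF cx y(1)]] ..
  also have "\<dots> = \<Phi> (z \<otimes>\<^bsub>F0F0 G\<^esub> t (copy G j p \<otimes>\<^bsub>F0 G\<^esub> (copy G j q \<otimes>\<^bsub>F0 G\<^esub> x)) y)"
    by (rule mult(3)[OF z cx])
  also have "copy G j p \<otimes>\<^bsub>F0 G\<^esub> (copy G j q \<otimes>\<^bsub>F0 G\<^esub> x) = copy G j (p \<otimes>\<^bsub>free_alg G\<^esub> q) \<otimes>\<^bsub>F0 G\<^esub> x"
    unfolding ch(4)[OF mult(1,2)] A.m_assoc[OF c x] ..
  finally show ?case .
qed

text \<open>The vacuum of the other leg lies in the range of p_1, so the leg acts through the copy
  of colour 1, whose vacuum moments are those of \<mu>. At level 0 the sums would be empty.\<close>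

lemma \<Phi>_leg_hom_moment:
  assumes a: "a \<in> carrier (free_alg G)" and m: "1 \<le> m"
  shows "\<Phi> (leg_hom m a) = \<mu> a"
proof -
  note I = A.one_closed
  have cc: "copy G 1 a \<in> carrier (F0 G)" by (rule stage_F0_closed[OF copy_stage[OF a order_refl]])
  have tI: "t \<one>\<^bsub>F0 G\<^esub> \<one>\<^bsub>F0 G\<^esub> = \<one>\<^bsub>F0F0 G\<^esub>" using t_cases tt_one by auto
  have "\<Phi> (leg_hom m a) = \<Phi> (\<one>\<^bsub>F0F0 G\<^esub> \<otimes>\<^bsub>F0F0 G\<^esub> (leg_hom m a \<otimes>\<^bsub>F0F0 G\<^esub> t \<one>\<^bsub>F0 G\<^esub> \<one>\<^bsub>F0 G\<^esub>))"
    unfolding tI T.r_one[OF leg_homD(1)[OF a]] T.l_one[OF leg_homD(1)[OF a]] ..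
  also have "\<dots> = \<Phi> (\<one>\<^bsub>F0F0 G\<^esub> \<otimes>\<^bsub>F0F0 G\<^esub> t (copy G 1 a \<otimes>\<^bsub>F0 G\<^esub> \<one>\<^bsub>F0 G\<^esub>) \<one>\<^bsub>F0 G\<^esub>)"
    by (rule \<Phi>_leg_hom[OF a order_refl m I R.in_proj_one T.one_closed I])
  also have "\<dots> = \<phi> (copy G 1 a) * \<psi> \<one>\<^bsub>F0 G\<^esub>"
    unfolding A.r_one[OF cc] T.l_one[OF t_closed[OF cc I]] by (rule \<Phi>_t[OF cc I])
  also have "\<psi> \<one>\<^bsub>F0 G\<^esub> = 1" using R.st by (simp add: state_def)
  also have "\<phi> (copy G 1 a) = \<mu> a"
  proof -
    have q: "V\<^sub>1 (qq G 1 \<otimes>\<^bsub>F0 G\<^esub> \<one>\<^bsub>F0 G\<^esub>) = V\<^sub>1 \<one>\<^bsub>F0 G\<^esub>" using L.in_proj_one by (simp add: in_proj_def)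
    have "V\<^sub>1 (qq G 1 \<otimes>\<^bsub>F0 G\<^esub> (copy G 1 a \<otimes>\<^bsub>F0 G\<^esub> \<one>\<^bsub>F0 G\<^esub>)) v\<^sub>1 = \<mu> a * V\<^sub>1 \<one>\<^bsub>F0 G\<^esub> v\<^sub>1"
      using fun_cong[OF L.V_center[OF order_refl I q a], of v\<^sub>1] .
    moreover have "V\<^sub>1 \<one>\<^bsub>F0 G\<^esub> v\<^sub>1 = 1" using L.\<phi>_V[OF I] L.st by (simp add: state_def)
    ultimately show ?thesis unfolding A.r_one[OF cc] L.V_qq_vac[OF cc] L.\<phi>_V[OF cc] by simp
  qed
  finally show ?thesis by simp
qed

end

section \<open>The free product state on the monotone tensor product\<close>

context leg_action
begin

text \<open>The conclusion reproduces the hypotheses with the legs exchanged and j increased: the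
  acting leg ends in the range of p_(j+1), and the other one, lying in that of p_j, is fixed by
  q_(j+1).\<close>

lemma \<Phi>_leg_hom_step:
  assumes a: "a \<in> carrier (free_alg G)" "\<mu> a = 0" and j: "1 \<le> j" "j \<le> m"
    and x: "x \<in> carrier (F0 G)" "V\<^sub>1 (qq G j \<otimes>\<^bsub>F0 G\<^esub> x) = V\<^sub>1 x" and y: "y \<in> carrier (F0 G)" "in_proj G V\<^sub>2 j y"
    and w: "w \<in> carrier (F0F0 G)" "\<forall>z\<in>carrier (F0F0 G). \<Phi> (z \<otimes>\<^bsub>F0F0 G\<^esub> w) = \<Phi> (z \<otimes>\<^bsub>F0F0 G\<^esub> t x y)"
  shows "\<exists>x'\<in>carrier (F0 G). (\<forall>z\<in>carrier (F0F0 G).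
      \<Phi> (z \<otimes>\<^bsub>F0F0 G\<^esub> (leg_hom m a \<otimes>\<^bsub>F0F0 G\<^esub> w)) = \<Phi> (z \<otimes>\<^bsub>F0F0 G\<^esub> t x' y)) \<and>
    in_proj G V\<^sub>1 (Suc j) x' \<and> V\<^sub>2 (qq G (Suc j) \<otimes>\<^bsub>F0 G\<^esub> y) = V\<^sub>2 y"
proof (intro bexI conjI ballI)
  note l = leg_homD(1)[OF a(1), of m]
  fix z assume z: "z \<in> carrier (F0F0 G)"
  have "\<Phi> (z \<otimes>\<^bsub>F0F0 G\<^esub> (leg_hom m a \<otimes>\<^bsub>F0F0 G\<^esub> w)) = \<Phi> (z \<otimes>\<^bsub>F0F0 G\<^esub> (leg_hom m a \<otimes>\<^bsub>F0F0 G\<^esub> t x y))"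
    using bspec[OF w(2) T.m_closed[OF z l]] unfolding T.m_assoc[OF z l w(1)] T.m_assoc[OF z l t_closed[OF x(1) y(1)]] .
  also have "\<dots> = \<Phi> (z \<otimes>\<^bsub>F0F0 G\<^esub> t (copy G j a \<otimes>\<^bsub>F0 G\<^esub> x) y)"
    by (rule \<Phi>_leg_hom[OF a(1) j y z x(1)])
  finally show "\<Phi> (z \<otimes>\<^bsub>F0F0 G\<^esub> (leg_hom m a \<otimes>\<^bsub>F0F0 G\<^esub> w)) = \<Phi> (z \<otimes>\<^bsub>F0F0 G\<^esub> t (copy G j a \<otimes>\<^bsub>F0 G\<^esub> x) y)" .
next
  show "in_proj G V\<^sub>1 (Suc j) (copy G j a \<otimes>\<^bsub>F0 G\<^esub> x)"
    by (rule L.in_proj_center[OF j(1) x a])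
  show "V\<^sub>2 (qq G (Suc j) \<otimes>\<^bsub>F0 G\<^esub> y) = V\<^sub>2 y" using y(2) by (simp add: in_proj_def)
  show "copy G j a \<otimes>\<^bsub>F0 G\<^esub> x \<in> carrier (F0 G)"
    by (rule A.m_closed[OF stage_F0_closed[OF copy_stage[OF a(1) j(1)]] x(1)])
qed

end

abbreviation (input) free_square where "free_square G \<equiv> free_product (free_alg G) (free_alg G)"

abbreviation (input) free_incl where "free_incl G \<equiv> fp_incl (free_alg G) (free_alg G)"

abbreviation (input) free_prod where
  "free_prod G ss \<equiv> foldr (\<lambda>s z. free_incl G s \<otimes>\<^bsub>free_square G\<^esub> z) ss \<one>\<^bsub>free_square G\<^esub>"

text \<open>\<open>J m\<close> is the level-m truncation of the homomorphism of the theorem,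
  obtained from the two leg homomorphisms. One functional \<Phi> serves both legs, read with the
  tensor factors exchanged.\<close>

locale leg_pair = L: leg_action G "tt G" \<mu> \<phi> V\<^sub>1 v\<^sub>1 \<nu> \<psi> V\<^sub>2 v\<^sub>2 \<Phi> +
    R: leg_action G "\<lambda>x y. tt G y x" \<nu> \<psi> V\<^sub>2 v\<^sub>2 \<mu> \<phi> V\<^sub>1 v\<^sub>1 \<Phi>
  for G :: "'g set" and \<mu> \<phi> V\<^sub>1 v\<^sub>1 \<nu> \<psi> V\<^sub>2 v\<^sub>2 \<Phi> +
  fixes J
  assumes J: "J m \<in> star_hom (free_square G) (F0F0 G)"
    and J_l: "a \<in> carrier (free_alg G) \<Longrightarrow> J m (free_incl G (Inl a)) = L.leg_hom m a"
    and J_r: "a \<in> carrier (free_alg G) \<Longrightarrow> J m (free_incl G (Inr a)) = R.leg_hom m a"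
    and \<mu>: "state (free_alg G) \<mu>" and \<nu>: "state (free_alg G) \<nu>" and \<Phi>_state: "state (F0F0 G) \<Phi>"
begin

lemmas free2 = star_algebra_free_alg[of G] star_algebra_free_alg[of G]
lemmas J_hom = alg_homD(2-6)[OF star_hom_alg_hom[OF J]]

sublocale P: star_algebra "free_square G" by (rule star_algebra_free_product[OF free2])

lemma centered_linear:
  "\<mu> \<in> linear_map (free_alg G) complex_star" "\<mu> \<one>\<^bsub>free_alg G\<^esub> = 1"
  "\<nu> \<in> linear_map (free_alg G) complex_star" "\<nu> \<one>\<^bsub>free_alg G\<^esub> = 1"
  using \<mu> \<nu> by (simp_all add: state_iff)

lemmas word_closed = fprod_closed[OF free2]
lemmas word_gens = alt_gens[OF free2 centered_linear]
lemmas word_ConsD = alt_ConsD[OF free2 centered_linear]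

lemma coherent_J: "z \<in> carrier (free_square G) \<Longrightarrow> L.D.coherent (\<lambda>m. J m z)"
proof (induction z rule: fp_induct[OF free2, consumes 1, case_names one incl add smult mult])
  case one
  show ?case unfolding J_hom(5) by (rule L.D.coherent_one)
next
  case (incl s)
  show ?case
  proof (rule fp_gens_cases[OF free2 incl])
    fix a assume 1: "a \<in> carrier (free_alg G)" "s = Inl a"
    show ?thesis unfolding 1(2) J_l[OF 1(1)] by (rule L.coherent_leg_hom[OF 1(1)])
  next
    fix a assume 2: "a \<in> carrier (free_alg G)" "s = Inr a"
    show ?thesis unfolding 2(2) J_r[OF 2(1)] by (rule R.coherent_leg_hom[OF 2(1)])
  qed
next
  case (add x y)
  show ?case unfolding J_hom(2)[OF add(1,2)] by (rule L.D.coherent_add[OF add(3,4)])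
next
  case (smult x c)
  show ?case unfolding J_hom(3)[OF smult(1)] by (rule L.D.coherent_smult[OF smult(2)])
next
  case (mult x y)
  show ?case unfolding J_hom(4)[OF mult(1,2)] by (rule L.D.coherent_mult[OF mult(3,4)])
qed

lemma J_lim: "(\<lambda>z. L.D.mcls (\<lambda>m. J m z)) \<in> star_hom (free_square G) (mclosure (F0F0 G))"
  by (rule L.D.star_hom_mclosure[OF J coherent_J])

text \<open>Each letter of an alternating centered word moves the vector of its own leg from the range of
  \<open>q\<^sub>j\<close> into that of \<open>p\<^sub>j\<^sub>+\<^sub>1\<close>, where the letters of the other leg act through \<open>\<sigma>\<^sub>j\<^sub>+\<^sub>1\<close>.\<close>

lemma \<Phi>_word:
  assumes "ss = [] \<or> alternating_centered (free_alg G) (free_alg G) \<mu> \<nu> ss" "length ss \<le> m"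
  shows "\<exists>x\<in>carrier (F0 G). \<exists>y\<in>carrier (F0 G).
    (\<forall>z\<in>carrier (F0F0 G). \<Phi> (z \<otimes>\<^bsub>F0F0 G\<^esub> J m (free_prod G ss)) = \<Phi> (z \<otimes>\<^bsub>F0F0 G\<^esub> tt G x y)) \<and>
    (ss = [] \<or> isl (hd ss) \<longrightarrow>
       in_proj G V\<^sub>1 (Suc (length ss)) x \<and> V\<^sub>2 (qq G (Suc (length ss)) \<otimes>\<^bsub>F0 G\<^esub> y) = V\<^sub>2 y) \<and>
    (ss = [] \<or> \<not> isl (hd ss) \<longrightarrow>
       in_proj G V\<^sub>2 (Suc (length ss)) y \<and> V\<^sub>1 (qq G (Suc (length ss)) \<otimes>\<^bsub>F0 G\<^esub> x) = V\<^sub>1 x)"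
  using assms
proof (induction ss)
  \<comment> \<open>For the empty word both alternatives hold with colour 1, so the first letter to
    act may belong to either leg.\<close>
  case Nil
  note I = L.A.one_closed
  have p: "in_proj G V\<^sub>1 (Suc 0) \<one>\<^bsub>F0 G\<^esub>" "in_proj G V\<^sub>2 (Suc 0) \<one>\<^bsub>F0 G\<^esub>"
    using L.L.in_proj_one L.R.in_proj_one by simp_all
  show ?case
    by (intro bexI[OF _ I] conjI impI ballI) (simp_all add: J_hom(5) tt_one p L.L.V_one L.R.V_one)
next
  case (Cons s ss)
  have a: "alternating_centered (free_alg G) (free_alg G) \<mu> \<nu> (s # ss)" using Cons.prems(1) by simp
  note tail = word_ConsD(1)[OF a] and hd = word_ConsD(2)[OF a]
  have j: "1 \<le> Suc (length ss)" "Suc (length ss) \<le> m" using Cons.prems(2) by simp_all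
  have tl: "ss = [] \<or> alternating_centered (free_alg G) (free_alg G) \<mu> \<nu> ss" "length ss \<le> m"
    using tail j by auto
  have gs: "s \<in> fp_gens (free_alg G) (free_alg G)" "set ss \<subseteq> fp_gens (free_alg G) (free_alg G)"
    using word_gens[OF a] by simp_all
  note wc = word_closed[OF gs(2)] and sc = fp_incl_closed[OF free2 gs(1)]
  have prod: "J m (free_prod G (s # ss)) = J m (free_incl G s) \<otimes>\<^bsub>F0F0 G\<^esub> J m (free_prod G ss)"
    using J_hom(4)[OF sc wc] by simp
  from Cons.IH[OF tl] obtain x y where x: "x \<in> carrier (F0 G)" and y: "y \<in> carrier (F0 G)"
    and w: "\<forall>z\<in>carrier (F0F0 G). \<Phi> (z \<otimes>\<^bsub>F0F0 G\<^esub> J m (free_prod G ss)) = \<Phi> (z \<otimes>\<^bsub>F0F0 G\<^esub> tt G x y)"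
    and l: "ss = [] \<or> isl (hd ss) \<Longrightarrow>
       in_proj G V\<^sub>1 (Suc (length ss)) x \<and> V\<^sub>2 (qq G (Suc (length ss)) \<otimes>\<^bsub>F0 G\<^esub> y) = V\<^sub>2 y"
    and r: "ss = [] \<or> \<not> isl (hd ss) \<Longrightarrow>
       in_proj G V\<^sub>2 (Suc (length ss)) y \<and> V\<^sub>1 (qq G (Suc (length ss)) \<otimes>\<^bsub>F0 G\<^esub> x) = V\<^sub>1 x"
    by (elim bexE conjE) (rule that; (assumption | (erule mp, assumption)))
  note Jc = J_hom(1)[OF wc, of m]
  show ?case
  proof (cases "isl s")
    case True
    then obtain b where b: "s = Inl b" "b \<in> carrier (free_alg G)" "\<mu> b = 0" using hd by auto
    have r': "in_proj G V\<^sub>2 (Suc (length ss)) y" "V\<^sub>1 (qq G (Suc (length ss)) \<otimes>\<^bsub>F0 G\<^esub> x) = V\<^sub>1 x"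
      using r tail True by auto
    from L.\<Phi>_leg_hom_step[OF b(2,3) j x r'(2) y r'(1) Jc w] obtain x' where x': "x' \<in> carrier (F0 G)"
      and st: "\<forall>z\<in>carrier (F0F0 G). \<Phi> (z \<otimes>\<^bsub>F0F0 G\<^esub> (L.leg_hom m b \<otimes>\<^bsub>F0F0 G\<^esub> J m (free_prod G ss)))
          = \<Phi> (z \<otimes>\<^bsub>F0F0 G\<^esub> tt G x' y)"
        "in_proj G V\<^sub>1 (Suc (Suc (length ss))) x'" "V\<^sub>2 (qq G (Suc (Suc (length ss))) \<otimes>\<^bsub>F0 G\<^esub> y) = V\<^sub>2 y"
      by (elim bexE conjE) (rule that)
    have e: "J m (free_incl G s) = L.leg_hom m b" unfolding b(1) by (rule J_l[OF b(2)])
    show ?thesis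
      by (rule bexI[OF _ x'], rule bexI[OF _ y]) (use st True in \<open>simp only: prod e, simp\<close>)
  next
    case False
    then obtain b where b: "s = Inr b" "b \<in> carrier (free_alg G)" "\<nu> b = 0" using hd by auto
    have l': "in_proj G V\<^sub>1 (Suc (length ss)) x" "V\<^sub>2 (qq G (Suc (length ss)) \<otimes>\<^bsub>F0 G\<^esub> y) = V\<^sub>2 y"
      using l tail False by auto
    from R.\<Phi>_leg_hom_step[OF b(2,3) j y l'(2) x l'(1) Jc w] obtain y' where y': "y' \<in> carrier (F0 G)"
      and st: "\<forall>z\<in>carrier (F0F0 G). \<Phi> (z \<otimes>\<^bsub>F0F0 G\<^esub> (R.leg_hom m b \<otimes>\<^bsub>F0F0 G\<^esub> J m (free_prod G ss)))
          = \<Phi> (z \<otimes>\<^bsub>F0F0 G\<^esub> tt G x y')"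
        "in_proj G V\<^sub>2 (Suc (Suc (length ss))) y'" "V\<^sub>1 (qq G (Suc (Suc (length ss))) \<otimes>\<^bsub>F0 G\<^esub> x) = V\<^sub>1 x"
      by (elim bexE conjE) (rule that)
    have e: "J m (free_incl G s) = R.leg_hom m b" unfolding b(1) by (rule J_r[OF b(2)])
    show ?thesis
      by (rule bexI[OF _ x], rule bexI[OF _ y']) (use st False in \<open>simp only: prod e, simp\<close>)
  qed
qed

text \<open>With z = 1 the value factorizes as \<open>\<phi> x * \<psi> y\<close>, and for a word of
  length n \<ge> 1 the leg of its first letter ends in the range of p_(n+1), where its state
  vanishes. The level must offer a colour for each letter, whence the bound on the length.\<close>

lemma \<Phi>_alternating:
  assumes a: "alternating_centered (free_alg G) (free_alg G) \<mu> \<nu> ss" and m: "length ss \<le> m"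
  shows "\<Phi> (J m (free_prod G ss)) = 0"
proof -
  from \<Phi>_word[OF disjI2[OF a] m] obtain x y where x: "x \<in> carrier (F0 G)" and y: "y \<in> carrier (F0 G)"
    and w: "\<forall>z\<in>carrier (F0F0 G). \<Phi> (z \<otimes>\<^bsub>F0F0 G\<^esub> J m (free_prod G ss)) = \<Phi> (z \<otimes>\<^bsub>F0F0 G\<^esub> tt G x y)"
    and l: "ss = [] \<or> isl (hd ss) \<Longrightarrow>
       in_proj G V\<^sub>1 (Suc (length ss)) x \<and> V\<^sub>2 (qq G (Suc (length ss)) \<otimes>\<^bsub>F0 G\<^esub> y) = V\<^sub>2 y"
    and r: "ss = [] \<or> \<not> isl (hd ss) \<Longrightarrow>
       in_proj G V\<^sub>2 (Suc (length ss)) y \<and> V\<^sub>1 (qq G (Suc (length ss)) \<otimes>\<^bsub>F0 G\<^esub> x) = V\<^sub>1 x"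
    by (elim bexE conjE) (rule that; (assumption | (erule mp, assumption)))
  have "ss \<noteq> []" using a by (simp add: alternating_centered_def)
  then have n: "Suc (length ss) \<ge> 2" by (cases ss) auto
  have "\<phi> x = 0 \<or> \<psi> y = 0"
    using L.L.\<phi>_in_proj[OF conjunct1[OF l[OF disjI2]] n x] L.R.\<phi>_in_proj[OF conjunct1[OF r[OF disjI2]] n y] by blast
  moreover have "\<Phi> (J m (free_prod G ss)) = \<phi> x * \<psi> y"
    using bspec[OF w L.T.one_closed]
    unfolding L.T.l_one[OF J_hom(1)[OF word_closed[OF word_gens[OF a]]]] L.T.l_one[OF tt_closed[OF x y]] L.\<Phi>_t[OF x y] .
  ultimately show ?thesis by auto
qed

sublocale tower_state "F0F0 G" \<Phi>
proof (rule tower_state.intro[OF mtower_F0F0], unfold_locales)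
  have "tproj (F0F0 G) 1 = tt G (qq G 1) (qq G 1)" by (simp add: tproj_T one_enat_def)
  then show "\<Phi> (tproj (F0F0 G) 1) = 1"
    using L.\<Phi>_t[OF qq_closed qq_closed] L.L.supp L.R.supp by simp
qed (rule \<Phi>_state)

text \<open>All characterizing values are attained at finite levels: from m = 1 on for a single
  factor, and from the length on for an alternating word.\<close>

lemma free_product_state:
  assumes z: "z \<in> carrier (free_square G)"
  shows "free_product_state (free_alg G) (free_alg G) \<mu> \<nu> z = mlim \<Phi> (L.D.mcls (\<lambda>m. J m z))"
proof (rule free_product_state_eqI[OF free2 centered_linear _ _ _ _ z])
  let ?h = "\<lambda>z. L.D.mcls (\<lambda>m. J m z)"
  note h = alg_homD[OF star_hom_alg_hom[OF J_lim]] star_homD[OF J_lim]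
  note S = state_mlim[unfolded state_iff]
  show "state (free_square G) (\<lambda>z. mlim \<Phi> (?h z))" unfolding state_iff
  proof (intro conjI ballI)
    show "(\<lambda>z. mlim \<Phi> (?h z)) \<in> linear_map (free_square G) complex_star"
      by (rule linear_map_compose[OF conjunct1[OF S] h(1)])
    show "mlim \<Phi> (?h \<one>\<^bsub>free_square G\<^esub>) = 1" unfolding h(6) using S by blast
    fix x assume x: "x \<in> carrier (free_square G)"
    show "mlim \<Phi> (?h (adj (free_square G) x \<otimes>\<^bsub>free_square G\<^esub> x)) \<in> \<real>\<^sub>\<ge>\<^sub>0"
      unfolding h(5)[OF P.adj_closed[OF x] x] h(7)[OF x] using S h(2)[OF x] by blast
  qed
  fix a assume a: "a \<in> carrier (free_alg G)"
  have g: "Inl a \<in> fp_gens (free_alg G) (free_alg G)" "Inr a \<in> fp_gens (free_alg G) (free_alg G)"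
    using a by (simp_all add: fp_gens_def)
  show "mlim \<Phi> (?h (free_incl G (Inl a))) = \<mu> a"
    by (rule mlim_eqI[OF coherent_J[OF fp_incl_closed[OF free2 g(1)]] eventually_sequentiallyI[of 1]])
      (unfold J_l[OF a], rule L.\<Phi>_leg_hom_moment[OF a])
  show "mlim \<Phi> (?h (free_incl G (Inr a))) = \<nu> a"
    by (rule mlim_eqI[OF coherent_J[OF fp_incl_closed[OF free2 g(2)]] eventually_sequentiallyI[of 1]])
      (unfold J_r[OF a], rule R.\<Phi>_leg_hom_moment[OF a])
next
  fix ss assume a: "alternating_centered (free_alg G) (free_alg G) \<mu> \<nu> ss"
  show "mlim \<Phi> (L.D.mcls (\<lambda>m. J m (free_prod G ss))) = 0"
    by (rule mlim_eqI[OF coherent_J[OF word_closed[OF word_gens[OF a]]] eventually_sequentiallyI[of "length ss"]])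
      (rule \<Phi>_alternating[OF a])
qed

end

section \<open>The homomorphism \<open>\<tau>\<close> and the two convolutions\<close>

text \<open>Resolves the definite descriptions of \<tau> and \<open>fp_delta\<close>: the generators
  determine a star homomorphism, and extensionality fixes it off the carrier.\<close>

lemma the_star_hom_free_alg:
  assumes h: "h \<in> star_hom (free_alg G) E" "\<And>X. X \<in> G \<Longrightarrow> h (letter (Gen X)) = v X"
    and a: "a \<in> carrier (free_alg G)"
  shows "(THE h. h \<in> extensional (carrier (free_alg G)) \<and> h \<in> star_hom (free_alg G) E \<and>
     (\<forall>X\<in>G. h (letter (Gen X)) = v X)) a = h a" (is "The ?P a = _")
proof -
  interpret F: star_algebra "free_alg G" by (rule star_algebra_free_alg)
  let ?h = "restrict h (carrier (free_alg G))"
  have res: "?h x = h x" if "x \<in> carrier (free_alg G)" for x by (rule restrict_apply'[OF that])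
  have rs: "?h \<in> star_hom (free_alg G) E"
    using h(1) res F.one_closed F.a_closed F.smult_closed F.m_closed F.adj_closed
    by (simp add: star_hom_iff alg_hom_def linear_map_def Pi_iff)
  have g: "letter (Gen X) \<in> carrier (free_alg G)" if "X \<in> G" for X using that by simp
  have "The ?P = ?h"
  proof (rule the_equality)
    show "?P ?h" using rs h(2) res[OF g] by simp
    fix k assume k: "?P k"
    show "k = ?h"
    proof (rule extensionalityI[of _ "carrier (free_alg G)"])
      fix x assume x: "x \<in> carrier (free_alg G)"
      show "k x = ?h x"
        by (rule star_hom_free_alg_eqI[OF _ rs _ x]) (use k h(2) res[OF g] in simp_all)
    qed (use k in auto)
  qed
  then show ?thesis using res[OF a] by simp
qed

text \<open>The difference is used at k = 1 as well, which agrees with \<delta>X because X''(1) = 0.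
  Admitting adjoint letters makes the sums compatible with the adjoint.\<close>

primrec delta_sum :: "'g set \<Rightarrow> nat \<Rightarrow> 'g letter \<Rightarrow> 'g fgen star_poly set" where
  "delta_sum G 0 l = \<zero>\<^bsub>F0 G\<^esub>"
| "delta_sum G (Suc m) l = delta_sum G m l \<oplus>\<^bsub>F0 G\<^esub> (xa G l (Suc m) \<ominus>\<^bsub>F0 G\<^esub> xb G l (Suc m))"

abbreviation delta_hom :: "'g set \<Rightarrow> nat \<Rightarrow> 'g star_poly \<Rightarrow> 'g fgen star_poly set" where
  "delta_hom G m \<equiv> free_lift (F0 G) (delta_sum G m)"

context
  fixes G :: "'g set"
begin

interpretation A: star_algebra "F0 G" by (rule star_algebra_F0)
interpretation C: mtower "F0 G" by (rule mtower_F0)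

lemma delta_closed: "l \<in> letters G \<Longrightarrow> k \<ge> 1 \<Longrightarrow> xa G l k \<ominus>\<^bsub>F0 G\<^esub> xb G l k \<in> carrier (F0 G)"
  by (rule A.minus_closed[OF xa_closed xb_closed])

lemma delta_sum_closed: "l \<in> letters G \<Longrightarrow> delta_sum G m l \<in> carrier (F0 G)"
proof (induction m)
  case (Suc m)
  show ?case unfolding delta_sum.simps by (intro A.a_closed Suc delta_closed) simp
qed (simp only: delta_sum.simps A.zero_closed)

lemma delta_sum_stage: "l \<in> letters G \<Longrightarrow> n \<le> m \<Longrightarrow> delta_sum G n l \<in> stage (F0 G) m"
proof (induction n)
  case (Suc n)
  have k: "1 \<le> Suc n" by simp
  show ?case unfolding delta_sum.simps A.minus_eq_smult[OF xa_closed[OF Suc(2) k] xb_closed[OF Suc(2) k]]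
    by (intro C.stage_add C.stage_smult Suc(1) stage_F0_letters Suc(2,3) k) (use Suc(3) in simp)
qed (simp only: delta_sum.simps stage_F0_zero)

lemma delta_sum_adj: "l \<in> letters G \<Longrightarrow> adj (F0 G) (delta_sum G m l) = delta_sum G m (flip l)"
proof (induction m)
  case (Suc m)
  have k: "1 \<le> Suc m" by simp
  show ?case
    unfolding delta_sum.simps A.adj_add[OF delta_sum_closed[OF Suc(2)] delta_closed[OF Suc(2) k]] Suc(1)[OF Suc(2)]
      A.adj_minus[OF xa_closed[OF Suc(2) k] xb_closed[OF Suc(2) k]] xa_adj[OF Suc(2) k] xb_adj[OF Suc(2) k] ..
qed (simp only: delta_sum.simps A.adj_zero)

lemma delta_sum_qq:
  assumes l: "l \<in> letters G" and "i \<le> n"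
  shows "delta_sum G n l \<otimes>\<^bsub>F0 G\<^esub> qq G i = delta_sum G i l \<otimes>\<^bsub>F0 G\<^esub> qq G i"
  using assms(2)
proof (induction n rule: dec_induct)
  case (step n)
  have k: "1 \<le> Suc n" by simp
  have e: "xa G l (Suc n) \<otimes>\<^bsub>F0 G\<^esub> qq G i = xb G l (Suc n) \<otimes>\<^bsub>F0 G\<^esub> qq G i"
    by (rule qq_x_eq(2)[OF l]) (use step in simp)
  have z: "(xa G l (Suc n) \<ominus>\<^bsub>F0 G\<^esub> xb G l (Suc n)) \<otimes>\<^bsub>F0 G\<^esub> qq G i = \<zero>\<^bsub>F0 G\<^esub>"
    unfolding A.minus_mult_l[OF xa_closed[OF l k] xb_closed[OF l k] qq_closed] e
    by (rule A.minus_self[OF A.m_closed[OF xb_closed[OF l k] qq_closed]])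
  show ?case
    unfolding delta_sum.simps A.l_distr[OF delta_sum_closed[OF l] delta_closed[OF l k] qq_closed] z step(3)
    by (rule A.r_zero[OF A.m_closed[OF delta_sum_closed[OF l] qq_closed]])
qed simp

lemma delta_sum_eq:
  assumes X: "X \<in> G"
  shows "(\<Oplus>\<^bsub>F0 G\<^esub>k\<in>{1..m}. \<delta>X G X k) = delta_sum G m (Gen X)"
proof -
  have l: "Gen X \<in> letters G" using X by simp
  have d: "\<delta>X G X k = xa G (Gen X) k \<ominus>\<^bsub>F0 G\<^esub> xb G (Gen X) k" if "k \<ge> 1" for k
    using xb_1[OF l] A.minus_zero_r[OF xa_closed[OF l that]] by (cases "k = 1") (simp_all add: \<delta>X_def)
  have c: "\<delta>X G X k \<in> carrier (F0 G)" if "k \<ge> 1" for k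
    unfolding d[OF that] by (rule delta_closed[OF l that])
  show ?thesis
  proof (induction m)
    case 0
    show ?case by simp
  next
    case (Suc m)
    have k: "1 \<le> Suc m" by simp
    have "{1..Suc m} = insert (Suc m) {1..m}" by auto
    then have "(\<Oplus>\<^bsub>F0 G\<^esub>k\<in>{1..Suc m}. \<delta>X G X k) = \<delta>X G X (Suc m) \<oplus>\<^bsub>F0 G\<^esub> (\<Oplus>\<^bsub>F0 G\<^esub>k\<in>{1..m}. \<delta>X G X k)"
      using A.finsum_insert[of "{1..m}" "Suc m" "\<delta>X G X"] c by simp
    then show ?case unfolding Suc delta_sum.simps d[OF k]
      using A.a_comm[OF delta_closed[OF l k] delta_sum_closed[OF l]] by simp
  qed
qed

lemma delta_hom: "delta_hom G m \<in> star_hom (free_alg G) (F0 G)"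
  by (rule free_lift_star_hom[OF A.complex_alg_axioms _ star_algebra_F0]) (simp_all add: delta_sum_closed delta_sum_adj)

lemma delta_hom_letter: "l \<in> letters G \<Longrightarrow> delta_hom G m (letter l) = delta_sum G m l"
  by (rule free_lift_letter[OF A.complex_alg_axioms]) (rule delta_sum_closed)

lemma delta_sum_owmc:
  assumes X: "X \<in> G"
  shows "(\<lambda>m. delta_sum G m (Gen X), qq G) \<in> owmc (F0 G)"
proof -
  have l: "Gen X \<in> letters G" and f: "flip (Gen X) \<in> letters G" using X by simp_all
  have "msdd (F0 G) (qq G)"
  proof (rule C.msddI[of _ enat])
    show "qq G m = tproj (F0 G) (enat m)" for m by (simp only: F0_simps(8) F0_q_simps)
    show "\<forall>\<^sub>F n in sequentially. enat i \<le> enat n" for i by (rule eventually_sequentiallyI[of i]) simp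
  qed simp
  then show ?thesis unfolding owmc_def mem_Collect_eq prod.case delta_sum_adj[OF l]
    by (intro conjI allI impI delta_sum_stage[OF l order_refl] delta_sum_qq[OF l] delta_sum_qq[OF f]) simp_all
qed

lemma coherent_delta_hom: "a \<in> carrier (free_alg G) \<Longrightarrow> C.coherent (\<lambda>m. delta_hom G m a)"
proof (rule C.coherent_free_hom[OF delta_hom])
  fix X assume X: "X \<in> G"
  then have l: "Gen X \<in> letters G" by simp
  show "C.coherent (\<lambda>m. delta_hom G m (letter (Gen X)))"
    unfolding delta_hom_letter[OF l] by (rule C.owmc_coherent[OF delta_sum_owmc[OF X]])
qed

lemma \<tau>_eq:
  assumes a: "a \<in> carrier (free_alg G)"
  shows "\<tau> G a = C.mcls (\<lambda>m. delta_hom G m a)"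
  unfolding \<tau>_def \<F>_def
proof (rule the_star_hom_free_alg[OF C.star_hom_mclosure[OF delta_hom coherent_delta_hom] _ a])
  fix X assume X: "X \<in> G"
  then have l: "Gen X \<in> letters G" by simp
  show "C.mcls (\<lambda>m. delta_hom G m (letter (Gen X))) = mco (F0 G) (\<lambda>m. \<Oplus>\<^bsub>F0 G\<^esub>k\<in>{1..m}. \<delta>X G X k) (qq G)"
    unfolding delta_hom_letter[OF l] delta_sum_eq[OF X] C.mco_eq[OF delta_sum_owmc[OF X]] ..
qed

end

lemma (in ring) add_minus_swap:
  "a \<in> carrier R \<Longrightarrow> b \<in> carrier R \<Longrightarrow> c \<in> carrier R \<Longrightarrow> d \<in> carrier R \<Longrightarrow> e \<in> carrier R \<Longrightarrow> f \<in> carrier R \<Longrightarrow>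
    (a \<oplus> b) \<oplus> ((c \<oplus> d) \<ominus> (e \<oplus> f)) = (a \<oplus> (c \<ominus> e)) \<oplus> (b \<oplus> (d \<ominus> f))"
  by (simp add: a_minus_def minus_add a_ac)

context leg_pair
begin

text \<open>The weights q_k and q_(k-1) in \<Delta> are exactly those of the leg terms, so \<Delta>
  of X'(k) - X''(k) regroups into the k-th terms of the two legs. The identity is exact at each
  level, not only in the limit.\<close>

lemma comult0_delta_sum:
  assumes X: "X \<in> G"
  shows "comult0 G (delta_sum G m (Gen X)) = L.leg_sum m (Gen X) \<oplus>\<^bsub>F0F0 G\<^esub> R.leg_sum m (Gen X)"
proof (induction m)
  note h = alg_homD(1,3)[OF star_hom_alg_hom[OF comult0(1)]]
  case 0
  show ?case unfolding delta_sum.simps L.leg_sum.simps R.leg_sum.simps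
      linear_map_zero[OF L.A.complex_alg_axioms L.T.complex_alg_axioms h(1)]
    by (rule L.T.l_zero[OF L.T.zero_closed, symmetric])
next
  note h = alg_homD(1,3)[OF star_hom_alg_hom[OF comult0(1)]]
  case (Suc m)
  have l: "Gen X \<in> letters G" and k: "1 \<le> Suc m" using X by simp_all
  note c = xa_closed[OF l k] xb_closed[OF l k]
  note s = L.leg_sum_closed[OF l] R.leg_sum_closed[OF l]
    tt_closed[OF c(1) qq_closed] tt_closed[OF qq_closed c(1)] tt_closed[OF c(2) qq_closed] tt_closed[OF qq_closed c(2)]
  show ?case
    unfolding delta_sum.simps L.leg_sum.simps R.leg_sum.simps L.leg_term_def R.leg_term_def
      h(2)[OF delta_sum_closed[OF l] delta_closed[OF l k]] Suc
      linear_map_minus[OF L.A.complex_alg_axioms L.T.complex_alg_axioms h(1) c] comult0(2)[OF X k] comult0(3)[OF X k]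
    by (rule L.T.add_minus_swap[OF s])
qed

text \<open>Two star homomorphisms on the free algebra are compared on the generators, where
  \<open>comult0_delta_sum\<close> applies.\<close>

lemma J_delta:
  assumes a: "a \<in> carrier (free_alg G)"
  shows "fp_delta G a \<in> carrier (free_square G)" "J m (fp_delta G a) = comult0 G (delta_hom G m a)"
proof -
  let ?f = "\<lambda>l. free_incl G (Inl (letter l)) \<oplus>\<^bsub>free_square G\<^esub> free_incl G (Inr (letter l))"
  let ?d = "free_lift (free_square G) ?f"
  note I = fp_incl_l[OF free2] fp_incl_r[OF free2]
  note i = alg_homD(2)[OF star_hom_alg_hom[OF I(1)]] alg_homD(2)[OF star_hom_alg_hom[OF I(2)]]
  have lc: "letter l \<in> carrier (free_alg G)" if "l \<in> letters G" for l using that by simp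
  have fc: "?f l \<in> carrier (free_square G)" if "l \<in> letters G" for l
    by (rule P.a_closed[OF i(1)[OF lc[OF that]] i(2)[OF lc[OF that]]])
  have d: "?d \<in> star_hom (free_alg G) (free_square G)"
  proof (rule free_lift_star_hom[OF P.complex_alg_axioms fc P.star_algebra_axioms])
    fix l assume "l \<in> letters G"
    note l = lc[OF this]
    show "?f (flip l) = adj (free_square G) (?f l)"
      unfolding P.adj_add[OF i(1)[OF l] i(2)[OF l]] star_homD[OF I(1) l, symmetric] star_homD[OF I(2) l, symmetric] adj_letter ..
  qed
  have dl: "?d (letter l) = ?f l" if "l \<in> letters G" for l
    by (rule free_lift_letter[OF P.complex_alg_axioms fc that])
  have e: "fp_delta G a = ?d a"
    unfolding fp_delta_def Let_def by (rule the_star_hom_free_alg[OF d _ a]) (simp add: dl)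
  show "fp_delta G a \<in> carrier (free_square G)" unfolding e by (rule alg_homD(2)[OF star_hom_alg_hom[OF d] a])
  show "J m (fp_delta G a) = comult0 G (delta_hom G m a)" unfolding e
  proof (rule star_hom_free_alg_eqI[OF star_hom_compose[OF J d] star_hom_compose[OF comult0(1) delta_hom] _ a])
    fix X assume X: "X \<in> G"
    then have l: "Gen X \<in> letters G" by simp
    note c = lc[OF l]
    show "J m (?d (letter (Gen X))) = comult0 G (delta_hom G m (letter (Gen X)))"
      unfolding dl[OF l] J_hom(2)[OF i(1)[OF c] i(2)[OF c]] J_l[OF c] J_r[OF c]
        L.leg_hom_letter[OF l] R.leg_hom_letter[OF l] delta_hom_letter[OF l] comult0_delta_sum[OF X] ..
  qed
qed

lemma comult_\<tau>:
  assumes a: "a \<in> carrier (free_alg G)"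
  shows "comult G (\<tau> G a) = L.D.mcls (\<lambda>m. J m (fp_delta G a))"
  unfolding \<tau>_eq[OF a] comult_mcls[OF coherent_delta_hom[OF a]] J_delta(2)[OF a] ..

end

lemma (in vacuum_rep) tower_state: "tower_state (F0 G) \<phi>"
  by (rule tower_state.intro[OF mtower_F0], unfold_locales) (simp_all add: st supp[simplified] F0_simps(8) one_enat_def)

text \<open>The description depends on the functionals only through their values on the carriers, so
  a lifted state composed with the embedding may be replaced by the original one.\<close>

lemma tensor_functional_cong:
  assumes "\<And>a. a \<in> carrier A \<Longrightarrow> \<phi> a = \<phi>' a" "\<And>b. b \<in> carrier B \<Longrightarrow> \<psi> b = \<psi>' b"
  shows "tensor_functional A B \<phi> \<psi> = tensor_functional A B \<phi>' \<psi>'"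
  unfolding tensor_functional_def by (simp add: assms cong: ball_cong)

lemma leg_pair_exists:
  fixes G :: "'g set"
  assumes \<mu>: "state (free_alg G) \<mu>" and \<nu>: "state (free_alg G) \<nu>"
  shows "\<exists>\<phi> (V\<^sub>1 :: _ \<Rightarrow> 'g cword \<Rightarrow> complex) v\<^sub>1 \<psi> (V\<^sub>2 :: _ \<Rightarrow> 'g cword \<Rightarrow> complex) v\<^sub>2 J.
    leg_pair G \<mu> \<phi> V\<^sub>1 v\<^sub>1 \<nu> \<psi> V\<^sub>2 v\<^sub>2 (tensor_functional (F0 G) (F0 G) \<phi> \<psi>) J"
proof -
  obtain \<phi> and V\<^sub>1 :: "_ \<Rightarrow> 'g cword \<Rightarrow> complex" and v\<^sub>1 where L: "vacuum_rep G \<mu> \<phi> V\<^sub>1 v\<^sub>1"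
    using vacuum_rep_exists[OF \<mu>] by (elim exE) (rule that)
  obtain \<psi> and V\<^sub>2 :: "_ \<Rightarrow> 'g cword \<Rightarrow> complex" and v\<^sub>2 where R: "vacuum_rep G \<nu> \<psi> V\<^sub>2 v\<^sub>2"
    using vacuum_rep_exists[OF \<nu>] by (elim exE) (rule that)
  interpret L: vacuum_rep G \<mu> \<phi> V\<^sub>1 v\<^sub>1 by (rule L)
  interpret R: vacuum_rep G \<nu> \<psi> V\<^sub>2 v\<^sub>2 by (rule R)
  let ?\<Phi> = "tensor_functional (F0 G) (F0 G) \<phi> \<psi>"
  have st: "state (F0F0 G) ?\<Phi>"
    using state_tensor[OF star_algebra_F0 star_algebra_F0 L.st R.st]
    by (simp add: state_def linear_functional_def tensor_tower_simps)
  have lin: "?\<Phi> \<in> linear_map (F0F0 G) complex_star" using st by (simp add: state_iff)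
  have lf: "linear_functional (F0 G) \<phi>" "linear_functional (F0 G) \<psi>" using L.st R.st by (simp_all add: state_def)
  note t = tensor_functional(2)[OF star_algebra_F0 star_algebra_F0 lf]
  have l: "leg_action G (tt G) \<mu> \<phi> V\<^sub>1 v\<^sub>1 \<nu> \<psi> V\<^sub>2 v\<^sub>2 ?\<Phi>"
    by unfold_locales (simp_all add: lin t)
  have r: "leg_action G (\<lambda>x y. tt G y x) \<nu> \<psi> V\<^sub>2 v\<^sub>2 \<mu> \<phi> V\<^sub>1 v\<^sub>1 ?\<Phi>"
    by unfold_locales (simp_all add: lin t)
  note homs = tensor_leg.leg_hom[OF leg_action.axioms(1)[OF l]] tensor_leg.leg_hom[OF leg_action.axioms(1)[OF r]]
  have "\<forall>m. \<exists>h. h \<in> star_hom (free_square G) (F0F0 G) \<and>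
      (\<forall>a\<in>carrier (free_alg G). h (free_incl G (Inl a)) = tensor_leg.leg_hom G (tt G) m a) \<and>
      (\<forall>a\<in>carrier (free_alg G). h (free_incl G (Inr a)) = tensor_leg.leg_hom G (\<lambda>x y. tt G y x) m a)"
    by (rule allI, rule fp_lift[OF star_algebra_free_alg star_algebra_free_alg star_algebra_F0F0 homs])
  from choice[OF this] obtain J where J: "\<And>m. J m \<in> star_hom (free_square G) (F0F0 G)"
    "\<And>m a. a \<in> carrier (free_alg G) \<Longrightarrow> J m (free_incl G (Inl a)) = tensor_leg.leg_hom G (tt G) m a"
    "\<And>m a. a \<in> carrier (free_alg G) \<Longrightarrow> J m (free_incl G (Inr a)) = tensor_leg.leg_hom G (\<lambda>x y. tt G y x) m a"
    by blast
  have "leg_pair G \<mu> \<phi> V\<^sub>1 v\<^sub>1 \<nu> \<psi> V\<^sub>2 v\<^sub>2 ?\<Phi> J"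
    by (rule leg_pair.intro[OF l r], rule leg_pair_axioms.intro) (fact J \<mu> \<nu> st)+
  then show ?thesis by (intro exI)
qed

theorem corollary6p2:
  fixes G :: "'g set" and \<mu> \<nu> :: "'g star_poly \<Rightarrow> complex"
  assumes "state (free_alg G) \<mu>" and "state (free_alg G) \<nu>"
  shows "\<exists>\<mu>h \<nu>h J.
    state (\<F> G) \<mu>h \<and> state (\<F> G) \<nu>h \<and>
    mtensor_defined (F0 G) (F0 G) \<mu>h \<nu>h \<and>
    state (\<F>\<F> G) (mtensor (F0 G) (F0 G) \<mu>h \<nu>h) \<and>
    J \<in> star_hom (free_product (free_alg G) (free_alg G)) (\<F>\<F> G) \<and>
    (\<forall>z \<in> carrier (free_product (free_alg G) (free_alg G)).
       free_product_state (free_alg G) (free_alg G) \<mu> \<nu> z = mtensor (F0 G) (F0 G) \<mu>h \<nu>h (J z)) \<and>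
    (\<forall>a \<in> carrier (free_alg G). free_conv G \<mu> \<nu> a = star_conv G \<mu>h \<nu>h (\<tau> G a))"
proof -
  obtain \<phi> \<psi> and V\<^sub>1 V\<^sub>2 :: "'g fgen star_poly set \<Rightarrow> 'g cword \<Rightarrow> complex" and v\<^sub>1 v\<^sub>2 J
    where *: "leg_pair G \<mu> \<phi> V\<^sub>1 v\<^sub>1 \<nu> \<psi> V\<^sub>2 v\<^sub>2 (tensor_functional (F0 G) (F0 G) \<phi> \<psi>) J"
    using leg_pair_exists[OF assms] by (elim exE) (rule that)
  define \<Phi> where "\<Phi> = tensor_functional (F0 G) (F0 G) \<phi> \<psi>"
  interpret leg_pair G \<mu> \<phi> V\<^sub>1 v\<^sub>1 \<nu> \<psi> V\<^sub>2 v\<^sub>2 \<Phi> J unfolding \<Phi>_def by (rule *)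
  note ts = L.L.tower_state L.R.tower_state
  have tf: "tensor_functional (F0 G) (F0 G) (mlim \<phi> \<circ> mco_embed (F0 G)) (mlim \<psi> \<circ> mco_embed (F0 G)) = \<Phi>"
    unfolding \<Phi>_def
    by (rule tensor_functional_cong) (simp_all add: tower_state.mlim_embed[OF ts(1)] tower_state.mlim_embed[OF ts(2)])
  \<comment> \<open>\<open>mtensor\<close> and \<open>mlim\<close> are the same definite description
    once the tensor functional is \<Phi>, so the results on limits of a supported state apply to the
    tensor square.\<close>
  have mt: "mtensor (F0 G) (F0 G) (mlim \<phi>) (mlim \<psi>) = mlim \<Phi>"
    by (rule ext) (simp only: mtensor_def tf mlim_def)
  show ?thesis
  proof (intro exI conjI ballI)
    show "state (\<F> G) (mlim \<phi>)" "state (\<F> G) (mlim \<psi>)"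
      unfolding \<F>_def by (rule tower_state.state_mlim[OF ts(1)], rule tower_state.state_mlim[OF ts(2)])
    show "mtensor_defined (F0 G) (F0 G) (mlim \<phi>) (mlim \<psi>)"
      unfolding mtensor_defined_def tf L.D.carrier_mclosure using mlim_eventually(2) by blast
    show "state (\<F>\<F> G) (mtensor (F0 G) (F0 G) (mlim \<phi>) (mlim \<psi>))"
      unfolding mt \<F>\<F>_def by (rule state_mlim)
    show "(\<lambda>z. L.D.mcls (\<lambda>m. J m z)) \<in> star_hom (free_product (free_alg G) (free_alg G)) (\<F>\<F> G)"
      unfolding \<F>\<F>_def by (rule J_lim)
    show "free_product_state (free_alg G) (free_alg G) \<mu> \<nu> z =
        mtensor (F0 G) (F0 G) (mlim \<phi>) (mlim \<psi>) (L.D.mcls (\<lambda>m. J m z))"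
      if "z \<in> carrier (free_product (free_alg G) (free_alg G))" for z
      unfolding mt by (rule free_product_state[OF that])
    show "free_conv G \<mu> \<nu> a = star_conv G (mlim \<phi>) (mlim \<psi>) (\<tau> G a)" if a: "a \<in> carrier (free_alg G)" for a
      unfolding free_conv_def star_conv_def o_apply mt comult_\<tau>[OF a] by (rule free_product_state[OF J_delta(1)[OF a]])
  qed
qed

end
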